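(* Let $\mathcal{H}$ be a real separable Hilbert space, let $H\in(0,1)$, and let $B^H$ be an $\mathcal{H}$-valued fractional Brownian motion with Hurst parameter $H$ and trace-class spatial covariance operator $\Lambda$. Let $t>0$ and let $F,G\in L^2_H([0,t],L^2(\mathcal{H}))$ be nonrandom, where $L^2(\mathcal{H})$ denotes the Hilbert–Schmidt operators on $\mathcal{H}$. Then $$E\left[\int_0^t F(s)\,dB^H (s) \otimes\int_0^t G(s)\,dB^H (s)\right]= c(H) \int_0^t s^{1-2H}\,\big(D_{t-}^{1/2-H} s^{H-1/2}F\big) (s)\,\Lambda\, \big(D_{t-}^{1/2-H} s^{H-1/2}G\big)^* (s)\, ds,$$ where $$c(H) = \frac{2H\, \Gamma (3/2-H)\,\Gamma (H+1/2)}{\Gamma(2-2H)}.$$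
   Context: Tensor convention: for $u,v\in\mathcal{H}$, $u\otimes v$ is identified with the operator $x\mapsto\langle x,v\rangle u$. Fractional Brownian motion. A real fractional Brownian motion $b^H$ is a mean-zero Gaussian process with $E[b^H(t)b^H(t')]=\frac12(|t|^{2H}+|t'|^{2H}-|t-t'|^{2H})$. An $\mathcal{H}$-valued fractional Brownian motion $B^H$ is a mean-zero Gaussian process with $E[B^H(t)\otimes B^H(t')]=\frac12(|t|^{2H}+|t'|^{2H}-|t-t'|^{2H})\Lambda$, with $\Lambda$ trace class on $\mathcal{H}$. With $\lambda_k,h_k$ the eigenvalues and orthonormal eigenvectors of $\Lambda$, $B^H(t)=\sum_{k\ge1}\sqrt{\lambda_k}\,h_k b^H_k(t)$ with $b^H_k$ i.i.d. real fractional Brownian motions. Fractional calculus (Bochner integrals for Hilbert-space-valued functions). For $\alpha>0$, $(I_{t-}^{\alpha}f)(x)=\frac1{\Gamma(\alpha)}\int_x^t f(y)(y-x)^{\alpha-1}dy$ for $x<t$, and $(D_{t-}^{\alpha}f)(x)=\frac{d^{\lceil\alpha\rceil}}{dx^{\lceil\alpha\rceil}}(I_{t-}^{\lceil\alpha\rceil-\alpha}f)(x)$; $I^0_{t-}=D^0_{t-}$ is the identity; $D_{t-}^{-\alpha}=I_{t-}^{\alpha}$. (So for $H>1/2$ the operator $D_{t-}^{1/2-H}$ is the fractional integral $I_{t-}^{H-1/2}$.) The expression $(D_{t-}^{1/2-H}s^{H-1/2}F)(s)$ denotes $D_{t-}^{1/2-H}$ applied to the function $r\mapsto r^{H-1/2}F(r)$,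 evaluated at $s$. Integrands. For a Hilbert space $\mathcal{K}$, $L^2_H([0,t],\mathcal{K})$ is: for $H>1/2$, the nonrandom functions $f:[0,t]\to\mathcal{K}$ with $\int_0^t\int_0^t\|f(s)\|\|f(r)\|\,H(2H-1)|s-r|^{2H-2}\,ds\,dr<\infty$; for $H\le1/2$, the set $I_{t-}^{1/2-H}(L^2([0,t],\mathcal{K}))$. Stochastic integral. For real nonrandom $f\in L^2_H([0,t])$, $\int_0^t f\,db^H$ is the Wiener integral (the $L^2(\Omega)$-continuous linear extension of $1_{[0,s]}\mapsto b^H(s)$), and similarly for $\mathcal{H}$-valued $f$. For operator-valued nonrandom $F$, $\int_0^tF(s)\,dB^H(s):=\sum_{k\ge1}\sqrt{\lambda_k}\int_0^tF(s)h_k\,db^H_k(s)$. *)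

theory Defs
  imports "HOL-Probability.Probability"
begin

section \<open>Orthonormal bases of separable Hilbert spaces\<close>

definition orthonormal :: "'a::real_inner set \<Rightarrow> bool" where
  "orthonormal S \<longleftrightarrow> pairwise orthogonal S \<and> (\<forall>e\<in>S. norm e = 1)"

definition orthonormal_basis :: "'a::real_inner set \<Rightarrow> bool" where
  "orthonormal_basis S \<longleftrightarrow> orthonormal S \<and> closure (span S) = UNIV"

lemma orthonormal_subset: "orthonormal S \<Longrightarrow> T \<subseteq> S \<Longrightarrow> orthonormal T"
  unfolding orthonormal_def by (meson pairwise_subset subsetD)

lemma norm_sum_orthonormal:
  fixes S :: "'a::real_inner set"
  assumes "orthonormal S" "finite S"
  shows "(norm (\<Sum>e\<in>S. c e *\<^sub>R e))\<^sup>2 = (\<Sum>e\<in>S. (c e)\<^sup>2)"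
proof -
  have "(norm (\<Sum>e\<in>S. c e *\<^sub>R e))\<^sup>2 = (\<Sum>e\<in>S. (norm (c e *\<^sub>R e))\<^sup>2)"
    using assms unfolding orthonormal_def pairwise_def
    by (intro norm_sum_Pythagorean) (auto simp: pairwise_def orthogonal_def)
  also have "\<dots> = (\<Sum>e\<in>S. (c e)\<^sup>2)"
    using assms by (intro sum.cong) (auto simp: orthonormal_def)
  finally show ?thesis .
qed

lemma inner_sum_orthonormal:
  fixes S :: "'a::real_inner set"
  assumes "orthonormal S" "finite S" "e \<in> S"
  shows "(\<Sum>f\<in>S. c f *\<^sub>R f) \<bullet> e = c e"
proof -
  have "(\<Sum>f\<in>S. c f *\<^sub>R f) \<bullet> e = (\<Sum>f\<in>S. if f = e then c e else 0)"
    unfolding inner_sum_left using assms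
    by (intro sum.cong)
       (auto simp: orthonormal_def pairwise_def orthogonal_def dot_square_norm)
  then show ?thesis using assms by simp
qed

lemma bessel_finite:
  fixes S :: "'a::real_inner set"
  assumes "orthonormal S" "finite S"
  shows "(\<Sum>e\<in>S. (x \<bullet> e)\<^sup>2) \<le> (norm x)\<^sup>2"
proof -
  let ?p = "\<Sum>e\<in>S. (x \<bullet> e) *\<^sub>R e"
  have 1: "x \<bullet> ?p = (\<Sum>e\<in>S. (x \<bullet> e)\<^sup>2)"
    by (simp add: inner_sum_right power2_eq_square)
  have 2: "?p \<bullet> ?p = (\<Sum>e\<in>S. (x \<bullet> e)\<^sup>2)"
    using norm_sum_orthonormal[OF assms, of "\<lambda>e. x \<bullet> e"] by (simp add: dot_square_norm)
  have "0 \<le> (x - ?p) \<bullet> (x - ?p)" by simp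
  also have "\<dots> = (norm x)\<^sup>2 - (\<Sum>e\<in>S. (x \<bullet> e)\<^sup>2)"
    using 1 2 by (simp add: inner_diff_left inner_diff_right inner_commute power2_norm_eq_inner)
  finally show ?thesis by simp
qed

lemma orthonormal_extend:
  fixes S :: "'a::real_inner set"
  assumes "orthonormal S" "finite S"
  shows "\<exists>T. orthonormal T \<and> finite T \<and> S \<subseteq> T \<and> d \<in> span T"
proof -
  let ?p = "\<Sum>e\<in>S. (d \<bullet> e) *\<^sub>R e"
  let ?r = "d - ?p"
  have p: "?p \<in> span S" by (intro span_sum span_scale span_base)
  show ?thesis
  proof (cases "?r = 0")
    case True
    then show ?thesis using assms p by auto
  next
    case False
    let ?n = "?r /\<^sub>R norm ?r"
    have orth: "?r \<bullet> e = 0" if "e \<in> S" for e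
      using inner_sum_orthonormal[OF assms that, of "\<lambda>e. d \<bullet> e"]
      by (simp add: inner_diff_left)
    have "orthonormal (insert ?n S)"
      using assms(1) orth False unfolding orthonormal_def
      by (auto simp: pairwise_insert orthogonal_def inner_commute)
    moreover have "d \<in> span (insert ?n S)"
    proof -
      have "norm ?r *\<^sub>R ?n + ?p \<in> span (insert ?n S)"
      proof (rule span_add)
        show "norm ?r *\<^sub>R ?n \<in> span (insert ?n S)"
          by (rule span_scale[OF span_base[OF insertI1]])
        show "?p \<in> span (insert ?n S)"
          by (rule subsetD[OF span_mono[OF subset_insertI] p])
      qed
      then show ?thesis using False by simp
    qed
    ultimately show ?thesis using assms(2) by (meson finite.insertI subset_insertI)
  qed
qed

lemma orthonormal_basis_exists:
  "\<exists>S::'a::{real_inner, second_countable_topology} set. orthonormal_basis S"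
proof -
  obtain D :: "'a set" where D: "countable D" "\<And>U. open U \<Longrightarrow> U \<noteq> {} \<Longrightarrow> \<exists>d\<in>D. d \<in> U"
    by (metis countable_dense_exists)
  have "D \<noteq> {}" using D(2)[of UNIV] by auto
  then obtain d :: "nat \<Rightarrow> 'a" where d: "range d = D"
    using D(1) by (metis range_from_nat_into)
  let ?P = "\<lambda>n::nat. \<lambda>S::'a set. orthonormal S \<and> finite S \<and> (\<forall>i<n. d i \<in> span S)"
  have "\<exists>S. ?P 0 S" by (intro exI[of _ "{}"]) (simp add: orthonormal_def)
  moreover have "\<exists>T. ?P (Suc n) T \<and> S \<subseteq> T" if S: "?P n S" for S n
  proof -
    obtain T where T: "orthonormal T" "finite T" "S \<subseteq> T" "d n \<in> span T"
      using orthonormal_extend[of S "d n"] S by auto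
    then have "span S \<subseteq> span T" by (intro span_mono)
    then show ?thesis using T S by (intro exI[of _ T]) (auto simp: less_Suc_eq)
  qed
  ultimately have "\<exists>S. \<forall>n. ?P n (S n) \<and> S n \<subseteq> S (Suc n)"
    by (rule dependent_nat_choice)
  then obtain S where S: "\<And>n. ?P n (S n)" "\<And>n. S n \<subseteq> S (Suc n)"
    by (elim exE) blast
  have mono: "S m \<subseteq> S n" if "m \<le> n" for m n
    using lift_Suc_mono_le[of S, OF S(2) that] .
  let ?E = "\<Union>n. S n"
  have "orthonormal ?E"
    unfolding orthonormal_def pairwise_def
  proof (intro conjI ballI impI)
    fix x y assume "x \<in> ?E" "y \<in> ?E" "x \<noteq> y"
    then obtain m n where "x \<in> S m" "y \<in> S n" by blast
    then have "x \<in> S (max m n)" "y \<in> S (max m n)"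
      using mono by (meson max.cobounded1 max.cobounded2 subsetD)+
    then show "orthogonal x y"
      using S(1)[of "max m n"] \<open>x \<noteq> y\<close> by (auto simp: orthonormal_def pairwise_def)
  qed (use S(1) in \<open>auto simp: orthonormal_def\<close>)
  moreover have "closure (span ?E) = UNIV"
  proof -
    have "D \<subseteq> span ?E"
    proof
      fix x assume "x \<in> D"
      then obtain n where "x = d n" using d by blast
      then have "x \<in> span (S (Suc n))" using S(1) by blast
      then show "x \<in> span ?E" using span_mono[of "S (Suc n)" ?E] by blast
    qed
    moreover have "closure D = UNIV"
    proof -
      have "x \<in> closure D" for x
        unfolding closure_iff_nhds_not_empty using D(2) by blast
      then show ?thesis by blast
    qed
    ultimately show ?thesis using closure_mono by blast
  qed
  ultimately show ?thesis unfolding orthonormal_basis_def by (intro exI conjI)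
qed

definition some_basis :: "'a::{real_inner, second_countable_topology} set" where
  "some_basis = (SOME S. orthonormal_basis S)"

lemma orthonormal_basis_some_basis: "orthonormal_basis some_basis"
  unfolding some_basis_def by (rule someI_ex[OF orthonormal_basis_exists])

lemma orthonormal_some_basis: "orthonormal some_basis"
  by (rule conjunct1[OF orthonormal_basis_some_basis[unfolded orthonormal_basis_def]])

lemma closure_span_some_basis: "closure (span some_basis) = UNIV"
  by (rule conjunct2[OF orthonormal_basis_some_basis[unfolded orthonormal_basis_def]])

lemma parseval:
  fixes x :: "'a::real_inner"
  assumes E: "orthonormal_basis E"
  shows "((\<lambda>e. (x \<bullet> e)\<^sup>2) has_sum (norm x)\<^sup>2) E"
proof -
  have oE: "orthonormal E" and cE: "closure (span E) = UNIV"
    using E by (auto simp: orthonormal_basis_def)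
  have bound: "sum (\<lambda>e. (x \<bullet> e)\<^sup>2) S \<le> (norm x)\<^sup>2" if "finite S" "S \<subseteq> E" for S
    using bessel_finite orthonormal_subset[OF oE that(2)] that(1) by blast
  then have summ: "(\<lambda>e. (x \<bullet> e)\<^sup>2) summable_on E"
    by (intro nonneg_bdd_above_summable_on) (auto intro!: bdd_aboveI)
  have "infsum (\<lambda>e. (x \<bullet> e)\<^sup>2) E = (norm x)\<^sup>2"
  proof (rule antisym)
    show "infsum (\<lambda>e. (x \<bullet> e)\<^sup>2) E \<le> (norm x)\<^sup>2"
      using infsum_le_finite_sums[OF summ] bound by blast
    show "(norm x)\<^sup>2 \<le> infsum (\<lambda>e. (x \<bullet> e)\<^sup>2) E"
    proof (rule field_le_epsilon)
      fix \<epsilon> :: real assume "\<epsilon> > 0"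
      then obtain y where y: "y \<in> span E" "dist y x < sqrt \<epsilon>"
        using cE by (metis UNIV_I closure_approachable real_sqrt_gt_0_iff)
      obtain S r where S: "finite S" "S \<subseteq> E" "y = (\<Sum>a\<in>S. r a *\<^sub>R a)"
        using y(1) unfolding span_explicit by auto
      have oS: "orthonormal S" using orthonormal_subset[OF oE S(2)] .
      have xy: "x \<bullet> y = (\<Sum>e\<in>S. r e * (x \<bullet> e))"
        by (simp add: S(3) inner_sum_right)
      have yy: "y \<bullet> y = (\<Sum>e\<in>S. (r e)\<^sup>2)"
        using norm_sum_orthonormal[OF oS S(1), of r] S(3) by (simp add: dot_square_norm)
      have "(norm x)\<^sup>2 - (\<Sum>e\<in>S. (x \<bullet> e)\<^sup>2) \<le>
          (norm x)\<^sup>2 - (\<Sum>e\<in>S. (x \<bullet> e)\<^sup>2) + (\<Sum>e\<in>S. (x \<bullet> e - r e)\<^sup>2)"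
        by (simp add: sum_nonneg)
      also have "\<dots> = (norm x)\<^sup>2 - 2 * (\<Sum>e\<in>S. r e * (x \<bullet> e)) + (\<Sum>e\<in>S. (r e)\<^sup>2)"
        by (simp add: power2_diff sum.distrib sum_subtractf sum_distrib_left algebra_simps)
      also have "\<dots> = (x - y) \<bullet> (x - y)"
        using xy yy by (simp add: inner_diff_left inner_diff_right inner_commute power2_norm_eq_inner)
      also have "\<dots> = (dist y x)\<^sup>2"
        by (simp add: dot_square_norm dist_norm norm_minus_commute)
      also have "\<dots> \<le> (sqrt \<epsilon>)\<^sup>2"
        using y(2) by (intro power_mono) auto
      also have "\<dots> = \<epsilon>" using \<open>\<epsilon> > 0\<close> by simp
      finally have "(norm x)\<^sup>2 \<le> (\<Sum>e\<in>S. (x \<bullet> e)\<^sup>2) + \<epsilon>" by simp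
      also have "\<dots> \<le> infsum (\<lambda>e. (x \<bullet> e)\<^sup>2) E + \<epsilon>"
        using finite_sum_le_infsum[OF summ S(1,2)] by simp
      finally show "(norm x)\<^sup>2 \<le> infsum (\<lambda>e. (x \<bullet> e)\<^sup>2) E + \<epsilon>" .
    qed
  qed
  then show ?thesis using has_sum_infsum[OF summ] by simp
qed

section \<open>The Hilbert space of Hilbert--Schmidt operators\<close>

text \<open>The choice of the basis is immaterial, see \<open>norm_hs_any_basis\<close> below.\<close>

definition hilbert_schmidt ::
    "('a::{real_inner, second_countable_topology} \<Rightarrow>\<^sub>L 'a) \<Rightarrow> bool" where
  "hilbert_schmidt A \<longleftrightarrow> (\<lambda>e. (norm (blinfun_apply A e))\<^sup>2) summable_on some_basis"

typedef (overloaded) 'a hs =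
  "{A :: 'a::{real_inner, banach, second_countable_topology} \<Rightarrow>\<^sub>L 'a. hilbert_schmidt A}"
  morphisms blinfun_of_hs Abs_hs
  by (rule exI[of _ 0]) (simp add: hilbert_schmidt_def)

setup_lifting type_definition_hs

abbreviation hs_apply ::
    "'a::{real_inner, banach, second_countable_topology} hs \<Rightarrow> 'a \<Rightarrow> 'a" where
  "hs_apply A \<equiv> blinfun_apply (blinfun_of_hs A)"

lemma hs_eqI: "(\<And>x. hs_apply A x = hs_apply B x) \<Longrightarrow> A = B"
  by (metis blinfun_eqI blinfun_of_hs_inject)

lemma hilbert_schmidt_add:
  assumes "hilbert_schmidt A" "hilbert_schmidt B"
  shows "hilbert_schmidt (A + B)"
  unfolding hilbert_schmidt_def
proof (rule summable_on_comparison_test)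
  show "(\<lambda>e. 2 * (norm (blinfun_apply A e))\<^sup>2 + 2 * (norm (blinfun_apply B e))\<^sup>2) summable_on some_basis"
    using assms unfolding hilbert_schmidt_def
    by (intro summable_on_add summable_on_cmult_right)
  fix e
  have "(norm (blinfun_apply (A + B) e))\<^sup>2 \<le> (norm (blinfun_apply A e) + norm (blinfun_apply B e))\<^sup>2"
    by (intro power_mono) (auto simp: blinfun.add_left norm_triangle_ineq)
  also have "\<dots> \<le> 2 * (norm (blinfun_apply A e))\<^sup>2 + 2 * (norm (blinfun_apply B e))\<^sup>2"
    using sum_squares_bound[of "norm (blinfun_apply A e)" "norm (blinfun_apply B e)"]
    by (simp add: power2_sum)
  finally show "(norm (blinfun_apply (A + B) e))\<^sup>2 \<le>
    2 * (norm (blinfun_apply A e))\<^sup>2 + 2 * (norm (blinfun_apply B e))\<^sup>2" .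
qed simp

lemma hilbert_schmidt_scaleR: "hilbert_schmidt A \<Longrightarrow> hilbert_schmidt (c *\<^sub>R A)"
  unfolding hilbert_schmidt_def
  by (simp add: blinfun.scaleR_left power_mult_distrib summable_on_cmult_right)

lemma hilbert_schmidt_uminus: "hilbert_schmidt A \<Longrightarrow> hilbert_schmidt (- A)"
  using hilbert_schmidt_scaleR[of A "-1"] by simp

lemma hilbert_schmidt_diff:
  "hilbert_schmidt A \<Longrightarrow> hilbert_schmidt B \<Longrightarrow> hilbert_schmidt (A - B)"
  using hilbert_schmidt_add[of A "- B"] hilbert_schmidt_uminus[of B] by simp

lemma summable_hs: "(\<lambda>e. (norm (hs_apply A e))\<^sup>2) summable_on some_basis"
  using blinfun_of_hs[of A] by (simp add: hilbert_schmidt_def)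

lemma summable_hs_inner: "(\<lambda>e. hs_apply A e \<bullet> hs_apply B e) summable_on some_basis"
proof -
  have "(\<lambda>e. \<bar>hs_apply A e \<bullet> hs_apply B e\<bar>) summable_on some_basis"
  proof (rule summable_on_comparison_test)
    show "(\<lambda>e. (norm (hs_apply A e))\<^sup>2 + (norm (hs_apply B e))\<^sup>2) summable_on some_basis"
      by (intro summable_on_add summable_hs)
    fix e
    have "\<bar>hs_apply A e \<bullet> hs_apply B e\<bar> \<le> norm (hs_apply A e) * norm (hs_apply B e)"
      by (rule Cauchy_Schwarz_ineq2)
    also have "\<dots> \<le> (norm (hs_apply A e))\<^sup>2 + (norm (hs_apply B e))\<^sup>2"
    proof -
      have "0 \<le> norm (hs_apply A e) * norm (hs_apply B e)" by simp
      then show ?thesis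
        using sum_squares_bound[of "norm (hs_apply A e)" "norm (hs_apply B e)"]
        by linarith
    qed
    finally show "\<bar>hs_apply A e \<bullet> hs_apply B e\<bar> \<le> (norm (hs_apply A e))\<^sup>2 + (norm (hs_apply B e))\<^sup>2" .
  qed simp
  then show ?thesis
    by (subst summable_on_iff_abs_summable_on_real) (simp only: real_norm_def)
qed

instantiation hs :: ("{real_inner, banach, second_countable_topology}") real_vector
begin

lift_definition zero_hs :: "'a hs" is 0 by (simp add: hilbert_schmidt_def)
lift_definition plus_hs :: "'a hs \<Rightarrow> 'a hs \<Rightarrow> 'a hs" is "(+)" by (rule hilbert_schmidt_add)
lift_definition minus_hs :: "'a hs \<Rightarrow> 'a hs \<Rightarrow> 'a hs" is "(-)" by (rule hilbert_schmidt_diff)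
lift_definition uminus_hs :: "'a hs \<Rightarrow> 'a hs" is uminus by (rule hilbert_schmidt_uminus)
lift_definition scaleR_hs :: "real \<Rightarrow> 'a hs \<Rightarrow> 'a hs" is scaleR by (rule hilbert_schmidt_scaleR)

instance
  by standard (transfer; simp add: algebra_simps)+

end

lemma hs_apply_add: "hs_apply (A + B) x = hs_apply A x + hs_apply B x"
  by (simp add: plus_hs.rep_eq blinfun.add_left)
lemma hs_apply_diff: "hs_apply (A - B) x = hs_apply A x - hs_apply B x"
  by (simp add: minus_hs.rep_eq blinfun.diff_left)
lemma hs_apply_scaleR: "hs_apply (c *\<^sub>R A) x = c *\<^sub>R hs_apply A x"
  by (simp add: scaleR_hs.rep_eq blinfun.scaleR_left)
lemma hs_apply_zero: "hs_apply 0 x = 0"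
  by (simp add: zero_hs.rep_eq)
lemma hs_apply_sum: "hs_apply (\<Sum>i\<in>I. A i) x = (\<Sum>i\<in>I. hs_apply (A i) x)"
  by (induction I rule: infinite_finite_induct) (auto simp: hs_apply_zero hs_apply_add)

instantiation hs :: ("{real_inner, banach, second_countable_topology}") real_inner
begin

definition inner_hs :: "'a hs \<Rightarrow> 'a hs \<Rightarrow> real" where
  "inner_hs A B = (\<Sum>\<^sub>\<infinity>e\<in>some_basis. hs_apply A e \<bullet> hs_apply B e)"
definition norm_hs :: "'a hs \<Rightarrow> real" where
  "norm_hs A = sqrt (inner A A)"
definition dist_hs :: "'a hs \<Rightarrow> 'a hs \<Rightarrow> real" where
  "dist_hs A B = norm (A - B)"
definition sgn_hs :: "'a hs \<Rightarrow> 'a hs" where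
  "sgn_hs A = A /\<^sub>R norm A"
definition uniformity_hs :: "('a hs \<times> 'a hs) filter" where
  "uniformity_hs = (INF e\<in>{0<..}. principal {(x, y). dist x y < e})"
definition open_hs :: "'a hs set \<Rightarrow> bool" where
  "open_hs U = (\<forall>x\<in>U. \<forall>\<^sub>F (x', y) in uniformity. x' = x \<longrightarrow> y \<in> U)"

instance
proof
  fix A B C :: "'a hs" and r :: real
  show "inner A B = inner B A" by (simp add: inner_hs_def inner_commute)
  show "inner (A + B) C = inner A C + inner B C"
    by (simp add: inner_hs_def hs_apply_add inner_add_left infsum_add summable_hs_inner)
  show "inner (r *\<^sub>R A) B = r * inner A B"
    by (simp add: inner_hs_def hs_apply_scaleR infsum_cmult_right')
  show "0 \<le> inner A A" unfolding inner_hs_def by (intro infsum_nonneg) simp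
  show "(inner A A = 0) = (A = 0)"
  proof
    assume *: "inner A A = 0"
    have "hs_apply A e = 0" if "e \<in> some_basis" for e
      using nonneg_infsum_le_0D[of "\<lambda>e. hs_apply A e \<bullet> hs_apply A e" some_basis e]
        * summable_hs_inner[of A A] that by (simp add: inner_hs_def)
    then have z: "hs_apply A x = 0" if "x \<in> span some_basis" for x
      using linear_eq_0_on_span[of "hs_apply A" some_basis x] that
      by (simp add: blinfun.bounded_linear_right bounded_linear.linear)
    have "hs_apply A x = 0" for x
    proof -
      have "x \<in> closure (span some_basis)"
        by (simp add: closure_span_some_basis)
      moreover have "closed {x. hs_apply A x = 0}"
        by (intro closed_Collect_eq continuous_intros)
      ultimately show ?thesis
        using z closure_minimal[of "span some_basis" "{x. hs_apply A x = 0}"] by blast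
    qed
    then show "A = 0" by (intro hs_eqI) (simp add: hs_apply_zero)
  qed (simp add: inner_hs_def hs_apply_zero)
qed (rule norm_hs_def dist_hs_def sgn_hs_def uniformity_hs_def open_hs_def)+

end

lemma norm_hs_sq: "(norm A)\<^sup>2 = (\<Sum>\<^sub>\<infinity>e\<in>some_basis. (norm (hs_apply A e))\<^sup>2)"
  for A :: "'a::{real_inner, banach, second_countable_topology} hs"
  by (simp add: power2_norm_eq_inner inner_hs_def)

lemma finite_sum_le_norm_hs_sq:
  fixes A :: "'a::{real_inner, banach, second_countable_topology} hs"
  assumes "finite S" "S \<subseteq> some_basis"
  shows "(\<Sum>e\<in>S. (norm (hs_apply A e))\<^sup>2) \<le> (norm A)\<^sup>2"
  unfolding norm_hs_sq using assms by (intro finite_sum_le_infsum summable_hs) auto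

lemma norm_hs_apply_le:
  fixes A :: "'a::{real_inner, banach, second_countable_topology} hs"
  shows "norm (hs_apply A x) \<le> norm A * norm x"
proof -
  have *: "norm (hs_apply A x) \<le> norm A * norm x" if x: "x \<in> span some_basis" for x
  proof -
    obtain S r where S: "finite S" "S \<subseteq> some_basis" "x = (\<Sum>e\<in>S. r e *\<^sub>R e)"
      using x unfolding span_explicit by auto
    have "norm (hs_apply A x) \<le> (\<Sum>e\<in>S. \<bar>r e\<bar> * norm (hs_apply A e))"
      unfolding S(3) blinfun.sum_right blinfun.scaleR_right
      by (rule order_trans[OF norm_sum]) simp
    also have "\<dots> \<le> L2_set r S * L2_set (\<lambda>e. norm (hs_apply A e)) S"
      using L2_set_mult_ineq[of r "\<lambda>e. norm (hs_apply A e)" S] by simp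
    also have "\<dots> \<le> norm x * norm A"
    proof (rule mult_mono)
      show "L2_set r S \<le> norm x"
        using norm_sum_orthonormal[OF orthonormal_subset[OF orthonormal_some_basis S(2)] S(1), of r]
        unfolding L2_set_def S(3)[symmetric] by (metis norm_ge_zero order_refl real_sqrt_unique)
      show "L2_set (\<lambda>e. norm (hs_apply A e)) S \<le> norm A"
        unfolding L2_set_def
        by (rule real_le_lsqrt) (use finite_sum_le_norm_hs_sq[OF S(1,2)] in auto)
    qed auto
    finally show ?thesis by (simp add: mult.commute)
  qed
  have "closed {x. norm (hs_apply A x) \<le> norm A * norm x}"
    by (intro closed_Collect_le continuous_intros)
  moreover have "closure (span some_basis) = (UNIV :: 'a set)"
    by (rule closure_span_some_basis)
  ultimately show ?thesis
    using closure_minimal[of "span some_basis" "{x. norm (hs_apply A x) \<le> norm A * norm x}"] *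
    by auto
qed

lemma norm_blinfun_of_hs_le: "norm (blinfun_of_hs A) \<le> norm A"
  by (rule norm_blinfun_bound) (auto intro: norm_hs_apply_le)

instance hs :: ("{real_inner, banach, second_countable_topology}") banach
proof
  fix X :: "nat \<Rightarrow> 'a hs"
  assume X: "Cauchy X"
  have "Cauchy (\<lambda>n. blinfun_of_hs (X n))"
  proof (rule metric_CauchyI)
    fix \<epsilon> :: real assume "\<epsilon> > 0"
    then obtain N where N: "\<And>m n. m \<ge> N \<Longrightarrow> n \<ge> N \<Longrightarrow> dist (X m) (X n) < \<epsilon>"
      using metric_CauchyD[OF X] by metis
    have "dist (blinfun_of_hs (X m)) (blinfun_of_hs (X n)) < \<epsilon>" if "m \<ge> N" "n \<ge> N" for m n
      using le_less_trans[OF norm_blinfun_of_hs_le[of "X m - X n"]] N[OF that]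
      by (simp add: dist_norm minus_hs.rep_eq)
    then show "\<exists>N. \<forall>m\<ge>N. \<forall>n\<ge>N. dist (blinfun_of_hs (X m)) (blinfun_of_hs (X n)) < \<epsilon>"
      by blast
  qed
  then obtain A where A: "(\<lambda>n. blinfun_of_hs (X n)) \<longlonglongrightarrow> A"
    by (metis Cauchy_convergent convergent_def)
  have fin: "(\<Sum>e\<in>S. (norm (blinfun_apply (A - blinfun_of_hs (X n)) e))\<^sup>2) \<le> \<epsilon>\<^sup>2"
    if S: "finite S" "S \<subseteq> some_basis" and N: "\<And>m. m \<ge> N \<Longrightarrow> dist (X m) (X n) < \<epsilon>" for S n N \<epsilon>
  proof (rule tendsto_upperbound)
    show "(\<lambda>m. \<Sum>e\<in>S. (norm (blinfun_apply (blinfun_of_hs (X m) - blinfun_of_hs (X n)) e))\<^sup>2)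
        \<longlonglongrightarrow> (\<Sum>e\<in>S. (norm (blinfun_apply (A - blinfun_of_hs (X n)) e))\<^sup>2)"
      by (intro tendsto_intros A)
    show "\<forall>\<^sub>F m in sequentially.
        (\<Sum>e\<in>S. (norm (blinfun_apply (blinfun_of_hs (X m) - blinfun_of_hs (X n)) e))\<^sup>2) \<le> \<epsilon>\<^sup>2"
    proof (rule eventually_sequentiallyI)
      fix m assume "m \<ge> N"
      have "(\<Sum>e\<in>S. (norm (hs_apply (X m - X n) e))\<^sup>2) \<le> (norm (X m - X n))\<^sup>2"
        by (rule finite_sum_le_norm_hs_sq[OF S])
      also have "\<dots> \<le> \<epsilon>\<^sup>2"
        using N[OF \<open>m \<ge> N\<close>] by (intro power_mono) (auto simp: dist_norm)
      finally show "(\<Sum>e\<in>S. (norm (blinfun_apply (blinfun_of_hs (X m) - blinfun_of_hs (X n)) e))\<^sup>2) \<le> \<epsilon>\<^sup>2"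
        by (simp add: minus_hs.rep_eq)
    qed
  qed simp
  have hsd: "hilbert_schmidt (A - blinfun_of_hs (X n))"
    if "\<And>m. m \<ge> N \<Longrightarrow> dist (X m) (X n) < \<epsilon>" for n N \<epsilon>
    unfolding hilbert_schmidt_def
    by (rule nonneg_bdd_above_summable_on) (auto intro!: bdd_aboveI[of _ "\<epsilon>\<^sup>2"] fin that)
  obtain N1 where "\<And>m n. m \<ge> N1 \<Longrightarrow> n \<ge> N1 \<Longrightarrow> dist (X m) (X n) < 1"
    using metric_CauchyD[OF X zero_less_one] by metis
  then have "hilbert_schmidt (A - blinfun_of_hs (X N1))"
    by (intro hsd[of N1 N1 1]) auto
  from hilbert_schmidt_add[OF this, of "blinfun_of_hs (X N1)"]
  have hsA: "hilbert_schmidt A" using blinfun_of_hs[of "X N1"] by simp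
  define L where "L = Abs_hs A"
  have L: "blinfun_of_hs L = A" unfolding L_def using hsA by (simp add: Abs_hs_inverse)
  have "X \<longlonglongrightarrow> L"
  proof (rule metric_LIMSEQ_I)
    fix \<epsilon> :: real assume "\<epsilon> > 0"
    then obtain N where N: "\<And>m n. m \<ge> N \<Longrightarrow> n \<ge> N \<Longrightarrow> dist (X m) (X n) < \<epsilon> / 2"
      using metric_CauchyD[OF X, of "\<epsilon> / 2"] by (metis half_gt_zero)
    have "dist (X n) L < \<epsilon>" if "n \<ge> N" for n
    proof -
      have "(norm (L - X n))\<^sup>2 \<le> (\<epsilon> / 2)\<^sup>2"
        unfolding norm_hs_sq
      proof (rule infsum_le_finite_sums[OF summable_hs])
        fix S assume "finite S" "S \<subseteq> (some_basis :: 'a set)"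
        then show "(\<Sum>e\<in>S. (norm (hs_apply (L - X n) e))\<^sup>2) \<le> (\<epsilon> / 2)\<^sup>2"
          using fin[of S N n "\<epsilon> / 2"] N that by (simp add: minus_hs.rep_eq L)
      qed
      then have "norm (L - X n) \<le> \<epsilon> / 2"
        using \<open>\<epsilon> > 0\<close> by (simp add: power2_le_iff_abs_le)
      then show ?thesis using \<open>\<epsilon> > 0\<close> by (simp add: dist_norm norm_minus_commute)
    qed
    then show "\<exists>N. \<forall>n\<ge>N. dist (X n) L < \<epsilon>" by blast
  qed
  then show "convergent X" by (rule convergentI)
qed

lift_definition hs_tensor ::
    "'a::{real_inner, banach, second_countable_topology} \<Rightarrow> 'a \<Rightarrow> 'a hs"
  is "\<lambda>u v. blinfun_scaleR_left u o\<^sub>L blinfun_inner_left v"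
proof -
  fix u v :: 'a
  have "(\<lambda>e. (norm u)\<^sup>2 * (v \<bullet> e)\<^sup>2) summable_on some_basis"
    using parseval[OF orthonormal_basis_some_basis, of v]
    by (intro summable_on_cmult_right) (auto simp: summable_on_def)
  then show "hilbert_schmidt (blinfun_scaleR_left u o\<^sub>L blinfun_inner_left v)"
    by (simp add: hilbert_schmidt_def blinfun_scaleR_left.rep_eq blinfun_inner_left.rep_eq
        power_mult_distrib inner_commute mult.commute)
qed

lemma hs_apply_tensor: "hs_apply (hs_tensor u v) x = (x \<bullet> v) *\<^sub>R u"
  by (simp add: hs_tensor.rep_eq blinfun_scaleR_left.rep_eq blinfun_inner_left.rep_eq)

lemma hs_finite_rank_approx:
  fixes A :: "'a::{real_inner, banach, second_countable_topology} hs"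
  assumes "\<epsilon> > 0"
  obtains S where "finite S" "S \<subseteq> some_basis"
    "norm (A - (\<Sum>e\<in>S. hs_tensor (hs_apply A e) e)) \<le> \<epsilon>"
proof -
  obtain S where S: "finite S" "S \<subseteq> some_basis"
    and d: "dist (\<Sum>e\<in>S. (norm (hs_apply A e))\<^sup>2) ((norm A)\<^sup>2) \<le> \<epsilon>\<^sup>2"
    using infsum_finite_approximation[OF summable_hs[of A], of "\<epsilon>\<^sup>2"] assms
    unfolding norm_hs_sq by auto
  let ?T = "\<Sum>e\<in>S. hs_tensor (hs_apply A e) e"
  have T: "hs_apply ?T e = (if e \<in> S then hs_apply A e else 0)" if "e \<in> some_basis" for e
  proof -
    have "hs_apply ?T e = (\<Sum>f\<in>S. if f = e then hs_apply A e else 0)"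
      unfolding hs_apply_sum hs_apply_tensor using orthonormal_some_basis S(2) that
      by (intro sum.cong)
         (auto simp: orthonormal_def pairwise_def orthogonal_def dot_square_norm)
    then show ?thesis using S(1) by simp
  qed
  have "(norm (A - ?T))\<^sup>2 \<le> (norm A)\<^sup>2 - (\<Sum>e\<in>S. (norm (hs_apply A e))\<^sup>2)"
    unfolding norm_hs_sq[of "A - ?T"]
  proof (rule infsum_le_finite_sums[OF summable_hs])
    fix R assume R: "finite R" "R \<subseteq> (some_basis :: 'a set)"
    have "(\<Sum>e\<in>R. (norm (hs_apply (A - ?T) e))\<^sup>2) = (\<Sum>e\<in>R - S. (norm (hs_apply A e))\<^sup>2)"
      using R T by (intro sum.mono_neutral_cong_right) (auto simp: hs_apply_diff subset_iff)
    also have "\<dots> = (\<Sum>e\<in>R \<union> S. (norm (hs_apply A e))\<^sup>2) - (\<Sum>e\<in>S. (norm (hs_apply A e))\<^sup>2)"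
      using sum.subset_diff[of S "R \<union> S" "\<lambda>e. (norm (hs_apply A e))\<^sup>2"] R(1) S(1)
      by (simp add: Un_Diff)
    also have "\<dots> \<le> (norm A)\<^sup>2 - (\<Sum>e\<in>S. (norm (hs_apply A e))\<^sup>2)"
      using finite_sum_le_norm_hs_sq[of "R \<union> S" A] R S by simp
    finally show "(\<Sum>e\<in>R. (norm (hs_apply (A - ?T) e))\<^sup>2)
        \<le> (norm A)\<^sup>2 - (\<Sum>e\<in>S. (norm (hs_apply A e))\<^sup>2)" .
  qed
  also have "\<dots> \<le> \<epsilon>\<^sup>2" using d by (simp add: dist_real_def)
  finally have "norm (A - ?T) \<le> \<epsilon>" using assms by (simp add: power2_le_iff_abs_le)
  then show ?thesis using that S by blast
qed

lemma norm_hs_tensor: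
  fixes u v :: "'a::{real_inner, banach, second_countable_topology}"
  shows "norm (hs_tensor u v) = norm u * norm v"
proof -
  have "((\<lambda>e. (norm u)\<^sup>2 * (v \<bullet> e)\<^sup>2) has_sum (norm u)\<^sup>2 * (norm v)\<^sup>2) some_basis"
    by (intro has_sum_cmult_right parseval orthonormal_basis_some_basis)
  then have "(norm (hs_tensor u v))\<^sup>2 = (norm u * norm v)\<^sup>2"
    unfolding norm_hs_sq
    by (intro infsumI) (simp add: hs_apply_tensor power_mult_distrib inner_commute mult.commute)
  then show ?thesis by simp
qed

lemma countable_orthonormal:
  fixes S :: "'a::{real_inner, second_countable_topology} set"
  assumes "orthonormal S"
  shows "countable S"
proof -
  obtain D :: "'a set" where D: "countable D" "\<And>U. open U \<Longrightarrow> U \<noteq> {} \<Longrightarrow> \<exists>d\<in>D. d \<in> U"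
    by (metis countable_dense_exists)
  have "\<exists>d\<in>D. dist e d < 1/2" for e
    using D(2)[of "ball e (1/2)"] by auto
  then obtain g where g: "\<And>e. g e \<in> D" "\<And>e. dist e (g e) < 1/2" by metis
  have "inj_on g S"
  proof (rule inj_onI, rule ccontr)
    fix e f assume ef: "e \<in> S" "f \<in> S" "g e = g f" "e \<noteq> f"
    have "dist e f < 1" using g(2)[of e] g(2)[of f] ef(3)
      by (metis dist_commute dist_triangle_half_r)
    moreover have "(dist e f)\<^sup>2 = 2"
      using assms ef norm_add_Pythagorean[of e "- f"]
      by (simp add: orthonormal_def pairwise_def orthogonal_clauses dist_norm)
    ultimately show False
      using power_strict_mono[of "dist e f" 1 2] by simp
  qed
  then show ?thesis using D(1) g(1) by (meson countable_image_inj_on countable_subset image_subsetI)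
qed

lemma second_countable_metricI:
  fixes D :: "'b::metric_space set"
  assumes "countable D" and dense: "\<And>x \<epsilon>. \<epsilon> > 0 \<Longrightarrow> \<exists>d\<in>D. dist x d < \<epsilon>"
  shows "\<exists>B::'b set set. countable B \<and> open = generate_topology B"
proof (intro exI conjI ext)
  let ?B = "(\<lambda>(d, n). ball d (1 / Suc n)) ` (D \<times> (UNIV :: nat set))"
  show "countable ?B" using assms(1) by simp
  fix U :: "'b set"
  show "open U = generate_topology ?B U"
  proof
    assume U: "open U"
    have "U = \<Union>{b \<in> ?B. b \<subseteq> U}"
    proof (intro equalityI subsetI)
      fix x assume "x \<in> U"
      then obtain \<epsilon> where \<epsilon>: "\<epsilon> > 0" "ball x \<epsilon> \<subseteq> U" using U openE by blast
      obtain n where n: "1 / Suc n < \<epsilon> / 2" using \<epsilon>(1) nat_approx_posE[of "\<epsilon> / 2"] by auto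
      obtain d where d: "d \<in> D" "dist x d < 1 / Suc n" using dense[of "1 / Suc n" x] by auto
      have "ball d (1 / Suc n) \<subseteq> ball x \<epsilon>"
      proof
        fix y assume "y \<in> ball d (1 / Suc n)"
        then have "dist x y < 1 / Suc n + 1 / Suc n"
          using d(2) dist_triangle[of x y d] by (simp del: of_nat_Suc)
        then show "y \<in> ball x \<epsilon>" using n by simp
      qed
      then have "ball d (1 / Suc n) \<in> {b \<in> ?B. b \<subseteq> U}" using d(1) \<epsilon>(2) by fast
      moreover have "x \<in> ball d (1 / Suc n)" using d(2) by (simp add: dist_commute)
      ultimately show "x \<in> \<Union>{b \<in> ?B. b \<subseteq> U}" by (rule UnionI)
    qed blast
    moreover have "generate_topology ?B (\<Union>{b \<in> ?B. b \<subseteq> U})"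
      by (rule generate_topology.UN) (auto intro: generate_topology.Basis)
    ultimately show "generate_topology ?B U" by simp
  next
    assume "generate_topology ?B U"
    then show "open U" by induction auto
  qed
qed

instance hs :: ("{real_inner, banach, second_countable_topology}") second_countable_topology
proof
  obtain D :: "'a set" where D: "countable D" "\<And>U. open U \<Longrightarrow> U \<noteq> {} \<Longrightarrow> \<exists>d\<in>D. d \<in> U"
    by (metis countable_dense_exists)
  let ?f = "\<lambda>L :: ('a \<times> 'a) list. \<Sum>(d, e)\<leftarrow>L. hs_tensor d e"
  let ?L = "lists (D \<times> (some_basis :: 'a set))"
  have "countable (?f ` ?L)"
    using D(1) countable_orthonormal[OF orthonormal_some_basis] by (intro countable_image countable_lists) auto
  moreover have "\<exists>B\<in>?f ` ?L. dist A B < \<epsilon>" if "\<epsilon> > 0" for A :: "'a hs" and \<epsilon>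
  proof -
    have "\<epsilon> / 2 > 0" using that by simp
    then obtain S where S: "finite S" "S \<subseteq> some_basis"
      "norm (A - (\<Sum>e\<in>S. hs_tensor (hs_apply A e) e)) \<le> \<epsilon> / 2"
      by (rule hs_finite_rank_approx)
    define \<delta> where "\<delta> = \<epsilon> / (2 * (real (card S) + 1))"
    have \<delta>: "\<delta> > 0" using that by (simp add: \<delta>_def)
    have "\<exists>d\<in>D. dist x d < \<delta>" for x using D(2)[of "ball x \<delta>"] \<delta> by auto
    then obtain g where g: "\<And>x. g x \<in> D" "\<And>x. dist x (g x) < \<delta>" by metis
    obtain es where es: "distinct es" "set es = S" using finite_distinct_list[OF S(1)] by blast
    let ?M = "map (\<lambda>e. (g (hs_apply A e), e)) es"
    have fM: "?f ?M = (\<Sum>e\<in>S. hs_tensor (g (hs_apply A e)) e)"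
      using es by (simp add: o_def sum_list_distinct_conv_sum_set)
    have tens: "hs_tensor x e - hs_tensor y e = hs_tensor (x - y) e" for x y e :: 'a
      by (rule hs_eqI) (simp add: hs_apply_diff hs_apply_tensor scaleR_diff_right)
    have "norm ((\<Sum>e\<in>S. hs_tensor (hs_apply A e) e) - ?f ?M)
        \<le> (\<Sum>e\<in>S. norm (hs_tensor (hs_apply A e - g (hs_apply A e)) e))"
      unfolding fM sum_subtractf[symmetric] tens by (rule norm_sum)
    also have "\<dots> \<le> (\<Sum>e\<in>S. \<delta>)"
    proof (rule sum_mono)
      fix e assume "e \<in> S"
      then have "norm e = 1" using S(2) orthonormal_some_basis by (auto simp: orthonormal_def)
      then show "norm (hs_tensor (hs_apply A e - g (hs_apply A e)) e) \<le> \<delta>"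
        using g(2)[of "hs_apply A e"] by (simp add: norm_hs_tensor dist_norm)
    qed
    also have "\<dots> < \<epsilon> / 2"
      using that by (simp add: \<delta>_def field_simps)
    finally have "norm ((\<Sum>e\<in>S. hs_tensor (hs_apply A e) e) - ?f ?M) < \<epsilon> / 2" .
    then have "dist A (?f ?M) < \<epsilon>"
      using S(3) norm_triangle_ineq[of "A - (\<Sum>e\<in>S. hs_tensor (hs_apply A e) e)"
          "(\<Sum>e\<in>S. hs_tensor (hs_apply A e) e) - ?f ?M"]
      by (simp add: dist_norm)
    moreover have "?M \<in> ?L" using g(1) es(2) S(2) by (auto simp: lists_eq_set)
    ultimately show ?thesis by blast
  qed
  ultimately show "\<exists>B::'a hs set set. countable B \<and> open = generate_topology B"
    by (rule second_countable_metricI)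
qed

lift_definition hs_comp ::
    "'a::{real_inner, banach, second_countable_topology} hs \<Rightarrow> 'a hs \<Rightarrow> 'a hs"
    (infixl \<open>\<odot>\<close> 70)
  is "blinfun_compose"
proof -
  fix A B :: "'a \<Rightarrow>\<^sub>L 'a"
  assume "hilbert_schmidt B"
  then have "(\<lambda>e. (norm A)\<^sup>2 * (norm (blinfun_apply B e))\<^sup>2) summable_on some_basis"
    unfolding hilbert_schmidt_def by (rule summable_on_cmult_right)
  then show "hilbert_schmidt (A o\<^sub>L B)"
    unfolding hilbert_schmidt_def
    by (rule summable_on_comparison_test)
       (auto simp flip: power_mult_distrib intro!: power_mono norm_blinfun)
qed

definition hs_adjoint ::
    "'a::{real_inner, banach, second_countable_topology} hs \<Rightarrow> 'a hs" where
  "hs_adjoint A = (THE B. \<forall>x y. hs_apply A x \<bullet> y = x \<bullet> hs_apply B y)"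

lemma parseval_inner:
  fixes x y :: "'a::real_inner"
  assumes E: "orthonormal_basis E"
  shows "((\<lambda>e. (x \<bullet> e) * (y \<bullet> e)) has_sum x \<bullet> y) E"
proof -
  have "((\<lambda>e. ((x + y) \<bullet> e)\<^sup>2 + - ((x - y) \<bullet> e)\<^sup>2) has_sum (norm (x + y))\<^sup>2 + - (norm (x - y))\<^sup>2) E"
    by (intro has_sum_add has_sum_uminusI parseval[OF E])
  from has_sum_cmult_right[OF this, of "1/4"]
  have "((\<lambda>e. (1/4) * (((x + y) \<bullet> e)\<^sup>2 + - ((x - y) \<bullet> e)\<^sup>2)) has_sum
      (1/4) * ((norm (x + y))\<^sup>2 + - (norm (x - y))\<^sup>2)) E" .
  moreover have "(1/4) * (((x + y) \<bullet> e)\<^sup>2 + - ((x - y) \<bullet> e)\<^sup>2) = (x \<bullet> e) * (y \<bullet> e)" for e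
    by (simp add: inner_left_distrib inner_diff_left power2_eq_square algebra_simps)
  moreover have "(1/4) * ((norm (x + y))\<^sup>2 + - (norm (x - y))\<^sup>2) = x \<bullet> y"
    unfolding power2_norm_eq_inner
    by (simp add: inner_left_distrib inner_right_distrib inner_diff_left inner_diff_right
        inner_commute)
  ultimately show ?thesis by simp
qed

lemma inner_hs_tensor: "hs_tensor u v \<bullet> hs_tensor u' v' = (u \<bullet> u') * (v \<bullet> v')"
proof -
  have "((\<lambda>e. (u \<bullet> u') * ((v \<bullet> e) * (v' \<bullet> e))) has_sum (u \<bullet> u') * (v \<bullet> v')) some_basis"
    by (intro has_sum_cmult_right parseval_inner orthonormal_basis_some_basis)
  moreover have "hs_apply (hs_tensor u v) e \<bullet> hs_apply (hs_tensor u' v') e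
      = (u \<bullet> u') * ((v \<bullet> e) * (v' \<bullet> e))" for e
    by (simp add: hs_apply_tensor inner_commute[of e])
  ultimately show ?thesis unfolding inner_hs_def by (simp add: infsumI)
qed

lemma hs_adjoint_exists:
  fixes A :: "'a::{real_inner, banach, second_countable_topology} hs"
  shows "\<exists>!B. \<forall>x y. hs_apply A x \<bullet> y = x \<bullet> hs_apply B y"
proof (rule ex_ex1I)
  have "\<exists>S. finite S \<and> norm (A - (\<Sum>e\<in>S. hs_tensor (hs_apply A e) e)) \<le> 1 / Suc n" for n
    using hs_finite_rank_approx[of "1 / Suc n" A] by auto
  then obtain S where S: "\<And>n. norm (A - (\<Sum>e\<in>S n. hs_tensor (hs_apply A e) e)) \<le> 1 / Suc n"
    by metis
  define X where "X n = (\<Sum>e\<in>S n. hs_tensor (hs_apply A e) e)" for n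
  define Y where "Y n = (\<Sum>e\<in>S n. hs_tensor e (hs_apply A e))" for n
  have X: "X \<longlonglongrightarrow> A"
  proof (rule metric_LIMSEQ_I)
    fix \<epsilon> :: real assume "\<epsilon> > 0"
    then obtain N where N: "1 / Suc N < \<epsilon>" using nat_approx_posE by blast
    have "dist (X n) A < \<epsilon>" if "n \<ge> N" for n
    proof -
      have "dist (X n) A \<le> 1 / Suc n"
        using S[of n] by (simp add: X_def dist_norm norm_minus_commute)
      also have "\<dots> \<le> 1 / Suc N" using that by (intro divide_left_mono) auto
      finally show ?thesis using N by simp
    qed
    then show "\<exists>N. \<forall>n\<ge>N. dist (X n) A < \<epsilon>" by blast
  qed
  have inner_eq: "Y m \<bullet> Y n = X m \<bullet> X n" for m n
    unfolding X_def Y_def inner_sum_left inner_sum_right inner_hs_tensor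
    by (simp add: mult.commute)
  have "dist (Y m) (Y n) = dist (X m) (X n)" for m n
    unfolding dist_norm norm_eq_sqrt_inner
    by (simp add: inner_diff_left inner_diff_right inner_eq)
  then have "Cauchy Y" using LIMSEQ_imp_Cauchy[OF X] by (simp add: Cauchy_def)
  then obtain B where Y: "Y \<longlonglongrightarrow> B" by (metis Cauchy_convergent convergent_def)
  have lim: "(\<lambda>n. hs_apply (Z n) x) \<longlonglongrightarrow> hs_apply C x" if Z: "Z \<longlonglongrightarrow> C"
    for Z :: "nat \<Rightarrow> 'a hs" and C x
  proof (rule LIM_zero_cancel, rule Lim_null_comparison)
    show "\<forall>\<^sub>F n in sequentially. norm (hs_apply (Z n) x - hs_apply C x) \<le> norm (Z n - C) * norm x"
      using norm_hs_apply_le[of "Z _ - C" x] by (simp add: hs_apply_diff)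
    show "(\<lambda>n. norm (Z n - C) * norm x) \<longlonglongrightarrow> 0"
      using tendsto_mult_left_zero[OF tendsto_norm_zero[OF LIM_zero[OF Z]]] .
  qed
  have XY: "hs_apply (X n) x \<bullet> y = x \<bullet> hs_apply (Y n) y" for n x y
    by (simp add: X_def Y_def hs_apply_sum hs_apply_tensor inner_sum_left inner_sum_right
        inner_commute mult.commute)
  have "hs_apply A x \<bullet> y = x \<bullet> hs_apply B y" for x y
  proof (rule LIMSEQ_unique)
    show "(\<lambda>n. hs_apply (X n) x \<bullet> y) \<longlonglongrightarrow> hs_apply A x \<bullet> y"
      by (intro tendsto_intros lim X)
    show "(\<lambda>n. hs_apply (X n) x \<bullet> y) \<longlonglongrightarrow> x \<bullet> hs_apply B y"
      unfolding XY by (intro tendsto_intros lim Y)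
  qed
  then show "\<exists>B. \<forall>x y. hs_apply A x \<bullet> y = x \<bullet> hs_apply B y" by blast
next
  fix B C :: "'a hs"
  assume "\<forall>x y. hs_apply A x \<bullet> y = x \<bullet> hs_apply B y" "\<forall>x y. hs_apply A x \<bullet> y = x \<bullet> hs_apply C y"
  then have "x \<bullet> hs_apply B y = x \<bullet> hs_apply C y" for x y by metis
  then show "B = C" by (intro hs_eqI) (meson vector_eq_ldot)
qed

lemma inner_hs_apply_left: "hs_apply A x \<bullet> y = x \<bullet> hs_apply (hs_adjoint A) y"
  using theI'[OF hs_adjoint_exists[of A]] unfolding hs_adjoint_def by blast

lemma hs_adjoint_unique:
  "(\<And>x y. hs_apply A x \<bullet> y = x \<bullet> hs_apply B y) \<Longrightarrow> hs_adjoint A = B"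
  unfolding hs_adjoint_def by (rule the1_equality[OF hs_adjoint_exists]) blast

lemma norm_hs_any_basis:
  fixes A :: "'a::{real_inner, banach, second_countable_topology} hs"
  assumes E: "orthonormal_basis E"
  shows "((\<lambda>e. (norm (hs_apply A e))\<^sup>2) has_sum (norm A)\<^sup>2) E"
proof -
  have dual: "((\<lambda>e. (norm (hs_apply (hs_adjoint A) e))\<^sup>2) has_sum (norm A)\<^sup>2) F"
    if F: "orthonormal_basis F" for F and A :: "'a hs"
  proof -
    let ?f = "\<lambda>(e, f). (hs_apply A f \<bullet> e)\<^sup>2"
    have 1: "((\<lambda>f. (hs_apply A f \<bullet> e)\<^sup>2) has_sum (norm (hs_apply (hs_adjoint A) e))\<^sup>2) some_basis" for e
      using parseval[OF orthonormal_basis_some_basis, of "hs_apply (hs_adjoint A) e"]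
      by (simp only: inner_hs_apply_left inner_commute[of _ "hs_apply (hs_adjoint A) e"])
    have 2: "((\<lambda>e. (hs_apply A f \<bullet> e)\<^sup>2) has_sum (norm (hs_apply A f))\<^sup>2) F" for f
      by (rule parseval[OF F])
    have 3: "((\<lambda>f. (norm (hs_apply A f))\<^sup>2) has_sum (norm A)\<^sup>2) some_basis"
      unfolding norm_hs_sq by (rule has_sum_infsum[OF summable_hs])
    have "((\<lambda>(f, e). (hs_apply A f \<bullet> e)\<^sup>2) has_sum (norm A)\<^sup>2) (some_basis \<times> F)"
      using 2 3
      by (intro has_sum_SigmaI[OF _ 3] summable_on_SigmaI[where g="\<lambda>f. (norm (hs_apply A f))\<^sup>2"])
         (auto simp: summable_on_def)
    then have "(?f has_sum (norm A)\<^sup>2) (F \<times> some_basis)"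
      by (subst has_sum_swap) (simp add: case_prod_unfold)
    from has_sum_SigmaD[OF this] 1 show ?thesis by simp
  qed
  have "(norm (hs_adjoint A))\<^sup>2 = (norm A)\<^sup>2"
    unfolding norm_hs_sq[of "hs_adjoint A"]
    by (rule infsumI[OF dual[OF orthonormal_basis_some_basis]])
  moreover have "hs_adjoint (hs_adjoint A) = A"
  proof (rule hs_adjoint_unique)
    fix x y
    have "hs_apply (hs_adjoint A) x \<bullet> y = y \<bullet> hs_apply (hs_adjoint A) x"
      by (rule inner_commute)
    also have "\<dots> = hs_apply A y \<bullet> x" by (rule inner_hs_apply_left[symmetric])
    also have "\<dots> = x \<bullet> hs_apply A y" by (rule inner_commute)
    finally show "hs_apply (hs_adjoint A) x \<bullet> y = x \<bullet> hs_apply A y" .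
  qed
  ultimately show ?thesis using dual[OF E, of "hs_adjoint A"] by simp
qed

section \<open>Hilbert-space-valued fractional Brownian motion\<close>

text \<open>A covariance operator of trace class, i.e. a self-adjoint, nonnegative operator with finite
  trace. Since trace-class operators are Hilbert--Schmidt, taking it in \<^typ>\<open>'a hs\<close> is no restriction.\<close>

definition trace_class_covariance ::
    "'a::{real_inner, banach, second_countable_topology} hs \<Rightarrow> bool" where
  "trace_class_covariance \<Lambda> \<longleftrightarrow>
     (\<forall>x y. hs_apply \<Lambda> x \<bullet> y = x \<bullet> hs_apply \<Lambda> y) \<and>
     (\<forall>x. 0 \<le> hs_apply \<Lambda> x \<bullet> x) \<and>
     (\<lambda>e. hs_apply \<Lambda> e \<bullet> e) summable_on some_basis"

text \<open>Degenerate (almost surely constant) variables count as Gaussian.\<close>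

definition gaussian_rv :: "'w measure \<Rightarrow> ('w \<Rightarrow> real) \<Rightarrow> bool" where
  "gaussian_rv M X \<longleftrightarrow> X \<in> borel_measurable M \<and>
     ((\<exists>\<mu>. AE \<omega> in M. X \<omega> = \<mu>) \<or>
      (\<exists>\<mu> \<sigma>. \<sigma> > 0 \<and> distributed M lborel X (normal_density \<mu> \<sigma>)))"

definition gaussian_process ::
    "'w measure \<Rightarrow> real set \<Rightarrow> (real \<Rightarrow> 'w \<Rightarrow> 'a::real_inner) \<Rightarrow> bool" where
  "gaussian_process M T B \<longleftrightarrow>
     (\<forall>s\<in>T. B s \<in> borel_measurable M) \<and>
     (\<forall>ps :: (real \<times> 'a) list. fst ` set ps \<subseteq> T \<longrightarrow>
        gaussian_rv M (\<lambda>\<omega>. \<Sum>(s, v)\<leftarrow>ps. B s \<omega> \<bullet> v))"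

definition fbm_cov :: "real \<Rightarrow> real \<Rightarrow> real \<Rightarrow> real" where
  "fbm_cov H s r = (\<bar>s\<bar> powr (2 * H) + \<bar>r\<bar> powr (2 * H) - \<bar>s - r\<bar> powr (2 * H)) / 2"

definition hilbert_fbm ::
    "'w measure \<Rightarrow> real \<Rightarrow> 'a::{real_inner, banach, second_countable_topology} hs
      \<Rightarrow> (real \<Rightarrow> 'w \<Rightarrow> 'a) \<Rightarrow> bool" where
  "hilbert_fbm M H \<Lambda> B \<longleftrightarrow>
     trace_class_covariance \<Lambda> \<and>
     gaussian_process M {0..} B \<and>
     (\<forall>s\<ge>0. integrable M (\<lambda>\<omega>. (norm (B s \<omega>))\<^sup>2) \<and> has_bochner_integral M (B s) 0) \<and>
     (\<forall>s\<ge>0. \<forall>r\<ge>0. has_bochner_integral M (\<lambda>\<omega>. hs_tensor (B s \<omega>) (B r \<omega>)) (fbm_cov H s r *\<^sub>R \<Lambda>))"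

text \<open>Complete orthonormal system of eigenvectors; the index set \<open>K\<close> accommodates both
  finite- and infinite-dimensional spaces.\<close>

definition eigenbasis ::
    "'a::{real_inner, banach, second_countable_topology} hs
      \<Rightarrow> nat set \<Rightarrow> (nat \<Rightarrow> real) \<Rightarrow> (nat \<Rightarrow> 'a) \<Rightarrow> bool" where
  "eigenbasis \<Lambda> K lam h \<longleftrightarrow>
     inj_on h K \<and> orthonormal_basis (h ` K) \<and> (\<forall>k\<in>K. hs_apply \<Lambda> (h k) = lam k *\<^sub>R h k)"

text \<open>The scalar processes in the expansion of \<open>B s\<close> as the sum of
  \<open>sqrt (lam k) *\<^sub>R b\<^sub>k s *\<^sub>R h k\<close>. If \<open>lam k = 0\<close>, then the coordinate process is
  irrelevant (it is zero here) because it only enters multiplied by \<open>sqrt (lam k)\<close>.\<close>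

definition fbm_coord ::
    "(real \<Rightarrow> 'w \<Rightarrow> 'a::real_inner) \<Rightarrow> (nat \<Rightarrow> real) \<Rightarrow> (nat \<Rightarrow> 'a) \<Rightarrow> nat \<Rightarrow> real \<Rightarrow> 'w \<Rightarrow> real" where
  "fbm_coord B lam h k s \<omega> = (B s \<omega> \<bullet> h k) / sqrt (lam k)"

section \<open>Fractional calculus\<close>

definition frac_int ::
    "real \<Rightarrow> real \<Rightarrow> (real \<Rightarrow> 'k::{banach, second_countable_topology}) \<Rightarrow> real \<Rightarrow> 'k" where
  "frac_int t \<alpha> f x =
     (if \<alpha> = 0 then f x
      else (1 / Gamma \<alpha>) *\<^sub>R (LINT y:{x..t}|lebesgue. (y - x) powr (\<alpha> - 1) *\<^sub>R f y))"

text \<open>For negative order the fractional derivative is the fractional integral of the opposite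
  order. There is no sign \<open>(-1)\<close> to the power \<open>\<lceil>\<alpha>\<rceil>\<close>.\<close>

definition frac_deriv ::
    "real \<Rightarrow> real \<Rightarrow> (real \<Rightarrow> 'k::{banach, second_countable_topology}) \<Rightarrow> real \<Rightarrow> 'k" where
  "frac_deriv t \<alpha> f =
     (if \<alpha> < 0 then frac_int t (- \<alpha>) f
      else ((\<lambda>g x. vector_derivative g (at x)) ^^ nat \<lceil>\<alpha>\<rceil>) (frac_int t (real_of_int \<lceil>\<alpha>\<rceil> - \<alpha>) f))"

section \<open>Integrands and stochastic integrals\<close>

definition L2_fun ::
    "real \<Rightarrow> (real \<Rightarrow> 'k::{banach, second_countable_topology}) set" where
  "L2_fun t = {f \<in> borel_measurable (lebesgue_on {0..t}).
     integrable (lebesgue_on {0..t}) (\<lambda>s. (norm (f s))\<^sup>2)}"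

definition LH_energy :: "real \<Rightarrow> real \<Rightarrow> (real \<Rightarrow> 'k::real_normed_vector) \<Rightarrow> ennreal" where
  "LH_energy H t f =
     (\<integral>\<^sup>+s. (\<integral>\<^sup>+r. ennreal (norm (f s) * norm (f r) * (H * (2 * H - 1)) * \<bar>s - r\<bar> powr (2 * H - 2))
        \<partial>lebesgue_on {0..t}) \<partial>lebesgue_on {0..t})"

text \<open>The preimages of \<open>f\<close> in \<open>L\<^sup>2\<close> under the fractional integral of order \<open>1/2 - H\<close>; functions
  are identified when they agree almost everywhere.\<close>

definition frac_preimages ::
    "real \<Rightarrow> real \<Rightarrow> (real \<Rightarrow> 'k::{banach, second_countable_topology}) \<Rightarrow> (real \<Rightarrow> 'k) set" where
  "frac_preimages H t f =
     {\<phi> \<in> L2_fun t. AE s in lebesgue_on {0..t}. f s = frac_int t (1/2 - H) \<phi> s}"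

definition LH ::
    "real \<Rightarrow> real \<Rightarrow> (real \<Rightarrow> 'k::{banach, second_countable_topology}) set" where
  "LH H t =
     (if H > 1/2 then {f \<in> borel_measurable (lebesgue_on {0..t}). LH_energy H t f < \<infinity>}
      else {f. frac_preimages H t f \<noteq> {}})"

text \<open>The squared norm of \<^const>\<open>LH\<close>: for \<open>H > 1/2\<close> the square root of \<^const>\<open>LH_energy\<close> is a norm, for
  \<open>H \<le> 1/2\<close> the norm is transported from \<open>L\<^sup>2\<close> (the preimage is unique almost everywhere).\<close>

definition LH_norm_sq ::
    "real \<Rightarrow> real \<Rightarrow> (real \<Rightarrow> 'k::{banach, second_countable_topology}) \<Rightarrow> ennreal" where
  "LH_norm_sq H t f =
     (if H > 1/2 then LH_energy H t f
      else (INF \<phi>\<in>frac_preimages H t f. \<integral>\<^sup>+s. ennreal ((norm (\<phi> s))\<^sup>2) \<partial>lebesgue_on {0..t}))"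

text \<open>A list of pairs \<open>(s, x)\<close> encodes the step function given by the sum of the \<open>1\<^bsub>[0,s]\<^esub> x\<close>.\<close>

definition step_fun :: "(real \<times> 'k::real_vector) list \<Rightarrow> real \<Rightarrow> 'k" where
  "step_fun ps r = (\<Sum>(s, x)\<leftarrow>ps. indicator {0..s} r *\<^sub>R x)"

definition step_integral ::
    "(real \<Rightarrow> 'w \<Rightarrow> real) \<Rightarrow> (real \<times> 'k::real_vector) list \<Rightarrow> 'w \<Rightarrow> 'k" where
  "step_integral b ps \<omega> = (\<Sum>(s, x)\<leftarrow>ps. b s \<omega> *\<^sub>R x)"

definition converges_L2 ::
    "'w measure \<Rightarrow> (nat \<Rightarrow> 'w \<Rightarrow> 'k::real_normed_vector) \<Rightarrow> ('w \<Rightarrow> 'k) \<Rightarrow> bool" where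
  "converges_L2 M X Y \<longleftrightarrow> Y \<in> borel_measurable M \<and>
     (\<lambda>n. \<integral>\<^sup>+\<omega>. ennreal ((norm (X n \<omega> - Y \<omega>))\<^sup>2) \<partial>M) \<longlonglongrightarrow> 0"

text \<open>The continuous linear extension of the integral of step functions from the norm of
  \<^const>\<open>LH\<close> to \<open>L\<^sup>2(\<Omega>)\<close>. It is determined up to almost sure equality; a version is chosen.\<close>

definition wiener_integral ::
    "'w measure \<Rightarrow> real \<Rightarrow> real \<Rightarrow> (real \<Rightarrow> 'w \<Rightarrow> real)
      \<Rightarrow> (real \<Rightarrow> 'k::{banach, second_countable_topology}) \<Rightarrow> 'w \<Rightarrow> 'k" where
  "wiener_integral M H t b f =
     (SOME X. \<exists>ps :: nat \<Rightarrow> (real \<times> 'k) list.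
        (\<forall>n. fst ` set (ps n) \<subseteq> {0..t}) \<and>
        (\<lambda>n. LH_norm_sq H t (\<lambda>s. step_fun (ps n) s - f s)) \<longlonglongrightarrow> 0 \<and>
        converges_L2 M (\<lambda>n. step_integral b (ps n)) X)"

text \<open>The series converges in \<open>L\<^sup>2(\<Omega>)\<close>; again a version is chosen.\<close>

definition stoch_integral ::
    "'w measure \<Rightarrow> real \<Rightarrow> real
      \<Rightarrow> (real \<Rightarrow> 'w \<Rightarrow> 'a::{real_inner, banach, second_countable_topology})
      \<Rightarrow> nat set \<Rightarrow> (nat \<Rightarrow> real) \<Rightarrow> (nat \<Rightarrow> 'a) \<Rightarrow> (real \<Rightarrow> 'a hs) \<Rightarrow> 'w \<Rightarrow> 'a" where
  "stoch_integral M H t B K lam h F =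
     (SOME X. converges_L2 M
        (\<lambda>n \<omega>. \<Sum>k\<in>K \<inter> {..<n}. sqrt (lam k) *\<^sub>R
           wiener_integral M H t (fbm_coord B lam h k) (\<lambda>s. hs_apply (F s) (h k)) \<omega>)
        X)"

definition hurst_const :: "real \<Rightarrow> real" where
  "hurst_const H = 2 * H * Gamma (3/2 - H) * Gamma (H + 1/2) / Gamma (2 - 2 * H)"

end

theory Submission
  imports Defs
begin

text \<open>Write \<open>T F\<close> for the transform \<open>s \<mapsto> s\<^sup>\<alpha> (D\<^sup>\<alpha> r\<^sup>-\<^sup>\<alpha> F) (s)\<close> with \<open>\<alpha> = 1/2 - H\<close>, so that the
right-hand side of the theorem is \<open>c(H) \<integral> T F \<Lambda> (T G)* ds\<close>. The theorem is an Ito isometry, and it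
rests on one scalar identity, \<open>fbm_transform_indicator_covariance\<close>:
\<open>c(H) \<integral> T 1[0,u] T 1[0,v] ds = E b(u) b(v)\<close> for a real fractional Brownian motion \<open>b\<close>. By bilinearity
the integral of step functions is therefore isometric, up to \<open>c(H)\<close>, to \<open>T\<close> followed by the inner
product of \<open>L\<^sup>2\<close> (\<open>step_isometry\<close>). Two facts carry this to all integrands: step functions are dense
in the space of integrands (\<open>step_fun_dense\<close>), and \<open>T\<close> is continuous from that space to \<open>L\<^sup>2\<close>
(\<open>step_transform_bound\<close>). Completeness of \<open>L\<^sup>2(\<Omega>)\<close> then yields the Wiener integral, and any bounded
bilinear product of two Wiener integrals can be computed in the limit (\<open>wiener_isometry\<close>).

The three scalar facts have different proofs in the three ranges of \<open>H\<close>. For \<open>H > 1/2\<close>, \<open>T\<close> is an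
integral operator with an explicit positive kernel \<open>k\<close>, and a Beta integral evaluates
\<open>\<integral> k(x,y) k(x,z) dx\<close> as a multiple of \<open>\<bar>y - z\<bar>\<close> to the power \<open>2H - 2\<close>. Hence the norm of the
integrand space is, up to a constant, the \<open>L\<^sup>2\<close> norm of \<open>k\<close> applied to the pointwise norm of the integrand, which gives
continuity, and the covariance identity is a double integral of that power. For \<open>H < 1/2\<close> an integrand is a
fractional integral \<open>I\<^sup>\<alpha> \<phi>\<close> of some \<open>\<phi>\<close> in \<open>L\<^sup>2\<close>, and \<open>T\<close> differentiates \<open>I\<^sup>1\<^sup>-\<^sup>\<alpha> r\<^sup>-\<^sup>\<alpha> I\<^sup>\<alpha> \<phi>\<close>. Composing
the kernels shows that this is a tail integral, so that by Lebesgue's differentiation theorem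
\<open>T (I\<^sup>\<alpha> \<phi>)\<close> equals \<open>- (\<phi> + C \<phi>)\<close>, where \<open>C\<close> is an integral operator bounded on \<open>L\<^sup>2\<close>
(\<open>fbm_transform_eq_corr_op_AE\<close>). Density amounts to approximating in \<open>L\<^sup>2\<close> by the functions
\<open>x \<mapsto> (u - x)\<^sup>-\<^sup>\<alpha>\<close>, whose fractional integrals are multiples of the indicators of \<open>[0,u]\<close>; it follows from Abel's
identity, which writes an indicator as a superposition of such functions. The covariance identity
comes from an explicit formula for \<open>T 1[0,u]\<close>. For \<open>H = 1/2\<close>, \<open>T\<close> is the identity.

For operator-valued integrands let \<open>b\<^sub>k\<close> be the coordinates of the motion in the eigenbasis \<open>h\<^sub>k\<close> of
\<open>\<Lambda>\<close>. They are uncorrelated, so the summands of the defining series are orthogonal, and the partial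
sums have second moment \<open>c(H) \<integral> \<Sum>\<^sub>k \<lambda>\<^sub>k (T F h\<^sub>k) \<otimes> (T G h\<^sub>k) ds\<close> (\<open>partial_integral_isometry\<close>). The
sum over \<open>k\<close> converges pointwise to \<open>T F \<Lambda> (T G)*\<close> and is dominated by a multiple of
\<open>\<parallel>T F\<parallel> \<parallel>T G\<parallel>\<close>, which is integrable (\<open>spectral_integral\<close>).\<close>

section \<open>Square integrable functions and combinations of generators\<close>

abbreviation Leb :: "real \<Rightarrow> real measure" where
  "Leb t \<equiv> lebesgue_on {0..t}"

lemma measurable_ident_lebesgue_on: "(\<lambda>x. x) \<in> borel_measurable (lebesgue_on S)"
  using id_borel_measurable_lebesgue_on[of S] by (simp add: id_def)

text \<open>An extended nonnegative value avoids integrability side conditions in limit arguments.\<close>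

definition L2_sq :: "'b measure \<Rightarrow> ('b \<Rightarrow> 'k::real_normed_vector) \<Rightarrow> ennreal" where
  "L2_sq M f = (\<integral>\<^sup>+x. ennreal ((norm (f x))\<^sup>2) \<partial>M)"

lemma L2_fun_iff:
  "f \<in> L2_fun t \<longleftrightarrow>
    f \<in> borel_measurable (Leb t) \<and> L2_sq (Leb t) f < \<infinity>"
  unfolding L2_fun_def L2_sq_def by (auto simp: integrable_iff_bounded)

lemma norm_add_sq_le: "(norm (x + y))\<^sup>2 \<le> 2 * (norm x)\<^sup>2 + 2 * (norm y)\<^sup>2"
  for x y :: "'k::real_normed_vector"
proof -
  have "(norm (x + y))\<^sup>2 \<le> (norm x + norm y)\<^sup>2"
    by (intro power_mono norm_triangle_ineq) simp
  also have "\<dots> \<le> 2 * (norm x)\<^sup>2 + 2 * (norm y)\<^sup>2"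
    using sum_squares_bound[of "norm x" "norm y"] by (simp add: power2_sum)
  finally show ?thesis .
qed

lemma L2_sq_add_le:
  fixes f g :: "'b \<Rightarrow> 'k::{real_normed_vector, second_countable_topology}"
  assumes [measurable]: "f \<in> borel_measurable M" "g \<in> borel_measurable M"
  shows "L2_sq M (\<lambda>x. f x + g x) \<le> 2 * L2_sq M f + 2 * L2_sq M g"
proof -
  have "L2_sq M (\<lambda>x. f x + g x)
      \<le> (\<integral>\<^sup>+x. 2 * ennreal ((norm (f x))\<^sup>2) + 2 * ennreal ((norm (g x))\<^sup>2) \<partial>M)"
    unfolding L2_sq_def
  proof (rule nn_integral_mono)
    fix x
    have "ennreal ((norm (f x + g x))\<^sup>2) \<le> ennreal (2 * (norm (f x))\<^sup>2 + 2 * (norm (g x))\<^sup>2)"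
      by (intro ennreal_leI norm_add_sq_le)
    also have "\<dots> = 2 * ennreal ((norm (f x))\<^sup>2) + 2 * ennreal ((norm (g x))\<^sup>2)"
      by (simp add: ennreal_mult)
    finally show "ennreal ((norm (f x + g x))\<^sup>2)
        \<le> 2 * ennreal ((norm (f x))\<^sup>2) + 2 * ennreal ((norm (g x))\<^sup>2)" .
  qed
  also have "\<dots> = 2 * L2_sq M f + 2 * L2_sq M g"
    unfolding L2_sq_def by (simp add: nn_integral_add nn_integral_cmult)
  finally show ?thesis .
qed

lemma L2_sq_uminus: "L2_sq M (\<lambda>x. - f x) = L2_sq M f"
  by (simp add: L2_sq_def)

lemma L2_sq_minus_commute: "L2_sq M (\<lambda>x. f x - g x) = L2_sq M (\<lambda>x. g x - f x)"
  by (simp add: L2_sq_def norm_minus_commute)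

lemma L2_sq_diff_le:
  fixes f g :: "'b \<Rightarrow> 'k::{real_normed_vector, second_countable_topology}"
  assumes [measurable]: "f \<in> borel_measurable M" "g \<in> borel_measurable M"
  shows "L2_sq M (\<lambda>x. f x - g x) \<le> 2 * L2_sq M f + 2 * L2_sq M g"
  using L2_sq_add_le[of f M "\<lambda>x. - g x"] by (simp add: L2_sq_uminus)

lemma L2_sq_triangle_le:
  fixes f g h :: "'b \<Rightarrow> 'k::{real_normed_vector, second_countable_topology}"
  assumes [measurable]: "f \<in> borel_measurable M" "g \<in> borel_measurable M" "h \<in> borel_measurable M"
  shows "L2_sq M (\<lambda>x. f x - h x) \<le> 2 * L2_sq M (\<lambda>x. f x - g x) + 2 * L2_sq M (\<lambda>x. g x - h x)"
  using L2_sq_add_le[of "\<lambda>x. f x - g x" M "\<lambda>x. g x - h x"] by simp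

lemma L2_sq_cong_AE: "AE x in M. f x = g x \<Longrightarrow> L2_sq M f = L2_sq M g"
  unfolding L2_sq_def by (rule nn_integral_cong_AE) auto

lemma L2_sq_map_le:
  fixes f :: "'b \<Rightarrow> 'k::{real_normed_vector, second_countable_topology}"
    and L :: "'k \<Rightarrow> 'l::real_normed_vector"
  assumes [measurable]: "f \<in> borel_measurable M" and L: "\<And>y. norm (L y) \<le> B * norm y"
  shows "L2_sq M (\<lambda>x. L (f x)) \<le> ennreal (B\<^sup>2) * L2_sq M f"
proof -
  have "L2_sq M (\<lambda>x. L (f x)) \<le> (\<integral>\<^sup>+x. ennreal (B\<^sup>2) * ennreal ((norm (f x))\<^sup>2) \<partial>M)"
    unfolding L2_sq_def
  proof (rule nn_integral_mono)
    fix x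
    have "(norm (L (f x)))\<^sup>2 \<le> (B * norm (f x))\<^sup>2" by (intro power_mono L) simp
    then show "ennreal ((norm (L (f x)))\<^sup>2) \<le> ennreal (B\<^sup>2) * ennreal ((norm (f x))\<^sup>2)"
      by (simp add: ennreal_mult[symmetric] power_mult_distrib ennreal_leI)
  qed
  then show ?thesis unfolding L2_sq_def by (simp add: nn_integral_cmult)
qed

text \<open>Step functions, their transforms, step integrals and the preimages of step functions under the
fractional integral are all finite linear combinations of generators indexed by time: the generators
are indicators, transformed indicators, the values of the process, and Abel kernels. Sharing the list
of coefficients lets identities pass from one to the other.\<close>

definition comb :: "(real \<Rightarrow> 'b \<Rightarrow> real) \<Rightarrow> (real \<times> 'k::real_vector) list \<Rightarrow> 'b \<Rightarrow> 'k" where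
  "comb \<kappa> ps x = (\<Sum>(s, v)\<leftarrow>ps. \<kappa> s x *\<^sub>R v)"

lemma comb_Nil [simp]: "comb \<kappa> [] x = 0"
  by (simp add: comb_def)

lemma comb_Cons: "comb \<kappa> ((s, v) # ps) x = \<kappa> s x *\<^sub>R v + comb \<kappa> ps x"
  by (simp add: comb_def)

lemma comb_append: "comb \<kappa> (ps @ qs) x = comb \<kappa> ps x + comb \<kappa> qs x"
  by (simp add: comb_def)

lemma comb_map:
  assumes "linear L"
  shows "comb \<kappa> (map (\<lambda>(s, v). (s, L v)) ps) x = L (comb \<kappa> ps x)"
proof -
  interpret linear L by fact
  show ?thesis by (induction ps) (auto simp: comb_Cons add scale)
qed

lemma borel_measurable_comb:
  fixes ps :: "(real \<times> 'k::{real_normed_vector, second_countable_topology}) list"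
  assumes [measurable]: "\<And>s. \<kappa> s \<in> borel_measurable M"
  shows "comb \<kappa> ps \<in> borel_measurable M"
proof (induction ps)
  case Nil
  show ?case by (simp add: comb_def[abs_def])
next
  case (Cons p ps)
  obtain s v where p: "p = (s, v)" by fastforce
  have [measurable]: "comb \<kappa> ps \<in> borel_measurable M" by fact
  have "comb \<kappa> (p # ps) = (\<lambda>x. \<kappa> s x *\<^sub>R v + comb \<kappa> ps x)"
    by (auto simp: p comb_Cons)
  then show ?case by simp
qed

lemma step_fun_eq_comb: "step_fun = comb (\<lambda>s. indicat_real {0..s})"
  by (intro ext) (simp add: step_fun_def comb_def)

lemma step_fun_Nil [simp]: "step_fun [] r = 0"
  by (simp add: step_fun_def)

lemma step_fun_Cons: "step_fun ((s, x) # ps) r = indicator {0..s} r *\<^sub>R x + step_fun ps r"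
  by (simp add: step_fun_def)

lemma borel_measurable_step_fun [measurable]:
  fixes ps :: "(real \<times> 'k::{real_normed_vector, second_countable_topology}) list"
  shows "step_fun ps \<in> borel_measurable borel"
  unfolding step_fun_eq_comb by (rule borel_measurable_comb) measurable

lemma measurable_lebesgue_on_borel:
  "f \<in> borel_measurable borel \<Longrightarrow> f \<in> borel_measurable (lebesgue_on S)"
  by (rule measurable_compose[OF measurable_ident_lebesgue_on])

lemmas borel_measurable_step_fun_lebesgue_on [measurable] =
  measurable_lebesgue_on_borel[OF borel_measurable_step_fun]

text \<open>The closed linear span of the generators \<open>\<kappa> s\<close> in \<open>L\<^sup>2\<close>. Vector-valued coefficients are
allowed, so that scalar density results extend to Banach spaces.\<close>

definition approximable ::
    "(real \<Rightarrow> real \<Rightarrow> real) \<Rightarrow> real \<Rightarrow> (real \<Rightarrow> 'k::{banach, second_countable_topology}) \<Rightarrow> bool" where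
  "approximable \<kappa> t f \<longleftrightarrow> f \<in> borel_measurable (Leb t) \<and>
     (\<forall>\<epsilon>>0. \<exists>ps. fst ` set ps \<subseteq> {0..t} \<and>
        L2_sq (Leb t) (\<lambda>x. comb \<kappa> ps x - f x) < ennreal \<epsilon>)"

context
  fixes \<kappa> :: "real \<Rightarrow> real \<Rightarrow> real" and t :: real
  assumes \<kappa>: "\<And>s. \<kappa> s \<in> borel_measurable (Leb t)"
begin

lemma borel_measurable_comb_generator [measurable]:
  "comb \<kappa> ps \<in> borel_measurable (Leb t)"
  for ps :: "(real \<times> 'k::{real_normed_vector, second_countable_topology}) list"
  using \<kappa> by (rule borel_measurable_comb)

lemma approximable_limit:
  fixes f :: "real \<Rightarrow> 'k::{banach, second_countable_topology}"
  assumes [measurable]: "f \<in> borel_measurable (Leb t)"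
    and g: "\<And>\<epsilon>. \<epsilon> > 0 \<Longrightarrow> \<exists>g. approximable \<kappa> t g \<and>
      L2_sq (Leb t) (\<lambda>x. g x - f x) < ennreal \<epsilon>"
  shows "approximable \<kappa> t f"
  unfolding approximable_def
proof (intro conjI allI impI)
  fix \<epsilon> :: real assume \<epsilon>: "\<epsilon> > 0"
  obtain g where sg: "approximable \<kappa> t g"
    and g1: "L2_sq (Leb t) (\<lambda>x. g x - f x) < ennreal (\<epsilon>/4)"
    using g[of "\<epsilon>/4"] \<epsilon> by auto
  have [measurable]: "g \<in> borel_measurable (Leb t)"
    using sg by (simp add: approximable_def)
  obtain ps where ps: "fst ` set ps \<subseteq> {0..t}"
    "L2_sq (Leb t) (\<lambda>x. comb \<kappa> ps x - g x) < ennreal (\<epsilon>/4)"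
    using sg \<epsilon> unfolding approximable_def by (meson divide_pos_pos zero_less_numeral)
  have "L2_sq (Leb t) (\<lambda>x. comb \<kappa> ps x - f x) \<le>
    2 * L2_sq (Leb t) (\<lambda>x. comb \<kappa> ps x - g x) + 2 * L2_sq (Leb t) (\<lambda>x. g x - f x)"
    by (rule L2_sq_triangle_le) measurable
  also have "\<dots> < 2 * ennreal (\<epsilon>/4) + 2 * ennreal (\<epsilon>/4)"
    using ps(2) g1 by (intro add_strict_mono ennreal_mult_strict_left_mono) auto
  also have "\<dots> = ennreal \<epsilon>"
  proof -
    have "2 * ennreal (\<epsilon>/4) = ennreal (\<epsilon>/2)"
      using \<epsilon> ennreal_mult'[of 2 "\<epsilon>/4"] by simp
    then show ?thesis using \<epsilon> by (simp flip: ennreal_plus)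
  qed
  finally show "\<exists>ps. fst ` set ps \<subseteq> {0..t} \<and> L2_sq (Leb t) (\<lambda>x. comb \<kappa> ps x - f x) < ennreal \<epsilon>"
    using ps(1) by blast
qed fact

lemma approximable_comb:
  "fst ` set ps \<subseteq> {0..t} \<Longrightarrow> approximable \<kappa> t (comb \<kappa> ps)"
  unfolding approximable_def
proof (intro conjI allI impI exI)
  show "L2_sq (Leb t) (\<lambda>x. comb \<kappa> ps x - comb \<kappa> ps x) < ennreal \<epsilon>" if "\<epsilon> > 0" for \<epsilon>
    using that by (simp add: L2_sq_def)
qed auto

lemma approximable_add:
  fixes f g :: "real \<Rightarrow> 'k::{banach, second_countable_topology}"
  assumes f: "approximable \<kappa> t f" and g: "approximable \<kappa> t g"
  shows "approximable \<kappa> t (\<lambda>x. f x + g x)"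
  unfolding approximable_def
proof (intro conjI allI impI)
  have [measurable]: "f \<in> borel_measurable (Leb t)" "g \<in> borel_measurable (Leb t)"
    using f g by (auto simp: approximable_def)
  show "(\<lambda>x. f x + g x) \<in> borel_measurable (Leb t)" by measurable
  fix \<epsilon> :: real assume \<epsilon>: "\<epsilon> > 0"
  then have "\<epsilon>/4 > 0" by simp
  then obtain ps qs where ps: "fst ` set ps \<subseteq> {0..t}"
    "L2_sq (Leb t) (\<lambda>x. comb \<kappa> ps x - f x) < ennreal (\<epsilon>/4)"
    and qs: "fst ` set qs \<subseteq> {0..t}"
    "L2_sq (Leb t) (\<lambda>x. comb \<kappa> qs x - g x) < ennreal (\<epsilon>/4)"
    using f g unfolding approximable_def by blast
  have "L2_sq (Leb t) (\<lambda>x. comb \<kappa> (ps @ qs) x - (f x + g x)) =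
    L2_sq (Leb t) (\<lambda>x. (comb \<kappa> ps x - f x) + (comb \<kappa> qs x - g x))"
    by (simp add: comb_append algebra_simps)
  also have "\<dots> \<le> 2 * L2_sq (Leb t) (\<lambda>x. comb \<kappa> ps x - f x) +
      2 * L2_sq (Leb t) (\<lambda>x. comb \<kappa> qs x - g x)"
    by (rule L2_sq_add_le) measurable
  also have "\<dots> < 2 * ennreal (\<epsilon>/4) + 2 * ennreal (\<epsilon>/4)"
    using ps(2) qs(2) by (intro add_strict_mono ennreal_mult_strict_left_mono) auto
  also have "\<dots> = ennreal \<epsilon>"
  proof -
    have "2 * ennreal (\<epsilon>/4) = ennreal (\<epsilon>/2)"
      using \<epsilon> ennreal_mult'[of 2 "\<epsilon>/4"] by simp
    then show ?thesis using \<epsilon> by (simp flip: ennreal_plus)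
  qed
  finally show "\<exists>ps. fst ` set ps \<subseteq> {0..t} \<and>
      L2_sq (Leb t) (\<lambda>x. comb \<kappa> ps x - (f x + g x)) < ennreal \<epsilon>"
    using ps(1) qs(1) by (intro exI[of _ "ps @ qs"]) auto
qed

lemma approximable_linear:
  fixes f :: "real \<Rightarrow> 'k::{banach, second_countable_topology}"
    and L :: "'k \<Rightarrow> 'l::{banach, second_countable_topology}"
  assumes f: "approximable \<kappa> t f" and L: "bounded_linear L"
  shows "approximable \<kappa> t (\<lambda>x. L (f x))"
  unfolding approximable_def
proof (intro conjI allI impI)
  have [measurable]: "f \<in> borel_measurable (Leb t)"
    using f by (auto simp: approximable_def)
  have [measurable]: "L \<in> borel_measurable borel"
    by (intro borel_measurable_continuous_onI linear_continuous_on L)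
  show "(\<lambda>x. L (f x)) \<in> borel_measurable (Leb t)" by measurable
  obtain B where B: "B > 0" "\<And>y. norm (L y) \<le> B * norm y"
    using bounded_linear.pos_bounded[OF L] by (auto simp: mult.commute)
  fix \<epsilon> :: real assume \<epsilon>: "\<epsilon> > 0"
  then have "\<epsilon> / B\<^sup>2 > 0" using B by simp
  then obtain ps where ps: "fst ` set ps \<subseteq> {0..t}"
    "L2_sq (Leb t) (\<lambda>x. comb \<kappa> ps x - f x) < ennreal (\<epsilon> / B\<^sup>2)"
    using f unfolding approximable_def by blast
  let ?qs = "map (\<lambda>(s, x). (s, L x)) ps"
  have "L2_sq (Leb t) (\<lambda>x. comb \<kappa> ?qs x - L (f x)) =
      L2_sq (Leb t) (\<lambda>x. L (comb \<kappa> ps x - f x))"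
    by (simp add: comb_map[OF bounded_linear.linear[OF L]] bounded_linear.linear[OF L, THEN linear_diff])
  also have "\<dots> \<le> ennreal (B\<^sup>2) * L2_sq (Leb t) (\<lambda>x. comb \<kappa> ps x - f x)"
    by (rule L2_sq_map_le[OF _ B(2)]) measurable
  also have "\<dots> < ennreal (B\<^sup>2) * ennreal (\<epsilon> / B\<^sup>2)"
    using ps(2) B(1) by (intro ennreal_mult_strict_left_mono) auto
  also have "\<dots> = ennreal \<epsilon>" using B \<epsilon> by (simp flip: ennreal_mult)
  finally show "\<exists>ps. fst ` set ps \<subseteq> {0..t} \<and>
      L2_sq (Leb t) (\<lambda>x. comb \<kappa> ps x - L (f x)) < ennreal \<epsilon>"
    using ps(1) by (intro exI[of _ ?qs]) (auto simp: case_prod_unfold image_image)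
qed

lemma approximable_sum:
  fixes f :: "'i \<Rightarrow> real \<Rightarrow> 'k::{banach, second_countable_topology}"
  assumes "\<And>i. i \<in> I \<Longrightarrow> approximable \<kappa> t (f i)"
  shows "approximable \<kappa> t (\<lambda>x. \<Sum>i\<in>I. f i x)"
  using assms
proof (induction I rule: infinite_finite_induct)
  case (insert i I)
  then show ?case by (auto intro: approximable_add)
qed (use approximable_comb[of "[]"] in \<open>auto simp: comb_def[abs_def]\<close>)

text \<open>This reduces density to a single function: if \<open>\<kappa>\<close> approximates each generator of a
dense family, it approximates everything.\<close>

lemma approximable_trans:
  fixes f :: "real \<Rightarrow> 'k::{banach, second_countable_topology}"
  assumes f: "approximable \<theta> t f" and \<theta>: "\<And>s. s \<in> {0..t} \<Longrightarrow> approximable \<kappa> t (\<theta> s)"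
  shows "approximable \<kappa> t f"
proof (rule approximable_limit)
  show "f \<in> borel_measurable (Leb t)" using f by (simp add: approximable_def)
  fix \<epsilon> :: real assume "\<epsilon> > 0"
  then obtain ps where ps: "fst ` set ps \<subseteq> {0..t}"
    "L2_sq (Leb t) (\<lambda>x. comb \<theta> ps x - f x) < ennreal \<epsilon>"
    using f unfolding approximable_def by blast
  from ps(1) have "approximable \<kappa> t (comb \<theta> ps)"
  proof (induction ps)
    case Nil
    show ?case using approximable_comb[of "[]"] by (simp add: comb_def[abs_def])
  next
    case (Cons p ps)
    obtain s v where p: "p = (s, v)" by fastforce
    have "approximable \<kappa> t (\<lambda>x. \<theta> s x *\<^sub>R v + comb \<theta> ps x)"
      using Cons by (intro approximable_add approximable_linear[OF \<theta> bounded_linear_scaleR_left]) (auto simp: p)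
    then show ?case by (simp add: p comb_Cons[abs_def])
  qed
  then show "\<exists>g. approximable \<kappa> t g \<and> L2_sq (Leb t) (\<lambda>x. g x - f x) < ennreal \<epsilon>"
    using ps(2) by blast
qed

end

abbreviation step_approx ::
    "real \<Rightarrow> (real \<Rightarrow> 'k::{banach, second_countable_topology}) \<Rightarrow> bool" where
  "step_approx \<equiv> approximable (\<lambda>s. indicat_real {0..s})"

lemma step_approx_def:
  "step_approx t f \<longleftrightarrow> f \<in> borel_measurable (Leb t) \<and>
     (\<forall>\<epsilon>>0. \<exists>ps. fst ` set ps \<subseteq> {0..t} \<and>
        L2_sq (Leb t) (\<lambda>x. step_fun ps x - f x) < ennreal \<epsilon>)"
  unfolding approximable_def step_fun_eq_comb by (rule refl)

lemma borel_measurable_indicator_Icc: "indicat_real {0..s::real} \<in> borel_measurable (lebesgue_on S)"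
  by (intro measurable_lebesgue_on_borel borel_measurable_indicator atLeastAtMost_borel)

lemmas step_approx_limit = approximable_limit[OF borel_measurable_indicator_Icc]
lemmas step_approx_step_fun = approximable_comb[OF borel_measurable_indicator_Icc, folded step_fun_eq_comb]
lemmas step_approx_add = approximable_add[OF borel_measurable_indicator_Icc]
lemmas step_approx_linear = approximable_linear[OF borel_measurable_indicator_Icc]
lemmas step_approx_sum = approximable_sum[OF borel_measurable_indicator_Icc]

lemma step_approx_cong:
  assumes "\<And>x. x \<in> {0..t} \<Longrightarrow> f x = g x" "step_approx t f"
  shows "step_approx t g"
proof -
  have "f \<in> borel_measurable (Leb t) \<longleftrightarrow> g \<in> borel_measurable (Leb t)"
    using assms(1) by (intro measurable_cong) auto
  moreover have "L2_sq (Leb t) (\<lambda>x. step_fun ps x - f x) = L2_sq (Leb t) (\<lambda>x. step_fun ps x - g x)" for ps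
    unfolding L2_sq_def using assms(1) by (intro nn_integral_cong) auto
  ultimately show ?thesis using assms(2) by (simp add: step_approx_def)
qed

lemma finite_measure_Icc: "finite_measure (lebesgue_on {a..b::real})"
  by (rule finite_measure_lebesgue_on) simp

text \<open>The half-lines form a generator, closed under intersection, of the Borel sets, and the sets
with approximable indicator are closed under complements and countable disjoint unions.\<close>

lemma step_approx_indicator_borel:
  assumes t: "0 \<le> t" and A: "A \<in> sets (borel :: real measure)"
  shows "step_approx t (indicator A :: real \<Rightarrow> real)"
proof -
  interpret finite_measure "Leb t" by (rule finite_measure_Icc)
  have one: "step_approx t (\<lambda>x. 1 :: real)"
    by (rule step_approx_cong[OF _ step_approx_step_fun[of "[(t, 1)]"]]) (use t in \<open>auto simp: step_fun_def comb_def\<close>)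
  have *: "A \<in> sigma_sets UNIV (range atMost)"
    using A by (simp add: borel_eq_atMost)
  have "Int_stable (range atMost :: real set set)"
    by (auto simp: Int_stable_def image_iff Int_atMost)
  moreover have "range atMost \<subseteq> Pow (UNIV :: real set)" by simp
  ultimately show ?thesis using *
  proof (induction rule: sigma_sets_induct_disjoint)
    case (basic A)
    then obtain s where s: "A = {..s}" by auto
    show ?case
    proof (cases "s < 0")
      case True
      show ?thesis
        by (rule step_approx_cong[OF _ step_approx_step_fun[of "[]"]]) (use s True in \<open>auto simp: step_fun_def comb_def\<close>)
    next
      case False
      show ?thesis
        by (rule step_approx_cong[OF _ step_approx_step_fun[of "[(min s t, 1)]"]])
           (use s False t in \<open>auto simp: step_fun_def comb_def indicator_def\<close>)
    qed
  next
    case empty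
    show ?case
      by (rule step_approx_cong[OF _ step_approx_step_fun[of "[]"]]) (auto simp: step_fun_def comb_def)
  next
    case (compl A)
    have "step_approx t (\<lambda>x. 1 + - indicat_real A x)"
      by (intro step_approx_add one step_approx_linear[OF compl(2)] bounded_linear_minus bounded_linear_ident)
    then show ?case
      by (rule step_approx_cong[rotated]) (simp add: indicator_def)
  next
    case (union A)
    have [measurable]: "A i \<in> sets borel" for i
      using union.hyps by (simp add: borel_eq_atMost sets_measure_of image_subset_iff)
    show ?case
    proof (rule step_approx_limit)
      show "indicat_real (\<Union>(range A)) \<in> borel_measurable (Leb t)"
        by (rule measurable_lebesgue_on_borel) measurable
      fix \<epsilon> :: real assume \<epsilon>: "\<epsilon> > 0"
      let ?f = "\<lambda>n x. \<Sum>i<n. indicat_real (A i) x"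
      have sm: "(\<lambda>n. L2_sq (Leb t) (\<lambda>x. ?f n x - indicat_real (\<Union>(range A)) x)) \<longlonglongrightarrow> 
          (\<integral>\<^sup>+x. 0 \<partial>Leb t)"
        unfolding L2_sq_def
      proof (rule nn_integral_dominated_convergence[where w="\<lambda>_. 1"])
        have f: "?f n x = indicat_real (\<Union>i<n. A i) x" for n x
          using union.hyps by (subst indicator_UN_disjoint) (auto simp: disjoint_family_on_def)
        show "AE x in Leb t. ennreal ((norm (?f n x - indicat_real (\<Union> (range A)) x))\<^sup>2) \<le> 1" for n
          unfolding f by (auto simp: indicator_def)
        show "AE x in Leb t. (\<lambda>n. ennreal ((norm (?f n x - indicat_real (\<Union> (range A)) x))\<^sup>2)) \<longlonglongrightarrow> 0"
          unfolding f
        proof (rule AE_I2)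
          fix x
          have "(\<lambda>n. indicat_real (\<Union>i<n. A i) x) \<longlonglongrightarrow> indicat_real (\<Union> (range A)) x"
            by (rule LIMSEQ_indicator_UN)
          then have "(\<lambda>n. ennreal ((norm (indicat_real (\<Union>i<n. A i) x - indicat_real (\<Union> (range A)) x))\<^sup>2)) \<longlonglongrightarrow> ennreal ((norm (indicat_real (\<Union> (range A)) x - indicat_real (\<Union> (range A)) x))\<^sup>2)"
            by (intro tendsto_intros tendsto_ennrealI)
          then show "(\<lambda>n. ennreal ((norm (indicat_real (\<Union>i<n. A i) x - indicat_real (\<Union> (range A)) x))\<^sup>2)) \<longlonglongrightarrow> 0"
            by simp
        qed
      qed (auto simp: emeasure_eq_measure less_top[symmetric] intro!: measurable_lebesgue_on_borel)
      then have "eventually (\<lambda>n. L2_sq (Leb t) (\<lambda>x. ?f n x - indicat_real (\<Union>(range A)) x) < ennreal \<epsilon>) sequentially"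
        using \<epsilon> by (intro order_tendstoD) auto
      then obtain n where "L2_sq (Leb t) (\<lambda>x. ?f n x - indicat_real (\<Union>(range A)) x) < ennreal \<epsilon>"
        by (auto simp: eventually_sequentially)
      moreover have "step_approx t (?f n)" by (intro step_approx_sum union.IH)
      ultimately show "\<exists>g. step_approx t g \<and> L2_sq (Leb t) (\<lambda>x. g x - indicat_real (\<Union> (range A)) x) < ennreal \<epsilon>"
        by blast
    qed
  qed
qed

lemma step_approx_cong_AE:
  fixes f g :: "real \<Rightarrow> 'k::{banach, second_countable_topology}"
  assumes "AE x in Leb t. f x = g x" "step_approx t f"
    and "g \<in> borel_measurable (Leb t)"
  shows "step_approx t g"
proof -
  have "L2_sq (Leb t) (\<lambda>x. step_fun ps x - f x) = L2_sq (Leb t) (\<lambda>x. step_fun ps x - g x)" for ps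
    using assms(1) by (intro L2_sq_cong_AE) auto
  then show ?thesis using assms(2,3) by (simp add: step_approx_def)
qed

lemma step_approx_indicator:
  assumes t: "0 \<le> t" and A: "A \<in> sets (Leb t)"
  shows "step_approx t (indicator A :: real \<Rightarrow> real)"
proof -
  have "A \<in> sets lebesgue" using A by (auto simp: sets_restrict_space_iff)
  then obtain S N N' where S: "A = S \<union> N" "N \<subseteq> N'" "N' \<in> null_sets lborel" "S \<in> sets lborel"
    by (rule sets_completionE)
  have "N' \<in> null_sets lebesgue" using S(3) by (rule null_sets_completionI)
  then have "AE x in lebesgue. x \<notin> N'" by (rule AE_not_in)
  then have "AE x in Leb t. x \<notin> N'"
    by (simp add: AE_restrict_space_iff) (auto elim: eventually_mono)
  then have "AE x in Leb t. indicat_real S x = indicat_real A x"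
    by eventually_elim (use S in \<open>auto simp: indicator_def\<close>)
  moreover have "step_approx t (indicat_real S)"
    using step_approx_indicator_borel[OF t, of S] S(4) by simp
  ultimately show ?thesis by (rule step_approx_cong_AE) (use A in auto)
qed

text \<open>Simple functions dominated by a multiple of \<open>f\<close> reduce the claim to indicators of measurable sets.\<close>

theorem step_approx_L2:
  fixes f :: "real \<Rightarrow> 'k::{banach, second_countable_topology}"
  assumes t: "0 \<le> t" and f: "f \<in> L2_fun t"
  shows "step_approx t f"
proof -
  have fM [measurable]: "f \<in> borel_measurable (Leb t)" and fin: "L2_sq (Leb t) f < \<infinity>"
    using f by (auto simp: L2_fun_iff)
  obtain F where F: "\<And>i. simple_function (Leb t) (F i)"
    "\<And>x. x \<in> {0..t} \<Longrightarrow> (\<lambda>i. F i x) \<longlonglongrightarrow> f x"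
    "\<And>i x. x \<in> {0..t} \<Longrightarrow> dist (F i x) 0 \<le> 2 * dist (f x) 0"
    using borel_measurable_implies_sequence_metric[OF fM, of 0] that
    unfolding space_lebesgue_on by blast
  have [measurable]: "F i \<in> borel_measurable (Leb t)" for i
    using F(1) by (rule borel_measurable_simple_function)
  have Fs: "step_approx t (F i)" for i
  proof -
    have "step_approx t (\<lambda>x. \<Sum>y\<in>F i ` {0..t}. indicat_real (F i -` {y} \<inter> {0..t}) x *\<^sub>R y)"
    proof (rule step_approx_sum)
      fix y assume "y \<in> F i ` {0..t}"
      have "F i -` {y} \<inter> {0..t} \<in> sets (Leb t)"
        using simple_functionD(2)[OF F(1), of i "{y}"] by simp
      from step_approx_linear[OF step_approx_indicator[OF t this] bounded_linear_scaleR_left[of y]]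
      show "step_approx t (\<lambda>x. indicat_real (F i -` {y} \<inter> {0..t}) x *\<^sub>R y)" .
    qed
    then show ?thesis
    proof (rule step_approx_cong[rotated])
      fix x assume x: "x \<in> {0..t}"
      have "(\<Sum>y\<in>F i ` {0..t}. indicat_real (F i -` {y} \<inter> {0..t}) x *\<^sub>R y) =
         (\<Sum>y\<in>F i ` {0..t}. if F i x = y then y else 0)"
        using x by (intro sum.cong) (auto simp: indicator_def)
      also have "\<dots> = F i x" using x simple_functionD(1)[OF F(1)[of i]] by simp
      finally show "(\<Sum>y\<in>F i ` {0..t}. indicat_real (F i -` {y} \<inter> {0..t}) x *\<^sub>R y) = F i x" .
    qed
  qed
  show ?thesis
  proof (rule step_approx_limit[OF fM])
    fix \<epsilon> :: real assume \<epsilon>: "\<epsilon> > 0"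
    have "(\<lambda>n. L2_sq (Leb t) (\<lambda>x. F n x - f x)) \<longlonglongrightarrow> (\<integral>\<^sup>+x. 0 \<partial>Leb t)"
      unfolding L2_sq_def
    proof (rule nn_integral_dominated_convergence[where w="\<lambda>x. 9 * ennreal ((norm (f x))\<^sup>2)"])
      show "AE x in Leb t. ennreal ((norm (F n x - f x))\<^sup>2) \<le> 9 * ennreal ((norm (f x))\<^sup>2)" for n
      proof (rule AE_I2)
        fix x assume "x \<in> space (Leb t)"
        then have "norm (F n x) \<le> 2 * norm (f x)" using F(3)[of x n] by simp
        then have "norm (F n x - f x) \<le> 3 * norm (f x)"
          using norm_triangle_ineq4[of "F n x" "f x"] by linarith
        then have "(norm (F n x - f x))\<^sup>2 \<le> (3 * norm (f x))\<^sup>2" by (intro power_mono) auto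
        then show "ennreal ((norm (F n x - f x))\<^sup>2) \<le> 9 * ennreal ((norm (f x))\<^sup>2)"
          by (simp add: power_mult_distrib ennreal_numeral[symmetric] ennreal_mult[symmetric]
              ennreal_leI del: ennreal_numeral)
      qed
      show "AE x in Leb t. (\<lambda>n. ennreal ((norm (F n x - f x))\<^sup>2)) \<longlonglongrightarrow> 0"
      proof (rule AE_I2)
        fix x assume "x \<in> space (Leb t)"
        then have "(\<lambda>n. F n x) \<longlonglongrightarrow> f x" using F(2) by simp
        then have "(\<lambda>n. ennreal ((norm (F n x - f x))\<^sup>2)) \<longlonglongrightarrow> ennreal ((norm (f x - f x))\<^sup>2)"
          by (intro tendsto_intros tendsto_ennrealI)
        then show "(\<lambda>n. ennreal ((norm (F n x - f x))\<^sup>2)) \<longlonglongrightarrow> 0" by simp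
      qed
      show "(\<integral>\<^sup>+ x. 9 * ennreal ((norm (f x))\<^sup>2) \<partial>Leb t) < \<infinity>"
        using fin by (simp add: L2_sq_def nn_integral_cmult ennreal_mult_less_top)
    qed auto
    then have "eventually (\<lambda>n. L2_sq (Leb t) (\<lambda>x. F n x - f x) < ennreal \<epsilon>) sequentially"
      using \<epsilon> by (intro order_tendstoD) auto
    then show "\<exists>g. step_approx t g \<and> L2_sq (Leb t) (\<lambda>x. g x - f x) < ennreal \<epsilon>"
      using Fs by (auto simp: eventually_sequentially)
  qed
qed

section \<open>Differentiation of tail integrals\<close>

text \<open>The weak type inequality for the maximal function: a disjoint Vitali subfamily of balls on which
\<open>g\<close> has mass at least \<open>l\<close> times the radius has total length at most \<open>2/l\<close> times the mass of \<open>g\<close>.\<close>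

lemma Vitali_maximal_cover:
  fixes g :: "real \<Rightarrow> ennreal" and l :: real
  assumes [measurable]: "g \<in> borel_measurable lebesgue" and l: "l > 0"
    and S: "\<And>x \<delta>. x \<in> S \<Longrightarrow> \<delta> > 0 \<Longrightarrow>
      \<exists>r. 0 < r \<and> r < \<delta> \<and> ennreal (l * r) \<le> emeasure (density lebesgue g) (cball x r)"
  shows "\<exists>V. V \<in> sets lebesgue \<and> S \<subseteq> V \<and>
    emeasure lebesgue V \<le> ennreal (2 / l) * (\<integral>\<^sup>+x. g x \<partial>lebesgue)"
proof -
  define K where "K = {(x, r). x \<in> S \<and> 0 < r \<and> ennreal (l * r) \<le> emeasure (density lebesgue g) (cball x r)}"
  obtain C where C: "countable C" "C \<subseteq> K"
     "pairwise (\<lambda>i j. disjnt (cball (fst i) (snd i)) (cball (fst j) (snd j))) C"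
     "negligible (S - (\<Union>i\<in>C. cball (fst i) (snd i)))"
  proof (rule Vitali_covering_theorem_cballs[of K snd S fst])
    show "0 < snd i" if "i \<in> K" for i using that by (auto simp: K_def)
    show "\<exists>i. i \<in> K \<and> x \<in> cball (fst i) (snd i) \<and> snd i < d" if "x \<in> S" "0 < d" for x d
    proof -
      obtain r where "0 < r" "r < d" "ennreal (l * r) \<le> emeasure (density lebesgue g) (cball x r)"
        using S[OF \<open>x \<in> S\<close> \<open>0 < d\<close>] by blast
      then show ?thesis using \<open>x \<in> S\<close> by (intro exI[of _ "(x, r)"]) (auto simp: K_def)
    qed
  qed
  let ?U = "\<Union>i\<in>C. cball (fst i) (snd i)"
  have dis: "disjoint_family_on (\<lambda>i. cball (fst i) (snd i)) C"
    using C(3) by (auto simp: disjoint_family_on_def pairwise_def disjnt_def)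
  have U: "?U \<in> sets lebesgue"
    using C(1) by (intro sets.countable_UN'') auto
  have null: "S - ?U \<in> null_sets lebesgue"
    using C(4) by (simp add: negligible_iff_null_sets)
  have "emeasure lebesgue (?U \<union> (S - ?U)) = emeasure lebesgue ?U"
    by (rule emeasure_Un_null_set[OF U null])
  also have "\<dots> = (\<integral>\<^sup>+i. emeasure lebesgue (cball (fst i) (snd i)) \<partial>count_space C)"
    by (rule emeasure_UN_countable[OF _ C(1) dis]) auto
  also have "\<dots> \<le> (\<integral>\<^sup>+i. ennreal (2 / l) * emeasure (density lebesgue g) (cball (fst i) (snd i)) \<partial>count_space C)"
  proof (rule nn_integral_mono)
    fix i assume "i \<in> space (count_space C)"
    then have i: "i \<in> K" using C(2) by auto
    then have r: "snd i > 0" and le: "ennreal (l * snd i) \<le> emeasure (density lebesgue g) (cball (fst i) (snd i))"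
      by (auto simp: K_def)
    have "emeasure lebesgue (cball (fst i) (snd i)) = ennreal (2 * snd i)"
      using r by (simp add: cball_eq_atLeastAtMost)
    also have "\<dots> = ennreal (2 / l) * ennreal (l * snd i)"
      using l r by (simp flip: ennreal_mult)
    also have "\<dots> \<le> ennreal (2 / l) * emeasure (density lebesgue g) (cball (fst i) (snd i))"
      by (intro mult_left_mono le) simp
    finally show "emeasure lebesgue (cball (fst i) (snd i)) \<le> \<dots>" .
  qed
  also have "\<dots> = ennreal (2 / l) * (\<integral>\<^sup>+i. emeasure (density lebesgue g) (cball (fst i) (snd i)) \<partial>count_space C)"
    by (rule nn_integral_cmult) simp
  also have "(\<integral>\<^sup>+i. emeasure (density lebesgue g) (cball (fst i) (snd i)) \<partial>count_space C) =
      emeasure (density lebesgue g) ?U"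
    by (rule emeasure_UN_countable[OF _ C(1) dis, symmetric]) auto
  also have "\<dots> \<le> emeasure (density lebesgue g) UNIV"
    by (rule emeasure_mono) auto
  also have "\<dots> = (\<integral>\<^sup>+x. g x \<partial>lebesgue)"
    by (simp add: emeasure_density)
  finally have "emeasure lebesgue (?U \<union> (S - ?U)) \<le> ennreal (2 / l) * (\<integral>\<^sup>+x. g x \<partial>lebesgue)"
    by (simp add: mult_left_mono)
  moreover have "?U \<union> (S - ?U) \<in> sets lebesgue" using U null by blast
  ultimately show ?thesis by blast
qed

lemma step_fun_locally_constant:
  assumes "x \<noteq> 0" "x \<notin> fst ` set ps"
  shows "\<exists>\<delta>>0. \<forall>z. \<bar>z - x\<bar> < \<delta> \<longrightarrow> step_fun ps z = step_fun ps x"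
  using assms
proof (induction ps)
  case (Cons p ps)
  obtain s v where p: "p = (s, v)" by fastforce
  obtain \<delta> where \<delta>: "\<delta> > 0" "\<And>z. \<bar>z - x\<bar> < \<delta> \<Longrightarrow> step_fun ps z = step_fun ps x"
    using Cons by auto
  let ?d = "min \<delta> (min \<bar>x\<bar> \<bar>x - s\<bar>)"
  have "?d > 0" using \<delta>(1) Cons.prems by (auto simp: p)
  moreover have "step_fun (p # ps) z = step_fun (p # ps) x" if "\<bar>z - x\<bar> < ?d" for z
  proof -
    have "indicat_real {0..s} z = indicat_real {0..s} x"
      using that by (auto simp: indicator_def)
    then show ?thesis using \<delta>(2)[of z] that by (simp add: p step_fun_Cons)
  qed
  ultimately show ?case by blast
qed (auto intro: exI[of _ 1])

lemma step_fun_outside: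
  assumes "fst ` set ps \<subseteq> {0..t}" "x \<notin> {0..t}"
  shows "step_fun ps x = 0"
  using assms by (induction ps) (auto simp: step_fun_Cons indicator_def)

lemma nn_integral_lebesgue_on:
  assumes "S \<in> sets lebesgue"
  shows "(\<integral>\<^sup>+x. f x \<partial>lebesgue_on S) = (\<integral>\<^sup>+x. f x * indicator S x \<partial>lebesgue)"
  using assms by (subst nn_integral_restrict_space) auto

lemma L2_fun_integrable:
  assumes "f \<in> L2_fun t"
  shows "integrable (Leb t) f"
proof -
  have [measurable]: "f \<in> borel_measurable (Leb t)"
    and 2: "integrable (Leb t) (\<lambda>s. (norm (f s))\<^sup>2)"
    using assms by (auto simp: L2_fun_def)
  interpret finite_measure "Leb t" by (rule finite_measure_Icc)
  show ?thesis
  proof (rule Bochner_Integration.integrable_bound)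
    show "integrable (Leb t) (\<lambda>s. 1 + (norm (f s))\<^sup>2)"
      by (intro Bochner_Integration.integrable_add 2) simp
    show "AE x in Leb t. norm (f x) \<le> norm (1 + (norm (f x))\<^sup>2)"
    proof (rule AE_I2)
      fix x
      have "0 \<le> (norm (f x) - 1)\<^sup>2" by simp
      then have "norm (f x) * 2 \<le> 1 + (norm (f x))\<^sup>2" by (simp add: power2_diff)
      then have "norm (f x) \<le> 1 + (norm (f x))\<^sup>2" using norm_ge_zero[of "f x"] by linarith
      then show "norm (f x) \<le> norm (1 + (norm (f x))\<^sup>2)" by simp
    qed
  qed measurable
qed

text \<open>The free parameter in \<open>a \<le> \<eta> + a\<^sup>2 / \<eta>\<close> replaces the Cauchy--Schwarz inequality
and keeps square roots out of the estimate.\<close>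

lemma nn_integral_norm_le_L2_sq:
  fixes f :: "real \<Rightarrow> 'k::{banach, second_countable_topology}"
  assumes [measurable]: "f \<in> borel_measurable (Leb t)" and "\<eta> > 0" "0 \<le> t"
  shows "(\<integral>\<^sup>+x. ennreal (norm (f x)) \<partial>Leb t) \<le>
    ennreal (\<eta> * t) + ennreal (1 / \<eta>) * L2_sq (Leb t) f"
proof -
  have "(\<integral>\<^sup>+x. ennreal (norm (f x)) \<partial>Leb t) \<le>
      (\<integral>\<^sup>+x. ennreal \<eta> + ennreal (1 / \<eta>) * ennreal ((norm (f x))\<^sup>2) \<partial>Leb t)"
  proof (rule nn_integral_mono)
    fix x
    have "norm (f x) \<le> \<eta> + 1 / \<eta> * (norm (f x))\<^sup>2"
    proof (cases "norm (f x) \<le> \<eta>")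
      case True
      have "0 \<le> 1 / \<eta> * (norm (f x))\<^sup>2" using \<open>\<eta> > 0\<close> by simp
      then show ?thesis using True by linarith
    next
      case False
      then have "\<eta> * norm (f x) \<le> norm (f x) * norm (f x)" by (intro mult_right_mono) auto
      then have "norm (f x) \<le> 1 / \<eta> * (norm (f x))\<^sup>2"
        using \<open>\<eta> > 0\<close> by (simp add: field_simps power2_eq_square)
      then show ?thesis using \<open>\<eta> > 0\<close> by linarith
    qed
    then have "ennreal (norm (f x)) \<le> ennreal (\<eta> + 1 / \<eta> * (norm (f x))\<^sup>2)" by (rule ennreal_leI)
    also have "\<dots> = ennreal \<eta> + ennreal (1 / \<eta>) * ennreal ((norm (f x))\<^sup>2)"
      using \<open>\<eta> > 0\<close> by (subst ennreal_plus) (auto simp flip: ennreal_mult'')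
    finally show "ennreal (norm (f x)) \<le> ennreal \<eta> + ennreal (1 / \<eta>) * ennreal ((norm (f x))\<^sup>2)" .
  qed
  also have "\<dots> = ennreal \<eta> * emeasure (Leb t) {0..t} + ennreal (1 / \<eta>) * L2_sq (Leb t) f"
    unfolding L2_sq_def by (subst nn_integral_add) (auto simp: nn_integral_cmult)
  also have "emeasure (Leb t) {0..t} = ennreal t"
    using \<open>0 \<le> t\<close> by (subst emeasure_restrict_space) auto
  finally show ?thesis using \<open>\<eta> > 0\<close> \<open>0 \<le> t\<close> by (simp add: ennreal_mult)
qed

text \<open>Split \<open>f\<close> into a step function and a remainder \<open>g\<close> of small \<open>L\<^sup>1\<close> norm. Away from the jumps the
step part has an exact difference quotient, so a large deviation at \<open>x\<close> forces either \<open>\<bar>g x\<bar> \<ge> l\<close> or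
large averages of \<open>g\<close> on arbitrarily small balls around \<open>x\<close>. Both sets are small, by the inequalities
of Markov and Vitali.\<close>

lemma primitive_deviation_negligible:
  assumes t: "0 < t" and f: "f \<in> L2_fun t" and out: "\<And>x. x \<notin> {0..t} \<Longrightarrow> f x = 0"
    and int: "integrable lebesgue f" and l: "l > 0"
  defines "G \<equiv> \<lambda>x. LINT z|lebesgue. indicator {..x} z *\<^sub>R f z"
  shows "negligible {x. \<forall>\<delta>>0. \<exists>y. y \<noteq> x \<and> \<bar>y - x\<bar> < \<delta> \<and>
      norm (G y - G x - (y - x) *\<^sub>R f x) > 2 * l * \<bar>y - x\<bar>}" (is "negligible ?B")
  unfolding negligible_outer
proof (intro allI impI)
  fix e :: real assume e: "e > 0"
  have [measurable]: "f \<in> borel_measurable lebesgue" using int by (rule borel_measurable_integrable)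
  have [measurable]: "f \<in> borel_measurable (Leb t)" using f by (simp add: L2_fun_iff)
  \<comment> \<open>Chosen so that the remainder has \<open>L\<^sup>1\<close> norm at most \<open>e * l / 4\<close>; the two exceptional sets then have measure at most \<open>3 * e / 4\<close>.\<close>
  define \<eta> where "\<eta> = e * l / (8 * t)"
  have \<eta>: "\<eta> > 0" using e l t by (simp add: \<eta>_def)
  have "step_approx t f" using step_approx_L2[OF _ f] t by simp
  moreover have "\<eta> * (e * l / 8) > 0" using \<eta> e l by simp
  ultimately obtain ps where ps: "fst ` set ps \<subseteq> {0..t}"
    and aps: "L2_sq (Leb t) (\<lambda>x. step_fun ps x - f x) < ennreal (\<eta> * (e * l / 8))"
    unfolding step_approx_def by blast
  define g where "g x = f x - step_fun ps x" for x
  have [measurable]: "step_fun ps \<in> borel_measurable lebesgue"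
    by (intro measurable_completion) simp
  have [measurable]: "g \<in> borel_measurable lebesgue" unfolding g_def by measurable
  let ?I = "\<integral>\<^sup>+x. ennreal (norm (g x)) \<partial>lebesgue"
  have "?I = (\<integral>\<^sup>+x. ennreal (norm (step_fun ps x - f x)) \<partial>Leb t)"
    by (subst nn_integral_lebesgue_on)
       (auto intro!: nn_integral_cong simp: g_def norm_minus_commute indicator_def out step_fun_outside[OF ps])
  also have "\<dots> \<le> ennreal (\<eta> * t) + ennreal (1 / \<eta>) * L2_sq (Leb t) (\<lambda>x. step_fun ps x - f x)"
    by (rule nn_integral_norm_le_L2_sq) (use \<eta> t in auto)
  also have "\<dots> \<le> ennreal (\<eta> * t) + ennreal (1 / \<eta>) * ennreal (\<eta> * (e * l / 8))"
    by (intro add_left_mono mult_left_mono less_imp_le[OF aps]) simp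
  also have "\<dots> = ennreal (\<eta> * t) + ennreal (e * l / 8)"
    using \<eta> e l by (simp flip: ennreal_mult)
  also have "\<dots> = ennreal (e * l / 4)"
    using \<eta> e l t by (simp add: \<eta>_def flip: ennreal_plus)
  finally have I: "?I \<le> ennreal (e * l / 4)" .
  let ?P = "{x. x \<in> insert 0 (fst ` set ps)}"
  let ?N = "{x. norm (g x) \<ge> l}"
  let ?S = "?B - ?P - ?N"
  \<comment> \<open>A large deviation at a point of \<open>?S\<close> is due to the average of the remainder over a small ball.\<close>
  have "\<exists>V. V \<in> sets lebesgue \<and> ?S \<subseteq> V \<and> emeasure lebesgue V \<le> ennreal (2 / l) * ?I"
  proof (rule Vitali_maximal_cover[OF _ l])
    fix x \<delta> :: real assume x: "x \<in> ?S" and \<delta>: "\<delta> > 0"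
    obtain \<delta>0 where \<delta>0: "\<delta>0 > 0" "\<And>z. \<bar>z - x\<bar> < \<delta>0 \<Longrightarrow> step_fun ps z = step_fun ps x"
      using step_fun_locally_constant[of x ps] x by auto
    have "min \<delta> \<delta>0 > 0" using \<delta> \<delta>0 by simp
    then obtain y where y: "y \<noteq> x" "\<bar>y - x\<bar> < min \<delta> \<delta>0"
      "norm (G y - G x - (y - x) *\<^sub>R f x) > 2 * l * \<bar>y - x\<bar>"
      using x by (simp only: mem_Collect_eq Diff_iff) blast
    define r where "r = \<bar>y - x\<bar>"
    have r: "r > 0" "r < \<delta>" "r < \<delta>0" using y by (auto simp: r_def)
    define i where "i z = (indicator {..y} z - indicator {..x} z :: real)" for z
    have i_abs: "\<bar>i z\<bar> = indicator (if x \<le> y then {x<..y} else {y<..x}) z" for z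
      by (auto simp: i_def indicator_def)
    have i_le: "\<bar>i z\<bar> \<le> indicator (cball x r) z" for z
      unfolding i_abs by (auto simp: r_def dist_real_def indicator_def)
    have [measurable]: "i \<in> borel_measurable lebesgue" unfolding i_def[abs_def]
      by (intro borel_measurable_diff borel_measurable_indicator) auto
    have i_nn: "(\<integral>\<^sup>+z. ennreal \<bar>i z\<bar> \<partial>lebesgue) = ennreal r"
      unfolding i_abs ennreal_indicator using emeasure_lborel_Ioc[of x y] emeasure_lborel_Ioc[of y x]
      by (simp add: r_def)
    have i_int: "integrable lebesgue i"
      by (rule integrableI_bounded) (auto simp: i_nn)
    have i_integral: "integral\<^sup>L lebesgue i = y - x"
    proof (cases "x \<le> y")
      case True
      then have "i = indicator {x<..y}" by (auto simp: i_def indicator_def)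
      then show ?thesis using True by simp
    next
      case False
      then have "i = (\<lambda>z. - indicator {y<..x} z)" by (auto simp: i_def indicator_def)
      then show ?thesis using False by simp
    qed
    have int': "integrable lebesgue (\<lambda>z. indicator A z *\<^sub>R f z)" if "A \<in> sets lebesgue" for A
      using integrable_mult_indicator[OF that int] .
    have "G y - G x = (LINT z|lebesgue. i z *\<^sub>R f z)"
      unfolding G_def by (subst Bochner_Integration.integral_diff[symmetric])
        (auto simp: i_def scaleR_diff_left intro!: int')
    moreover have "(y - x) *\<^sub>R f x = (LINT z|lebesgue. i z *\<^sub>R f x)"
      using i_int by (simp add: i_integral)
    ultimately have "G y - G x - (y - x) *\<^sub>R f x = (LINT z|lebesgue. i z *\<^sub>R f z) - (LINT z|lebesgue. i z *\<^sub>R f x)"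
      by simp
    also have "\<dots> = (LINT z|lebesgue. i z *\<^sub>R f z - i z *\<^sub>R f x)"
    proof (rule Bochner_Integration.integral_diff[symmetric])
      have "integrable lebesgue (\<lambda>z. indicator {..y} z *\<^sub>R f z - indicator {..x} z *\<^sub>R f z)"
        by (intro Bochner_Integration.integrable_diff int') auto
      then show "integrable lebesgue (\<lambda>z. i z *\<^sub>R f z)" by (simp add: i_def scaleR_diff_left)
    qed (use i_int in auto)
    finally have eq: "G y - G x - (y - x) *\<^sub>R f x = (LINT z|lebesgue. i z *\<^sub>R (f z - f x))"
      by (simp add: scaleR_diff_right)
    have "ennreal (2 * l * r) \<le> ennreal (norm (G y - G x - (y - x) *\<^sub>R f x))"
      using y(3) by (intro ennreal_leI) (simp add: r_def)
    also have "\<dots> \<le> (\<integral>\<^sup>+z. ennreal (norm (i z *\<^sub>R (f z - f x))) \<partial>lebesgue)"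
    proof (cases "integrable lebesgue (\<lambda>z. i z *\<^sub>R (f z - f x))")
      case True
      then show ?thesis unfolding eq by (rule integral_norm_bound_ennreal)
    qed (simp add: eq not_integrable_integral_eq)
    also have "\<dots> \<le> (\<integral>\<^sup>+z. ennreal (norm (g z)) * indicator (cball x r) z + ennreal l * ennreal \<bar>i z\<bar> \<partial>lebesgue)"
    proof (rule nn_integral_mono)
      fix z
      show "ennreal (norm (i z *\<^sub>R (f z - f x))) \<le> ennreal (norm (g z)) * indicator (cball x r) z + ennreal l * ennreal \<bar>i z\<bar>"
      proof (cases "z \<in> cball x r")
        case True
        then have "step_fun ps z = step_fun ps x"
          using \<delta>0(2)[of z] r by (auto simp: dist_real_def abs_minus_commute)
        then have "f z - f x = g z - g x" by (simp add: g_def)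
        then have "norm (f z - f x) \<le> norm (g z) + l"
          using norm_triangle_ineq4[of "g z" "g x"] x by simp
        then have "norm (i z *\<^sub>R (f z - f x)) \<le> \<bar>i z\<bar> * (norm (g z) + l)"
          by (simp add: mult_left_mono)
        also have "\<dots> \<le> norm (g z) + l * \<bar>i z\<bar>"
          using i_le[of z] True mult_right_mono[of "\<bar>i z\<bar>" 1 "norm (g z)"] by (simp add: algebra_simps)
        finally have "ennreal (norm (i z *\<^sub>R (f z - f x))) \<le> ennreal (norm (g z) + l * \<bar>i z\<bar>)"
          by (rule ennreal_leI)
        then show ?thesis using True l by (simp add: ennreal_mult'')
      next
        case False
        then have "i z = 0" using i_le[of z] by simp
        then show ?thesis by simp
      qed
    qed
    also have "\<dots> = emeasure (density lebesgue (\<lambda>z. ennreal (norm (g z)))) (cball x r) + ennreal l * ennreal r"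
    proof -
      have gM: "(\<lambda>z. ennreal (norm (g z))) \<in> borel_measurable lebesgue" by measurable
      then have "(\<lambda>z. ennreal (norm (g z)) * indicator (cball x r) z) \<in> borel_measurable lebesgue"
        by (intro borel_measurable_times_ennreal borel_measurable_indicator) auto
      moreover have iM: "(\<lambda>z. ennreal \<bar>i z\<bar>) \<in> borel_measurable lebesgue" by measurable
      moreover have "(\<lambda>z. ennreal l * ennreal \<bar>i z\<bar>) \<in> borel_measurable lebesgue"
        by (intro borel_measurable_times_ennreal borel_measurable_const iM)
      moreover have "cball x r \<in> sets lebesgue" by simp
      ultimately show ?thesis
        by (simp only: nn_integral_add emeasure_density[OF gM] nn_integral_cmult[OF iM] i_nn)
    qed
    finally have "ennreal (2 * l * r) \<le> emeasure (density lebesgue (\<lambda>z. ennreal (norm (g z)))) (cball x r) + ennreal l * ennreal r" .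
    moreover have "ennreal (2 * l * r) = ennreal (l * r) + ennreal l * ennreal r"
      using l r(1) by (simp flip: ennreal_mult ennreal_plus)
    ultimately have "ennreal (l * r) \<le> emeasure (density lebesgue (\<lambda>z. ennreal (norm (g z)))) (cball x r)"
      using ennreal_add_left_cancel_le[of "ennreal l * ennreal r"]
      by (simp add: add.commute[of _ "ennreal l * ennreal r"] ennreal_mult_eq_top_iff)
    then show "\<exists>r>0. r < \<delta> \<and> ennreal (l * r) \<le> emeasure (density lebesgue (\<lambda>x. ennreal (norm (g x)))) (cball x r)"
      using r by blast
  qed measurable
  then obtain V where V: "V \<in> sets lebesgue" "?S \<subseteq> V" "emeasure lebesgue V \<le> ennreal (2 / l) * ?I" by blast
  have "(\<lambda>x. norm (g x)) \<in> borel_measurable lebesgue" by measurable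
  then have N: "?N \<in> sets lebesgue"
    using borel_measurable_le[of "\<lambda>_. l" lebesgue "\<lambda>x. norm (g x)"] by simp
  have "ennreal l * emeasure lebesgue ?N \<le> ?I"
  proof -
    have "ennreal l * emeasure lebesgue ?N = (\<integral>\<^sup>+x. ennreal l * indicator ?N x \<partial>lebesgue)"
      using N by (simp add: nn_integral_cmult_indicator)
    also have "\<dots> \<le> ?I"
      by (intro nn_integral_mono) (auto simp: indicator_def intro: ennreal_leI)
    finally show ?thesis .
  qed
  then have "ennreal (1 / l) * (ennreal l * emeasure lebesgue ?N) \<le> ennreal (1 / l) * ?I"
    by (rule mult_left_mono) simp
  then have N': "emeasure lebesgue ?N \<le> ennreal (1 / l) * ?I"
    using l by (simp add: mult.assoc[symmetric] flip: ennreal_mult)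
  let ?W = "(V \<union> ?N) \<union> ?P"
  have Pn: "?P \<in> null_sets lebesgue"
    using negligible_finite[of ?P] by (simp add: negligible_iff_null_sets)
  have "emeasure lebesgue ?W = emeasure lebesgue (V \<union> ?N)"
    using V(1) N by (intro emeasure_Un_null_set Pn) auto
  also have "\<dots> \<le> emeasure lebesgue V + emeasure lebesgue ?N"
    by (rule emeasure_subadditive[OF V(1) N])
  also have "\<dots> \<le> ennreal (2 / l) * ennreal (e * l / 4) + ennreal (1 / l) * ennreal (e * l / 4)"
    by (intro add_mono order_trans[OF V(3)] order_trans[OF N'] mult_left_mono I) auto
  also have "\<dots> = ennreal (e * 3 / 4)"
    using l e by (simp flip: ennreal_mult ennreal_plus)
  finally have W: "emeasure lebesgue ?W \<le> ennreal (e * 3 / 4)" .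
  have Ws: "?W \<in> sets lebesgue" using V(1) N Pn by auto
  show "\<exists>T. ?B \<subseteq> T \<and> T \<in> lmeasurable \<and> measure lebesgue T < e"
  proof (intro exI[of _ ?W] conjI)
    show "?B \<subseteq> ?W" using V(2) by blast
    show "?W \<in> lmeasurable" using Ws W by (intro fmeasurableI) (auto intro: le_less_trans)
    have "measure lebesgue ?W \<le> e * 3 / 4"
      unfolding measure_def using enn2real_mono[OF W] e by simp
    then show "measure lebesgue ?W < e" using e by simp
  qed
qed

text \<open>Lebesgue's differentiation theorem for Banach-space-valued functions: the exceptional sets of
the preceding lemma for \<open>l = 1/n\<close> have a negligible union.\<close>

theorem Lebesgue_differentiation_L2:
  fixes f :: "real \<Rightarrow> 'k::{banach, second_countable_topology}"
  assumes t: "0 < t" and f: "f \<in> L2_fun t"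
  shows "AE x in Leb t.
    ((\<lambda>x. LINT y|Leb t. indicator {x..} y *\<^sub>R f y) has_vector_derivative - f x) (at x)"
proof -
  define h where "h x = indicator {0..t} x *\<^sub>R f x" for x
  have hf: "h x = f x" if "x \<in> {0..t}" for x using that by (simp add: h_def)
  have "h \<in> borel_measurable (Leb t) \<longleftrightarrow> f \<in> borel_measurable (Leb t)"
    by (intro measurable_cong) (auto simp: hf)
  moreover have "L2_sq (Leb t) h = L2_sq (Leb t) f"
    unfolding L2_sq_def by (intro nn_integral_cong) (auto simp: hf)
  ultimately have "h \<in> L2_fun t \<longleftrightarrow> f \<in> L2_fun t" unfolding L2_fun_iff by simp
  then have h: "h \<in> L2_fun t" using f by simp
  have int: "integrable lebesgue h"
    using L2_fun_integrable[OF f] unfolding h_def[abs_def] by (subst (asm) integrable_restrict_space) auto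
  define G where "G = (\<lambda>x. LINT z|lebesgue. indicator {..x} z *\<^sub>R h z)"
  let ?B = "\<lambda>l. {x. \<forall>\<delta>>0. \<exists>y. y \<noteq> x \<and> \<bar>y - x\<bar> < \<delta> \<and> norm (G y - G x - (y - x) *\<^sub>R h x) > 2 * l * \<bar>y - x\<bar>}"
  have "negligible (?B (1 / Suc n))" for n
    unfolding G_def by (rule primitive_deviation_negligible[OF t h _ int]) (auto simp: h_def)
  then have "negligible (\<Union>n. ?B (1 / Suc n))"
    by (intro negligible_countable_Union) auto
  then have "AE x in lebesgue. x \<notin> (\<Union>n. ?B (1 / Suc n))"
    by (intro AE_not_in) (simp add: negligible_iff_null_sets)
  then have "AE x in lebesgue. (G has_vector_derivative h x) (at x)"
  proof eventually_elim
    case (elim x)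
    show ?case
      unfolding has_vector_derivative_def has_derivative_at_alt
    proof (intro conjI allI impI)
      fix e :: real assume "e > 0"
      then have "e / 2 > 0" by simp
      then obtain n where n: "1 / Suc n < e / 2" using nat_approx_posE by blast
      obtain \<delta> where \<delta>: "\<delta> > 0" "\<And>y. y \<noteq> x \<Longrightarrow> \<bar>y - x\<bar> < \<delta> \<Longrightarrow>
          norm (G y - G x - (y - x) *\<^sub>R h x) \<le> 2 * (1 / Suc n) * \<bar>y - x\<bar>"
        using elim by (simp add: not_less) (meson not_less)
      have "norm (G y - G x - (y - x) *\<^sub>R h x) \<le> e * norm (y - x)" if "norm (y - x) < \<delta>" for y
      proof (cases "y = x")
        case False
        have "norm (G y - G x - (y - x) *\<^sub>R h x) \<le> 2 * (1 / Suc n) * \<bar>y - x\<bar>"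
          using \<delta>(2)[OF False] that by simp
        also have "\<dots> \<le> e * \<bar>y - x\<bar>" using n by (intro mult_right_mono) auto
        finally show ?thesis by simp
      qed simp
      then show "\<exists>d>0. \<forall>y. norm (y - x) < d \<longrightarrow> norm (G y - G x - (y - x) *\<^sub>R h x) \<le> e * norm (y - x)"
        using \<delta>(1) by blast
    qed (rule bounded_linear_scaleR_left)
  qed
  then have AE: "AE x in Leb t. (G has_vector_derivative h x) (at x)"
    by (simp add: AE_restrict_space_iff) (auto elim: eventually_mono)
  have eq: "(LINT y|Leb t. indicator {x..} y *\<^sub>R f y) = integral\<^sup>L lebesgue h - G x" for x
  proof -
    have "(LINT y|Leb t. indicator {x..} y *\<^sub>R f y) = (LINT y|lebesgue. indicator {x..} y *\<^sub>R h y)"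
      by (subst integral_restrict_space) (auto simp: h_def mult.commute intro!: Bochner_Integration.integral_cong)
    also have "\<dots> = (LINT y|lebesgue. h y - indicator {..x} y *\<^sub>R h y)"
    proof (rule integral_cong_AE)
      have "AE y in lebesgue. y \<notin> {x}" by (intro AE_not_in) (simp add: negligible_iff_null_sets[symmetric])
      then show "AE y in lebesgue. indicator {x..} y *\<^sub>R h y = h y - indicator {..x} y *\<^sub>R h y"
        by eventually_elim (auto simp: indicator_def)
      have hM: "h \<in> borel_measurable lebesgue" using int by (rule borel_measurable_integrable)
      show "(\<lambda>y. indicator {x..} y *\<^sub>R h y) \<in> borel_measurable lebesgue"
        by (intro borel_measurable_scaleR borel_measurable_indicator hM) auto
      show "(\<lambda>y. h y - indicator {..x} y *\<^sub>R h y) \<in> borel_measurable lebesgue"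
        by (intro borel_measurable_diff borel_measurable_scaleR borel_measurable_indicator hM) auto
    qed
    also have "\<dots> = integral\<^sup>L lebesgue h - G x"
      unfolding G_def by (intro Bochner_Integration.integral_diff int integrable_mult_indicator) auto
    finally show ?thesis .
  qed
  show ?thesis
    unfolding eq using AE AE_space
  proof eventually_elim
    case (elim x)
    then have "((\<lambda>x. integral\<^sup>L lebesgue h - G x) has_vector_derivative 0 - h x) (at x)"
      by (intro has_vector_derivative_diff has_vector_derivative_const)
    then show ?case using elim by (simp add: hf)
  qed
qed

section \<open>Beta integrals\<close>

text \<open>Restricted measures are defined over \<open>lebesgue\<close>, whereas Tonelli's theorem and substitution are stated over
\<open>lborel\<close>; without automatic rewriting each step can name the measure it needs.\<close>

declare nn_integral_completion [simp del]

text \<open>Improper integrals of nonnegative functions are covered, because the derivative is only required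
inside the interval.\<close>

lemma nn_integral_FTC:
  fixes F f :: "real \<Rightarrow> real"
  assumes "a \<le> b" "continuous_on {a..b} F"
    and "\<And>x. x \<in> {a<..<b} \<Longrightarrow> (F has_real_derivative f x) (at x)"
    and "\<And>x. x \<in> {a..b} \<Longrightarrow> 0 \<le> f x"
  shows "(\<integral>\<^sup>+x. ennreal (f x) * indicator {a..b} x \<partial>lebesgue) = ennreal (F b - F a)"
proof -
  have "(f has_integral F b - F a) {a..b}"
    using assms by (intro fundamental_theorem_of_calculus_interior)
      (auto simp: has_real_derivative_iff_has_vector_derivative)
  from nn_integral_has_integral_lebesgue[OF _ this] assms(4)
  have "(\<integral>\<^sup>+x. ennreal (indicator {a..b} x * f x) \<partial>lebesgue) = ennreal (F b - F a)"
    by (simp add: nn_integral_completion)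
  also have "(\<integral>\<^sup>+x. ennreal (indicator {a..b} x * f x) \<partial>lebesgue) =
      (\<integral>\<^sup>+x. ennreal (f x) * indicator {a..b} x \<partial>lebesgue)"
    by (intro nn_integral_cong) (auto simp: indicator_def)
  finally show ?thesis .
qed

lemma nn_integral_Beta:
  fixes a b :: real
  assumes "a > 0" "b > 0"
  shows "(\<integral>\<^sup>+q. ennreal (q powr (a - 1) * (1 - q) powr (b - 1)) * indicator {0..1} q \<partial>lborel) = ennreal (Beta a b)"
proof -
  have "(\<integral>\<^sup>+q. ennreal (indicator {0..1} q * (q powr (a - 1) * (1 - q) powr (b - 1))) \<partial>lborel) = ennreal (Beta a b)"
    by (rule nn_integral_has_integral_lebesgue[OF _ has_integral_Beta_real[OF assms]]) auto
  also have "(\<integral>\<^sup>+q. ennreal (indicator {0..1} q * (q powr (a - 1) * (1 - q) powr (b - 1))) \<partial>lborel) = (\<integral>\<^sup>+q. ennreal (q powr (a - 1) * (1 - q) powr (b - 1)) * indicator {0..1} q \<partial>lborel)"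
    by (intro nn_integral_cong) (auto simp: indicator_def)
  finally show ?thesis .
qed

text \<open>The exponents sum to \<open>-2\<close>, so Moebius transformations change the integrand, as a differential, only by
a constant: the one that maps \<open>0, y, w\<close> to \<open>0, 1, \<infinity>\<close> produces a Beta integral. This evaluates the
overlap of the kernels of two time points in both ranges of the Hurst parameter.\<close>

lemma nn_integral_Beta_three_factors:
  fixes a b y w :: real
  assumes ab: "a > 0" "b > 0" and yw: "0 < y" "y < w"
  shows "(\<integral>\<^sup>+s. ennreal (s powr (a - 1) * (y - s) powr (b - 1) * (w - s) powr (- a - b)) * indicator {0..y} s \<partial>lebesgue)
    = ennreal (Beta a b * y powr (a + b - 1) * (w - y) powr (- a) * w powr (- b))"
proof -
  define D where "D q = w - y + y * q" for q
  \<comment> \<open>The inverse of the Moebius transformation.\<close>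
  define g where "g q = y * w * q / D q" for q
  define g' where "g' q = y * w * (w - y) / (D q)\<^sup>2" for q
  define C where "C = y powr (a + b - 1) * (w - y) powr (- a) * w powr (- b)"
  let ?f = "\<lambda>s. s powr (a - 1) * (y - s) powr (b - 1) * (w - s) powr (- a - b)"
  have Dpos: "D q > 0" if "q \<in> {0..1}" for q
    using that yw by (auto simp: D_def intro!: add_pos_nonneg)
  have g01: "g 0 = 0" "g 1 = y" using yw by (auto simp: g_def D_def)
  have pos: "?f (g q) * g' q = C * (q powr (a - 1) * (1 - q) powr (b - 1))" if q: "0 < q" "q < 1" for q
  proof -
    have D: "D q > 0" using Dpos[of q] q by simp
    have 1: "y - g q = y * (w - y) * (1 - q) / D q"
      using D by (simp add: g_def field_simps) (simp add: D_def algebra_simps)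
    have 2: "w - g q = w * (w - y) / D q"
      using D by (simp add: g_def field_simps) (simp add: D_def algebra_simps)
    have "ln (?f (g q) * g' q) = ln (C * (q powr (a - 1) * (1 - q) powr (b - 1)))"
      unfolding 1 2 unfolding g_def g'_def C_def using q yw D
      by (simp add: ln_mult ln_div ln_powr ln_realpow) (simp add: algebra_simps)
    moreover have "?f (g q) * g' q > 0"
      unfolding 1 2 unfolding g_def g'_def using q yw D by simp
    moreover have "C * (q powr (a - 1) * (1 - q) powr (b - 1)) > 0"
      unfolding C_def using q yw by simp
    ultimately show ?thesis by simp
  qed
  have eq: "?f (g q) * g' q = C * (q powr (a - 1) * (1 - q) powr (b - 1))" if q: "q \<in> {0..1}" for q
  proof -
    consider "q = 0" | "q = 1" | "0 < q" "q < 1" using q by fastforce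
    then show ?thesis by cases (use pos g01 in auto)
  qed
  have C: "C \<ge> 0" by (simp add: C_def)
  have "(\<integral>\<^sup>+s. ennreal (?f s) * indicator {0..y} s \<partial>lebesgue) = (\<integral>\<^sup>+s. ennreal (?f s) * indicator {0..y} s \<partial>lborel)"
    by (rule nn_integral_completion)
  also have "\<dots> = (\<integral>\<^sup>+s. ennreal (?f s) * indicator {g 0..g 1} s \<partial>lborel)"
    by (simp add: g01)
  also have "\<dots> = (\<integral>\<^sup>+s. ennreal (?f s * indicator {g 0..g 1} s) \<partial>lborel)"
    by (intro nn_integral_cong) (auto simp: indicator_def)
  also have "\<dots> = (\<integral>\<^sup>+q. ennreal (?f (g q) * g' q * indicator {0..1} q) \<partial>lborel)"
  proof (rule nn_integral_substitution)
    show "set_borel_measurable borel {g 0..g 1} ?f" unfolding set_borel_measurable_def by measurable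
    show "(g has_real_derivative g' q) (at q)" if "q \<in> {0..1}" for q
      using Dpos[OF that] unfolding g_def[abs_def] g'_def D_def
      by (auto intro!: derivative_eq_intros simp: divide_simps power2_eq_square algebra_simps)
    show "continuous_on {0..1} g'" unfolding g'_def[abs_def] D_def
      using Dpos by (intro continuous_intros) (force simp: D_def)
    show "0 \<le> g' q" if "q \<in> {0..1}" for q using yw by (simp add: g'_def)
  qed simp
  also have "\<dots> = (\<integral>\<^sup>+q. ennreal C * (ennreal (q powr (a - 1) * (1 - q) powr (b - 1)) * indicator {0..1} q) \<partial>lborel)"
    by (intro nn_integral_cong) (auto simp: indicator_def eq ennreal_mult' C)
  also have "\<dots> = ennreal C * ennreal (Beta a b)"
    by (subst nn_integral_cmult) (simp_all add: nn_integral_Beta[OF ab])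
  also have "\<dots> = ennreal (Beta a b * y powr (a + b - 1) * (w - y) powr (- a) * w powr (- b))"
    using C by (simp add: C_def mult_ac flip: ennreal_mult'')
  finally show ?thesis .
qed

lemma nn_integral_Beta_two_factors:
  fixes a b x u :: real
  assumes ab: "a > 0" "b > 0" and xu: "x < u"
  shows "(\<integral>\<^sup>+y. ennreal ((y - x) powr (a - 1) * (u - y) powr (b - 1)) * indicator {x..u} y \<partial>lebesgue)
    = ennreal (Beta a b * (u - x) powr (a + b - 1))"
proof -
  define g where "g q = x + (u - x) * q" for q
  let ?f = "\<lambda>y. (y - x) powr (a - 1) * (u - y) powr (b - 1)"
  have g01: "g 0 = x" "g 1 = u" by (auto simp: g_def)
  have eq: "?f (g q) * (u - x) = (u - x) powr (a + b - 1) * (q powr (a - 1) * (1 - q) powr (b - 1))" if "q \<in> {0..1}" for q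
  proof -
    have 1: "g q - x = (u - x) * q" by (simp add: g_def)
    have 2: "u - g q = (u - x) * (1 - q)" by (simp add: g_def algebra_simps)
    have "(u - x) powr (a + b - 1) = (u - x) powr (a - 1) * (u - x) powr (b - 1) * (u - x)"
      using xu by (simp add: powr_mult_base mult.commute flip: powr_add)
    then show ?thesis unfolding 1 2 using that xu by (simp add: powr_mult mult_ac)
  qed
  have "(\<integral>\<^sup>+s. ennreal (?f s) * indicator {x..u} s \<partial>lebesgue) = (\<integral>\<^sup>+s. ennreal (?f s) * indicator {x..u} s \<partial>lborel)"
    by (rule nn_integral_completion)
  also have "\<dots> = (\<integral>\<^sup>+s. ennreal (?f s * indicator {g 0..g 1} s) \<partial>lborel)"
    unfolding g01 by (intro nn_integral_cong) (auto simp: indicator_def)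
  also have "\<dots> = (\<integral>\<^sup>+q. ennreal (?f (g q) * (u - x) * indicator {0..1} q) \<partial>lborel)"
  proof (rule nn_integral_substitution)
    show "set_borel_measurable borel {g 0..g 1} ?f" unfolding set_borel_measurable_def by measurable
    show "(g has_real_derivative u - x) (at q)" for q
      unfolding g_def[abs_def] by (auto intro!: derivative_eq_intros)
  qed (use xu in auto)
  also have "\<dots> = (\<integral>\<^sup>+q. ennreal ((u - x) powr (a + b - 1)) * (ennreal (q powr (a - 1) * (1 - q) powr (b - 1)) * indicator {0..1} q) \<partial>lborel)"
    by (intro nn_integral_cong) (auto simp: indicator_def eq ennreal_mult')
  also have "\<dots> = ennreal ((u - x) powr (a + b - 1)) * ennreal (Beta a b)"
    by (subst nn_integral_cmult) (simp_all add: nn_integral_Beta[OF ab])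
  also have "\<dots> = ennreal (Beta a b * (u - x) powr (a + b - 1))"
    by (simp add: mult_ac flip: ennreal_mult'')
  finally show ?thesis .
qed

lemma nn_integral_abs_diff_powr:
  fixes e s v :: real
  assumes e: "e > -1" and s: "0 \<le> s" "s \<le> v"
  shows "(\<integral>\<^sup>+r. ennreal (\<bar>s - r\<bar> powr e) * indicator {0..v} r \<partial>lebesgue) =
    ennreal ((s powr (e + 1) + (v - s) powr (e + 1)) / (e + 1))"
proof -
  define c where "c = e + 1"
  have c: "c > 0" and e': "e = c - 1" using e by (auto simp: c_def)
  have "AE r in lborel. r \<noteq> s" by (rule AE_lborel_singleton)
  then have AE: "AE r in lebesgue. r \<noteq> s" by (rule AE_completion)
  have m: "(\<lambda>r. ennreal (f r) * indicator A r) \<in> borel_measurable lebesgue"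
    if "f \<in> borel_measurable borel" "A \<in> sets borel" for f :: "real \<Rightarrow> real" and A
    using that by (intro measurable_completion) simp
  have "(\<integral>\<^sup>+r. ennreal (\<bar>s - r\<bar> powr e) * indicator {0..v} r \<partial>lebesgue) =
     (\<integral>\<^sup>+r. ennreal ((s - r) powr e) * indicator {0..s} r + ennreal ((r - s) powr e) * indicator {s..v} r \<partial>lebesgue)"
  proof (rule nn_integral_cong_AE)
    show "AE r in lebesgue. ennreal (\<bar>s - r\<bar> powr e) * indicator {0..v} r =
        ennreal ((s - r) powr e) * indicator {0..s} r + ennreal ((r - s) powr e) * indicator {s..v} r"
      using AE by eventually_elim (use s in \<open>auto simp: indicator_def abs_if\<close>)
  qed
  also have "\<dots> = (\<integral>\<^sup>+r. ennreal ((s - r) powr e) * indicator {0..s} r \<partial>lebesgue) +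
      (\<integral>\<^sup>+r. ennreal ((r - s) powr e) * indicator {s..v} r \<partial>lebesgue)"
    by (rule nn_integral_add; rule m) auto
  also have "(\<integral>\<^sup>+r. ennreal ((s - r) powr e) * indicator {0..s} r \<partial>lebesgue) =
      ennreal (- ((s - s) powr c) / c - (- ((s - 0) powr c) / c))"
    using c s unfolding e' by (intro nn_integral_FTC)
      (auto intro!: continuous_intros derivative_eq_intros continuous_on_powr')
  also have "(\<integral>\<^sup>+r. ennreal ((r - s) powr e) * indicator {s..v} r \<partial>lebesgue) =
      ennreal ((v - s) powr c / c - (s - s) powr c / c)"
    using c s unfolding e' by (intro nn_integral_FTC)
      (auto intro!: continuous_intros derivative_eq_intros continuous_on_powr')
  finally show ?thesis
    using c s by (simp add: add_divide_distrib flip: ennreal_plus c_def)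
qed

section \<open>The transform of an integrand\<close>

text \<open>The factor \<open>s powr (1/2 - H)\<close> is the square root of the weight \<open>s powr (1 - 2 * H)\<close> of the theorem;
including it makes the claim an isometry into unweighted \<open>L\<^sup>2\<close>.\<close>

definition fbm_transform ::
    "real \<Rightarrow> real \<Rightarrow> (real \<Rightarrow> 'k::{banach, second_countable_topology}) \<Rightarrow> real \<Rightarrow> 'k" where
  "fbm_transform H t f s =
     s powr (1/2 - H) *\<^sub>R frac_deriv t (1/2 - H) (\<lambda>r. r powr (H - 1/2) *\<^sub>R f r) s"

lemma sigma_finite_lebesgue_on_Icc: "sigma_finite_measure (lebesgue_on {a..b::real})"
  using finite_measure_Icc[of a b] by (simp add: finite_measure_def)

lemma pair_sigma_finite_Icc: "pair_sigma_finite (lebesgue_on {a..b::real}) (lebesgue_on {c..d::real})"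
  by (intro pair_sigma_finite.intro sigma_finite_lebesgue_on_Icc)

lemma AE_lebesgue_on_neq: "AE x in lebesgue_on S. x \<noteq> (c::real)" if "S \<in> sets lebesgue"
proof -
  have "AE r in lborel. r \<noteq> c" by (rule AE_lborel_singleton)
  then have "AE r in lebesgue. r \<noteq> c" by (rule AE_completion)
  then show ?thesis using that by (simp add: AE_restrict_space_iff) (auto elim: eventually_mono)
qed

lemma AE_Icc_neq: "AE x in lebesgue_on {a..b}. x \<noteq> (c::real)"
  by (rule AE_lebesgue_on_neq) simp

lemma measurable_lebesgue_on_real:
  "f \<in> M \<rightarrow>\<^sub>M lebesgue_on S \<Longrightarrow> f \<in> borel_measurable M"
  using measurable_compose[OF _ measurable_ident_lebesgue_on] by blast

lemma fbm_cov_commute: "fbm_cov H s r = fbm_cov H r s"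
  by (simp add: fbm_cov_def abs_minus_commute)

section \<open>Hurst parameter above one half\<close>

definition int_kernel :: "real \<Rightarrow> real \<Rightarrow> real \<Rightarrow> real" where
  "int_kernel \<alpha> x y =
     (if x < y then x powr (- \<alpha>) * y powr \<alpha> * (y - x) powr (\<alpha> - 1) / Gamma \<alpha> else 0)"

lemma int_kernel_nonneg: "\<alpha> > 0 \<Longrightarrow> int_kernel \<alpha> x y \<ge> 0"
  by (simp add: int_kernel_def Gamma_real_pos less_imp_le)

lemma borel_measurable_int_kernel:
  assumes "f \<in> M \<rightarrow>\<^sub>M lebesgue_on S" "g \<in> M \<rightarrow>\<^sub>M lebesgue_on R"
  shows "(\<lambda>w. int_kernel \<alpha> (f w) (g w)) \<in> borel_measurable M"
proof -
  have [measurable]: "f \<in> borel_measurable M" "g \<in> borel_measurable M"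
    using assms by (auto intro: measurable_lebesgue_on_real)
  show ?thesis unfolding int_kernel_def by measurable
qed

lemma borel_measurable_int_kernel_right [measurable]:
  "int_kernel \<alpha> x \<in> borel_measurable (lebesgue_on S)"
proof (rule measurable_lebesgue_on_borel)
  show "int_kernel \<alpha> x \<in> borel_measurable borel"
    unfolding int_kernel_def[abs_def] by measurable
qed

lemma borel_measurable_int_kernel_left [measurable]:
  "(\<lambda>x. int_kernel \<alpha> x y) \<in> borel_measurable (lebesgue_on S)"
proof (rule measurable_lebesgue_on_borel)
  show "(\<lambda>x. int_kernel \<alpha> x y) \<in> borel_measurable borel"
    unfolding int_kernel_def[abs_def] by measurable
qed

lemma borel_measurable_int_kernel_pair [measurable]:
  "(\<lambda>p. int_kernel \<alpha> (fst p) (snd p)) \<in> borel_measurable (lebesgue_on S \<Otimes>\<^sub>M lebesgue_on R)"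
  by (rule borel_measurable_int_kernel) (rule measurable_fst measurable_snd)+

lemma fbm_transform_eq_int_kernel:
  fixes f :: "real \<Rightarrow> 'k::{banach, second_countable_topology}"
  assumes H: "1/2 < H" and x: "x \<in> {0..t}"
  shows "fbm_transform H t f x = (LINT y|Leb t. int_kernel (H - 1/2) x y *\<^sub>R f y)"
proof -
  have "fbm_transform H t f x = x powr (1/2 - H) *\<^sub>R (1 / Gamma (H - 1/2)) *\<^sub>R
     (LINT y|lebesgue. indicator {x..t} y *\<^sub>R (y - x) powr (H - 1/2 - 1) *\<^sub>R y powr (H - 1/2) *\<^sub>R f y)"
    using H by (simp add: fbm_transform_def frac_deriv_def frac_int_def set_lebesgue_integral_def)
  also have "\<dots> = (LINT y|lebesgue. x powr (1/2 - H) *\<^sub>R (1 / Gamma (H - 1/2)) *\<^sub>R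
     indicator {x..t} y *\<^sub>R (y - x) powr (H - 1/2 - 1) *\<^sub>R y powr (H - 1/2) *\<^sub>R f y)"
    by (simp only: integral_scaleR_right)
  also have "\<dots> = (LINT y|lebesgue. indicator {0..t} y *\<^sub>R int_kernel (H - 1/2) x y *\<^sub>R f y)"
    using x by (intro Bochner_Integration.integral_cong) (auto simp: int_kernel_def indicator_def mult_ac)
  also have "\<dots> = (LINT y|Leb t. int_kernel (H - 1/2) x y *\<^sub>R f y)"
    by (subst integral_restrict_space) auto
  finally show ?thesis .
qed

text \<open>For \<open>y < z\<close> the three powers of \<open>x\<close>, \<open>y - x\<close> and \<open>z - x\<close> have exponents that sum to \<open>-2\<close>.\<close>

lemma int_kernel_product_integral:
  assumes a: "0 < \<alpha>" "\<alpha> < 1/2" and y: "0 < y" "y \<le> t" and z: "0 < z" "z \<le> t" and yz: "y \<noteq> z"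
  shows "(\<integral>\<^sup>+x. ennreal (int_kernel \<alpha> x y) * ennreal (int_kernel \<alpha> x z) \<partial>Leb t) =
    ennreal (Beta (1 - 2 * \<alpha>) \<alpha> / (Gamma \<alpha>)\<^sup>2 * \<bar>y - z\<bar> powr (2 * \<alpha> - 1))"
proof -
  have *: "(\<integral>\<^sup>+x. ennreal (int_kernel \<alpha> x y) * ennreal (int_kernel \<alpha> x z) \<partial>Leb t) =
    ennreal (Beta (1 - 2 * \<alpha>) \<alpha> / (Gamma \<alpha>)\<^sup>2 * \<bar>y - z\<bar> powr (2 * \<alpha> - 1))"
    if y: "0 < y" "y \<le> t" and z: "0 < z" "z \<le> t" and yz: "y < z" for y z
  proof -
    let ?C = "y powr \<alpha> * z powr \<alpha> / (Gamma \<alpha>)\<^sup>2"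
    let ?f = "\<lambda>x. x powr (1 - 2 * \<alpha> - 1) * (y - x) powr (\<alpha> - 1) * (z - x) powr (- (1 - 2 * \<alpha>) - \<alpha>)"
    have C: "?C \<ge> 0" by simp
    have "(\<integral>\<^sup>+x. ennreal (int_kernel \<alpha> x y) * ennreal (int_kernel \<alpha> x z) \<partial>Leb t) =
      (\<integral>\<^sup>+x. ennreal (int_kernel \<alpha> x y) * ennreal (int_kernel \<alpha> x z) * indicator {0..t} x \<partial>lebesgue)"
      by (rule nn_integral_lebesgue_on) simp
    also have "\<dots> = (\<integral>\<^sup>+x. ennreal ?C * (ennreal (?f x) * indicator {0..y} x) \<partial>lebesgue)"
    proof (rule nn_integral_cong)
      fix x
      have "int_kernel \<alpha> x y * int_kernel \<alpha> x z = ?C * ?f x" if "0 \<le> x" "x \<le> y"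
      proof (cases "x = y")
        case True
        then show ?thesis by (simp add: int_kernel_def)
      next
        case False
        have "x powr (1 - 2 * \<alpha> - 1) = x powr (- \<alpha>) * x powr (- \<alpha>)" by (simp flip: powr_add)
        moreover have "- (1 - 2 * \<alpha>) - \<alpha> = \<alpha> - 1" by simp
        ultimately show ?thesis using False that yz
          by (simp add: int_kernel_def power2_eq_square mult_ac)
      qed
      moreover have "int_kernel \<alpha> x y = 0" if "x > y" using that by (simp add: int_kernel_def)
      ultimately show "ennreal (int_kernel \<alpha> x y) * ennreal (int_kernel \<alpha> x z) * indicator {0..t} x =
          ennreal ?C * (ennreal (?f x) * indicator {0..y} x)"
        using y int_kernel_nonneg[OF a(1), of x y] int_kernel_nonneg[OF a(1), of x z] C
        by (auto simp: indicator_def simp flip: ennreal_mult')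
    qed
    also have "\<dots> = ennreal ?C * (\<integral>\<^sup>+x. ennreal (?f x) * indicator {0..y} x \<partial>lebesgue)"
      by (rule nn_integral_cmult) (auto intro!: measurable_completion)
    also have "\<dots> = ennreal ?C * ennreal (Beta (1 - 2 * \<alpha>) \<alpha> * y powr (1 - 2 * \<alpha> + \<alpha> - 1) *
        (z - y) powr (- (1 - 2 * \<alpha>)) * z powr (- \<alpha>))"
      using a y yz by (subst nn_integral_Beta_three_factors) auto
    also have "\<dots> = ennreal (?C * (Beta (1 - 2 * \<alpha>) \<alpha> * y powr (1 - 2 * \<alpha> + \<alpha> - 1) *
        (z - y) powr (- (1 - 2 * \<alpha>)) * z powr (- \<alpha>)))"
      using C by (simp only: ennreal_mult')
    also have "?C * (Beta (1 - 2 * \<alpha>) \<alpha> * y powr (1 - 2 * \<alpha> + \<alpha> - 1) *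
        (z - y) powr (- (1 - 2 * \<alpha>)) * z powr (- \<alpha>)) =
        Beta (1 - 2 * \<alpha>) \<alpha> / (Gamma \<alpha>)\<^sup>2 * \<bar>y - z\<bar> powr (2 * \<alpha> - 1)"
      using y z yz by (simp add: powr_minus field_simps abs_if)
    finally show ?thesis .
  qed
  show ?thesis
  proof (cases "y < z")
    case True
    then show ?thesis using * y z by blast
  next
    case False
    then have "z < y" using yz by simp
    from *[OF z y this] show ?thesis by (simp add: mult.commute abs_minus_commute)
  qed
qed

text \<open>Working with nonnegative integrands first makes Tonelli's theorem available before any
integrability is known.\<close>

definition kernel_op :: "real \<Rightarrow> real \<Rightarrow> (real \<Rightarrow> ennreal) \<Rightarrow> real \<Rightarrow> ennreal" where
  "kernel_op t \<alpha> g x = (\<integral>\<^sup>+y. ennreal (int_kernel \<alpha> x y) * g y \<partial>Leb t)"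

lemma borel_measurable_kernel_op [measurable]:
  assumes [measurable]: "g \<in> borel_measurable (Leb t)"
  shows "kernel_op t \<alpha> g \<in> borel_measurable (Leb t)"
proof -
  interpret sigma_finite_measure "Leb t" by (rule sigma_finite_lebesgue_on_Icc)
  show ?thesis unfolding kernel_op_def[abs_def] by measurable
qed

lemma borel_measurable_abs_diff_powr:
  fixes f g :: "'b \<Rightarrow> real"
  assumes "f \<in> M \<rightarrow>\<^sub>M lebesgue_on S" "g \<in> M \<rightarrow>\<^sub>M lebesgue_on R"
  shows "(\<lambda>w. \<bar>f w - g w\<bar> powr e) \<in> borel_measurable M"
proof -
  have [measurable]: "f \<in> borel_measurable M" "g \<in> borel_measurable M"
    using assms by (auto intro: measurable_lebesgue_on_real)
  show ?thesis
    by (intro powr_real_measurable borel_measurable_abs borel_measurable_diff borel_measurable_const) fact+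
qed

lemma borel_measurable_abs_diff_powr_right [measurable]:
  "(\<lambda>z. \<bar>y - z\<bar> powr e :: real) \<in> borel_measurable (lebesgue_on S)"
  by (rule measurable_lebesgue_on_borel) measurable

lemma borel_measurable_abs_diff_powr_pair [measurable]:
  "(\<lambda>p. \<bar>fst p - snd p\<bar> powr e :: real) \<in> borel_measurable (lebesgue_on S \<Otimes>\<^sub>M lebesgue_on R)"
  by (rule borel_measurable_abs_diff_powr) (rule measurable_fst measurable_snd)+

lemma kernel_op_product:
  assumes a: "0 < \<alpha>" "\<alpha> < 1/2"
    and [measurable]: "g \<in> borel_measurable (Leb t)" "h \<in> borel_measurable (Leb t)"
  shows "(\<integral>\<^sup>+x. kernel_op t \<alpha> g x * kernel_op t \<alpha> h x \<partial>Leb t) =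
    (\<integral>\<^sup>+y. (\<integral>\<^sup>+z. ennreal (Beta (1 - 2 * \<alpha>) \<alpha> / (Gamma \<alpha>)\<^sup>2 * \<bar>y - z\<bar> powr (2 * \<alpha> - 1)) * (g y * h z)
      \<partial>Leb t) \<partial>Leb t)"
proof -
  let ?e = "\<lambda>y z. Beta (1 - 2 * \<alpha>) \<alpha> / (Gamma \<alpha>)\<^sup>2 * \<bar>y - z\<bar> powr (2 * \<alpha> - 1)"
  let ?M = "Leb t"
  let ?k = "\<lambda>x y. ennreal (int_kernel \<alpha> x y)"
  interpret sigma_finite_measure ?M by (rule sigma_finite_lebesgue_on_Icc)
  interpret pair_sigma_finite ?M ?M by (rule pair_sigma_finite_Icc)
  have k1: "(\<lambda>x. ?k x y) \<in> borel_measurable ?M" for y by measurable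
  have k2: "(\<lambda>y. ?k x y) \<in> borel_measurable ?M" for x by measurable
  have kp: "(\<lambda>p. ?k (fst p) (snd p)) \<in> borel_measurable (?M \<Otimes>\<^sub>M ?M)" by measurable
  have kg: "(\<lambda>y. ?k x y * g y) \<in> borel_measurable ?M" for x by (intro borel_measurable_times_ennreal k2) fact
  have kh: "(\<lambda>y. ?k x y * h y) \<in> borel_measurable ?M" for x by (intro borel_measurable_times_ennreal k2) fact
  have g': "(\<lambda>p. g (snd p)) \<in> borel_measurable (?M \<Otimes>\<^sub>M ?M)" by measurable
  have h': "(\<lambda>p. h (snd p)) \<in> borel_measurable (?M \<Otimes>\<^sub>M ?M)" by measurable
  have Kh: "(\<lambda>p. kernel_op t \<alpha> h (fst p)) \<in> borel_measurable (?M \<Otimes>\<^sub>M ?M)" by measurable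
  have "(\<integral>\<^sup>+x. kernel_op t \<alpha> g x * kernel_op t \<alpha> h x \<partial>?M) =
      (\<integral>\<^sup>+x. (\<integral>\<^sup>+y. ?k x y * g y * kernel_op t \<alpha> h x \<partial>?M) \<partial>?M)"
    unfolding kernel_op_def[of t \<alpha> g] by (intro nn_integral_cong nn_integral_multc[symmetric] kg)
  also have "\<dots> = (\<integral>\<^sup>+y. (\<integral>\<^sup>+x. ?k x y * g y * kernel_op t \<alpha> h x \<partial>?M) \<partial>?M)"
    by (rule Fubini'[symmetric])
       (unfold case_prod_unfold, intro borel_measurable_times_ennreal kp g' Kh)
  also have "\<dots> = (\<integral>\<^sup>+y. (\<integral>\<^sup>+x. (\<integral>\<^sup>+z. ?k x y * g y * (?k x z * h z) \<partial>?M) \<partial>?M) \<partial>?M)"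
    unfolding kernel_op_def[of t \<alpha> h] by (intro nn_integral_cong nn_integral_cmult[symmetric] kh)
  also have "\<dots> = (\<integral>\<^sup>+y. (\<integral>\<^sup>+z. (\<integral>\<^sup>+x. ?k x y * g y * (?k x z * h z) \<partial>?M) \<partial>?M) \<partial>?M)"
  proof (rule nn_integral_cong, rule Fubini'[symmetric])
    fix y
    have "(\<lambda>p. ?k (fst p) y) \<in> borel_measurable (?M \<Otimes>\<^sub>M ?M)"
      by (rule measurable_compose[OF measurable_fst k1])
    then show "(\<lambda>(x, z). ?k x y * g y * (?k x z * h z)) \<in> borel_measurable (?M \<Otimes>\<^sub>M ?M)"
      unfolding case_prod_unfold
      by (intro borel_measurable_times_ennreal kp h' borel_measurable_const)
  qed
  also have "\<dots> = (\<integral>\<^sup>+y. (\<integral>\<^sup>+z. ennreal (?e y z) * (g y * h z) \<partial>?M) \<partial>?M)"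
  proof (rule nn_integral_cong_AE)
    have inner: "AE z in ?M. (\<integral>\<^sup>+x. ?k x y * g y * (?k x z * h z) \<partial>?M) =
        ennreal (?e y z) * (g y * h z)"
      if y: "y \<in> {0..t}" "y \<noteq> 0" for y
      using AE_Icc_neq[where c=0 and a=0 and b=t] AE_Icc_neq[where c=y and a=0 and b=t] AE_space
    proof eventually_elim
      case (elim z)
      have "(\<integral>\<^sup>+x. ?k x y * g y * (?k x z * h z) \<partial>?M) = (\<integral>\<^sup>+x. (?k x y * ?k x z) * (g y * h z) \<partial>?M)"
        by (intro nn_integral_cong) (simp only: ac_simps)
      also have "\<dots> = (\<integral>\<^sup>+x. ?k x y * ?k x z \<partial>?M) * (g y * h z)"
        by (intro nn_integral_multc borel_measurable_times_ennreal k1)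
      also have "(\<integral>\<^sup>+x. ?k x y * ?k x z \<partial>?M) = ennreal (?e y z)"
        by (rule int_kernel_product_integral[OF a]) (use y elim in auto)
      finally show ?case .
    qed
    show "AE y in ?M. (\<integral>\<^sup>+z. (\<integral>\<^sup>+x. ?k x y * g y * (?k x z * h z) \<partial>?M) \<partial>?M) =
      (\<integral>\<^sup>+z. ennreal (?e y z) * (g y * h z) \<partial>?M)"
      using AE_Icc_neq[where c=0 and a=0 and b=t] AE_space
    proof eventually_elim
      case (elim y)
      then show ?case by (intro nn_integral_cong_AE inner) auto
    qed
  qed
  finally show ?thesis .
qed

lemma hurst_const_pos: "0 < H \<Longrightarrow> H < 1 \<Longrightarrow> hurst_const H > 0"
  by (simp add: hurst_const_def Gamma_real_pos)

text \<open>The value of the constant comes from the Beta integral of the kernels and the factor \<open>H (2 H - 1)\<close> of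
the energy.\<close>

lemma hurst_const_mult_Beta_gt:
  assumes "1/2 < H" "H < 1"
  shows "hurst_const H * (Beta (1 - 2 * (H - 1/2)) (H - 1/2) / (Gamma (H - 1/2))\<^sup>2) = H * (2 * H - 1)"
proof -
  have g: "Gamma (H + 1/2) = (H - 1/2) * Gamma (H - 1/2)"
  proof -
    have "H - 1/2 \<notin> \<int>\<^sub>\<le>\<^sub>0" using nonpos_Ints_nonpos[of "H - 1/2"] assms by auto
    moreover have "H - 1/2 + 1 = H + 1/2" by simp
    ultimately show ?thesis using Gamma_plus1[of "H - 1/2"] by metis
  qed
  have pos: "Gamma (H - 1/2) > 0" "Gamma (2 - 2 * H) > 0" "Gamma (3/2 - H) > 0"
    using assms by (auto intro!: Gamma_real_pos)
  have b: "Beta (1 - 2 * (H - 1/2)) (H - 1/2) = Gamma (2 - 2 * H) * Gamma (H - 1/2) / Gamma (3/2 - H)"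
    by (simp add: Beta_def algebra_simps)
  show ?thesis
    unfolding hurst_const_def g b using pos by (simp add: field_simps power2_eq_square)
qed

lemma hurst_const_kernel_op_product:
  assumes H: "1/2 < H" "H < 1"
    and [measurable]: "g \<in> borel_measurable (Leb t)" "h \<in> borel_measurable (Leb t)"
  shows "ennreal (hurst_const H) *
      (\<integral>\<^sup>+x. kernel_op t (H - 1/2) g x * kernel_op t (H - 1/2) h x \<partial>Leb t) =
    (\<integral>\<^sup>+y. (\<integral>\<^sup>+z. ennreal (H * (2 * H - 1) * \<bar>y - z\<bar> powr (2 * H - 2)) * (g y * h z)
      \<partial>Leb t) \<partial>Leb t)"
proof -
  let ?M = "Leb t"
  let ?d = "Beta (1 - 2 * (H - 1/2)) (H - 1/2) / (Gamma (H - 1/2))\<^sup>2"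
  have c: "hurst_const H \<ge> 0" using hurst_const_pos[of H] H by simp
  interpret sigma_finite_measure ?M by (rule sigma_finite_lebesgue_on_Icc)
  have m1: "(\<lambda>z. ennreal (?d * \<bar>y - z\<bar> powr (2 * (H - 1/2) - 1)) * (g y * h z)) \<in> borel_measurable ?M" if "y \<in> space ?M" for y
    by measurable
  have m3: "(\<lambda>y. \<integral>\<^sup>+z. ennreal (?d * \<bar>y - z\<bar> powr (2 * (H - 1/2) - 1)) * (g y * h z) \<partial>?M) \<in> borel_measurable ?M"
    by (intro borel_measurable_nn_integral) (unfold case_prod_unfold, measurable)
  have "ennreal (hurst_const H) * (\<integral>\<^sup>+x. kernel_op t (H - 1/2) g x * kernel_op t (H - 1/2) h x \<partial>?M) =
    ennreal (hurst_const H) * (\<integral>\<^sup>+y. (\<integral>\<^sup>+z. ennreal (?d * \<bar>y - z\<bar> powr (2 * (H - 1/2) - 1)) * (g y * h z) \<partial>?M) \<partial>?M)"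
    using H by (subst kernel_op_product) auto
  also have "\<dots> = (\<integral>\<^sup>+y. ennreal (hurst_const H) * (\<integral>\<^sup>+z. ennreal (?d * \<bar>y - z\<bar> powr (2 * (H - 1/2) - 1)) * (g y * h z) \<partial>?M) \<partial>?M)"
    by (rule nn_integral_cmult[symmetric, OF m3])
  also have "\<dots> = (\<integral>\<^sup>+y. (\<integral>\<^sup>+z. ennreal (hurst_const H) * (ennreal (?d * \<bar>y - z\<bar> powr (2 * (H - 1/2) - 1)) * (g y * h z)) \<partial>?M) \<partial>?M)"
    by (intro nn_integral_cong nn_integral_cmult[symmetric] m1)
  also have "\<dots> = (\<integral>\<^sup>+y. (\<integral>\<^sup>+z. ennreal (H * (2 * H - 1) * \<bar>y - z\<bar> powr (2 * H - 2)) * (g y * h z) \<partial>?M) \<partial>?M)"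
  proof (intro nn_integral_cong)
    fix y z
    have "ennreal (hurst_const H) * ennreal (?d * \<bar>y - z\<bar> powr (2 * (H - 1/2) - 1)) =
        ennreal (hurst_const H * ?d * \<bar>y - z\<bar> powr (2 * (H - 1/2) - 1))"
      using c by (simp only: ennreal_mult'[symmetric] mult.assoc)
    also have "\<dots> = ennreal (H * (2 * H - 1) * \<bar>y - z\<bar> powr (2 * H - 2))"
      unfolding hurst_const_mult_Beta_gt[OF H] by (simp add: algebra_simps)
    finally show "ennreal (hurst_const H) * (ennreal (?d * \<bar>y - z\<bar> powr (2 * (H - 1/2) - 1)) * (g y * h z)) =
        ennreal (H * (2 * H - 1) * \<bar>y - z\<bar> powr (2 * H - 2)) * (g y * h z)"
      by (simp only: mult.assoc[symmetric])
  qed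
  finally show ?thesis .
qed

text \<open>Up to the constant, the energy is the square of an \<open>L\<^sup>2\<close> norm; this makes it subadditive up to a factor, and dominated
convergence applicable.\<close>

lemma LH_energy_eq_kernel_op:
  fixes f :: "real \<Rightarrow> 'k::{banach, second_countable_topology}"
  assumes H: "1/2 < H" "H < 1"
    and [measurable]: "f \<in> borel_measurable (Leb t)"
  shows "LH_energy H t f = ennreal (hurst_const H) *
      (\<integral>\<^sup>+x. (kernel_op t (H - 1/2) (\<lambda>y. ennreal (norm (f y))) x)\<^sup>2 \<partial>Leb t)"
proof -
  have c: "0 \<le> H * (2 * H - 1)" using H by simp
  have "ennreal (norm (f y) * norm (f z) * (H * (2 * H - 1)) * \<bar>y - z\<bar> powr (2 * H - 2)) =
      ennreal (H * (2 * H - 1) * \<bar>y - z\<bar> powr (2 * H - 2)) * (ennreal (norm (f y)) * ennreal (norm (f z)))" for y z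
  proof -
    have "0 \<le> H * (2 * H - 1) * \<bar>y - z\<bar> powr (2 * H - 2)"
      using c by (rule mult_nonneg_nonneg) simp
    then have "ennreal (H * (2 * H - 1) * \<bar>y - z\<bar> powr (2 * H - 2)) * (ennreal (norm (f y)) * ennreal (norm (f z))) =
      ennreal (H * (2 * H - 1) * \<bar>y - z\<bar> powr (2 * H - 2) * (norm (f y) * norm (f z)))"
      by (simp only: ennreal_mult' norm_ge_zero)
    then show ?thesis by (simp only: mult_ac)
  qed
  moreover have nf: "(\<lambda>y. ennreal (norm (f y))) \<in> borel_measurable (Leb t)"
    by measurable
  ultimately show ?thesis
    unfolding power2_eq_square LH_energy_def
    by (simp only: hurst_const_kernel_op_product[OF H nf nf])
qed

lemma ennreal_add_sq_le: "((a::ennreal) + b)\<^sup>2 \<le> 2 * a\<^sup>2 + 2 * b\<^sup>2"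
proof (cases a; cases b)
  fix x y :: real assume xy: "a = ennreal x" "0 \<le> x" "b = ennreal y" "0 \<le> y"
  have "(x + y)\<^sup>2 \<le> 2 * x\<^sup>2 + 2 * y\<^sup>2"
    using sum_squares_bound[of x y] by (simp add: power2_sum)
  then have "ennreal ((x + y)\<^sup>2) \<le> ennreal (2 * x\<^sup>2 + 2 * y\<^sup>2)" by (rule ennreal_leI)
  also have "\<dots> = 2 * a\<^sup>2 + 2 * b\<^sup>2" using xy by (simp add: ennreal_mult' ennreal_power)
  also have "ennreal ((x + y)\<^sup>2) = (a + b)\<^sup>2" using xy by (simp add: ennreal_power flip: ennreal_plus)
  finally show ?thesis .
qed (auto simp: power2_eq_square ennreal_mult_top ennreal_top_mult)

lemma LH_energy_add_le:
  fixes f g :: "real \<Rightarrow> 'k::{banach, second_countable_topology}"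
  assumes H: "1/2 < H" "H < 1"
    and [measurable]: "f \<in> borel_measurable (Leb t)" "g \<in> borel_measurable (Leb t)"
  shows "LH_energy H t (\<lambda>x. f x + g x) \<le> 2 * LH_energy H t f + 2 * LH_energy H t g"
proof -
  let ?M = "Leb t"
  let ?K = "\<lambda>f :: real \<Rightarrow> 'k. kernel_op t (H - 1/2) (\<lambda>y. ennreal (norm (f y)))"
  have K: "?K (\<lambda>x. f x + g x) x \<le> ?K f x + ?K g x" for x
  proof -
    have "?K (\<lambda>x. f x + g x) x \<le> (\<integral>\<^sup>+y. ennreal (int_kernel (H - 1/2) x y) * ennreal (norm (f y)) +
        ennreal (int_kernel (H - 1/2) x y) * ennreal (norm (g y)) \<partial>?M)"
      unfolding kernel_op_def
      by (intro nn_integral_mono)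
         (simp add: norm_triangle_ineq mult_left_mono ennreal_leI flip: distrib_left ennreal_plus)
    also have "\<dots> = ?K f x + ?K g x"
      unfolding kernel_op_def by (rule nn_integral_add) measurable
    finally show ?thesis .
  qed
  have "(\<integral>\<^sup>+x. (?K (\<lambda>x. f x + g x) x)\<^sup>2 \<partial>?M) \<le> (\<integral>\<^sup>+x. 2 * (?K f x)\<^sup>2 + 2 * (?K g x)\<^sup>2 \<partial>?M)"
    by (intro nn_integral_mono order_trans[OF power_mono[OF K] ennreal_add_sq_le]) auto
  also have "\<dots> = 2 * (\<integral>\<^sup>+x. (?K f x)\<^sup>2 \<partial>?M) + 2 * (\<integral>\<^sup>+x. (?K g x)\<^sup>2 \<partial>?M)"
    by (subst nn_integral_add) (auto simp: nn_integral_cmult)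
  finally have "ennreal (hurst_const H) * (\<integral>\<^sup>+x. (?K (\<lambda>x. f x + g x) x)\<^sup>2 \<partial>?M) \<le>
      ennreal (hurst_const H) * (2 * (\<integral>\<^sup>+x. (?K f x)\<^sup>2 \<partial>?M) + 2 * (\<integral>\<^sup>+x. (?K g x)\<^sup>2 \<partial>?M))"
    by (rule mult_left_mono) simp
  then show ?thesis
    using H by (simp add: LH_energy_eq_kernel_op distrib_left mult_ac)
qed

lemma nn_integral_abs_diff_powr_Icc:
  assumes "0 < e" "0 \<le> s" "s \<le> v" "v \<le> t"
  shows "(\<integral>\<^sup>+r. ennreal (\<bar>s - r\<bar> powr (e - 1)) * indicator {0..v} r \<partial>Leb t) =
    ennreal ((s powr e + (v - s) powr e) / e)"
proof -
  have "(\<integral>\<^sup>+r. ennreal (\<bar>s - r\<bar> powr (e - 1)) * indicator {0..v} r \<partial>Leb t) =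
      (\<integral>\<^sup>+r. ennreal (\<bar>s - r\<bar> powr (e - 1)) * indicator {0..v} r \<partial>lebesgue)"
    using assms by (subst nn_integral_lebesgue_on) (auto intro!: nn_integral_cong simp: indicator_def)
  then show ?thesis using nn_integral_abs_diff_powr[of "e - 1" s v] assms by simp
qed

text \<open>Schur's test: the kernel \<open>\<bar>y - z\<bar> powr (2 * H - 2)\<close> has bounded marginals.\<close>

lemma LH_energy_le_L2_sq:
  fixes f :: "real \<Rightarrow> 'k::{banach, second_countable_topology}"
  assumes H: "1/2 < H" "H < 1" and t: "0 < t"
    and [measurable]: "f \<in> borel_measurable (Leb t)"
  shows "LH_energy H t f \<le> ennreal (4 * t powr (2 * H - 1)) * L2_sq (Leb t) f"
proof -
  let ?M = "Leb t"
  let ?w = "\<lambda>y z. ennreal (H * (2 * H - 1) * \<bar>y - z\<bar> powr (2 * H - 2))"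
  let ?n = "\<lambda>y. ennreal ((norm (f y))\<^sup>2)"
  let ?I = "\<lambda>y. \<integral>\<^sup>+z. ?w y z \<partial>?M"
  interpret sigma_finite_measure ?M by (rule sigma_finite_lebesgue_on_Icc)
  interpret pair_sigma_finite ?M ?M by (rule pair_sigma_finite_Icc)
  have c: "0 \<le> H * (2 * H - 1)" using H by simp
  have w1: "(\<lambda>p. ?w (fst p) (snd p)) \<in> borel_measurable (?M \<Otimes>\<^sub>M ?M)"
    by measurable
  have w2: "(\<lambda>z. ?w y z) \<in> borel_measurable ?M" if "y \<in> space ?M" for y
    by measurable
  have inner: "(?I y) \<le> ennreal (2 * t powr (2 * H - 1))" if y: "y \<in> space ?M" for y
  proof -
    have y': "0 \<le> y" "y \<le> t" using y by auto
    have "(?I y) = (\<integral>\<^sup>+z. ennreal (H * (2 * H - 1)) * (ennreal (\<bar>y - z\<bar> powr (2 * H - 1 - 1)) * indicator {0..t} z) \<partial>?M)"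
      using c by (intro nn_integral_cong) (auto simp: ennreal_mult')
    also have "\<dots> = ennreal (H * (2 * H - 1)) *
        (\<integral>\<^sup>+z. ennreal (\<bar>y - z\<bar> powr (2 * H - 1 - 1)) * indicator {0..t} z \<partial>?M)"
    proof (rule nn_integral_cmult)
      show "(\<lambda>z. ennreal (\<bar>y - z\<bar> powr (2 * H - 1 - 1)) * indicator {0..t} z) \<in> borel_measurable ?M"
        by (rule measurable_lebesgue_on_borel) measurable
    qed
    also have "(\<integral>\<^sup>+z. ennreal (\<bar>y - z\<bar> powr (2 * H - 1 - 1)) * indicator {0..t} z \<partial>?M) =
        ennreal ((y powr (2 * H - 1) + (t - y) powr (2 * H - 1)) / (2 * H - 1))"
      using H y' by (intro nn_integral_abs_diff_powr_Icc) auto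
    also have "ennreal (H * (2 * H - 1)) * \<dots> =
        ennreal (H * (2 * H - 1) * ((y powr (2 * H - 1) + (t - y) powr (2 * H - 1)) / (2 * H - 1)))"
      by (rule ennreal_mult'[OF c, symmetric])
    also have "H * (2 * H - 1) * ((y powr (2 * H - 1) + (t - y) powr (2 * H - 1)) / (2 * H - 1)) =
        H * (y powr (2 * H - 1) + (t - y) powr (2 * H - 1))"
      using H by simp
    also have "\<dots> \<le> ennreal (1 * (t powr (2 * H - 1) + t powr (2 * H - 1)))"
      using H y' by (intro ennreal_leI mult_mono add_mono powr_mono2) auto
    finally show ?thesis by simp
  qed
  have "LH_energy H t f \<le> (\<integral>\<^sup>+y. (\<integral>\<^sup>+z. ?n y * ?w y z + ?n z * ?w y z \<partial>?M) \<partial>?M)"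
    unfolding LH_energy_def
  proof (intro nn_integral_mono)
    fix y z
    have "0 \<le> norm (f y) * norm (f z)" by simp
    then have "norm (f y) * norm (f z) \<le> (norm (f y))\<^sup>2 + (norm (f z))\<^sup>2"
      using sum_squares_bound[of "norm (f y)" "norm (f z)"] by linarith
    then have "norm (f y) * norm (f z) * (H * (2 * H - 1)) * \<bar>y - z\<bar> powr (2 * H - 2) \<le>
        ((norm (f y))\<^sup>2 + (norm (f z))\<^sup>2) * (H * (2 * H - 1)) * \<bar>y - z\<bar> powr (2 * H - 2)"
      using c by (intro mult_right_mono) auto
    then have "ennreal (norm (f y) * norm (f z) * (H * (2 * H - 1)) * \<bar>y - z\<bar> powr (2 * H - 2)) \<le>
        ennreal ((norm (f y))\<^sup>2 * (H * (2 * H - 1) * \<bar>y - z\<bar> powr (2 * H - 2)) +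
          (norm (f z))\<^sup>2 * (H * (2 * H - 1) * \<bar>y - z\<bar> powr (2 * H - 2)))"
      by (intro ennreal_leI) (simp add: algebra_simps)
    also have "\<dots> = ?n y * ?w y z + ?n z * ?w y z"
      using c by (subst ennreal_plus) (auto simp only: ennreal_mult' zero_le_power2 powr_ge_zero intro!: mult_nonneg_nonneg)
    finally show "ennreal (norm (f y) * norm (f z) * (H * (2 * H - 1)) * \<bar>y - z\<bar> powr (2 * H - 2)) \<le> ?n y * ?w y z + ?n z * ?w y z" .
  qed
  also have "\<dots> = (\<integral>\<^sup>+y. ?n y * (?I y) + (\<integral>\<^sup>+z. ?n z * ?w y z \<partial>?M) \<partial>?M)"
  proof (rule nn_integral_cong)
    fix y assume y: "y \<in> space ?M"
    note [measurable] = w2[OF y]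
    show "(\<integral>\<^sup>+z. ?n y * ?w y z + ?n z * ?w y z \<partial>?M) = ?n y * (?I y) + (\<integral>\<^sup>+z. ?n z * ?w y z \<partial>?M)"
      by (subst nn_integral_add) (auto simp: nn_integral_cmult)
  qed
  also have "\<dots> = (\<integral>\<^sup>+y. ?n y * (?I y) \<partial>?M) + (\<integral>\<^sup>+y. (\<integral>\<^sup>+z. ?n z * ?w y z \<partial>?M) \<partial>?M)"
  proof (rule nn_integral_add)
    show "(\<lambda>y. ?n y * (?I y)) \<in> borel_measurable ?M"
    proof (rule borel_measurable_times_ennreal)
      show "(\<lambda>y. \<integral>\<^sup>+z. ?w y z \<partial>?M) \<in> borel_measurable ?M"
        by (intro sigma_finite_measure.borel_measurable_nn_integral[OF sigma_finite_lebesgue_on_Icc]) (unfold case_prod_unfold, measurable)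
    qed measurable
    show "(\<lambda>y. \<integral>\<^sup>+z. ?n z * ?w y z \<partial>?M) \<in> borel_measurable ?M"
      by (intro sigma_finite_measure.borel_measurable_nn_integral[OF sigma_finite_lebesgue_on_Icc]) (unfold case_prod_unfold, measurable)
  qed
  also have "(\<integral>\<^sup>+y. (\<integral>\<^sup>+z. ?n z * ?w y z \<partial>?M) \<partial>?M) = (\<integral>\<^sup>+z. (\<integral>\<^sup>+y. ?n z * ?w y z \<partial>?M) \<partial>?M)"
    by (rule Fubini'[symmetric]) (unfold case_prod_unfold, measurable)
  also have "\<dots> = (\<integral>\<^sup>+z. ?n z * (\<integral>\<^sup>+y. ?w z y \<partial>?M) \<partial>?M)"
  proof (rule nn_integral_cong)
    fix z assume z: "z \<in> space ?M"
    show "(\<integral>\<^sup>+y. ?n z * ?w y z \<partial>?M) = ?n z * (\<integral>\<^sup>+y. ?w z y \<partial>?M)"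
      unfolding abs_minus_commute[of _ z] by (rule nn_integral_cmult[OF w2[OF z]])
  qed
  also have "(\<integral>\<^sup>+y. ?n y * (?I y) \<partial>?M) + \<dots> \<le>
      (\<integral>\<^sup>+y. ?n y * ennreal (2 * t powr (2 * H - 1)) \<partial>?M) + (\<integral>\<^sup>+y. ?n y * ennreal (2 * t powr (2 * H - 1)) \<partial>?M)"
    by (intro add_mono nn_integral_mono mult_left_mono inner) auto
  also have "\<dots> = ennreal (4 * t powr (2 * H - 1)) * L2_sq ?M f"
    unfolding L2_sq_def
    by (simp add: nn_integral_multc mult.commute flip: distrib_right ennreal_plus)
  finally show ?thesis .
qed

text \<open>The extension of the transform of indicators by linearity. It agrees with the transform of the step
function almost everywhere, which takes a proof where the transform is a derivative.\<close>

abbreviation step_transform ::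
    "real \<Rightarrow> real \<Rightarrow> (real \<times> 'k::real_vector) list \<Rightarrow> real \<Rightarrow> 'k" where
  "step_transform H t \<equiv> comb (\<lambda>s. fbm_transform H t (indicat_real {0..s}))"

lemma step_fun_in_L2_fun:
  fixes ps :: "(real \<times> 'k::{banach, second_countable_topology}) list"
  shows "step_fun ps \<in> L2_fun t"
  unfolding L2_fun_iff
proof
  interpret finite_measure "Leb t" by (rule finite_measure_Icc)
  show "L2_sq (Leb t) (step_fun ps) < \<infinity>"
  proof (induction ps)
    case (Cons p ps)
    obtain s v where p: "p = (s, v)" by fastforce
    have m: "(\<lambda>r. indicator {0..s} r *\<^sub>R v) \<in> borel_measurable (Leb t)"
      by (rule measurable_lebesgue_on_borel) measurable
    have "L2_sq (Leb t) (\<lambda>r. indicator {0..s} r *\<^sub>R v) \<le> (\<integral>\<^sup>+r. ennreal ((norm v)\<^sup>2) \<partial>Leb t)"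
      unfolding L2_sq_def by (intro nn_integral_mono ennreal_leI) (auto simp: indicator_def)
    also have "\<dots> < \<infinity>"
      by (simp add: emeasure_eq_measure ennreal_mult_eq_top_iff less_top[symmetric])
    finally have 1: "L2_sq (Leb t) (\<lambda>r. indicator {0..s} r *\<^sub>R v) < \<infinity>" .
    have "L2_sq (Leb t) (step_fun (p # ps)) \<le>
        2 * L2_sq (Leb t) (\<lambda>r. indicator {0..s} r *\<^sub>R v) + 2 * L2_sq (Leb t) (step_fun ps)"
      using L2_sq_add_le[OF m borel_measurable_step_fun_lebesgue_on, of ps] by (simp add: p step_fun_Cons[abs_def])
    also have "\<dots> < \<infinity>" using 1 Cons by (simp add: ennreal_mult_less_top)
    finally show ?case .
  qed (simp add: L2_sq_def)
qed measurable

lemma indicator_as_step_fun: "indicat_real {0..s} = step_fun [(s, 1)]"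
  by (auto simp: step_fun_def)

context
  fixes H t :: real
  assumes H: "1/2 < H" "H < 1" and t: "0 < t"
begin

lemma kernel_op_finite_AE:
  fixes f :: "real \<Rightarrow> 'k::{banach, second_countable_topology}"
  assumes fM [measurable]: "f \<in> borel_measurable (Leb t)" and fin: "LH_energy H t f < \<infinity>"
  shows "AE x in Leb t. kernel_op t (H - 1/2) (\<lambda>y. ennreal (norm (f y))) x < \<infinity>"
proof -
  let ?K = "kernel_op t (H - 1/2) (\<lambda>y. ennreal (norm (f y)))"
  have [measurable]: "?K \<in> borel_measurable (Leb t)"
    by (rule borel_measurable_kernel_op) measurable
  have "ennreal (hurst_const H) > 0" using hurst_const_pos[of H] H by simp
  then have "(\<integral>\<^sup>+x. (?K x)\<^sup>2 \<partial>Leb t) \<noteq> \<infinity>"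
    using fin unfolding LH_energy_eq_kernel_op[OF H fM] by (auto simp: ennreal_mult_less_top)
  then have "AE x in Leb t. (?K x)\<^sup>2 \<noteq> \<infinity>"
    by (intro nn_integral_PInf_AE) measurable
  then show ?thesis
    by eventually_elim (auto simp: power2_eq_square ennreal_mult_eq_top_iff top.not_eq_extremum)
qed

lemma int_kernel_integrable:
  fixes f :: "real \<Rightarrow> 'k::{banach, second_countable_topology}"
  assumes [measurable]: "f \<in> borel_measurable (Leb t)"
    and "kernel_op t (H - 1/2) (\<lambda>y. ennreal (norm (f y))) x < \<infinity>"
  shows "integrable (Leb t) (\<lambda>y. int_kernel (H - 1/2) x y *\<^sub>R f y)"
proof (rule integrableI_bounded)
  have "(\<integral>\<^sup>+y. ennreal (norm (int_kernel (H - 1/2) x y *\<^sub>R f y)) \<partial>Leb t) =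
      kernel_op t (H - 1/2) (\<lambda>y. ennreal (norm (f y))) x"
    unfolding kernel_op_def using int_kernel_nonneg[of "H - 1/2" x] H
    by (intro nn_integral_cong) (simp add: ennreal_mult')
  then show "(\<integral>\<^sup>+y. ennreal (norm (int_kernel (H - 1/2) x y *\<^sub>R f y)) \<partial>Leb t) < \<infinity>"
    using assms(2) by simp
qed measurable

lemma int_kernel_integrable_AE:
  fixes f :: "real \<Rightarrow> 'k::{banach, second_countable_topology}"
  assumes fM: "f \<in> borel_measurable (Leb t)" and fin: "LH_energy H t f < \<infinity>"
  shows "AE x in Leb t. integrable (Leb t) (\<lambda>y. int_kernel (H - 1/2) x y *\<^sub>R f y)"
  using kernel_op_finite_AE[OF assms] by eventually_elim (rule int_kernel_integrable[OF fM])

lemma fbm_transform_measurable_gt: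
  fixes f :: "real \<Rightarrow> 'k::{banach, second_countable_topology}"
  assumes [measurable]: "f \<in> borel_measurable (Leb t)"
  shows "fbm_transform H t f \<in> borel_measurable (Leb t)"
proof -
  interpret sigma_finite_measure "Leb t" by (rule sigma_finite_lebesgue_on_Icc)
  have "(\<lambda>x. LINT y|Leb t. int_kernel (H - 1/2) x y *\<^sub>R f y) \<in> borel_measurable (Leb t)"
    by (intro borel_measurable_lebesgue_integral) (unfold case_prod_unfold, measurable)
  then show ?thesis
    by (rule measurable_cong[THEN iffD1, rotated]) (simp add: fbm_transform_eq_int_kernel[OF H(1)])
qed

text \<open>The norm of the transform is at most the kernel applied to the norm.\<close>

lemma L2_sq_fbm_transform_le_energy:
  fixes f :: "real \<Rightarrow> 'k::{banach, second_countable_topology}"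
  assumes fM [measurable]: "f \<in> borel_measurable (Leb t)" and fin: "LH_energy H t f < \<infinity>"
  shows "L2_sq (Leb t) (fbm_transform H t f) \<le> ennreal (1 / hurst_const H) * LH_energy H t f"
proof -
  let ?K = "kernel_op t (H - 1/2) (\<lambda>y. ennreal (norm (f y)))"
  have c: "hurst_const H > 0" using hurst_const_pos[of H] H by simp
  have "L2_sq (Leb t) (fbm_transform H t f) \<le> (\<integral>\<^sup>+x. (?K x)\<^sup>2 \<partial>Leb t)"
    unfolding L2_sq_def
  proof (rule nn_integral_mono_AE)
    show "AE x in Leb t. ennreal ((norm (fbm_transform H t f x))\<^sup>2) \<le> (?K x)\<^sup>2"
      using int_kernel_integrable_AE[OF fM fin] AE_space
    proof eventually_elim
      case (elim x)
      have "ennreal (norm (fbm_transform H t f x)) \<le> (\<integral>\<^sup>+y. ennreal (norm (int_kernel (H - 1/2) x y *\<^sub>R f y)) \<partial>Leb t)"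
        using elim by (simp only: fbm_transform_eq_int_kernel[OF H(1)] space_lebesgue_on integral_norm_bound_ennreal)
      also have "\<dots> = ?K x"
        unfolding kernel_op_def using int_kernel_nonneg[of "H - 1/2" x] H
        by (intro nn_integral_cong) (simp add: ennreal_mult')
      finally have "(ennreal (norm (fbm_transform H t f x)))\<^sup>2 \<le> (?K x)\<^sup>2" by (rule power_mono) simp
      then show ?case by (simp add: ennreal_power)
    qed
  qed
  also have "\<dots> = ennreal (1 / hurst_const H) * (ennreal (hurst_const H) * (\<integral>\<^sup>+x. (?K x)\<^sup>2 \<partial>Leb t))"
  proof -
    have "ennreal (1 / hurst_const H) * ennreal (hurst_const H) = 1"
      using c by (simp flip: ennreal_mult)
    then show ?thesis by (simp add: mult.assoc[symmetric])
  qed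
  finally show ?thesis unfolding LH_energy_eq_kernel_op[OF H fM] .
qed

lemma L2_fun_finite_energy:
  assumes "f \<in> L2_fun t"
  shows "LH_energy H t f < \<infinity>"
proof -
  have "f \<in> borel_measurable (Leb t)" "L2_sq (Leb t) f < \<infinity>"
    using assms by (auto simp: L2_fun_iff)
  then show ?thesis
    using LH_energy_le_L2_sq[OF H t, of f] by (auto simp: ennreal_mult_less_top intro: le_less_trans)
qed

lemma fbm_transform_in_L2_fun_gt:
  assumes "f \<in> LH H t"
  shows "fbm_transform H t f \<in> L2_fun t"
proof -
  have f: "f \<in> borel_measurable (Leb t)" "LH_energy H t f < \<infinity>"
    using assms H by (auto simp: LH_def)
  have "ennreal (1 / hurst_const H) * LH_energy H t f < \<infinity>"
    using f(2) by (simp add: ennreal_mult_less_top)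
  with L2_sq_fbm_transform_le_energy[OF f] show ?thesis
    unfolding L2_fun_iff using fbm_transform_measurable_gt[OF f(1)] by (auto intro: le_less_trans)
qed

lemma step_transform_AE_gt:
  fixes ps :: "(real \<times> 'k::{banach, second_countable_topology}) list"
  shows "AE x in Leb t. step_transform H t ps x =
    (LINT y|Leb t. int_kernel (H - 1/2) x y *\<^sub>R step_fun ps y)"
proof (induction ps)
  case (Cons p ps)
  obtain s v where p: "p = (s, v)" by fastforce
  have i: "AE x in Leb t. integrable (Leb t) (\<lambda>y. int_kernel (H - 1/2) x y *\<^sub>R step_fun qs y)"
    for qs :: "(real \<times> 'l::{banach, second_countable_topology}) list"
    by (intro int_kernel_integrable_AE L2_fun_finite_energy step_fun_in_L2_fun) measurable
  show ?case
    using Cons i[of "[(s, 1::real)]"] i[of ps] AE_space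
  proof eventually_elim
    case (elim x)
    have ind: "integrable (Leb t) (\<lambda>y. int_kernel (H - 1/2) x y * indicat_real {0..s} y)"
      using elim(2) by (simp add: step_fun_def)
    then have "integrable (Leb t) (\<lambda>y. (int_kernel (H - 1/2) x y * indicat_real {0..s} y) *\<^sub>R v)"
      by (rule integrable_scaleR_left)
    then have "(LINT y|Leb t. int_kernel (H - 1/2) x y *\<^sub>R step_fun (p # ps) y) =
      (LINT y|Leb t. (int_kernel (H - 1/2) x y * indicat_real {0..s} y) *\<^sub>R v) +
      (LINT y|Leb t. int_kernel (H - 1/2) x y *\<^sub>R step_fun ps y)"
      using elim(3) by (subst Bochner_Integration.integral_add[symmetric])
        (auto simp: p step_fun_Cons scaleR_add_right)
    also have "(LINT y|Leb t. (int_kernel (H - 1/2) x y * indicat_real {0..s} y) *\<^sub>R v) =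
      fbm_transform H t (indicat_real {0..s}) x *\<^sub>R v"
      using elim(4) by (subst integral_scaleR_left[OF ind]) (simp add: fbm_transform_eq_int_kernel[OF H(1)])
    finally show ?case using elim(1) by (simp add: p comb_Cons)
  qed
qed simp

lemma step_transform_bound_gt:
  assumes f: "f \<in> LH H t"
  shows "L2_sq (Leb t) (\<lambda>x. step_transform H t ps x - fbm_transform H t f x) \<le>
    ennreal (1 / hurst_const H) * LH_norm_sq H t (\<lambda>x. step_fun ps x - f x)"
proof (cases "LH_norm_sq H t (\<lambda>x. step_fun ps x - f x) < \<infinity>")
  case True
  have fM [measurable]: "f \<in> borel_measurable (Leb t)" and fin: "LH_energy H t f < \<infinity>"
    using f H by (auto simp: LH_def)
  have dM: "(\<lambda>x. step_fun ps x - f x) \<in> borel_measurable (Leb t)" by measurable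
  have dfin: "LH_energy H t (\<lambda>x. step_fun ps x - f x) < \<infinity>"
    using True H by (simp add: LH_norm_sq_def)
  have "AE x in Leb t. step_transform H t ps x - fbm_transform H t f x = fbm_transform H t (\<lambda>x. step_fun ps x - f x) x"
    using step_transform_AE_gt[of ps] int_kernel_integrable_AE[OF fM fin] int_kernel_integrable_AE[OF dM dfin] AE_space
  proof eventually_elim
    case (elim x)
    have "(LINT y|Leb t. int_kernel (H - 1/2) x y *\<^sub>R step_fun ps y) =
      (LINT y|Leb t. int_kernel (H - 1/2) x y *\<^sub>R (step_fun ps y - f y)) +
      (LINT y|Leb t. int_kernel (H - 1/2) x y *\<^sub>R f y)"
      using elim(2,3) by (subst Bochner_Integration.integral_add[symmetric]) (auto simp: scaleR_diff_right)
    then show ?case using elim by (simp add: fbm_transform_eq_int_kernel[OF H(1)])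
  qed
  then have "L2_sq (Leb t) (\<lambda>x. step_transform H t ps x - fbm_transform H t f x) =
      L2_sq (Leb t) (fbm_transform H t (\<lambda>x. step_fun ps x - f x))"
    by (rule L2_sq_cong_AE)
  also have "\<dots> \<le> ennreal (1 / hurst_const H) * LH_norm_sq H t (\<lambda>x. step_fun ps x - f x)"
    using L2_sq_fbm_transform_le_energy[OF dM dfin] H by (simp add: LH_norm_sq_def)
  finally show ?thesis .
next
  case False
  then have "LH_norm_sq H t (\<lambda>x. step_fun ps x - f x) = \<infinity>" by (simp add: not_less top_unique)
  then show ?thesis using hurst_const_pos[of H] H by (simp add: ennreal_mult_top)
qed

lemma LH_linear_gt:
  fixes f :: "real \<Rightarrow> 'k::{banach, second_countable_topology}"
    and L :: "'k \<Rightarrow> 'l::{banach, second_countable_topology}"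
  assumes f: "f \<in> LH H t" and L: "bounded_linear L"
  shows "(\<lambda>x. L (f x)) \<in> LH H t"
    and "AE x in Leb t. fbm_transform H t (\<lambda>x. L (f x)) x = L (fbm_transform H t f x)"
proof -
  have fM [measurable]: "f \<in> borel_measurable (Leb t)" and fin: "LH_energy H t f < \<infinity>"
    using f H by (auto simp: LH_def)
  have [measurable]: "L \<in> borel_measurable borel"
    by (intro borel_measurable_continuous_onI linear_continuous_on L)
  obtain B where B: "B > 0" "\<And>y. norm (L y) \<le> B * norm y"
    using bounded_linear.pos_bounded[OF L] by (auto simp: mult.commute)
  have w: "0 \<le> H * (2 * H - 1)" using H by simp
  have "LH_energy H t (\<lambda>x. L (f x)) \<le> LH_energy H t (\<lambda>x. B *\<^sub>R f x)"
    unfolding LH_energy_def using w B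
    by (intro nn_integral_mono ennreal_leI mult_right_mono mult_mono) auto
  also have "\<dots> < \<infinity>"
  proof -
    have "(\<lambda>x. B *\<^sub>R f x) \<in> borel_measurable (Leb t)" by measurable
    have K: "kernel_op t (H - 1/2) (\<lambda>y. ennreal (norm (B *\<^sub>R f y))) x = ennreal B * kernel_op t (H - 1/2) (\<lambda>y. ennreal (norm (f y))) x" for x
    proof -
      have "kernel_op t (H - 1/2) (\<lambda>y. ennreal (norm (B *\<^sub>R f y))) x =
        (\<integral>\<^sup>+y. ennreal B * (ennreal (int_kernel (H - 1/2) x y) * ennreal (norm (f y))) \<partial>Leb t)"
        unfolding kernel_op_def using B(1) by (intro nn_integral_cong) (simp add: ennreal_mult' mult_ac)
      also have "\<dots> = ennreal B * kernel_op t (H - 1/2) (\<lambda>y. ennreal (norm (f y))) x"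
        unfolding kernel_op_def by (rule nn_integral_cmult) measurable
      finally show ?thesis .
    qed
    have "LH_energy H t (\<lambda>x. B *\<^sub>R f x) = (ennreal B)\<^sup>2 * LH_energy H t f"
    proof -
      have "(\<lambda>y. ennreal (norm (f y))) \<in> borel_measurable (Leb t)" by measurable
      note [measurable] = borel_measurable_kernel_op[OF this]
      show ?thesis
        by (subst (1 2) LH_energy_eq_kernel_op[OF H])
           (measurable, simp add: K power_mult_distrib nn_integral_cmult mult_ac del: norm_scaleR)
    qed
    then show ?thesis using fin by (simp add: ennreal_mult_less_top power2_eq_square)
  qed
  finally show "(\<lambda>x. L (f x)) \<in> LH H t"
    using H by (simp add: LH_def)
  show "AE x in Leb t. fbm_transform H t (\<lambda>x. L (f x)) x = L (fbm_transform H t f x)"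
    using int_kernel_integrable_AE[OF fM fin] AE_space
  proof eventually_elim
    case (elim x)
    have "(LINT y|Leb t. L (int_kernel (H - 1/2) x y *\<^sub>R f y)) = L (LINT y|Leb t. int_kernel (H - 1/2) x y *\<^sub>R f y)"
      by (rule integral_bounded_linear[OF L elim(1)])
    then show ?case
      using elim(2) by (simp add: fbm_transform_eq_int_kernel[OF H(1)] linear_cmul[OF bounded_linear.linear[OF L]])
  qed
qed

lemma fbm_transform_indicator_AE:
  "AE x in Leb t. 0 \<le> fbm_transform H t (indicat_real {0..u}) x \<and>
     ennreal (fbm_transform H t (indicat_real {0..u}) x) = kernel_op t (H - 1/2) (indicator {0..u}) x"
proof -
  have 1: "indicat_real {0..u} \<in> L2_fun t"
    unfolding indicator_as_step_fun by (rule step_fun_in_L2_fun)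
  then have "indicat_real {0..u} \<in> borel_measurable (Leb t)" by (simp add: L2_fun_iff)
  from int_kernel_integrable_AE[OF this L2_fun_finite_energy[OF 1]]
  show ?thesis using AE_space
  proof eventually_elim
    case (elim x)
    have nn: "0 \<le> int_kernel (H - 1/2) x y * indicat_real {0..u} y" for y
      using int_kernel_nonneg[of "H - 1/2" x y] H by simp
    have "kernel_op t (H - 1/2) (indicator {0..u}) x =
        (\<integral>\<^sup>+y. ennreal (int_kernel (H - 1/2) x y * indicat_real {0..u} y) \<partial>Leb t)"
      unfolding kernel_op_def by (intro nn_integral_cong) (auto simp: indicator_def)
    also have "\<dots> = ennreal (LINT y|Leb t. int_kernel (H - 1/2) x y * indicat_real {0..u} y)"
      using elim(1) nn by (intro nn_integral_eq_integral) auto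
    finally show ?case
      using elim(2) nn by (simp add: fbm_transform_eq_int_kernel[OF H(1)] Bochner_Integration.integral_nonneg)
  qed
qed

text \<open>The mixed derivative of the covariance in \<open>y\<close> and \<open>z\<close> is the integrand.\<close>

lemma fbm_cov_double_integral:
  assumes uv: "0 \<le> u" "u \<le> v" "v \<le> t"
  shows "(\<integral>\<^sup>+y. (\<integral>\<^sup>+z. ennreal (H * (2 * H - 1) * \<bar>y - z\<bar> powr (2 * H - 2)) *
      (indicator {0..u} y * indicator {0..v} z) \<partial>Leb t) \<partial>Leb t) = ennreal (fbm_cov H u v)"
proof -
  let ?M = "Leb t"
  let ?F = "\<lambda>y. (y powr (2 * H) - (v - y) powr (2 * H)) / 2"
  let ?f = "\<lambda>y. H * (y powr (2 * H - 1) + (v - y) powr (2 * H - 1))"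
  have c: "0 \<le> H * (2 * H - 1)" using H by simp
  have inner: "(\<integral>\<^sup>+z. ennreal (H * (2 * H - 1) * \<bar>y - z\<bar> powr (2 * H - 2)) * (indicator {0..u} y * indicator {0..v} z) \<partial>?M) =
      ennreal (?f y) * indicator {0..u} y" for y
  proof (cases "y \<in> {0..u}")
    case True
    have "(\<integral>\<^sup>+z. ennreal (H * (2 * H - 1) * \<bar>y - z\<bar> powr (2 * H - 2)) * (indicator {0..u} y * indicator {0..v} z) \<partial>?M) =
      (\<integral>\<^sup>+z. ennreal (H * (2 * H - 1)) * (ennreal (\<bar>y - z\<bar> powr (2 * H - 1 - 1)) * indicator {0..v} z) \<partial>?M)"
      using True by (intro nn_integral_cong) (auto simp: ennreal_mult'[OF c] indicator_def)
    also have "\<dots> = ennreal (H * (2 * H - 1)) * (\<integral>\<^sup>+z. ennreal (\<bar>y - z\<bar> powr (2 * H - 1 - 1)) * indicator {0..v} z \<partial>?M)"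
    proof (rule nn_integral_cmult)
      show "(\<lambda>z. ennreal (\<bar>y - z\<bar> powr (2 * H - 1 - 1)) * indicator {0..v} z) \<in> borel_measurable ?M"
        by (rule measurable_lebesgue_on_borel) measurable
    qed
    also have "(\<integral>\<^sup>+z. ennreal (\<bar>y - z\<bar> powr (2 * H - 1 - 1)) * indicator {0..v} z \<partial>?M) =
        ennreal ((y powr (2 * H - 1) + (v - y) powr (2 * H - 1)) / (2 * H - 1))"
      using True uv H by (intro nn_integral_abs_diff_powr_Icc) auto
    also have "ennreal (H * (2 * H - 1)) * \<dots> =
        ennreal (H * (2 * H - 1) * ((y powr (2 * H - 1) + (v - y) powr (2 * H - 1)) / (2 * H - 1)))"
      by (rule ennreal_mult'[OF c, symmetric])
    also have "H * (2 * H - 1) * ((y powr (2 * H - 1) + (v - y) powr (2 * H - 1)) / (2 * H - 1)) = ?f y"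
      using H by simp
    finally show ?thesis using True by simp
  qed simp
  have "(\<integral>\<^sup>+y. ennreal (?f y) * indicator {0..u} y \<partial>?M) = (\<integral>\<^sup>+y. ennreal (?f y) * indicator {0..u} y \<partial>lebesgue)"
    using uv by (subst nn_integral_lebesgue_on) (auto intro!: nn_integral_cong simp: indicator_def)
  also have "\<dots> = ennreal (?F u - ?F 0)"
  proof (rule nn_integral_FTC)
    show "continuous_on {0..u} ?F"
      using H uv by (intro continuous_intros continuous_on_powr') auto
    show "(?F has_real_derivative ?f y) (at y)" if "y \<in> {0<..<u}" for y
      using H uv that by (auto intro!: derivative_eq_intros simp: field_simps)
  qed (use uv H in auto)
  also have "?F u - ?F 0 = fbm_cov H u v"
    using uv H by (simp add: fbm_cov_def abs_if field_simps)
  finally show ?thesis unfolding inner .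
qed

lemma fbm_transform_indicator_covariance_gt:
  assumes "u \<in> {0..t}" "v \<in> {0..t}"
  shows "hurst_const H * (LINT x|Leb t.
      fbm_transform H t (indicat_real {0..u}) x * fbm_transform H t (indicat_real {0..v}) x) = fbm_cov H u v"
proof -
  let ?M = "Leb t"
  have *: "hurst_const H * (LINT x|Leb t.
      fbm_transform H t (indicat_real {0..u}) x * fbm_transform H t (indicat_real {0..v}) x) = fbm_cov H u v"
    if uv: "0 \<le> u" "u \<le> v" "v \<le> t" for u v
  proof -
    let ?k = "\<lambda>u. fbm_transform H t (indicat_real {0..u})"
    have c: "hurst_const H \<ge> 0" using hurst_const_pos[of H] H by simp
    have im: "indicat_real {0..s} \<in> borel_measurable ?M" for s
      by (rule measurable_lebesgue_on_borel) measurable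
    have im': "(indicator {0..s} :: real \<Rightarrow> ennreal) \<in> borel_measurable ?M" for s
      by (rule measurable_lebesgue_on_borel) measurable
    have m: "(\<lambda>x. ?k u x * ?k v x) \<in> borel_measurable ?M"
      by (intro borel_measurable_times fbm_transform_measurable_gt im)
    have AE: "AE x in ?M. 0 \<le> ?k u x * ?k v x \<and> ennreal (?k u x * ?k v x) =
        kernel_op t (H - 1/2) (indicator {0..u}) x * kernel_op t (H - 1/2) (indicator {0..v}) x"
      using fbm_transform_indicator_AE[of u] fbm_transform_indicator_AE[of v]
      by eventually_elim (auto simp: ennreal_mult)
    have "ennreal (hurst_const H) * (\<integral>\<^sup>+x. ennreal (?k u x * ?k v x) \<partial>?M) = ennreal (fbm_cov H u v)"
    proof -
      have "(\<integral>\<^sup>+x. ennreal (?k u x * ?k v x) \<partial>?M) = (\<integral>\<^sup>+x. kernel_op t (H - 1/2) (indicator {0..u}) x * kernel_op t (H - 1/2) (indicator {0..v}) x \<partial>?M)"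
        by (rule nn_integral_cong_AE) (use AE in eventually_elim, simp)
      then show ?thesis
        using hurst_const_kernel_op_product[OF H im' im', of u v] fbm_cov_double_integral[OF uv] by simp
    qed
    moreover have "(LINT x|?M. ?k u x * ?k v x) = enn2real (\<integral>\<^sup>+x. ennreal (?k u x * ?k v x) \<partial>?M)"
      using AE by (intro integral_eq_nn_integral m) auto
    ultimately have "hurst_const H * (LINT x|?M. ?k u x * ?k v x) = enn2real (ennreal (fbm_cov H u v))"
      using c by (metis enn2real_ennreal enn2real_mult)
    moreover have "fbm_cov H u v \<ge> 0"
    proof -
      have "(v - u) powr (2 * H) \<le> v powr (2 * H)" using uv H by (intro powr_mono2) auto
      then have "(v - u) powr (2 * H) \<le> u powr (2 * H) + v powr (2 * H)"
        by (rule order_trans) simp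
      then show ?thesis using uv by (simp add: fbm_cov_def abs_minus_commute)
    qed
    ultimately show ?thesis by simp
  qed
  show ?thesis
  proof (cases "u \<le> v")
    case True
    then show ?thesis using * assms by simp
  next
    case False
    then show ?thesis using *[of v u] assms by (simp add: fbm_cov_commute mult.commute)
  qed
qed

text \<open>Dominated convergence, once inside the kernel operator and once outside it.\<close>

lemma LH_energy_truncation:
  fixes f :: "real \<Rightarrow> 'k::{banach, second_countable_topology}"
  assumes fM [measurable]: "f \<in> borel_measurable (Leb t)" and fin: "LH_energy H t f < \<infinity>"
  shows "(\<lambda>n. LH_energy H t (\<lambda>x. (if norm (f x) \<le> real n then f x else 0) - f x)) \<longlonglongrightarrow> 0"
proof -
  let ?M = "Leb t"
  let ?g = "\<lambda>n x. (if norm (f x) \<le> real n then f x else 0) - f x"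
  let ?K = "\<lambda>f :: real \<Rightarrow> 'k. kernel_op t (H - 1/2) (\<lambda>y. ennreal (norm (f y)))"
  have gM [measurable]: "?g n \<in> borel_measurable ?M" for n by measurable
  have KM: "?K h \<in> borel_measurable ?M" if [measurable]: "h \<in> borel_measurable ?M" for h
    by (rule borel_measurable_kernel_op) measurable
  note [measurable] = KM[OF fM] KM[OF gM]
  have g_le: "norm (?g n x) \<le> norm (f x)" for n x by simp
  have g0: "\<forall>\<^sub>F n in sequentially. ?g n x = 0" for x
  proof -
    obtain N where "norm (f x) \<le> real N" using real_arch_simple by blast
    then show ?thesis by (intro eventually_sequentiallyI[of N]) auto
  qed
  have lim: "(\<lambda>n. ?K (?g n) x) \<longlonglongrightarrow> 0" if "?K f x < \<infinity>" for x
  proof -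
    have "(\<lambda>n. ?K (?g n) x) \<longlonglongrightarrow> (\<integral>\<^sup>+y. 0 \<partial>?M)"
      unfolding kernel_op_def
    proof (rule nn_integral_dominated_convergence[where w="\<lambda>y. ennreal (int_kernel (H - 1/2) x y) * ennreal (norm (f y))"])
      show "(\<integral>\<^sup>+y. ennreal (int_kernel (H - 1/2) x y) * ennreal (norm (f y)) \<partial>?M) < \<infinity>"
        using that by (simp add: kernel_op_def)
      show "AE y in ?M. ennreal (int_kernel (H - 1/2) x y) * ennreal (norm (?g n y)) \<le> ennreal (int_kernel (H - 1/2) x y) * ennreal (norm (f y))" for n
        by (intro AE_I2 mult_left_mono ennreal_leI g_le) simp
      show "AE y in ?M. (\<lambda>n. ennreal (int_kernel (H - 1/2) x y) * ennreal (norm (?g n y))) \<longlonglongrightarrow> 0"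
      proof (intro AE_I2 tendsto_eventually)
        fix y show "\<forall>\<^sub>F n in sequentially. ennreal (int_kernel (H - 1/2) x y) * ennreal (norm (?g n y)) = 0"
          using g0[of y] by eventually_elim simp
      qed
    qed measurable
    then show ?thesis by simp
  qed
  have "(\<lambda>n. \<integral>\<^sup>+x. (?K (?g n) x)\<^sup>2 \<partial>?M) \<longlonglongrightarrow> (\<integral>\<^sup>+x. 0 \<partial>?M)"
  proof (rule nn_integral_dominated_convergence[where w="\<lambda>x. (?K f x)\<^sup>2"])
    have "ennreal (hurst_const H) > 0" using hurst_const_pos[of H] H by simp
    then show "(\<integral>\<^sup>+x. (?K f x)\<^sup>2 \<partial>?M) < \<infinity>"
      using fin unfolding LH_energy_eq_kernel_op[OF H fM] by (auto simp: ennreal_mult_less_top)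
    show "AE x in ?M. (?K (?g n) x)\<^sup>2 \<le> (?K f x)\<^sup>2" for n
      unfolding kernel_op_def
      by (intro AE_I2 power_mono nn_integral_mono mult_left_mono ennreal_leI g_le) auto
    show "AE x in ?M. (\<lambda>n. (?K (?g n) x)\<^sup>2) \<longlonglongrightarrow> 0"
      using kernel_op_finite_AE[OF fM fin]
    proof eventually_elim
      case (elim x)
      from tendsto_mult_ennreal[OF lim[OF elim] lim[OF elim]] show ?case
        by (simp add: power2_eq_square)
    qed
  qed measurable
  then have "(\<lambda>n. ennreal (hurst_const H) * (\<integral>\<^sup>+x. (?K (?g n) x)\<^sup>2 \<partial>?M)) \<longlonglongrightarrow> ennreal (hurst_const H) * 0"
    by (intro ennreal_tendsto_cmult) auto
  then show ?thesis by (simp add: LH_energy_eq_kernel_op[OF H gM])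
qed

text \<open>Truncation makes the function bounded, hence square integrable, and there the energy is controlled
by the \<open>L\<^sup>2\<close> norm.\<close>

lemma step_fun_dense_gt:
  assumes f: "f \<in> LH H t" and e: "e > 0"
  shows "\<exists>ps. fst ` set ps \<subseteq> {0..t} \<and> LH_norm_sq H t (\<lambda>x. step_fun ps x - f x) < ennreal e"
proof -
  let ?M = "Leb t"
  interpret finite_measure ?M by (rule finite_measure_Icc)
  have fM [measurable]: "f \<in> borel_measurable ?M" and fin: "LH_energy H t f < \<infinity>"
    using f H by (auto simp: LH_def)
  have "\<forall>\<^sub>F n in sequentially. LH_energy H t (\<lambda>x. (if norm (f x) \<le> real n then f x else 0) - f x) < ennreal (e / 4)"
    using LH_energy_truncation[OF fM fin] e by (intro order_tendstoD) auto
  then obtain n where n: "LH_energy H t (\<lambda>x. (if norm (f x) \<le> real n then f x else 0) - f x) < ennreal (e / 4)"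
    by (auto simp: eventually_sequentially)
  define g where "g x = (if norm (f x) \<le> real n then f x else 0)" for x
  have gM [measurable]: "g \<in> borel_measurable ?M" unfolding g_def[abs_def] by measurable
  have "L2_sq ?M g \<le> (\<integral>\<^sup>+x. ennreal ((real n)\<^sup>2) \<partial>?M)"
    unfolding L2_sq_def g_def by (intro nn_integral_mono ennreal_leI power_mono) auto
  also have "\<dots> < \<infinity>" by (simp add: emeasure_eq_measure ennreal_mult_eq_top_iff less_top[symmetric])
  finally have "g \<in> L2_fun t" by (simp add: L2_fun_iff gM)
  then have "step_approx t g" using t by (intro step_approx_L2) auto
  define C where "C = 4 * t powr (2 * H - 1)"
  have C: "C > 0" using t by (simp add: C_def)
  then have "e / (4 * C) > 0" using e by simp
  with \<open>step_approx t g\<close> obtain ps where ps: "fst ` set ps \<subseteq> {0..t}"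
    "L2_sq ?M (\<lambda>x. step_fun ps x - g x) < ennreal (e / (4 * C))"
    unfolding step_approx_def by blast
  have "LH_energy H t (\<lambda>x. step_fun ps x - g x) \<le> ennreal C * L2_sq ?M (\<lambda>x. step_fun ps x - g x)"
    unfolding C_def by (rule LH_energy_le_L2_sq[OF H t]) measurable
  also have "\<dots> < ennreal C * ennreal (e / (4 * C))"
    using ps(2) C by (intro ennreal_mult_strict_left_mono) auto
  also have "\<dots> = ennreal (e / 4)" using C e by (simp flip: ennreal_mult)
  finally have 1: "LH_energy H t (\<lambda>x. step_fun ps x - g x) < ennreal (e / 4)" .
  have "LH_energy H t (\<lambda>x. (step_fun ps x - g x) + (g x - f x)) \<le>
      2 * LH_energy H t (\<lambda>x. step_fun ps x - g x) + 2 * LH_energy H t (\<lambda>x. g x - f x)"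
    by (rule LH_energy_add_le[OF H]) measurable
  also have "\<dots> < 2 * ennreal (e / 4) + 2 * ennreal (e / 4)"
    using 1 n unfolding g_def by (intro add_strict_mono ennreal_mult_strict_left_mono) auto
  also have "\<dots> = ennreal e"
  proof -
    have "2 * ennreal (e/4) = ennreal (e/2)" using e ennreal_mult'[of 2 "e/4"] by simp
    then show ?thesis using e by (simp flip: ennreal_plus)
  qed
  finally show ?thesis using ps(1) H by (intro exI[of _ ps]) (simp add: LH_norm_sq_def)
qed

end

section \<open>Hurst parameter below one half: the transform on fractional integrals\<close>

text \<open>Substituting \<open>y = x (1 - v) + z v\<close> in the integral of
\<open>(y - x) powr (-\<alpha>) * y powr (-\<alpha>) * (z - y) powr (\<alpha> - 1)\<close> over \<open>[x,z]\<close> leaves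
\<open>v powr (-\<alpha>) * (1 - v) powr (\<alpha> - 1) * (x (1 - v) + z v) powr (-\<alpha>)\<close>. The kernel is minus the derivative
in \<open>x\<close> of this integral, divided by \<open>Beta (1 - \<alpha>) \<alpha>\<close>.\<close>

definition corr_kernel :: "real \<Rightarrow> real \<Rightarrow> real \<Rightarrow> ennreal" where
  "corr_kernel \<alpha> y z = (\<integral>\<^sup>+v. ennreal (\<alpha> / Beta (1 - \<alpha>) \<alpha> *
     (v powr (- \<alpha>) * (1 - v) powr \<alpha> * (y * (1 - v) + z * v) powr (- \<alpha> - 1))) * indicator {0..1} v \<partial>lborel)"

lemma borel_measurable_corr_kernel [measurable (raw)]:
  assumes [measurable]: "f \<in> borel_measurable M" "g \<in> borel_measurable M"
  shows "(\<lambda>w. corr_kernel \<alpha> (f w) (g w)) \<in> borel_measurable M"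
  unfolding corr_kernel_def by measurable

lemma Beta_real_pos: "0 < a \<Longrightarrow> 0 < b \<Longrightarrow> Beta a b > (0 :: real)"
  by (simp add: Beta_def Gamma_real_pos)

text \<open>Both \<open>y\<close> and \<open>z v\<close> are below \<open>y (1 - v) + z v\<close>; splitting the negative power between
them leaves an integrable power of \<open>v\<close>.\<close>

lemma corr_kernel_le:
  assumes a: "0 < \<alpha>" "\<alpha> < \<beta>" "\<beta> < 1/2" and yz: "0 < y" "y \<le> z"
  shows "corr_kernel \<alpha> y z \<le>
    ennreal (\<alpha> / Beta (1 - \<alpha>) \<alpha> / (\<beta> - \<alpha>) * (y powr (- \<alpha> - \<beta>) * z powr (\<beta> - 1)))"
proof -
  let ?A = "\<alpha> / Beta (1 - \<alpha>) \<alpha>"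
  let ?K = "y powr (- \<alpha> - \<beta>) * z powr (\<beta> - 1)"
  have A: "?A > 0" using Beta_real_pos[of "1 - \<alpha>" \<alpha>] a by simp
  have pt: "v powr (- \<alpha>) * (1 - v) powr \<alpha> * (y * (1 - v) + z * v) powr (- \<alpha> - 1) \<le> ?K * v powr (\<beta> - \<alpha> - 1)"
    if v: "0 \<le> v" "v \<le> 1" for v
  proof (cases "v = 0")
    case False
    then have v0: "v > 0" using v by simp
    let ?D = "y * (1 - v) + z * v"
    have "y * (1 - v) + y * v \<le> ?D" using yz v by (intro add_mono mult_right_mono) auto
    then have D1: "y \<le> ?D" by (simp add: algebra_simps)
    have D2: "z * v \<le> ?D" using yz v by simp
    have "?D powr (- \<alpha> - 1) = ?D powr (- \<alpha> - \<beta>) * ?D powr (\<beta> - 1)"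
      by (simp flip: powr_add)
    also have "\<dots> \<le> y powr (- \<alpha> - \<beta>) * (z * v) powr (\<beta> - 1)"
      using D1 D2 a yz v0 by (intro mult_mono powr_mono2') auto
    also have "\<dots> = ?K * v powr (\<beta> - 1)" using yz v by (simp add: powr_mult)
    finally have D: "?D powr (- \<alpha> - 1) \<le> ?K * v powr (\<beta> - 1)" .
    have "(1 - v) powr \<alpha> \<le> 1 powr \<alpha>" using v a by (intro powr_mono2) auto
    then have "v powr (- \<alpha>) * (1 - v) powr \<alpha> * ?D powr (- \<alpha> - 1) \<le> v powr (- \<alpha>) * 1 * (?K * v powr (\<beta> - 1))"
      using D by (intro mult_mono) auto
    also have "\<dots> = ?K * (v powr (- \<alpha>) * v powr (\<beta> - 1))" by simp
    also have "v powr (- \<alpha>) * v powr (\<beta> - 1) = v powr (\<beta> - \<alpha> - 1)"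
      by (simp add: algebra_simps flip: powr_add)
    finally show ?thesis .
  qed simp
  have "corr_kernel \<alpha> y z \<le> (\<integral>\<^sup>+v. ennreal (?A * ?K) * (ennreal (v powr (\<beta> - \<alpha> - 1)) * indicator {0..1} v) \<partial>lborel)"
    unfolding corr_kernel_def
  proof (rule nn_integral_mono)
    fix v :: real
    show "ennreal (?A * (v powr (- \<alpha>) * (1 - v) powr \<alpha> * (y * (1 - v) + z * v) powr (- \<alpha> - 1))) * indicator {0..1} v
      \<le> ennreal (?A * ?K) * (ennreal (v powr (\<beta> - \<alpha> - 1)) * indicator {0..1} v)"
    proof (cases "v \<in> {0..1}")
      case True
      have "?A * (v powr (- \<alpha>) * (1 - v) powr \<alpha> * (y * (1 - v) + z * v) powr (- \<alpha> - 1)) \<le> ?A * (?K * v powr (\<beta> - \<alpha> - 1))"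
        using True A by (intro mult_left_mono pt) auto
      then have "ennreal (?A * (v powr (- \<alpha>) * (1 - v) powr \<alpha> * (y * (1 - v) + z * v) powr (- \<alpha> - 1))) \<le> ennreal (?A * ?K * v powr (\<beta> - \<alpha> - 1))"
        by (intro ennreal_leI) (simp only: mult.assoc)
      also have "\<dots> = ennreal (?A * ?K) * ennreal (v powr (\<beta> - \<alpha> - 1))"
        by (rule ennreal_mult'') simp
      finally show ?thesis using True by simp
    qed simp
  qed
  also have "\<dots> = ennreal (?A * ?K) * (\<integral>\<^sup>+v. ennreal (v powr (\<beta> - \<alpha> - 1)) * indicator {0..1} v \<partial>lborel)"
    by (rule nn_integral_cmult) measurable
  also have "(\<integral>\<^sup>+v. ennreal (v powr (\<beta> - \<alpha> - 1)) * indicator {0..1} v \<partial>lborel) =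
      (\<integral>\<^sup>+v. ennreal (v powr (\<beta> - \<alpha> - 1)) * indicator {0..1} v \<partial>lebesgue)"
    by (rule nn_integral_completion[symmetric])
  also have "\<dots> = ennreal (1 powr (\<beta> - \<alpha>) / (\<beta> - \<alpha>) - 0 powr (\<beta> - \<alpha>) / (\<beta> - \<alpha>))"
    using a by (intro nn_integral_FTC continuous_intros continuous_on_powr')
      (auto intro!: derivative_eq_intros)
  also have "ennreal (?A * ?K) * \<dots> = ennreal (?A * ?K * (1 / (\<beta> - \<alpha>)))"
    using a by (subst ennreal_mult''[symmetric]) auto
  finally show ?thesis by (simp add: mult_ac)
qed

text \<open>The last factor of the substituted integrand equals its value at \<open>x = z\<close> plus the integral of minus
its derivative; the former contributes a Beta integral and the latter the kernel.\<close>

lemma corr_kernel_integral: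
  assumes a: "0 < \<alpha>" "\<alpha> < 1/2" and xz: "0 < x" "x < z"
  shows "(\<integral>\<^sup>+y. ennreal ((y - x) powr (- \<alpha>) * y powr (- \<alpha>) * (z - y) powr (\<alpha> - 1)) * indicator {x..z} y \<partial>lborel) =
    ennreal (Beta (1 - \<alpha>) \<alpha>) * (ennreal (z powr (- \<alpha>)) + (\<integral>\<^sup>+y. corr_kernel \<alpha> y z * indicator {x..z} y \<partial>lborel))"
proof -
  let ?B = "Beta (1 - \<alpha>) \<alpha>"
  let ?f = "\<lambda>y. (y - x) powr (- \<alpha>) * y powr (- \<alpha>) * (z - y) powr (\<alpha> - 1)"
  let ?w = "\<lambda>v. v powr (- \<alpha>) * (1 - v) powr (\<alpha> - 1)"
  let ?D = "\<lambda>y v. y * (1 - v) + z * v"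
  let ?e = "\<lambda>y v. \<alpha> / ?B * (v powr (- \<alpha>) * (1 - v) powr \<alpha> * ?D y v powr (- \<alpha> - 1))"
  let ?k = "\<lambda>y v. \<alpha> * (1 - v) * ?D y v powr (- \<alpha> - 1)"
  have B: "?B > 0" using Beta_real_pos[of "1 - \<alpha>" \<alpha>] a by simp
  define g where "g v = x + (z - x) * v" for v
  have g01: "g 0 = x" "g 1 = z" by (auto simp: g_def)
  have gD: "g v = ?D x v" for v by (simp add: g_def algebra_simps)
  have Dpos: "?D y v > 0" if "y \<in> {x..z}" "v \<in> {0..1}" for y v
  proof -
    have "y * (1 - v) \<ge> x * (1 - v)" "z * v \<ge> x * v" using that xz by (auto intro!: mult_right_mono)
    then have "?D y v \<ge> x" by (simp add: algebra_simps)
    then show ?thesis using xz by simp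
  qed
  have eq: "?f (g v) * (z - x) = ?w v * g v powr (- \<alpha>)" if "v \<in> {0..1}" for v
  proof -
    have 1: "g v - x = (z - x) * v" by (simp add: g_def)
    have 2: "z - g v = (z - x) * (1 - v)" by (simp add: g_def algebra_simps)
    have "(z - x) powr (- \<alpha>) * (z - x) powr (\<alpha> - 1) * (z - x) powr 1 = 1"
      using xz by (simp only: powr_add[symmetric]) simp
    then have "(z - x) powr (- \<alpha>) * (z - x) powr (\<alpha> - 1) * (z - x) = 1" using xz by simp
    then show ?thesis unfolding 1 2 using that xz by (simp add: powr_mult mult_ac)
  qed
  have J: "ennreal (g v powr (- \<alpha>)) = ennreal (z powr (- \<alpha>)) + (\<integral>\<^sup>+y. ennreal (?k y v) * indicator {x..z} y \<partial>lborel)"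
    if v: "v \<in> {0..1}" for v
  proof -
    have "(\<integral>\<^sup>+y. ennreal (?k y v) * indicator {x..z} y \<partial>lborel) = (\<integral>\<^sup>+y. ennreal (?k y v) * indicator {x..z} y \<partial>lebesgue)"
      by (rule nn_integral_completion[symmetric])
    also have "\<dots> = ennreal (- (?D z v powr (- \<alpha>)) - (- (?D x v powr (- \<alpha>))))"
    proof (rule nn_integral_FTC)
      show "continuous_on {x..z} (\<lambda>y. - (?D y v powr (- \<alpha>)))"
        using Dpos[OF _ v] by (intro continuous_intros) force
      show "((\<lambda>y. - (?D y v powr (- \<alpha>))) has_real_derivative ?k y v) (at y)" if "y \<in> {x<..<z}" for y
        using Dpos[of y v] that v by (auto intro!: derivative_eq_intros)
      show "0 \<le> ?k y v" if "y \<in> {x..z}" for y using v a by simp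
    qed (use xz in simp)
    also have "?D z v = z" by (simp add: algebra_simps)
    finally have "(\<integral>\<^sup>+y. ennreal (?k y v) * indicator {x..z} y \<partial>lborel) = ennreal (g v powr (- \<alpha>) - z powr (- \<alpha>))"
      by (simp add: gD)
    moreover have "z powr (- \<alpha>) \<le> g v powr (- \<alpha>)"
    proof (rule powr_mono2')
      have "(z - x) * v \<le> (z - x) * 1" using v xz by (intro mult_left_mono) auto
      then show "g v \<le> z" by (simp add: g_def)
      show "0 < g v" using Dpos[of x v] v xz by (simp add: gD)
    qed (use a in simp)
    ultimately show ?thesis by (simp flip: ennreal_plus)
  qed
  have k_nn: "ennreal (?w v) * (ennreal (?k y v) * indicator {x..z} y) * indicator {0..1} v =
      ennreal ?B * (ennreal (?e y v) * indicator {0..1} v * indicator {x..z} y)" for y v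
  proof (cases "v \<in> {0..1} \<and> y \<in> {x..z}")
    case True
    have "(1 - v) powr (\<alpha> - 1) * (1 - v) = (1 - v) powr \<alpha>"
      using powr_mult_base[of "1 - v" "\<alpha> - 1"] True by (simp add: mult.commute)
    then have "?w v * ?k y v = ?B * (?e y v)"
      using B by (simp add: mult_ac)
    moreover have "ennreal (?w v) * ennreal (?k y v) = ennreal (?w v * ?k y v)"
      by (rule ennreal_mult'[symmetric]) simp
    moreover have "ennreal (?B * (?e y v)) =
        ennreal ?B * ennreal (?e y v)"
      by (rule ennreal_mult') (use B in simp)
    moreover have "indicator {0..1} v = (1::ennreal)" "indicator {x..z} y = (1::ennreal)" using True by auto
    ultimately show ?thesis by (simp only: mult_1_right)
  qed (auto simp: indicator_def)
  have "(\<integral>\<^sup>+y. ennreal (?f y) * indicator {x..z} y \<partial>lborel) = (\<integral>\<^sup>+y. ennreal (?f y * indicator {g 0..g 1} y) \<partial>lborel)"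
    unfolding g01 by (intro nn_integral_cong) (auto simp: indicator_def)
  also have "\<dots> = (\<integral>\<^sup>+v. ennreal (?f (g v) * (z - x) * indicator {0..1} v) \<partial>lborel)"
  proof (rule nn_integral_substitution)
    show "set_borel_measurable borel {g 0..g 1} ?f" unfolding set_borel_measurable_def by measurable
    show "(g has_real_derivative z - x) (at q)" for q
      unfolding g_def[abs_def] by (auto intro!: derivative_eq_intros)
  qed (use xz in auto)
  also have "\<dots> = (\<integral>\<^sup>+v. ennreal (z powr (- \<alpha>)) * (ennreal (?w v) * indicator {0..1} v) +
      (\<integral>\<^sup>+y. ennreal (?w v) * (ennreal (?k y v) * indicator {x..z} y) * indicator {0..1} v \<partial>lborel) \<partial>lborel)"
  proof (rule nn_integral_cong)
    fix v :: real
    show "ennreal (?f (g v) * (z - x) * indicator {0..1} v) = ennreal (z powr (- \<alpha>)) * (ennreal (?w v) * indicator {0..1} v) +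
      (\<integral>\<^sup>+y. ennreal (?w v) * (ennreal (?k y v) * indicator {x..z} y) * indicator {0..1} v \<partial>lborel)"
    proof (cases "v \<in> {0..1}")
      case True
      have "ennreal (?f (g v) * (z - x)) = ennreal (?w v) * ennreal (g v powr (- \<alpha>))"
        unfolding eq[OF True] by (rule ennreal_mult') simp
      then show ?thesis using True
        by (simp add: J distrib_left nn_integral_cmult mult.commute)
    qed simp
  qed
  also have "\<dots> = (\<integral>\<^sup>+v. ennreal (z powr (- \<alpha>)) * (ennreal (?w v) * indicator {0..1} v) \<partial>lborel) +
      (\<integral>\<^sup>+v. (\<integral>\<^sup>+y. ennreal (?w v) * (ennreal (?k y v) * indicator {x..z} y) * indicator {0..1} v \<partial>lborel) \<partial>lborel)"
    by (rule nn_integral_add) measurable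
  also have "(\<integral>\<^sup>+v. ennreal (z powr (- \<alpha>)) * (ennreal (?w v) * indicator {0..1} v) \<partial>lborel) = ennreal ?B * ennreal (z powr (- \<alpha>))"
    using nn_integral_Beta[of "1 - \<alpha>" \<alpha>] a by (subst nn_integral_cmult) (auto simp: mult.commute)
  also have "(\<integral>\<^sup>+v. (\<integral>\<^sup>+y. ennreal (?w v) * (ennreal (?k y v) * indicator {x..z} y) * indicator {0..1} v \<partial>lborel) \<partial>lborel) =
     (\<integral>\<^sup>+y. (\<integral>\<^sup>+v. ennreal (?w v) * (ennreal (?k y v) * indicator {x..z} y) * indicator {0..1} v \<partial>lborel) \<partial>lborel)"
    by (rule lborel_pair.Fubini') measurable
  also have "\<dots> = (\<integral>\<^sup>+y. ennreal ?B * (corr_kernel \<alpha> y z * indicator {x..z} y) \<partial>lborel)"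
    unfolding k_nn
  proof (rule nn_integral_cong)
    fix y
    show "(\<integral>\<^sup>+v. ennreal ?B * (ennreal (?e y v) * indicator {0..1} v * indicator {x..z} y) \<partial>lborel) =
      ennreal ?B * (corr_kernel \<alpha> y z * indicator {x..z} y)"
      unfolding corr_kernel_def by (subst nn_integral_cmult, measurable, subst nn_integral_multc, measurable)
  qed
  also have "\<dots> = ennreal ?B * (\<integral>\<^sup>+y. corr_kernel \<alpha> y z * indicator {x..z} y \<partial>lborel)"
    by (rule nn_integral_cmult) measurable
  finally show ?thesis by (simp add: distrib_left)
qed

lemma borel_measurable_lebesgue_on_AE:
  fixes f g :: "real \<Rightarrow> 'k::topological_space"
  assumes f: "f \<in> borel_measurable (lebesgue_on S)" and S: "S \<in> sets lebesgue"
    and AE: "AE x in lebesgue_on S. f x = g x"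
  shows "g \<in> borel_measurable (lebesgue_on S)"
proof (rule measurableI)
  obtain N where N: "{x \<in> S. f x \<noteq> g x} \<subseteq> N" "N \<in> null_sets (lebesgue_on S)"
    using AE unfolding eventually_ae_filter by auto
  then have N0: "N \<in> null_sets lebesgue"
    using S by (simp add: null_sets_restrict_space)
  fix A :: "'k set" assume A: "A \<in> sets borel"
  have 1: "f -` A \<inter> S \<in> sets (lebesgue_on S)"
    using measurable_sets[OF f A] by simp
  have sub: "X \<in> sets lebesgue" if "X \<subseteq> N" for X
    using null_sets_completion_subset[OF that] N0 by blast
  have eq: "g -` A \<inter> S = (f -` A \<inter> S - N) \<union> (g -` A \<inter> S \<inter> N)"
    using N(1) by auto
  have "f -` A \<inter> S - N \<in> sets (lebesgue_on S)" using 1 N(2) by auto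
  moreover have "g -` A \<inter> S \<inter> N \<in> sets (lebesgue_on S)"
    using sub[of "g -` A \<inter> S \<inter> N"] S by (auto simp: sets_restrict_space_iff)
  ultimately have "g -` A \<inter> S \<in> sets (lebesgue_on S)"
    by (subst eq) (rule sets.Un)
  then show "g -` A \<inter> space (lebesgue_on S) \<in> sets (lebesgue_on S)"
    by simp
qed simp

text \<open>The integrand is a scalar kernel times a function of one variable, so Tonelli's theorem for its norm
supplies all the integrability for Fubini's theorem.\<close>

lemma Fubini_kernel:
  fixes k :: "real \<Rightarrow> real \<Rightarrow> real" and \<phi> :: "real \<Rightarrow> 'k::{banach, second_countable_topology}"
  assumes km: "(\<lambda>p. k (fst p) (snd p)) \<in> borel_measurable (Leb t \<Otimes>\<^sub>M Leb t)"
    and \<phi>: "\<phi> \<in> borel_measurable (Leb t)"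
    and nn: "\<And>y z. 0 \<le> k y z"
    and fin: "(\<integral>\<^sup>+z. (\<integral>\<^sup>+y. ennreal (k y z) \<partial>Leb t) * ennreal (norm (\<phi> z)) \<partial>Leb t) < \<infinity>"
  shows "(LINT y|Leb t. LINT z|Leb t. k y z *\<^sub>R \<phi> z) =
      (LINT z|Leb t. (LINT y|Leb t. k y z) *\<^sub>R \<phi> z)"
    and "integrable (Leb t) (\<lambda>y. LINT z|Leb t. k y z *\<^sub>R \<phi> z)"
    and "AE y in Leb t. integrable (Leb t) (\<lambda>z. k y z *\<^sub>R \<phi> z)"
proof -
  let ?M = "Leb t"
  interpret pair_sigma_finite ?M ?M by (rule pair_sigma_finite_Icc)
  have \<phi>2: "(\<lambda>p. \<phi> (snd p)) \<in> borel_measurable (?M \<Otimes>\<^sub>M ?M)"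
    by (rule measurable_compose[OF measurable_snd \<phi>])
  have fm: "(\<lambda>(y, z). k y z *\<^sub>R \<phi> z) \<in> borel_measurable (?M \<Otimes>\<^sub>M ?M)"
    unfolding case_prod_unfold by (rule borel_measurable_scaleR[OF km \<phi>2])
  have k1: "(\<lambda>y. k y z) \<in> borel_measurable ?M" if "z \<in> space ?M" for z
    using measurable_compose[OF measurable_Pair2'[OF that, of ?M] km] by simp
  have int: "integrable (?M \<Otimes>\<^sub>M ?M) (\<lambda>(y, z). k y z *\<^sub>R \<phi> z)"
  proof (rule integrableI_bounded[OF fm])
    have nm: "(\<lambda>p. ennreal (norm (case p of (y, z) \<Rightarrow> k y z *\<^sub>R \<phi> z))) \<in> borel_measurable (?M \<Otimes>\<^sub>M ?M)"
      using fm by measurable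
    have "(\<integral>\<^sup>+p. ennreal (norm (case p of (y, z) \<Rightarrow> k y z *\<^sub>R \<phi> z)) \<partial>(?M \<Otimes>\<^sub>M ?M)) =
        (\<integral>\<^sup>+z. (\<integral>\<^sup>+y. ennreal (norm (k y z *\<^sub>R \<phi> z)) \<partial>?M) \<partial>?M)"
      using nn_integral_snd[OF nm] by simp
    also have "\<dots> = (\<integral>\<^sup>+z. (\<integral>\<^sup>+y. ennreal (k y z) \<partial>?M) * ennreal (norm (\<phi> z)) \<partial>?M)"
    proof (rule nn_integral_cong)
      fix z assume z: "z \<in> space ?M"
      have "(\<integral>\<^sup>+y. ennreal (norm (k y z *\<^sub>R \<phi> z)) \<partial>?M) = (\<integral>\<^sup>+y. ennreal (k y z) * ennreal (norm (\<phi> z)) \<partial>?M)"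
        using nn by (intro nn_integral_cong) (simp add: ennreal_mult')
      also have "\<dots> = (\<integral>\<^sup>+y. ennreal (k y z) \<partial>?M) * ennreal (norm (\<phi> z))"
        using k1[OF z] by (intro nn_integral_multc) measurable
      finally show "(\<integral>\<^sup>+y. ennreal (norm (k y z *\<^sub>R \<phi> z)) \<partial>?M) = \<dots>" .
    qed
    finally show "(\<integral>\<^sup>+p. ennreal (norm (case p of (y, z) \<Rightarrow> k y z *\<^sub>R \<phi> z)) \<partial>(?M \<Otimes>\<^sub>M ?M)) < \<infinity>"
      using fin by simp
  qed
  show "AE y in ?M. integrable ?M (\<lambda>z. k y z *\<^sub>R \<phi> z)" by (rule AE_integrable_fst[OF int])
  show "integrable ?M (\<lambda>y. LINT z|?M. k y z *\<^sub>R \<phi> z)" by (rule integrable_fst[OF int])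
  have "(LINT y|?M. LINT z|?M. k y z *\<^sub>R \<phi> z) = (LINT z|?M. LINT y|?M. k y z *\<^sub>R \<phi> z)"
    by (rule Fubini_integral[OF int, symmetric])
  also have "\<dots> = (LINT z|?M. (LINT y|?M. k y z) *\<^sub>R \<phi> z)"
  proof (rule integral_cong_AE)
    have "(\<lambda>(z, y). k y z *\<^sub>R \<phi> z) \<in> borel_measurable (?M \<Otimes>\<^sub>M ?M)"
      using measurable_compose[OF measurable_pair_swap' fm] by (simp add: case_prod_unfold)
    then show "(\<lambda>z. LINT y|?M. k y z *\<^sub>R \<phi> z) \<in> borel_measurable ?M"
      by (intro M1.borel_measurable_lebesgue_integral) simp
    have "(\<lambda>(z, y). k y z) \<in> borel_measurable (?M \<Otimes>\<^sub>M ?M)"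
      using measurable_compose[OF measurable_pair_swap' km] by (simp add: case_prod_unfold)
    then show "(\<lambda>z. (LINT y|?M. k y z) *\<^sub>R \<phi> z) \<in> borel_measurable ?M"
      by (intro borel_measurable_scaleR \<phi> M1.borel_measurable_lebesgue_integral) simp
    have "AE z in ?M. (\<integral>\<^sup>+y. ennreal (k y z) \<partial>?M) * ennreal (norm (\<phi> z)) \<noteq> \<infinity>"
    proof (rule nn_integral_PInf_AE)
      have "(\<lambda>(z, y). ennreal (k y z)) \<in> borel_measurable (?M \<Otimes>\<^sub>M ?M)"
        using measurable_compose[OF measurable_pair_swap' km] by (simp add: case_prod_unfold)
      then show "(\<lambda>z. (\<integral>\<^sup>+y. ennreal (k y z) \<partial>?M) * ennreal (norm (\<phi> z))) \<in> borel_measurable ?M"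
        using \<phi> by (intro borel_measurable_times_ennreal M1.borel_measurable_nn_integral) auto
    qed (use fin in simp)
    then show "AE z in ?M. (LINT y|?M. k y z *\<^sub>R \<phi> z) = (LINT y|?M. k y z) *\<^sub>R \<phi> z"
      using AE_space
    proof eventually_elim
      case (elim z)
      show ?case
      proof (cases "\<phi> z = 0")
        case False
        then have "(\<integral>\<^sup>+y. ennreal (k y z) \<partial>?M) < \<infinity>"
          using elim(1) by (auto simp: ennreal_mult_eq_top_iff less_top[symmetric])
        then have "integrable ?M (\<lambda>y. k y z)"
          using k1[OF elim(2)] nn by (intro integrableI_bounded) auto
        then show ?thesis by (rule integral_scaleR_left)
      qed simp
    qed
  qed
  finally show "(LINT y|?M. LINT z|?M. k y z *\<^sub>R \<phi> z) = (LINT z|?M. (LINT y|?M. k y z) *\<^sub>R \<phi> z)" .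
qed

text \<open>The weights that occur below may destroy square integrability at \<open>0\<close>, so the differentiation theorem is
applied on each \<open>[1/n, t]\<close> separately.\<close>

lemma tail_integral_derivative_AE:
  fixes \<psi> :: "real \<Rightarrow> 'k::{banach, second_countable_topology}"
  assumes t: "0 < t" and \<psi>: "\<And>\<delta>. \<delta> > 0 \<Longrightarrow> (\<lambda>y. indicator {\<delta>..} y *\<^sub>R \<psi> y) \<in> L2_fun t"
    and G: "\<And>x. 0 < x \<Longrightarrow> x < t \<Longrightarrow> G x = (LINT y|Leb t. indicator {x..} y *\<^sub>R \<psi> y)"
  shows "AE x in Leb t. (G has_vector_derivative - \<psi> x) (at x)"
proof -
  let ?M = "Leb t"
  have "AE x in ?M. \<forall>n. ((\<lambda>x. LINT y|?M. indicator {x..} y *\<^sub>R indicator {1 / Suc n..} y *\<^sub>R \<psi> y)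
      has_vector_derivative - (indicator {1 / Suc n..} x *\<^sub>R \<psi> x)) (at x)"
    unfolding AE_all_countable by (intro allI Lebesgue_differentiation_L2 t \<psi>) simp
  then show ?thesis
    using AE_Icc_neq[where c=0 and a=0 and b=t] AE_Icc_neq[where c=t and a=0 and b=t] AE_space
  proof eventually_elim
    case (elim x)
    then have x: "0 < x" "x < t" by auto
    then obtain n where n: "1 / Suc n < x" using nat_approx_posE by blast
    have "((\<lambda>x. LINT y|?M. indicator {x..} y *\<^sub>R indicator {1 / Suc n..} y *\<^sub>R \<psi> y)
      has_vector_derivative - \<psi> x) (at x)"
      using elim(1)[rule_format, of n] n by simp
    then show ?case
    proof (rule has_vector_derivative_transform_within_open)
      show "open {1 / Suc n<..<t}" "x \<in> {1 / Suc n<..<t}" using n x by auto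
      fix y assume y: "y \<in> {1 / Suc n<..<t}"
      then have "0 < y" using order.strict_trans[of 0 "1 / Suc n" y] by simp
      then have "G y = (LINT z|?M. indicator {y..} z *\<^sub>R \<psi> z)" using G y by simp
      also have "\<dots> = (LINT z|?M. indicator {y..} z *\<^sub>R indicator {1 / Suc n..} z *\<^sub>R \<psi> z)"
        using y by (intro Bochner_Integration.integral_cong) (auto simp: indicator_def)
      finally show "(LINT z|?M. indicator {y..} z *\<^sub>R indicator {1 / Suc n..} z *\<^sub>R \<psi> z) = G y" by simp
    qed
  qed
qed

lemma fbm_transform_eq_derivative:
  assumes "H < 1/2" "0 < H"
  shows "fbm_transform H t f x = x powr (1/2 - H) *\<^sub>R
    vector_derivative (frac_int t (1 - (1/2 - H)) (\<lambda>r. r powr (- (1/2 - H)) *\<^sub>R f r)) (at x)"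
proof -
  have "\<lceil>1/2 - H\<rceil> = 1" using assms by (simp add: ceiling_eq_iff)
  then show ?thesis using assms by (simp add: fbm_transform_def frac_deriv_def)
qed

text \<open>The factor \<open>x powr \<alpha>\<close> belongs to the transform; with it, the kernel is homogeneous of degree \<open>-1\<close>.\<close>

definition corr_real :: "real \<Rightarrow> real \<Rightarrow> real \<Rightarrow> real" where
  "corr_real \<alpha> x z = (if 0 < x \<and> x < z then x powr \<alpha> * enn2real (corr_kernel \<alpha> x z) else 0)"

lemma corr_real_nonneg [simp]: "0 \<le> corr_real \<alpha> x z"
  by (simp add: corr_real_def)

lemma borel_measurable_corr_real:
  assumes [measurable]: "f \<in> borel_measurable M" "g \<in> borel_measurable M"
  shows "(\<lambda>w. corr_real \<alpha> (f w) (g w)) \<in> borel_measurable M"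
  unfolding corr_real_def by measurable

lemma borel_measurable_corr_real_right [measurable]: "corr_real \<alpha> x \<in> borel_measurable (lebesgue_on S)"
  by (intro measurable_lebesgue_on_borel borel_measurable_corr_real[of "\<lambda>_. x" _ "\<lambda>z. z"]) auto

lemma borel_measurable_corr_real_left [measurable]: "(\<lambda>x. corr_real \<alpha> x z) \<in> borel_measurable (lebesgue_on S)"
  by (intro measurable_lebesgue_on_borel borel_measurable_corr_real) auto

lemma borel_measurable_corr_real_pair [measurable]:
  "(\<lambda>p. corr_real \<alpha> (fst p) (snd p)) \<in> borel_measurable (lebesgue_on S \<Otimes>\<^sub>M lebesgue_on R)"
  by (intro borel_measurable_corr_real measurable_lebesgue_on_real[OF measurable_fst] measurable_lebesgue_on_real[OF measurable_snd])

text \<open>The midpoint of \<open>\<alpha>\<close> and \<open>1/2\<close>: an exponent above \<open>\<alpha>\<close> is needed for the bound on the kernel, and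
one below \<open>1/2\<close> for the boundedness of the operator.\<close>

definition corr_exp :: "real \<Rightarrow> real" where "corr_exp \<alpha> = (\<alpha> + 1/2) / 2"
definition corr_const :: "real \<Rightarrow> real" where
  "corr_const \<alpha> = \<alpha> / Beta (1 - \<alpha>) \<alpha> / (corr_exp \<alpha> - \<alpha>)"

lemma corr_const_pos: "0 < \<alpha> \<Longrightarrow> \<alpha> < 1/2 \<Longrightarrow> corr_const \<alpha> > 0"
  using Beta_real_pos[of "1 - \<alpha>" \<alpha>] by (simp add: corr_const_def corr_exp_def)

lemma corr_kernel_le_exp:
  assumes a: "0 < \<alpha>" "\<alpha> < 1/2" and "0 < y" "y \<le> z"
  shows "corr_kernel \<alpha> y z \<le> ennreal (corr_const \<alpha> * (y powr (- \<alpha> - corr_exp \<alpha>) * z powr (corr_exp \<alpha> - 1)))"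
  unfolding corr_const_def using assms by (intro corr_kernel_le) (auto simp: corr_exp_def)

lemma corr_real_le:
  assumes a: "0 < \<alpha>" "\<alpha> < 1/2" and x: "0 < x" "x \<le> z"
  shows "corr_real \<alpha> x z \<le> corr_const \<alpha> * (x powr (- corr_exp \<alpha>) * z powr (corr_exp \<alpha> - 1))"
proof -
  have C: "corr_const \<alpha> > 0" by (rule corr_const_pos[OF a])
  have "enn2real (corr_kernel \<alpha> x z) \<le> corr_const \<alpha> * (x powr (- \<alpha> - corr_exp \<alpha>) * z powr (corr_exp \<alpha> - 1))"
    using corr_kernel_le_exp[OF assms] C by (intro enn2real_leI) auto
  then have "x powr \<alpha> * enn2real (corr_kernel \<alpha> x z) \<le> x powr \<alpha> * (corr_const \<alpha> * (x powr (- \<alpha> - corr_exp \<alpha>) * z powr (corr_exp \<alpha> - 1)))"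
    by (rule mult_left_mono) simp
  also have "\<dots> = corr_const \<alpha> * ((x powr \<alpha> * x powr (- \<alpha> - corr_exp \<alpha>)) * z powr (corr_exp \<alpha> - 1))"
    by simp
  also have "x powr \<alpha> * x powr (- \<alpha> - corr_exp \<alpha>) = x powr (- corr_exp \<alpha>)"
    by (simp flip: powr_add)
  finally show ?thesis using C by (simp add: corr_real_def)
qed

lemma corr_real_integrable:
  assumes a: "0 < \<alpha>" "\<alpha> < 1/2" and \<phi>: "\<phi> \<in> L2_fun t"
  shows "integrable (Leb t) (\<lambda>z. corr_real \<alpha> x z *\<^sub>R \<phi> z)"
proof (rule Bochner_Integration.integrable_bound)
  let ?c = "corr_const \<alpha> * (x powr (- corr_exp \<alpha>) * x powr (corr_exp \<alpha> - 1))"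
  have [measurable]: "\<phi> \<in> borel_measurable (Leb t)" using \<phi> by (simp add: L2_fun_iff)
  show "integrable (Leb t) (\<lambda>z. ?c *\<^sub>R \<phi> z)"
    using L2_fun_integrable[OF \<phi>] by simp
  show "(\<lambda>z. corr_real \<alpha> x z *\<^sub>R \<phi> z) \<in> borel_measurable (Leb t)" by measurable
  have C: "corr_const \<alpha> > 0" by (rule corr_const_pos[OF a])
  show "AE z in Leb t. norm (corr_real \<alpha> x z *\<^sub>R \<phi> z) \<le> norm (?c *\<^sub>R \<phi> z)"
  proof (rule AE_I2)
    fix z
    have "corr_real \<alpha> x z \<le> ?c"
    proof (cases "0 < x \<and> x < z")
      case True
      then have "corr_real \<alpha> x z \<le> corr_const \<alpha> * (x powr (- corr_exp \<alpha>) * z powr (corr_exp \<alpha> - 1))"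
        using corr_real_le[OF a] by simp
      also have "\<dots> \<le> ?c"
        using True C a by (intro mult_left_mono powr_mono2') (auto simp: corr_exp_def)
      finally show ?thesis .
    qed (use C in \<open>auto simp: corr_real_def\<close>)
    then show "norm (corr_real \<alpha> x z *\<^sub>R \<phi> z) \<le> norm (?c *\<^sub>R \<phi> z)"
      using C by (simp add: mult_right_mono)
  qed
qed

text \<open>Up to its sign, this is the transform in terms of the preimage under the fractional integral.\<close>

definition corr_op :: "real \<Rightarrow> real \<Rightarrow> (real \<Rightarrow> 'k::{banach, second_countable_topology}) \<Rightarrow> real \<Rightarrow> 'k" where
  "corr_op t \<alpha> \<phi> x = \<phi> x + (LINT z|Leb t. corr_real \<alpha> x z *\<^sub>R \<phi> z)"

text \<open>A Hardy type inequality for the kernel \<open>x powr (-b) * z powr (b - 1)\<close> on \<open>x < z\<close> with \<open>b < 1/2\<close>: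
the Cauchy--Schwarz inequality with a power of \<open>z\<close> as weight, then Tonelli's theorem.\<close>

lemma corr_real_L2_bound:
  assumes a: "0 < \<alpha>" "\<alpha> < 1/2" and \<phi>: "\<phi> \<in> L2_fun t"
  shows "L2_sq (Leb t) (\<lambda>x. LINT z|Leb t. corr_real \<alpha> x z *\<^sub>R \<phi> z) \<le>
    ennreal ((corr_const \<alpha> / (1/2 - corr_exp \<alpha>))\<^sup>2) * L2_sq (Leb t) \<phi>"
proof -
  let ?M = "Leb t"
  let ?C = "corr_const \<alpha>"
  define b where "b = corr_exp \<alpha>"
  have b: "0 < b" "b < 1/2" using a by (auto simp: b_def corr_exp_def)
  have C: "?C > 0" by (rule corr_const_pos[OF a])
  have \<phi>M [measurable]: "\<phi> \<in> borel_measurable ?M" using \<phi> by (simp add: L2_fun_iff)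
  interpret pair_sigma_finite ?M ?M by (rule pair_sigma_finite_Icc)
  let ?n = "\<lambda>z. ennreal (z powr (b - 1/2)) * ennreal ((norm (\<phi> z))\<^sup>2)"
  let ?T = "\<lambda>x. LINT z|?M. corr_real \<alpha> x z *\<^sub>R \<phi> z"
  let ?R = "\<lambda>x. \<integral>\<^sup>+z. ennreal (x powr (- b - 1/2)) * (?n z * indicator {x..t} z) \<partial>?M"
  have pM [measurable]: "(\<lambda>z. ennreal (z powr e)) \<in> borel_measurable ?M" for e
    by (rule measurable_lebesgue_on_borel) measurable
  have nM [measurable]: "?n \<in> borel_measurable ?M" by measurable
  have indM: "(\<lambda>p. indicator {fst p..t} (snd p) :: ennreal) \<in> borel_measurable (?M \<Otimes>\<^sub>M ?M)"
  proof -
    have [measurable]: "fst \<in> borel_measurable (?M \<Otimes>\<^sub>M ?M)" "snd \<in> borel_measurable (?M \<Otimes>\<^sub>M ?M)"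
      using measurable_lebesgue_on_real[OF measurable_fst] measurable_lebesgue_on_real[OF measurable_snd] by blast+
    have "(\<lambda>p. indicator {fst p..t} (snd p) :: ennreal) = (\<lambda>p. if fst p \<le> snd p \<and> snd p \<le> t then 1 else 0)"
      by (auto simp: indicator_def)
    then show ?thesis by simp
  qed
  have indM1: "(\<lambda>z. indicator {x..t} z :: ennreal) \<in> borel_measurable ?M" for x
    by (rule measurable_lebesgue_on_borel) measurable
  have point: "ennreal ((norm (?T x))\<^sup>2) \<le>
      ennreal (?C\<^sup>2 / (1/2 - b)) * (?R x)"
    if x: "0 < x" "x \<le> t" for x
  proof -
    let ?A = "\<lambda>z. ennreal (?C * x powr (- b) * z powr ((b - 1) / 2 - 1/4)) * indicator {x..t} z"
    let ?B = "\<lambda>z. ennreal (z powr ((b - 1) / 2 + 1/4)) * ennreal (norm (\<phi> z)) * indicator {x..t} z"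
    have AM: "?A \<in> borel_measurable ?M"
      by (rule measurable_lebesgue_on_borel) measurable
    have BM: "?B \<in> borel_measurable ?M"
      by (intro borel_measurable_times_ennreal pM indM1) measurable
    have "ennreal (norm (?T x)) \<le> (\<integral>\<^sup>+z. ennreal (norm (corr_real \<alpha> x z *\<^sub>R \<phi> z)) \<partial>?M)"
      by (rule integral_norm_bound_ennreal[OF corr_real_integrable[OF a \<phi>]])
    also have "\<dots> \<le> (\<integral>\<^sup>+z. ?A z * ?B z \<partial>?M)"
    proof (rule nn_integral_mono)
      fix z assume z: "z \<in> space ?M"
      show "ennreal (norm (corr_real \<alpha> x z *\<^sub>R \<phi> z)) \<le> ?A z * ?B z"
      proof (cases "x \<le> z")
        case True
        have e: "(b - 1) / 2 - 1/4 + ((b - 1) / 2 + 1/4) = b - 1" by (simp add: field_simps)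
        have "z powr (b - 1) = z powr ((b - 1) / 2 - 1/4) * z powr ((b - 1) / 2 + 1/4)"
          unfolding powr_add[symmetric] e ..
        then have "corr_real \<alpha> x z * norm (\<phi> z) \<le>
            (?C * x powr (- b) * z powr ((b - 1) / 2 - 1/4)) * (z powr ((b - 1) / 2 + 1/4) * norm (\<phi> z))"
          using mult_right_mono[OF corr_real_le[OF a x(1) True] norm_ge_zero[of "\<phi> z"]]
          by (simp add: b_def mult_ac)
        then have "ennreal (norm (corr_real \<alpha> x z *\<^sub>R \<phi> z)) \<le>
            ennreal ((?C * x powr (- b) * z powr ((b - 1) / 2 - 1/4)) * (z powr ((b - 1) / 2 + 1/4) * norm (\<phi> z)))"
          by (intro ennreal_leI) simp
        also have "\<dots> = ?A z * ?B z"
          using True z C by (simp add: ennreal_mult)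
        finally show ?thesis .
      qed (simp add: corr_real_def)
    qed
    finally have "(ennreal (norm (?T x)))\<^sup>2 \<le> (\<integral>\<^sup>+z. ?A z * ?B z \<partial>?M)\<^sup>2"
      by (rule power_mono) simp
    also have "\<dots> \<le> (\<integral>\<^sup>+z. (?A z)\<^sup>2 \<partial>?M) * (\<integral>\<^sup>+z. (?B z)\<^sup>2 \<partial>?M)"
      by (rule Cauchy_Schwarz_nn_integral[OF AM BM])
    also have "(\<integral>\<^sup>+z. (?B z)\<^sup>2 \<partial>?M) = (\<integral>\<^sup>+z. ?n z * indicator {x..t} z \<partial>?M)"
    proof (rule nn_integral_cong)
      fix z :: real
      have "(b - 1) / 2 + 1/4 + ((b - 1) / 2 + 1/4) = b - 1/2" by (simp add: field_simps)
      then have "(z powr ((b - 1) / 2 + 1/4))\<^sup>2 = z powr (b - 1/2)"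
        unfolding power2_eq_square powr_add[symmetric] by simp
      then show "(?B z)\<^sup>2 = ?n z * indicator {x..t} z"
        by (auto simp: indicator_def power_mult_distrib ennreal_power)
    qed
    also have "(\<integral>\<^sup>+z. (?A z)\<^sup>2 \<partial>?M) \<le> ennreal (?C\<^sup>2 / (1/2 - b) * x powr (- b - 1/2))"
    proof -
      have "(\<integral>\<^sup>+z. (?A z)\<^sup>2 \<partial>?M) = (\<integral>\<^sup>+z. ennreal ((?C * x powr (- b))\<^sup>2 * z powr (b - 1/2 - 1)) * indicator {x..t} z \<partial>lebesgue)"
      proof (subst nn_integral_lebesgue_on)
        show "(\<integral>\<^sup>+z. (?A z)\<^sup>2 * indicator {0..t} z \<partial>lebesgue) =
          (\<integral>\<^sup>+z. ennreal ((?C * x powr (- b))\<^sup>2 * z powr (b - 1/2 - 1)) * indicator {x..t} z \<partial>lebesgue)"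
        proof (rule nn_integral_cong)
          fix z :: real
          have "(b - 1) / 2 - 1/4 + ((b - 1) / 2 - 1/4) = b - 1/2 - 1" by (simp add: field_simps)
          then have "(z powr ((b - 1) / 2 - 1/4))\<^sup>2 = z powr (b - 1/2 - 1)"
            unfolding power2_eq_square powr_add[symmetric] by simp
          then show "(?A z)\<^sup>2 * indicator {0..t} z = ennreal ((?C * x powr (- b))\<^sup>2 * z powr (b - 1/2 - 1)) * indicator {x..t} z"
            using x C by (auto simp: indicator_def power_mult_distrib ennreal_power)
        qed
      qed simp
      also have "\<dots> = ennreal ((?C * x powr (- b))\<^sup>2 * (t powr (b - 1/2) / (b - 1/2)) - (?C * x powr (- b))\<^sup>2 * (x powr (b - 1/2) / (b - 1/2)))"
      proof (rule nn_integral_FTC)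
        show "continuous_on {x..t} (\<lambda>z. (?C * x powr (- b))\<^sup>2 * (z powr (b - 1/2) / (b - 1/2)))"
          using x b by (intro continuous_intros) auto
        show "((\<lambda>z. (?C * x powr (- b))\<^sup>2 * (z powr (b - 1/2) / (b - 1/2))) has_real_derivative
            (?C * x powr (- b))\<^sup>2 * z powr (b - 1/2 - 1)) (at z)" if "z \<in> {x<..<t}" for z
        proof -
          have "((\<lambda>z. z powr (b - 1/2) / (b - 1/2)) has_real_derivative z powr (b - 1/2 - 1)) (at z)"
            using DERIV_cdivide[OF has_real_derivative_powr[of z "b - 1/2"], of "b - 1/2"] that x b by simp
          then show ?thesis by (rule DERIV_cmult)
        qed
      qed (use x in auto)
      also have "\<dots> \<le> ennreal (?C\<^sup>2 / (1/2 - b) * x powr (- b - 1/2))"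
      proof (rule ennreal_leI)
        have "(x powr (- b))\<^sup>2 * x powr (b - 1/2) = x powr (- b + - b + (b - 1/2))"
          by (simp only: powr_add power2_eq_square)
        also have "- b + - b + (b - 1/2) = - b - 1/2" by simp
        finally have xx: "(x powr (- b))\<^sup>2 * x powr (b - 1/2) = x powr (- b - 1/2)" .
        have "(?C * x powr (- b))\<^sup>2 * (t powr (b - 1/2) / (b - 1/2)) \<le> 0"
          using b by (intro mult_nonneg_nonpos) (auto intro: divide_nonneg_neg)
        moreover have "- ((?C * x powr (- b))\<^sup>2 * (x powr (b - 1/2) / (b - 1/2))) = ?C\<^sup>2 / (1/2 - b) * ((x powr (- b))\<^sup>2 * x powr (b - 1/2))"
          using b by (simp add: power_mult_distrib field_simps)
        ultimately show "(?C * x powr (- b))\<^sup>2 * (t powr (b - 1/2) / (b - 1/2)) - (?C * x powr (- b))\<^sup>2 * (x powr (b - 1/2) / (b - 1/2))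
            \<le> ?C\<^sup>2 / (1/2 - b) * x powr (- b - 1/2)"
          unfolding xx by linarith
      qed
      finally show ?thesis .
    qed
    finally have "(ennreal (norm (?T x)))\<^sup>2 \<le>
        ennreal (?C\<^sup>2 / (1/2 - b) * x powr (- b - 1/2)) * (\<integral>\<^sup>+z. ?n z * indicator {x..t} z \<partial>?M)"
      by (simp add: mult_right_mono)
    also have "ennreal (?C\<^sup>2 / (1/2 - b) * x powr (- b - 1/2)) = ennreal (?C\<^sup>2 / (1/2 - b)) * ennreal (x powr (- b - 1/2))"
      by (rule ennreal_mult'') simp
    also have "\<dots> * (\<integral>\<^sup>+z. ?n z * indicator {x..t} z \<partial>?M) =
        ennreal (?C\<^sup>2 / (1/2 - b)) * (?R x)"
    proof -
      have "(\<lambda>z. ?n z * indicator {x..t} z) \<in> borel_measurable ?M"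
        by (intro borel_measurable_times_ennreal[OF nM indM1])
      then show ?thesis by (simp add: nn_integral_cmult mult.assoc)
    qed
    finally show ?thesis by (simp add: ennreal_power)
  qed
  have k2M: "(\<lambda>(x, z). ennreal (x powr (- b - 1/2)) * (?n z * indicator {x..t} z)) \<in> borel_measurable (?M \<Otimes>\<^sub>M ?M)"
    unfolding case_prod_unfold
    by (intro borel_measurable_times_ennreal indM measurable_compose[OF measurable_fst pM]
        measurable_compose[OF measurable_snd nM, unfolded comp_def] measurable_compose[OF measurable_snd pM]
        measurable_compose[OF measurable_snd borel_measurable_times_ennreal]) measurable
  have "L2_sq ?M (\<lambda>x. LINT z|?M. corr_real \<alpha> x z *\<^sub>R \<phi> z) \<le>
      (\<integral>\<^sup>+x. ennreal (?C\<^sup>2 / (1/2 - b)) * (?R x) \<partial>?M)"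
    unfolding L2_sq_def
  proof (rule nn_integral_mono_AE)
    show "AE x in ?M. ennreal ((norm (?T x))\<^sup>2) \<le>
      ennreal (?C\<^sup>2 / (1/2 - b)) * (?R x)"
      using AE_Icc_neq[where c=0 and a=0 and b=t] AE_space
      by eventually_elim (rule point, auto)
  qed
  also have "\<dots> = ennreal (?C\<^sup>2 / (1/2 - b)) * (\<integral>\<^sup>+x. (?R x) \<partial>?M)"
    by (rule nn_integral_cmult, rule M1.borel_measurable_nn_integral[OF k2M])
  also have "(\<integral>\<^sup>+x. (?R x) \<partial>?M) =
      (\<integral>\<^sup>+z. (\<integral>\<^sup>+x. ennreal (x powr (- b - 1/2)) * (?n z * indicator {x..t} z) \<partial>?M) \<partial>?M)"
    by (rule Fubini'[OF k2M, symmetric])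
  also have "\<dots> = (\<integral>\<^sup>+z. ennreal (1 / (1/2 - b)) * ennreal ((norm (\<phi> z))\<^sup>2) \<partial>?M)"
  proof (rule nn_integral_cong_AE)
    show "AE z in ?M. (\<integral>\<^sup>+x. ennreal (x powr (- b - 1/2)) * (?n z * indicator {x..t} z) \<partial>?M) = ennreal (1 / (1/2 - b)) * ennreal ((norm (\<phi> z))\<^sup>2)"
      using AE_Icc_neq[where c=0 and a=0 and b=t] AE_space
    proof eventually_elim
      case (elim z)
      then have z: "0 < z" "z \<le> t" by auto
      define e where "e = 1/2 - b"
      have e: "e > 0" "- b - 1/2 = e - 1" "b - 1/2 = - e" using b by (auto simp: e_def)
      have iM: "(\<lambda>x. ennreal (x powr (e - 1)) * indicator {0..z} x) \<in> borel_measurable ?M"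
        by (rule measurable_lebesgue_on_borel) measurable
      have "(\<integral>\<^sup>+x. ennreal (x powr (- b - 1/2)) * (?n z * indicator {x..t} z) \<partial>?M) =
        (\<integral>\<^sup>+x. (ennreal (x powr (e - 1)) * indicator {0..z} x) * ?n z \<partial>?M)"
        using z by (intro nn_integral_cong) (auto simp: indicator_def e(2) mult_ac)
      also have "\<dots> = (\<integral>\<^sup>+x. ennreal (x powr (e - 1)) * indicator {0..z} x \<partial>?M) * ?n z"
        by (rule nn_integral_multc[OF iM])
      also have "(\<integral>\<^sup>+x. ennreal (x powr (e - 1)) * indicator {0..z} x \<partial>?M) = (\<integral>\<^sup>+x. ennreal (x powr (e - 1)) * indicator {0..z} x \<partial>lebesgue)"
        using z by (subst nn_integral_lebesgue_on) (auto intro!: nn_integral_cong simp: indicator_def)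
      also have "\<dots> = ennreal (z powr e / e - 0 powr e / e)"
        using e z by (intro nn_integral_FTC continuous_intros continuous_on_powr')
          (auto intro!: derivative_eq_intros)
      also have "\<dots> * ?n z = ennreal (1 / e) * ennreal ((norm (\<phi> z))\<^sup>2)"
        using z e by (simp add: e(3) mult.assoc[symmetric] powr_minus flip: ennreal_mult)
      finally show ?case by (simp add: e_def)
    qed
  qed
  also have "\<dots> = ennreal (1 / (1/2 - b)) * L2_sq ?M \<phi>"
    unfolding L2_sq_def by (rule nn_integral_cmult) measurable
  also have "ennreal (?C\<^sup>2 / (1/2 - b)) * (ennreal (1 / (1/2 - b)) * L2_sq ?M \<phi>) =
      ennreal ((?C / (1/2 - b))\<^sup>2) * L2_sq ?M \<phi>"
    using b by (simp add: mult.assoc[symmetric] power2_eq_square flip: ennreal_mult)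
  finally show ?thesis unfolding b_def .
qed

lemma corr_op_L2:
  assumes a: "0 < \<alpha>" "\<alpha> < 1/2" and \<phi>: "\<phi> \<in> L2_fun t"
  shows "L2_sq (Leb t) (corr_op t \<alpha> \<phi>) \<le>
      ennreal (2 + 2 * (corr_const \<alpha> / (1/2 - corr_exp \<alpha>))\<^sup>2) * L2_sq (Leb t) \<phi>"
    and "corr_op t \<alpha> \<phi> \<in> L2_fun t"
proof -
  let ?M = "Leb t"
  let ?c = "(corr_const \<alpha> / (1/2 - corr_exp \<alpha>))\<^sup>2"
  have \<phi>M [measurable]: "\<phi> \<in> borel_measurable ?M" using \<phi> by (simp add: L2_fun_iff)
  interpret sigma_finite_measure ?M by (rule sigma_finite_lebesgue_on_Icc)
  have m [measurable]: "(\<lambda>x. LINT z|?M. corr_real \<alpha> x z *\<^sub>R \<phi> z) \<in> borel_measurable ?M"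
    by (intro borel_measurable_lebesgue_integral) (unfold case_prod_unfold, measurable)
  have "L2_sq ?M (corr_op t \<alpha> \<phi>) \<le> 2 * L2_sq ?M \<phi> + 2 * L2_sq ?M (\<lambda>x. LINT z|?M. corr_real \<alpha> x z *\<^sub>R \<phi> z)"
    unfolding corr_op_def[abs_def] by (rule L2_sq_add_le) measurable
  also have "\<dots> \<le> 2 * L2_sq ?M \<phi> + 2 * (ennreal ?c * L2_sq ?M \<phi>)"
    by (intro add_left_mono mult_left_mono corr_real_L2_bound[OF a \<phi>]) simp
  also have "\<dots> = ennreal (2 + 2 * ?c) * L2_sq ?M \<phi>"
  proof -
    have "ennreal (2 + 2 * ?c) = 2 + 2 * ennreal ?c"
      by (simp add: ennreal_mult')
    then show ?thesis by (simp add: distrib_right mult.assoc)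
  qed
  finally show *: "L2_sq ?M (corr_op t \<alpha> \<phi>) \<le> ennreal (2 + 2 * ?c) * L2_sq ?M \<phi>" .
  have "ennreal (2 + 2 * ?c) * L2_sq ?M \<phi> < \<infinity>"
    using \<phi> by (simp add: L2_fun_iff ennreal_mult_less_top)
  then have "L2_sq ?M (corr_op t \<alpha> \<phi>) < \<infinity>" using * by (rule le_less_trans[rotated])
  moreover have "corr_op t \<alpha> \<phi> \<in> borel_measurable ?M" unfolding corr_op_def[abs_def] by measurable
  ultimately show "corr_op t \<alpha> \<phi> \<in> L2_fun t" by (simp add: L2_fun_iff)
qed

text \<open>The kernel of the fractional integral of order \<open>\<alpha>\<close>.\<close>

definition abel :: "real \<Rightarrow> real \<Rightarrow> real \<Rightarrow> real" where
  "abel \<alpha> y z = (if y < z then (z - y) powr (\<alpha> - 1) / Gamma \<alpha> else 0)"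

lemma abel_nonneg: "0 < \<alpha> \<Longrightarrow> 0 \<le> abel \<alpha> y z"
  by (simp add: abel_def Gamma_real_pos less_imp_le)

lemma borel_measurable_abel:
  assumes [measurable]: "f \<in> borel_measurable M" "g \<in> borel_measurable M"
  shows "(\<lambda>w. abel \<alpha> (f w) (g w)) \<in> borel_measurable M"
  unfolding abel_def by measurable

lemma borel_measurable_abel_right [measurable]: "abel \<alpha> y \<in> borel_measurable (lebesgue_on S)"
  by (intro measurable_lebesgue_on_borel borel_measurable_abel[of "\<lambda>_. y" _ "\<lambda>z. z"]) auto

lemma borel_measurable_abel_left [measurable]: "(\<lambda>y. abel \<alpha> y z) \<in> borel_measurable (lebesgue_on S)"
  by (intro measurable_lebesgue_on_borel borel_measurable_abel) auto

lemma borel_measurable_abel_pair [measurable]: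
  "(\<lambda>p. abel \<alpha> (fst p) (snd p)) \<in> borel_measurable (lebesgue_on S \<Otimes>\<^sub>M lebesgue_on R)"
  by (intro borel_measurable_abel measurable_lebesgue_on_real[OF measurable_fst] measurable_lebesgue_on_real[OF measurable_snd])

lemma frac_int_eq_abel:
  fixes f :: "real \<Rightarrow> 'k::{banach, second_countable_topology}"
  assumes "0 < \<alpha>" and y: "y \<in> {0..t}"
  shows "frac_int t \<alpha> f y = (LINT z|Leb t. abel \<alpha> y z *\<^sub>R f z)"
proof -
  have "frac_int t \<alpha> f y = (1 / Gamma \<alpha>) *\<^sub>R (LINT z|lebesgue. indicator {y..t} z *\<^sub>R (z - y) powr (\<alpha> - 1) *\<^sub>R f z)"
    using assms by (simp add: frac_int_def set_lebesgue_integral_def)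
  also have "\<dots> = (LINT z|lebesgue. (1 / Gamma \<alpha>) *\<^sub>R indicator {y..t} z *\<^sub>R (z - y) powr (\<alpha> - 1) *\<^sub>R f z)"
    by (simp only: integral_scaleR_right)
  also have "\<dots> = (LINT z|lebesgue. indicator {0..t} z *\<^sub>R abel \<alpha> y z *\<^sub>R f z)"
    using y by (intro Bochner_Integration.integral_cong) (auto simp: abel_def indicator_def)
  also have "\<dots> = (LINT z|Leb t. abel \<alpha> y z *\<^sub>R f z)"
    by (subst integral_restrict_space) auto
  finally show ?thesis .
qed

lemma abel_left_integral_le:
  assumes a: "0 < \<alpha>" and z: "z \<in> {0..t}"
  shows "(\<integral>\<^sup>+y. ennreal (abel \<alpha> y z) \<partial>Leb t) \<le> ennreal (t powr \<alpha> / \<alpha> / Gamma \<alpha>)"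
proof -
  define c where "c = 1 / (\<alpha> * Gamma \<alpha>)"
  have G: "Gamma \<alpha> > 0" using a by (rule Gamma_real_pos)
  then have G0: "Gamma \<alpha> \<noteq> 0" by (rule less_imp_neq[symmetric])
  have c: "c \<ge> 0" "c * \<alpha> = 1 / Gamma \<alpha>" using a G0 G by (auto simp: c_def)
  have "(\<integral>\<^sup>+y. ennreal (abel \<alpha> y z) \<partial>Leb t) = (\<integral>\<^sup>+y. ennreal (c * \<alpha> * (z - y) powr (\<alpha> - 1)) * indicator {0..z} y \<partial>lebesgue)"
    using z by (subst nn_integral_lebesgue_on) (auto intro!: nn_integral_cong simp: indicator_def abel_def c(2))
  also have "\<dots> = ennreal (- (c * (z - z) powr \<alpha>) - (- (c * (z - 0) powr \<alpha>)))"
  proof (rule nn_integral_FTC)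
    show "continuous_on {0..z} (\<lambda>y. - (c * (z - y) powr \<alpha>))"
      using a z by (intro continuous_intros continuous_on_powr') auto
    show "((\<lambda>y. - (c * (z - y) powr \<alpha>)) has_real_derivative c * \<alpha> * (z - y) powr (\<alpha> - 1)) (at y)"
      if "y \<in> {0<..<z}" for y
      using that by (auto intro!: derivative_eq_intros)
  qed (use z c(1) a in auto)
  also have "\<dots> \<le> ennreal (t powr \<alpha> / \<alpha> / Gamma \<alpha>)"
  proof (rule ennreal_leI)
    have "c * z powr \<alpha> \<le> c * t powr \<alpha>" using a z c(1) by (intro mult_left_mono powr_mono2) auto
    then show "- (c * (z - z) powr \<alpha>) - (- (c * (z - 0) powr \<alpha>)) \<le> t powr \<alpha> / \<alpha> / Gamma \<alpha>"
      by (simp add: c_def)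
  qed
  finally show ?thesis .
qed

lemma nn_integral_mult_norm_finite:
  assumes \<phi>: "\<phi> \<in> L2_fun t" and A: "\<And>z. z \<in> {0..t} \<Longrightarrow> A z \<le> ennreal K"
  shows "(\<integral>\<^sup>+z. A z * ennreal (norm (\<phi> z)) \<partial>Leb t) < \<infinity>"
proof -
  have [measurable]: "\<phi> \<in> borel_measurable (Leb t)" using \<phi> by (simp add: L2_fun_iff)
  have "(\<integral>\<^sup>+z. A z * ennreal (norm (\<phi> z)) \<partial>Leb t) \<le> (\<integral>\<^sup>+z. ennreal K * ennreal (norm (\<phi> z)) \<partial>Leb t)"
    by (intro nn_integral_mono mult_right_mono A) auto
  also have "\<dots> = ennreal K * (\<integral>\<^sup>+z. ennreal (norm (\<phi> z)) \<partial>Leb t)"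
    by (rule nn_integral_cmult) measurable
  also have "\<dots> < \<infinity>"
    using L2_fun_integrable[OF \<phi>] by (simp add: integrable_iff_bounded ennreal_mult_less_top)
  finally show ?thesis .
qed

lemma abel_integrable_AE:
  assumes a: "0 < \<alpha>" and \<phi>: "\<phi> \<in> L2_fun t"
  shows "AE y in Leb t. integrable (Leb t) (\<lambda>z. abel \<alpha> y z *\<^sub>R \<phi> z)"
proof (rule Fubini_kernel(3))
  show "\<phi> \<in> borel_measurable (Leb t)" using \<phi> by (simp add: L2_fun_iff)
  show "(\<integral>\<^sup>+z. (\<integral>\<^sup>+y. ennreal (abel \<alpha> y z) \<partial>Leb t) * ennreal (norm (\<phi> z)) \<partial>Leb t) < \<infinity>"
    by (rule nn_integral_mult_norm_finite[OF \<phi> abel_left_integral_le[OF a]])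
qed (use abel_nonneg[OF a] in \<open>auto\<close>)

lemma borel_measurable_frac_int:
  fixes \<phi> :: "real \<Rightarrow> 'k::{banach, second_countable_topology}"
  assumes a: "0 < \<alpha>" and [measurable]: "\<phi> \<in> borel_measurable (Leb t)"
  shows "frac_int t \<alpha> \<phi> \<in> borel_measurable (Leb t)"
proof -
  interpret sigma_finite_measure "Leb t" by (rule sigma_finite_lebesgue_on_Icc)
  have "(\<lambda>y. LINT z|Leb t. abel \<alpha> y z *\<^sub>R \<phi> z) \<in> borel_measurable (Leb t)"
    by (intro borel_measurable_lebesgue_integral) (unfold case_prod_unfold, measurable)
  then show ?thesis
    by (rule measurable_cong[THEN iffD1, rotated]) (simp add: frac_int_eq_abel[OF a])
qed

lemma corr_kernel_le_const:
  assumes a: "0 < \<alpha>" "\<alpha> < 1/2" and x: "0 < x" "x \<le> y" "y \<le> z"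
  shows "corr_kernel \<alpha> y z \<le> ennreal (corr_const \<alpha> * (x powr (- \<alpha> - corr_exp \<alpha>) * x powr (corr_exp \<alpha> - 1)))"
proof -
  have "corr_kernel \<alpha> y z \<le> ennreal (corr_const \<alpha> * (y powr (- \<alpha> - corr_exp \<alpha>) * z powr (corr_exp \<alpha> - 1)))"
    using x by (intro corr_kernel_le_exp[OF a]) auto
  also have "\<dots> \<le> ennreal (corr_const \<alpha> * (x powr (- \<alpha> - corr_exp \<alpha>) * x powr (corr_exp \<alpha> - 1)))"
    using x a corr_const_pos[OF a]
    by (intro ennreal_leI mult_left_mono mult_mono powr_mono2') (auto simp: corr_exp_def)
  finally show ?thesis .
qed

lemma abel_abel_integral:
  assumes a: "0 < \<alpha>" "\<alpha> < 1/2" and x: "0 < x" "x < z" "z \<le> t"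
  shows "(\<integral>\<^sup>+y. ennreal (abel (1 - \<alpha>) x y * y powr (- \<alpha>) * abel \<alpha> y z) \<partial>Leb t) =
    ennreal (z powr (- \<alpha>)) + (\<integral>\<^sup>+y. corr_kernel \<alpha> y z * indicator {x..z} y \<partial>lborel)"
proof -
  let ?B = "Beta (1 - \<alpha>) \<alpha>"
  let ?f = "\<lambda>y. (y - x) powr (- \<alpha>) * y powr (- \<alpha>) * (z - y) powr (\<alpha> - 1)"
  have B: "?B > 0" using Beta_real_pos[of "1 - \<alpha>" \<alpha>] a by simp
  have B': "?B = Gamma (1 - \<alpha>) * Gamma \<alpha>" by (simp add: Beta_def)
  have "(\<integral>\<^sup>+y. ennreal (abel (1 - \<alpha>) x y * y powr (- \<alpha>) * abel \<alpha> y z) \<partial>Leb t) =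
     (\<integral>\<^sup>+y. ennreal (abel (1 - \<alpha>) x y * y powr (- \<alpha>) * abel \<alpha> y z) * indicator {0..t} y \<partial>lebesgue)"
    by (rule nn_integral_lebesgue_on) simp
  also have "\<dots> = (\<integral>\<^sup>+y. ennreal (1 / ?B) * (ennreal (?f y) * indicator {x..z} y) \<partial>lebesgue)"
  proof (rule nn_integral_cong)
    fix y
    have "ennreal (1 / ?B) * ennreal (?f y) = ennreal (1 / ?B * ?f y)"
      using B by (intro ennreal_mult'[symmetric]) simp
    moreover have "abel (1 - \<alpha>) x y * y powr (- \<alpha>) * abel \<alpha> y z = (if y \<in> {x..z} then 1 / ?B * ?f y else 0)"
      by (auto simp: abel_def B')
    ultimately show "ennreal (abel (1 - \<alpha>) x y * y powr (- \<alpha>) * abel \<alpha> y z) * indicator {0..t} y =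
        ennreal (1 / ?B) * (ennreal (?f y) * indicator {x..z} y)"
      using x by (auto simp: indicator_def)
  qed
  also have "\<dots> = ennreal (1 / ?B) * (\<integral>\<^sup>+y. ennreal (?f y) * indicator {x..z} y \<partial>lborel)"
    unfolding nn_integral_completion by (rule nn_integral_cmult) measurable
  also have "(\<integral>\<^sup>+y. ennreal (?f y) * indicator {x..z} y \<partial>lborel) =
      ennreal ?B * (ennreal (z powr (- \<alpha>)) + (\<integral>\<^sup>+y. corr_kernel \<alpha> y z * indicator {x..z} y \<partial>lborel))"
    by (rule corr_kernel_integral[OF a x(1,2)])
  also have "ennreal (1 / ?B) * (ennreal ?B * (ennreal (z powr (- \<alpha>)) + (\<integral>\<^sup>+y. corr_kernel \<alpha> y z * indicator {x..z} y \<partial>lborel))) =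
      ennreal (z powr (- \<alpha>)) + (\<integral>\<^sup>+y. corr_kernel \<alpha> y z * indicator {x..z} y \<partial>lborel)"
    using B by (simp add: mult.assoc[symmetric] flip: ennreal_mult)
  finally show ?thesis .
qed

text \<open>By Fubini's theorem the left-hand side integrates \<open>\<phi> z\<close> against the composed kernel, which
\<open>abel_abel_integral\<close> evaluates as \<open>z powr (-\<alpha>)\<close> plus an integral over \<open>[x,z]\<close>. Fubini's theorem once
more turns that into an integral over \<open>[x,t]\<close> of a function free of \<open>x\<close>, which can be
differentiated.\<close>

lemma frac_int_weighted_eq_tail_integral:
  assumes a: "0 < \<alpha>" "\<alpha> < 1/2" and \<phi>: "\<phi> \<in> L2_fun t" and x: "0 < x" "x \<le> t"
    and f: "AE y in Leb t. f y = frac_int t \<alpha> \<phi> y"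
  shows "frac_int t (1 - \<alpha>) (\<lambda>r. r powr (- \<alpha>) *\<^sub>R f r) x =
    (LINT y|Leb t. indicator {x..} y *\<^sub>R y powr (- \<alpha>) *\<^sub>R corr_op t \<alpha> \<phi> y)"
proof -
  let ?M = "Leb t"
  interpret finite_measure ?M by (rule finite_measure_Icc)
  have \<phi>M [measurable]: "\<phi> \<in> borel_measurable ?M" using \<phi> by (simp add: L2_fun_iff)
  have fiM: "frac_int t \<alpha> \<phi> \<in> borel_measurable ?M" by (rule borel_measurable_frac_int[OF a(1) \<phi>M])
  have fM [measurable]: "f \<in> borel_measurable ?M"
    by (rule borel_measurable_lebesgue_on_AE[OF fiM]) (use f in \<open>auto elim: eventually_mono\<close>)
  have pM [measurable]: "(\<lambda>y. y powr (- \<alpha>)) \<in> borel_measurable ?M"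
    by (rule measurable_lebesgue_on_borel) measurable
  have iM [measurable]: "(\<lambda>y. indicat_real {x..} y) \<in> borel_measurable ?M"
    by (rule measurable_lebesgue_on_borel) measurable
  let ?c = "corr_const \<alpha> * (x powr (- \<alpha> - corr_exp \<alpha>) * x powr (corr_exp \<alpha> - 1))"
  have c: "?c \<ge> 0" using corr_const_pos[OF a] by simp
  let ?N = "\<lambda>z. \<integral>\<^sup>+y. corr_kernel \<alpha> y z * indicator {x..z} y \<partial>lborel"
  have N: "?N z \<le> ennreal (?c * t)" if z: "x \<le> z" "z \<le> t" for z
  proof -
    have "?N z \<le> (\<integral>\<^sup>+y. ennreal ?c * indicator {x..z} y \<partial>lborel)"
      using corr_kernel_le_const[OF a x(1)] by (intro nn_integral_mono) (auto simp: indicator_def)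
    also have "\<dots> = ennreal ?c * ennreal (z - x)" using z by (simp add: nn_integral_cmult_indicator)
    also have "\<dots> \<le> ennreal ?c * ennreal t" using x z by (intro mult_left_mono ennreal_leI) auto
    also have "\<dots> = ennreal (?c * t)" using c x z by (simp add: ennreal_mult)
    finally show ?thesis .
  qed
  define K1 where "K1 y z = abel (1 - \<alpha>) x y * y powr (- \<alpha>) * abel \<alpha> y z" for y z
  define K2 where "K2 y z = indicat_real {x..} y * y powr (- \<alpha>) * corr_real \<alpha> y z" for y z
  have K1nn: "0 \<le> K1 y z" for y z using abel_nonneg[of \<alpha>] abel_nonneg[of "1 - \<alpha>"] a by (simp add: K1_def)
  have K2nn: "0 \<le> K2 y z" for y z by (simp add: K2_def)
  have K1p: "(\<lambda>p. K1 (fst p) (snd p)) \<in> borel_measurable (?M \<Otimes>\<^sub>M ?M)"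
    unfolding K1_def
    by (intro borel_measurable_times measurable_compose[OF measurable_fst pM] borel_measurable_abel_pair
        measurable_compose[OF measurable_fst borel_measurable_abel_right])
  have K2p: "(\<lambda>p. K2 (fst p) (snd p)) \<in> borel_measurable (?M \<Otimes>\<^sub>M ?M)"
    unfolding K2_def
    by (intro borel_measurable_times measurable_compose[OF measurable_fst pM] borel_measurable_corr_real_pair
        measurable_compose[OF measurable_fst iM])
  have K1m: "(\<lambda>y. K1 y z) \<in> borel_measurable ?M" for z unfolding K1_def by measurable
  have K2m: "(\<lambda>y. K2 y z) \<in> borel_measurable ?M" for z unfolding K2_def by measurable
  have K1int: "(\<integral>\<^sup>+y. ennreal (K1 y z) \<partial>?M) = (if x < z then ennreal (z powr (- \<alpha>)) + ?N z else 0)" if "z \<in> {0..t}" for z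
  proof (cases "x < z")
    case True
    then show ?thesis unfolding K1_def using abel_abel_integral[OF a x(1)] that by auto
  next
    case False
    then have "K1 y z = 0" for y by (auto simp: K1_def abel_def)
    then show ?thesis using False by simp
  qed
  have K2int: "(\<integral>\<^sup>+y. ennreal (K2 y z) \<partial>?M) = (if x < z then ?N z else 0)" if z: "z \<in> {0..t}" for z
  proof (cases "x < z")
    case True
    have "(\<integral>\<^sup>+y. ennreal (K2 y z) \<partial>?M) = (\<integral>\<^sup>+y. corr_kernel \<alpha> y z * indicator {x..z} y \<partial>?M)"
    proof (rule nn_integral_cong_AE)
      show "AE y in ?M. ennreal (K2 y z) = corr_kernel \<alpha> y z * indicator {x..z} y"
        using AE_Icc_neq[where c=z and a=0 and b=t]
      proof eventually_elim
        case (elim y)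
        show ?case
        proof (cases "x \<le> y \<and> y < z")
          case True
          then have "corr_kernel \<alpha> y z < \<infinity>"
            using corr_kernel_le_const[OF a x(1), of y z] by (auto intro: le_less_trans)
          moreover have "K2 y z = enn2real (corr_kernel \<alpha> y z)"
            using True x by (simp add: K2_def corr_real_def mult.assoc[symmetric] flip: powr_add)
          ultimately show ?thesis using True by (simp add: less_top)
        next
          case False
          then show ?thesis using elim by (auto simp: K2_def corr_real_def indicator_def)
        qed
      qed
    qed
    also have "\<dots> = (\<integral>\<^sup>+y. corr_kernel \<alpha> y z * indicator {x..z} y \<partial>lebesgue)"
      using z x by (subst nn_integral_lebesgue_on) (auto intro!: nn_integral_cong simp: indicator_def)
    also have "\<dots> = ?N z" by (rule nn_integral_completion)
    finally show ?thesis using True by simp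
  next
    case False
    then have "K2 y z = 0" for y by (auto simp: K2_def corr_real_def indicator_def)
    then show ?thesis using False by simp
  qed
  have le1: "(\<integral>\<^sup>+y. ennreal (K1 y z) \<partial>?M) \<le> ennreal (x powr (- \<alpha>) + ?c * t)" if z: "z \<in> {0..t}" for z
  proof (cases "x < z")
    case True
    have "ennreal (z powr (- \<alpha>)) + ?N z \<le> ennreal (x powr (- \<alpha>)) + ennreal (?c * t)"
      using True z x a by (intro add_mono N ennreal_leI powr_mono2') auto
    also have "\<dots> = ennreal (x powr (- \<alpha>) + ?c * t)" using c x by (subst ennreal_plus) auto
    finally show ?thesis using K1int[OF z] True by simp
  qed (simp add: K1int[OF z])
  have le2: "(\<integral>\<^sup>+y. ennreal (K2 y z) \<partial>?M) \<le> ennreal (?c * t)" if z: "z \<in> {0..t}" for z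
    using N[of z] z by (auto simp: K2int)
  note F1 = Fubini_kernel[OF K1p \<phi>M K1nn nn_integral_mult_norm_finite[OF \<phi> le1]]
  note F2 = Fubini_kernel[OF K2p \<phi>M K2nn nn_integral_mult_norm_finite[OF \<phi> le2]]
  have n1: "(LINT y|?M. K1 y z) = enn2real (\<integral>\<^sup>+y. ennreal (K1 y z) \<partial>?M)" for z
    using K1nn by (intro integral_eq_nn_integral K1m) auto
  have n2: "(LINT y|?M. K2 y z) = enn2real (\<integral>\<^sup>+y. ennreal (K2 y z) \<partial>?M)" for z
    using K2nn by (intro integral_eq_nn_integral K2m) auto
  have n2M: "(\<lambda>z. LINT y|?M. K2 y z) \<in> borel_measurable ?M"
  proof -
    have "(\<lambda>(z, y). K2 y z) \<in> borel_measurable (?M \<Otimes>\<^sub>M ?M)"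
      using measurable_compose[OF measurable_pair_swap' K2p] by (simp add: case_prod_unfold)
    then show ?thesis by (intro borel_measurable_lebesgue_integral) simp
  qed
  have n12: "(LINT y|?M. K1 y z) = indicat_real {x<..} z * z powr (- \<alpha>) + (LINT y|?M. K2 y z)" if z: "z \<in> {0..t}" for z
  proof (cases "x < z")
    case True
    have "?N z < \<infinity>" using N[of z] True z by (auto intro: le_less_trans)
    then show ?thesis unfolding n1 n2 K1int[OF z] K2int[OF z] using True
      by (simp add: enn2real_plus less_top)
  next
    case False
    then show ?thesis unfolding n1 n2 K1int[OF z] K2int[OF z] by simp
  qed
  have n2le: "(LINT y|?M. K2 y z) \<le> ?c * t" if z: "z \<in> {0..t}" for z
    unfolding n2 using le2[OF z] c x by (intro enn2real_leI) auto
  have n2nn: "0 \<le> (LINT y|?M. K2 y z)" for z unfolding n2 by simp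
  have int2: "integrable ?M (\<lambda>z. (LINT y|?M. K2 y z) *\<^sub>R \<phi> z)"
  proof (rule Bochner_Integration.integrable_bound)
    show "integrable ?M (\<lambda>z. (?c * t) *\<^sub>R \<phi> z)" using L2_fun_integrable[OF \<phi>] by simp
    show "AE z in ?M. norm ((LINT y|?M. K2 y z) *\<^sub>R \<phi> z) \<le> norm ((?c * t) *\<^sub>R \<phi> z)"
      using n2le n2nn c x by (intro AE_I2) (simp add: mult_right_mono)
  qed (intro borel_measurable_scaleR n2M \<phi>M)
  have pw: "indicat_real A z * z powr (- \<alpha>) \<le> x powr (- \<alpha>)" if "A \<subseteq> {x..}" for A z
    using that x a by (auto simp: indicator_def intro!: powr_mono2')
  have int1: "integrable ?M (\<lambda>z. (indicat_real A z * z powr (- \<alpha>)) *\<^sub>R \<phi> z)" if "A \<subseteq> {x..}" "A \<in> sets borel" for A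
  proof (rule Bochner_Integration.integrable_bound)
    show "integrable ?M (\<lambda>z. x powr (- \<alpha>) *\<^sub>R \<phi> z)" using L2_fun_integrable[OF \<phi>] by simp
    show "AE z in ?M. norm ((indicat_real A z * z powr (- \<alpha>)) *\<^sub>R \<phi> z) \<le> norm (x powr (- \<alpha>) *\<^sub>R \<phi> z)"
      using pw[OF that(1)] by (intro AE_I2) (simp add: mult_right_mono)
    have "indicat_real A \<in> borel_measurable ?M" using that(2) by (intro measurable_lebesgue_on_borel) simp
    then show "(\<lambda>z. (indicat_real A z * z powr (- \<alpha>)) *\<^sub>R \<phi> z) \<in> borel_measurable ?M" by measurable
  qed
  have "frac_int t (1 - \<alpha>) (\<lambda>r. r powr (- \<alpha>) *\<^sub>R f r) x = (LINT y|?M. abel (1 - \<alpha>) x y *\<^sub>R y powr (- \<alpha>) *\<^sub>R f y)"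
    using a x by (intro frac_int_eq_abel) auto
  also have "\<dots> = (LINT y|?M. LINT z|?M. K1 y z *\<^sub>R \<phi> z)"
  proof (rule integral_cong_AE)
    show "(\<lambda>y. abel (1 - \<alpha>) x y *\<^sub>R y powr (- \<alpha>) *\<^sub>R f y) \<in> borel_measurable ?M" by measurable
    show "(\<lambda>y. LINT z|?M. K1 y z *\<^sub>R \<phi> z) \<in> borel_measurable ?M"
      using F1(2) by (rule borel_measurable_integrable)
    show "AE y in ?M. abel (1 - \<alpha>) x y *\<^sub>R y powr (- \<alpha>) *\<^sub>R f y = (LINT z|?M. K1 y z *\<^sub>R \<phi> z)"
      using f AE_space
    proof eventually_elim
      case (elim y)
      have "(LINT z|?M. K1 y z *\<^sub>R \<phi> z) = (LINT z|?M. (abel (1 - \<alpha>) x y * y powr (- \<alpha>)) *\<^sub>R (abel \<alpha> y z *\<^sub>R \<phi> z))"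
        by (simp add: K1_def)
      also have "\<dots> = (abel (1 - \<alpha>) x y * y powr (- \<alpha>)) *\<^sub>R (LINT z|?M. abel \<alpha> y z *\<^sub>R \<phi> z)"
        by (rule integral_scaleR_right)
      also have "\<dots> = abel (1 - \<alpha>) x y *\<^sub>R y powr (- \<alpha>) *\<^sub>R f y"
        using elim a by (simp add: frac_int_eq_abel)
      finally show ?case by simp
    qed
  qed
  also have "\<dots> = (LINT z|?M. (LINT y|?M. K1 y z) *\<^sub>R \<phi> z)" by (rule F1(1))
  also have "\<dots> = (LINT z|?M. (indicat_real {x<..} z * z powr (- \<alpha>)) *\<^sub>R \<phi> z + (LINT y|?M. K2 y z) *\<^sub>R \<phi> z)"
    by (intro Bochner_Integration.integral_cong) (auto simp: n12 scaleR_add_left)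
  also have "\<dots> = (LINT z|?M. (indicat_real {x<..} z * z powr (- \<alpha>)) *\<^sub>R \<phi> z) + (LINT z|?M. (LINT y|?M. K2 y z) *\<^sub>R \<phi> z)"
    by (intro Bochner_Integration.integral_add int2 int1) auto
  also have "(LINT z|?M. (LINT y|?M. K2 y z) *\<^sub>R \<phi> z) = (LINT y|?M. LINT z|?M. K2 y z *\<^sub>R \<phi> z)"
    by (rule F2(1)[symmetric])
  also have "(LINT z|?M. (indicat_real {x<..} z * z powr (- \<alpha>)) *\<^sub>R \<phi> z) = (LINT z|?M. (indicat_real {x..} z * z powr (- \<alpha>)) *\<^sub>R \<phi> z)"
  proof (rule integral_cong_AE)
    show "(\<lambda>z. (indicat_real {x<..} z * z powr (- \<alpha>)) *\<^sub>R \<phi> z) \<in> borel_measurable ?M"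
      by (rule borel_measurable_integrable[OF int1]) auto
    show "(\<lambda>z. (indicat_real {x..} z * z powr (- \<alpha>)) *\<^sub>R \<phi> z) \<in> borel_measurable ?M"
      by (rule borel_measurable_integrable[OF int1]) auto
    show "AE z in ?M. (indicat_real {x<..} z * z powr (- \<alpha>)) *\<^sub>R \<phi> z = (indicat_real {x..} z * z powr (- \<alpha>)) *\<^sub>R \<phi> z"
      using AE_Icc_neq[where c=x and a=0 and b=t] by eventually_elim (auto simp: indicator_def)
  qed
  also have "(LINT z|?M. (indicat_real {x..} z * z powr (- \<alpha>)) *\<^sub>R \<phi> z) + (LINT y|?M. LINT z|?M. K2 y z *\<^sub>R \<phi> z) =
      (LINT y|?M. (indicat_real {x..} y * y powr (- \<alpha>)) *\<^sub>R \<phi> y + (LINT z|?M. K2 y z *\<^sub>R \<phi> z))"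
    by (intro Bochner_Integration.integral_add[symmetric] int1 F2(2)) auto
  also have "\<dots> = (LINT y|?M. indicator {x..} y *\<^sub>R y powr (- \<alpha>) *\<^sub>R corr_op t \<alpha> \<phi> y)"
  proof (rule Bochner_Integration.integral_cong)
    fix y
    have "(LINT z|?M. K2 y z *\<^sub>R \<phi> z) = (LINT z|?M. (indicat_real {x..} y * y powr (- \<alpha>)) *\<^sub>R (corr_real \<alpha> y z *\<^sub>R \<phi> z))"
      by (simp add: K2_def)
    also have "\<dots> = (indicat_real {x..} y * y powr (- \<alpha>)) *\<^sub>R (LINT z|?M. corr_real \<alpha> y z *\<^sub>R \<phi> z)"
      by (rule integral_scaleR_right)
    finally show "(indicat_real {x..} y * y powr (- \<alpha>)) *\<^sub>R \<phi> y + (LINT z|?M. K2 y z *\<^sub>R \<phi> z) =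
        indicator {x..} y *\<^sub>R y powr (- \<alpha>) *\<^sub>R corr_op t \<alpha> \<phi> y"
      by (simp add: corr_op_def scaleR_add_right)
  qed simp
  finally show ?thesis .
qed

lemma L2_fun_cutoff_powr:
  assumes a: "0 < \<alpha>" and d: "\<delta> > 0" and g: "g \<in> L2_fun t"
  shows "(\<lambda>y. indicator {\<delta>..} y *\<^sub>R y powr (- \<alpha>) *\<^sub>R g y) \<in> L2_fun t"
proof -
  let ?c = "\<lambda>y. indicat_real {\<delta>..} y *\<^sub>R y powr (- \<alpha>) *\<^sub>R g y"
  let ?M = "Leb t"
  have [measurable]: "g \<in> borel_measurable ?M" and fin: "L2_sq ?M g < \<infinity>" using g by (auto simp: L2_fun_iff)
  have m: "(\<lambda>y. indicat_real {\<delta>..} y) \<in> borel_measurable ?M" "(\<lambda>y. y powr (- \<alpha>)) \<in> borel_measurable ?M"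
    by (rule measurable_lebesgue_on_borel, measurable)+
  have "L2_sq ?M (\<lambda>y. indicator {\<delta>..} y *\<^sub>R y powr (- \<alpha>) *\<^sub>R g y) \<le>
      (\<integral>\<^sup>+y. ennreal ((\<delta> powr (- \<alpha>))\<^sup>2) * ennreal ((norm (g y))\<^sup>2) \<partial>?M)"
    unfolding L2_sq_def
  proof (rule nn_integral_mono)
    fix y
    have "norm (?c y) \<le> \<delta> powr (- \<alpha>) * norm (g y)"
      using a d by (auto simp: indicator_def intro!: mult_right_mono powr_mono2')
    then have "(norm (?c y))\<^sup>2 \<le> (\<delta> powr (- \<alpha>) * norm (g y))\<^sup>2"
      by (rule power_mono) simp
    then have "ennreal ((norm (?c y))\<^sup>2) \<le> ennreal ((\<delta> powr (- \<alpha>))\<^sup>2 * (norm (g y))\<^sup>2)"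
      by (intro ennreal_leI) (simp only: power_mult_distrib)
    also have "\<dots> = ennreal ((\<delta> powr (- \<alpha>))\<^sup>2) * ennreal ((norm (g y))\<^sup>2)"
      by (rule ennreal_mult) auto
    finally show "ennreal ((norm (?c y))\<^sup>2) \<le>
        ennreal ((\<delta> powr (- \<alpha>))\<^sup>2) * ennreal ((norm (g y))\<^sup>2)" .
  qed
  also have "\<dots> = ennreal ((\<delta> powr (- \<alpha>))\<^sup>2) * L2_sq ?M g"
    unfolding L2_sq_def by (rule nn_integral_cmult) measurable
  also have "\<dots> < \<infinity>" using fin by (simp add: ennreal_mult_less_top)
  finally show ?thesis unfolding L2_fun_iff
    by (intro conjI borel_measurable_scaleR m) auto
qed

lemma L2_fun_linear:
  fixes f :: "real \<Rightarrow> 'k::{banach, second_countable_topology}"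
    and L :: "'k \<Rightarrow> 'l::{banach, second_countable_topology}"
  assumes f: "f \<in> L2_fun t" and L: "bounded_linear L"
  shows "(\<lambda>x. L (f x)) \<in> L2_fun t"
proof -
  have [measurable]: "L \<in> borel_measurable borel"
    by (intro borel_measurable_continuous_onI linear_continuous_on L)
  have [measurable]: "f \<in> borel_measurable (Leb t)" and fin: "L2_sq (Leb t) f < \<infinity>"
    using f by (auto simp: L2_fun_iff)
  obtain B where B: "B > 0" "\<And>y. norm (L y) \<le> B * norm y"
    using bounded_linear.pos_bounded[OF L] by (auto simp: mult.commute)
  have "L2_sq (Leb t) (\<lambda>x. L (f x)) \<le> ennreal (B\<^sup>2) * L2_sq (Leb t) f"
    by (rule L2_sq_map_le[OF _ B(2)]) measurable
  also have "\<dots> < \<infinity>" using fin by (simp add: ennreal_mult_less_top)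
  finally show ?thesis by (simp add: L2_fun_iff)
qed

lemma L2_fun_add:
  assumes "f \<in> L2_fun t" "g \<in> L2_fun t"
  shows "(\<lambda>x. f x + g x) \<in> L2_fun t"
proof -
  have [measurable]: "f \<in> borel_measurable (Leb t)" "g \<in> borel_measurable (Leb t)"
    using assms by (auto simp: L2_fun_iff)
  have "L2_sq (Leb t) (\<lambda>x. f x + g x) \<le> 2 * L2_sq (Leb t) f + 2 * L2_sq (Leb t) g"
    by (rule L2_sq_add_le) measurable
  also have "\<dots> < \<infinity>" using assms by (simp add: L2_fun_iff ennreal_mult_less_top)
  finally show ?thesis by (simp add: L2_fun_iff)
qed

lemma L2_fun_diff:
  assumes "f \<in> L2_fun t" "g \<in> L2_fun t"
  shows "(\<lambda>x. f x - g x) \<in> L2_fun t"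
  using L2_fun_add[OF assms(1) L2_fun_linear[OF assms(2) bounded_linear_minus[OF bounded_linear_ident]]] by simp

lemma corr_op_linear:
  fixes \<phi> :: "real \<Rightarrow> 'k::{banach, second_countable_topology}"
    and L :: "'k \<Rightarrow> 'l::{banach, second_countable_topology}"
  assumes a: "0 < \<alpha>" "\<alpha> < 1/2" and \<phi>: "\<phi> \<in> L2_fun t" and L: "bounded_linear L"
  shows "corr_op t \<alpha> (\<lambda>z. L (\<phi> z)) x = L (corr_op t \<alpha> \<phi> x)"
  using integral_bounded_linear[OF L corr_real_integrable[OF a \<phi>, of x]]
  by (simp add: corr_op_def linear_add[OF bounded_linear.linear[OF L]] linear_cmul[OF bounded_linear.linear[OF L]])

lemma corr_op_add:
  assumes a: "0 < \<alpha>" "\<alpha> < 1/2" and \<phi>: "\<phi> \<in> L2_fun t" "\<xi> \<in> L2_fun t"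
  shows "corr_op t \<alpha> (\<lambda>z. \<phi> z + \<xi> z) x = corr_op t \<alpha> \<phi> x + corr_op t \<alpha> \<xi> x"
  using Bochner_Integration.integral_add[OF corr_real_integrable[OF a \<phi>(1), of x] corr_real_integrable[OF a \<phi>(2), of x]]
  by (simp add: corr_op_def scaleR_add_right)

lemma corr_op_diff:
  assumes a: "0 < \<alpha>" "\<alpha> < 1/2" and \<phi>: "\<phi> \<in> L2_fun t" "\<xi> \<in> L2_fun t"
  shows "corr_op t \<alpha> (\<lambda>z. \<phi> z - \<xi> z) x = corr_op t \<alpha> \<phi> x - corr_op t \<alpha> \<xi> x"
  using Bochner_Integration.integral_diff[OF corr_real_integrable[OF a \<phi>(1), of x] corr_real_integrable[OF a \<phi>(2), of x]]
  by (simp add: corr_op_def scaleR_diff_right)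

lemma abel_comp:
  assumes a: "0 < \<alpha>" "\<alpha> < 1" and x: "0 \<le> x" "x < u" "u \<le> t"
  shows "(\<integral>\<^sup>+y. ennreal (abel \<alpha> x y * abel (1 - \<alpha>) y u) \<partial>Leb t) = 1"
proof -
  let ?B = "Beta \<alpha> (1 - \<alpha>)"
  let ?f = "\<lambda>y. (y - x) powr (\<alpha> - 1) * (u - y) powr (1 - \<alpha> - 1)"
  have B: "?B > 0" using a by (intro Beta_real_pos) auto
  have B': "?B = Gamma \<alpha> * Gamma (1 - \<alpha>)" by (simp add: Beta_def)
  have "(\<integral>\<^sup>+y. ennreal (abel \<alpha> x y * abel (1 - \<alpha>) y u) \<partial>Leb t) =
     (\<integral>\<^sup>+y. ennreal (abel \<alpha> x y * abel (1 - \<alpha>) y u) * indicator {0..t} y \<partial>lebesgue)"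
    by (rule nn_integral_lebesgue_on) simp
  also have "\<dots> = (\<integral>\<^sup>+y. ennreal (1 / ?B) * (ennreal (?f y) * indicator {x..u} y) \<partial>lborel)"
    unfolding nn_integral_completion
  proof (rule nn_integral_cong)
    fix y
    have "ennreal (1 / ?B) * ennreal (?f y) = ennreal (1 / ?B * ?f y)"
      using B by (intro ennreal_mult'[symmetric]) simp
    moreover have "abel \<alpha> x y * abel (1 - \<alpha>) y u = (if y \<in> {x..u} then 1 / ?B * ?f y else 0)"
      by (auto simp: abel_def B')
    ultimately show "ennreal (abel \<alpha> x y * abel (1 - \<alpha>) y u) * indicator {0..t} y =
        ennreal (1 / ?B) * (ennreal (?f y) * indicator {x..u} y)"
      using x by (auto simp: indicator_def)
  qed
  also have "\<dots> = ennreal (1 / ?B) * (\<integral>\<^sup>+y. ennreal (?f y) * indicator {x..u} y \<partial>lborel)"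
    by (rule nn_integral_cmult) measurable
  also have "(\<integral>\<^sup>+y. ennreal (?f y) * indicator {x..u} y \<partial>lborel) = ennreal (?B * (u - x) powr (\<alpha> + (1 - \<alpha>) - 1))"
    using nn_integral_Beta_two_factors[of \<alpha> "1 - \<alpha>" x u] a x unfolding nn_integral_completion by simp
  also have "(u - x) powr (\<alpha> + (1 - \<alpha>) - 1) = 1" using x by simp
  finally show ?thesis using B by (simp flip: ennreal_mult)
qed

text \<open>For \<open>A \<ge> B \<ge> 0\<close> one has \<open>(A - B)\<^sup>2 \<le> A\<^sup>2 - B\<^sup>2\<close>, and the squares can be integrated exactly.\<close>

lemma abel_difference_L2:
  assumes a: "0 < \<alpha>" "\<alpha> < 1/2" and uv: "0 \<le> u" "u \<le> v" "v \<le> t"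
  shows "L2_sq (Leb t) (\<lambda>x. abel (1 - \<alpha>) x u - abel (1 - \<alpha>) x v) \<le>
    ennreal (2 * (v - u) powr (1 - 2 * \<alpha>) / (1 - 2 * \<alpha>) / (Gamma (1 - \<alpha>))\<^sup>2)"
proof -
  let ?M = "Leb t"
  define e where "e = 1 - 2 * \<alpha>"
  have e: "e > 0" "- (2 * \<alpha>) = e - 1" using a by (auto simp: e_def)
  define g where "g = 1 / (Gamma (1 - \<alpha>))\<^sup>2"
  have G: "Gamma (1 - \<alpha>) > 0" using a by (intro Gamma_real_pos) auto
  have g: "g \<ge> 0" by (simp add: g_def)
  let ?f1 = "\<lambda>x. if x < u then (u - x) powr (e - 1) - (v - x) powr (e - 1) else 0"
  let ?f2 = "\<lambda>x. (v - x) powr (e - 1)"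
  let ?s = "\<lambda>x. ?f1 x * indicator {0..u} x + ?f2 x * indicator {u..v} x"
  have f1nn: "0 \<le> ?f1 x" for x
    using uv a by (auto simp: e_def intro!: powr_mono2')
  have sq: "(w powr (- \<alpha>))\<^sup>2 = w powr (e - 1)" for w :: real
    by (simp add: power2_eq_square e(2)[symmetric] flip: powr_add)
  have pt: "(abel (1 - \<alpha>) x u - abel (1 - \<alpha>) x v)\<^sup>2 \<le> g * (?s x)"
    if x: "0 \<le> x" for x
  proof -
    consider "x < u" | "u \<le> x" "x < v" | "v \<le> x" by linarith
    then show ?thesis
    proof cases
      case 1
      let ?A = "(u - x) powr (- \<alpha>)" and ?B = "(v - x) powr (- \<alpha>)"
      have BA: "?B \<le> ?A" using 1 uv a by (intro powr_mono2') auto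
      have "?B * ?B \<le> ?A * ?B" using BA by (intro mult_right_mono) auto
      then have "(?A - ?B)\<^sup>2 \<le> ?A\<^sup>2 - ?B\<^sup>2" by (simp add: power2_eq_square algebra_simps)
      then have "g * (?A - ?B)\<^sup>2 \<le> g * (?A\<^sup>2 - ?B\<^sup>2)" using g by (rule mult_left_mono)
      moreover have "(abel (1 - \<alpha>) x u - abel (1 - \<alpha>) x v)\<^sup>2 = g * (?A - ?B)\<^sup>2"
        using 1 uv by (simp add: abel_def g_def power_divide diff_divide_distrib[symmetric])
      ultimately show ?thesis using 1 x uv by (simp add: sq)
    next
      case 2
      have "(abel (1 - \<alpha>) x u - abel (1 - \<alpha>) x v)\<^sup>2 = g * ((v - x) powr (- \<alpha>))\<^sup>2"
        using 2 by (simp add: abel_def g_def power_divide)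
      moreover have "0 \<le> g * (?f1 x * indicator {0..u} x)" using g f1nn[of x] by simp
      ultimately show ?thesis using 2 x uv by (simp add: sq)
    next
      case 3
      have "0 \<le> g * (?s x)" using g f1nn[of x] by simp
      then show ?thesis using 3 uv by (simp add: abel_def)
    qed
  qed
  have "L2_sq ?M (\<lambda>x. abel (1 - \<alpha>) x u - abel (1 - \<alpha>) x v) \<le>
      (\<integral>\<^sup>+x. ennreal g * (ennreal (?f1 x) * indicator {0..u} x + ennreal (?f2 x) * indicator {u..v} x) \<partial>?M)"
    unfolding L2_sq_def
  proof (rule nn_integral_mono)
    fix x assume "x \<in> space ?M"
    then have "ennreal ((norm (abel (1 - \<alpha>) x u - abel (1 - \<alpha>) x v))\<^sup>2) \<le>
        ennreal (g * (?s x))"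
      using pt[of x] by (intro ennreal_leI) simp
    also have "\<dots> = ennreal g * ennreal (?s x)"
      by (rule ennreal_mult'[OF g])
    also have "ennreal (?s x) =
        ennreal (?f1 x * indicator {0..u} x) + ennreal (?f2 x * indicator {u..v} x)"
      using f1nn[of x] by (intro ennreal_plus mult_nonneg_nonneg) auto
    also have "ennreal (?f1 x * indicator {0..u} x) = ennreal (?f1 x) * indicator {0..u} x"
      by (simp add: indicator_def)
    also have "ennreal (?f2 x * indicator {u..v} x) = ennreal (?f2 x) * indicator {u..v} x"
      by (simp add: indicator_def)
    finally show "ennreal ((norm (abel (1 - \<alpha>) x u - abel (1 - \<alpha>) x v))\<^sup>2) \<le>
      ennreal g * (ennreal (?f1 x) * indicator {0..u} x + ennreal (?f2 x) * indicator {u..v} x)" .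
  qed
  also have "\<dots> = ennreal g * ((\<integral>\<^sup>+x. ennreal (?f1 x) * indicator {0..u} x \<partial>?M) + (\<integral>\<^sup>+x. ennreal (?f2 x) * indicator {u..v} x \<partial>?M))"
  proof -
    have m: "(\<lambda>x. ennreal (?f1 x) * indicator {0..u} x) \<in> borel_measurable ?M"
      "(\<lambda>x. ennreal (?f2 x) * indicator {u..v} x) \<in> borel_measurable ?M"
      by (rule measurable_lebesgue_on_borel, measurable)+
    show ?thesis by (simp only: nn_integral_cmult[OF borel_measurable_add[OF m]] nn_integral_add[OF m])
  qed
  also have "(\<integral>\<^sup>+x. ennreal (?f1 x) * indicator {0..u} x \<partial>?M) = (\<integral>\<^sup>+x. ennreal (?f1 x) * indicator {0..u} x \<partial>lebesgue)"
    using uv by (subst nn_integral_lebesgue_on) (auto intro!: nn_integral_cong simp: indicator_def)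
  also have "\<dots> = ennreal (((v - u) powr e / e - (u - u) powr e / e) - ((v - 0) powr e / e - (u - 0) powr e / e))"
  proof (rule nn_integral_FTC)
    show "continuous_on {0..u} (\<lambda>x. (v - x) powr e / e - (u - x) powr e / e)"
      using e uv by (intro continuous_intros continuous_on_powr') auto
    show "((\<lambda>x. (v - x) powr e / e - (u - x) powr e / e) has_real_derivative ?f1 x) (at x)" if "x \<in> {0<..<u}" for x
      using that e uv by (auto intro!: derivative_eq_intros)
  qed (use f1nn uv in auto)
  also have "(\<integral>\<^sup>+x. ennreal (?f2 x) * indicator {u..v} x \<partial>?M) = (\<integral>\<^sup>+x. ennreal (?f2 x) * indicator {u..v} x \<partial>lebesgue)"
    using uv by (subst nn_integral_lebesgue_on) (auto intro!: nn_integral_cong simp: indicator_def)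
  also have "\<dots> = ennreal (- ((v - v) powr e / e) - (- ((v - u) powr e / e)))"
  proof (rule nn_integral_FTC)
    show "continuous_on {u..v} (\<lambda>x. - ((v - x) powr e / e))"
      using e uv by (intro continuous_intros continuous_on_powr') auto
    show "((\<lambda>x. - ((v - x) powr e / e)) has_real_derivative ?f2 x) (at x)" if "x \<in> {u<..<v}" for x
      using that e uv by (auto intro!: derivative_eq_intros)
  qed (use uv in auto)
  also have "ennreal g * (ennreal (((v - u) powr e / e - (u - u) powr e / e) - ((v - 0) powr e / e - (u - 0) powr e / e)) +
      ennreal (- ((v - v) powr e / e) - (- ((v - u) powr e / e)))) \<le> ennreal g * (ennreal ((v - u) powr e / e) + ennreal ((v - u) powr e / e))"
  proof (intro mult_left_mono add_mono ennreal_leI)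
    have "u powr e / e \<le> v powr e / e" using uv e by (intro divide_right_mono powr_mono2) auto
    then show "((v - u) powr e / e - (u - u) powr e / e) - ((v - 0) powr e / e - (u - 0) powr e / e) \<le> (v - u) powr e / e"
      by simp
  qed auto
  also have "\<dots> = ennreal (g * (2 * ((v - u) powr e / e)))"
  proof -
    have "ennreal ((v - u) powr e / e) + ennreal ((v - u) powr e / e) = ennreal (2 * ((v - u) powr e / e))"
      using e by (simp flip: ennreal_plus)
    then show ?thesis by (simp only: ennreal_mult'[OF g])
  qed
  also have "g * (2 * ((v - u) powr e / e)) = 2 * (v - u) powr (1 - 2 * \<alpha>) / (1 - 2 * \<alpha>) / (Gamma (1 - \<alpha>))\<^sup>2"
    by (simp add: g_def e_def)
  finally show ?thesis .
qed

lemma abel_in_L2_fun: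
  assumes a: "0 < \<alpha>" "\<alpha> < 1/2" and u: "u \<in> {0..t}"
  shows "(\<lambda>x. abel (1 - \<alpha>) x u) \<in> L2_fun t"
proof -
  have "L2_sq (Leb t) (\<lambda>x. abel (1 - \<alpha>) x 0 - abel (1 - \<alpha>) x u) =
    L2_sq (Leb t) (\<lambda>x. abel (1 - \<alpha>) x u)"
    unfolding L2_sq_def by (intro nn_integral_cong) (auto simp: abel_def)
  moreover have "L2_sq (Leb t) (\<lambda>x. abel (1 - \<alpha>) x 0 - abel (1 - \<alpha>) x u) < \<infinity>"
    using u by (intro le_less_trans[OF abel_difference_L2[OF a]]) auto
  ultimately show ?thesis by (simp add: L2_fun_iff)
qed

context
  fixes H t :: real
  assumes H: "0 < H" "H < 1/2" and t: "0 < t"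
begin

lemma order_bounds: "0 < 1/2 - H" "1/2 - H < 1/2" "1/2 - H < 1"
  using H by auto

text \<open>Differentiating the tail integral gives \<open>- x powr (-\<alpha>)\<close> times the operator; the outer factor of
the transform cancels the power.\<close>

lemma fbm_transform_eq_corr_op_AE:
  assumes "\<phi> \<in> frac_preimages H t f"
  shows "AE x in Leb t. fbm_transform H t f x = - corr_op t (1/2 - H) \<phi> x"
proof -
  let ?a = "1/2 - H"
  have \<phi>: "\<phi> \<in> L2_fun t" and f: "AE y in Leb t. f y = frac_int t ?a \<phi> y"
    using assms by (auto simp: frac_preimages_def)
  have "AE x in Leb t. (frac_int t (1 - ?a) (\<lambda>r. r powr (- ?a) *\<^sub>R f r)
      has_vector_derivative - (x powr (- ?a) *\<^sub>R corr_op t ?a \<phi> x)) (at x)"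
  proof (rule tail_integral_derivative_AE[OF t])
    show "(\<lambda>y. indicator {\<delta>..} y *\<^sub>R y powr (- ?a) *\<^sub>R corr_op t ?a \<phi> y) \<in> L2_fun t" if "\<delta> > 0" for \<delta>
      by (intro L2_fun_cutoff_powr corr_op_L2(2) order_bounds that \<phi>)
    show "frac_int t (1 - ?a) (\<lambda>r. r powr (- ?a) *\<^sub>R f r) x =
        (LINT y|Leb t. indicator {x..} y *\<^sub>R y powr (- ?a) *\<^sub>R corr_op t ?a \<phi> y)" if "0 < x" "x < t" for x
      using that by (intro frac_int_weighted_eq_tail_integral order_bounds \<phi> f) auto
  qed
  then show ?thesis
    using AE_Icc_neq[where c=0 and a=0 and b=t] AE_space
  proof eventually_elim
    case (elim x)
    have "x powr ?a * x powr (- ?a) = 1" using elim by (simp flip: powr_add)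
    then show ?case
      unfolding fbm_transform_eq_derivative[OF H(2,1)] vector_derivative_at[OF elim(1)] by simp
  qed
qed

lemma fbm_transform_in_L2_fun_lt:
  assumes "f \<in> LH H t"
  shows "fbm_transform H t f \<in> L2_fun t"
proof -
  obtain \<phi> where \<phi>: "\<phi> \<in> frac_preimages H t f" using assms H by (auto simp: LH_def)
  then have \<phi>2: "\<phi> \<in> L2_fun t" by (simp add: frac_preimages_def)
  have AE: "AE x in Leb t. - corr_op t (1/2 - H) \<phi> x = fbm_transform H t f x"
    using fbm_transform_eq_corr_op_AE[OF \<phi>] by eventually_elim simp
  have U: "(\<lambda>x. - corr_op t (1/2 - H) \<phi> x) \<in> L2_fun t"
    by (intro L2_fun_linear[OF corr_op_L2(2)] order_bounds \<phi>2 bounded_linear_minus bounded_linear_ident)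
  have "fbm_transform H t f \<in> borel_measurable (Leb t)"
    by (rule borel_measurable_lebesgue_on_AE[OF _ _ AE]) (use U in \<open>auto simp: L2_fun_iff\<close>)
  moreover have "L2_sq (Leb t) (fbm_transform H t f) = L2_sq (Leb t) (\<lambda>x. - corr_op t (1/2 - H) \<phi> x)"
    using AE by (intro L2_sq_cong_AE) (auto elim: eventually_mono)
  ultimately show ?thesis using U by (simp add: L2_fun_iff)
qed

lemma frac_preimages_linear:
  fixes \<phi> :: "real \<Rightarrow> 'k::{banach, second_countable_topology}"
    and L :: "'k \<Rightarrow> 'l::{banach, second_countable_topology}"
  assumes "\<phi> \<in> frac_preimages H t f" and L: "bounded_linear L"
  shows "(\<lambda>x. L (\<phi> x)) \<in> frac_preimages H t (\<lambda>x. L (f x))"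
proof -
  have \<phi>: "\<phi> \<in> L2_fun t" and f: "AE y in Leb t. f y = frac_int t (1/2 - H) \<phi> y"
    using assms by (auto simp: frac_preimages_def)
  have "AE y in Leb t. L (f y) = frac_int t (1/2 - H) (\<lambda>x. L (\<phi> x)) y"
    using f abel_integrable_AE[OF order_bounds(1) \<phi>] AE_space
  proof eventually_elim
    case (elim y)
    have "y \<in> {0..t}" using elim by simp
    then show ?case
      using integral_bounded_linear[OF L elim(2)] elim(1)
      by (simp add: frac_int_eq_abel[OF order_bounds(1)] linear_cmul[OF bounded_linear.linear[OF L]])
  qed
  then show ?thesis using L2_fun_linear[OF \<phi> L] by (simp add: frac_preimages_def)
qed

lemma frac_preimages_add:
  assumes "\<phi> \<in> frac_preimages H t f" "\<xi> \<in> frac_preimages H t g"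
  shows "(\<lambda>x. \<phi> x + \<xi> x) \<in> frac_preimages H t (\<lambda>x. f x + g x)"
proof -
  have \<phi>: "\<phi> \<in> L2_fun t" and f: "AE y in Leb t. f y = frac_int t (1/2 - H) \<phi> y"
    and \<xi>: "\<xi> \<in> L2_fun t" and g: "AE y in Leb t. g y = frac_int t (1/2 - H) \<xi> y"
    using assms by (auto simp: frac_preimages_def)
  have "AE y in Leb t. f y + g y = frac_int t (1/2 - H) (\<lambda>x. \<phi> x + \<xi> x) y"
    using f g abel_integrable_AE[OF order_bounds(1) \<phi>] abel_integrable_AE[OF order_bounds(1) \<xi>] AE_space
  proof eventually_elim
    case (elim y)
    have "y \<in> {0..t}" using elim by simp
    then show ?case
      using Bochner_Integration.integral_add[OF elim(3,4)] elim(1,2)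
      by (simp add: frac_int_eq_abel[OF order_bounds(1)] scaleR_add_right)
  qed
  then show ?thesis using L2_fun_add[OF \<phi> \<xi>] by (simp add: frac_preimages_def)
qed

lemma LH_linear_lt:
  fixes f :: "real \<Rightarrow> 'k::{banach, second_countable_topology}"
    and L :: "'k \<Rightarrow> 'l::{banach, second_countable_topology}"
  assumes f: "f \<in> LH H t" and L: "bounded_linear L"
  shows "(\<lambda>x. L (f x)) \<in> LH H t"
    and "AE x in Leb t. fbm_transform H t (\<lambda>x. L (f x)) x = L (fbm_transform H t f x)"
proof -
  obtain \<phi> where \<phi>: "\<phi> \<in> frac_preimages H t f" using f H by (auto simp: LH_def)
  then have \<phi>2: "\<phi> \<in> L2_fun t" by (simp add: frac_preimages_def)
  note L\<phi> = frac_preimages_linear[OF \<phi> L]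
  then show "(\<lambda>x. L (f x)) \<in> LH H t" using H by (auto simp: LH_def)
  show "AE x in Leb t. fbm_transform H t (\<lambda>x. L (f x)) x = L (fbm_transform H t f x)"
    using fbm_transform_eq_corr_op_AE[OF \<phi>] fbm_transform_eq_corr_op_AE[OF L\<phi>]
    by eventually_elim
       (simp add: corr_op_linear[OF order_bounds(1,2) \<phi>2 L] linear_neg[OF bounded_linear.linear[OF L]])
qed

text \<open>Abel's identity: fractional integrals of orders \<open>\<alpha>\<close> and \<open>1 - \<alpha>\<close> compose to integration.\<close>

lemma abel_in_frac_preimages:
  assumes u: "u \<in> {0..t}"
  shows "(\<lambda>x. abel (1 - (1/2 - H)) x u) \<in> frac_preimages H t (indicat_real {0..u})"
proof -
  have "AE x in Leb t. indicat_real {0..u} x = frac_int t (1/2 - H) (\<lambda>x. abel (1 - (1/2 - H)) x u) x"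
    using AE_Icc_neq[where c=u and a=0 and b=t] AE_space
  proof eventually_elim
    case (elim x)
    have x: "x \<in> {0..t}" using elim by simp
    have fi: "frac_int t (1/2 - H) (\<lambda>x. abel (1 - (1/2 - H)) x u) x =
        (LINT y|Leb t. abel (1/2 - H) x y * abel (1 - (1/2 - H)) y u)"
      using frac_int_eq_abel[OF order_bounds(1) x, of "\<lambda>x. abel (1 - (1/2 - H)) x u"] by simp
    show ?case
    proof (cases "x < u")
      case True
      have m: "(\<lambda>y. abel (1/2 - H) x y * abel (1 - (1/2 - H)) y u) \<in> borel_measurable (Leb t)"
        by (intro borel_measurable_times borel_measurable_abel_left borel_measurable_abel_right)
      have nn: "0 \<le> abel (1/2 - H) x y * abel (1 - (1/2 - H)) y u" for y
        using H by (intro mult_nonneg_nonneg abel_nonneg) auto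
      have "(LINT y|Leb t. abel (1/2 - H) x y * abel (1 - (1/2 - H)) y u) = 1"
        using abel_comp[OF order_bounds(1,3), of x u t] True x u nn
        by (subst integral_eq_nn_integral[OF m]) auto
      then show ?thesis using True x fi by simp
    next
      case False
      then have z: "abel (1/2 - H) x y * abel (1 - (1/2 - H)) y u = 0" for y by (auto simp: abel_def)
      show ?thesis unfolding fi z using False elim by simp
    qed
  qed
  then show ?thesis using abel_in_L2_fun[OF order_bounds(1,2) u] by (simp add: frac_preimages_def)
qed

lemma comb_abel_in_frac_preimages:
  fixes ps :: "(real \<times> 'k::{banach, second_countable_topology}) list"
  assumes "fst ` set ps \<subseteq> {0..t}"
  shows "comb (\<lambda>s x. abel (1 - (1/2 - H)) x s) ps \<in> frac_preimages H t (step_fun ps)"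
    and "AE x in Leb t. step_transform H t ps x = - corr_op t (1/2 - H) (comb (\<lambda>s x. abel (1 - (1/2 - H)) x s) ps) x"
proof -
  let ?c = "comb (\<lambda>s x. abel (1 - (1/2 - H)) x s)"
  have "?c ps \<in> frac_preimages H t (step_fun ps) \<and>
    (AE x in Leb t. step_transform H t ps x = - corr_op t (1/2 - H) (?c ps) x)"
    using assms
  proof (induction ps)
    case Nil
    have "(\<lambda>x. 0) \<in> L2_fun t" by (simp add: L2_fun_iff L2_sq_def)
    moreover have "frac_int t (1/2 - H) (\<lambda>x. 0 :: 'k) = (\<lambda>x. 0)"
      by (auto simp: frac_int_def set_lebesgue_integral_def)
    ultimately show ?case
      by (simp add: frac_preimages_def comb_def[abs_def] step_fun_def[abs_def] corr_op_def)
  next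
    case (Cons p ps)
    obtain s v where p: "p = (s, v)" by fastforce
    have s: "s \<in> {0..t}" using Cons.prems by (auto simp: p)
    have IH: "?c ps \<in> frac_preimages H t (step_fun ps)"
      "AE x in Leb t. step_transform H t ps x = - corr_op t (1/2 - H) (?c ps) x"
      using Cons by auto
    note sv = frac_preimages_linear[OF abel_in_frac_preimages[OF s] bounded_linear_scaleR_left[of v]]
    have 1: "?c (p # ps) \<in> frac_preimages H t (step_fun (p # ps))"
      using frac_preimages_add[OF sv IH(1)] by (simp add: p comb_Cons[abs_def] step_fun_Cons[abs_def])
    have "AE x in Leb t. step_transform H t (p # ps) x = - corr_op t (1/2 - H) (?c (p # ps)) x"
      using IH(2) fbm_transform_eq_corr_op_AE[OF abel_in_frac_preimages[OF s]]
    proof eventually_elim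
      case (elim x)
      have "corr_op t (1/2 - H) (?c (p # ps)) x =
          corr_op t (1/2 - H) (\<lambda>x. abel (1 - (1/2 - H)) x s *\<^sub>R v) x + corr_op t (1/2 - H) (?c ps) x"
        using corr_op_add[OF order_bounds(1,2), of "\<lambda>x. abel (1 - (1/2 - H)) x s *\<^sub>R v" t "?c ps" x] sv IH(1)
        by (simp add: p comb_Cons[abs_def] frac_preimages_def)
      also have "corr_op t (1/2 - H) (\<lambda>x. abel (1 - (1/2 - H)) x s *\<^sub>R v) x =
          corr_op t (1/2 - H) (\<lambda>x. abel (1 - (1/2 - H)) x s) x *\<^sub>R v"
        by (intro corr_op_linear order_bounds abel_in_L2_fun s bounded_linear_scaleR_left)
      finally have eq: "corr_op t (1/2 - H) (?c (p # ps)) x = corr_op t (1/2 - H) (\<lambda>x. abel (1 - (1/2 - H)) x s) x *\<^sub>R v + corr_op t (1/2 - H) (?c ps) x" .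
      show ?case unfolding eq unfolding p comb_Cons elim by simp
    qed
    with 1 show ?case by simp
  qed
  then show "?c ps \<in> frac_preimages H t (step_fun ps)"
    "AE x in Leb t. step_transform H t ps x = - corr_op t (1/2 - H) (?c ps) x" by auto
qed

lemma frac_preimages_diff:
  assumes "\<phi> \<in> frac_preimages H t f" "\<xi> \<in> frac_preimages H t g"
  shows "(\<lambda>x. \<phi> x - \<xi> x) \<in> frac_preimages H t (\<lambda>x. f x - g x)"
  using frac_preimages_add[OF assms(1) frac_preimages_linear[OF assms(2) bounded_linear_minus[OF bounded_linear_ident]]]
  by simp

text \<open>The estimate holds with every preimage of the difference, hence with the infimum that defines the
norm.\<close>

lemma step_transform_bound_lt:
  assumes f: "f \<in> LH H t"
  shows "\<exists>C>0. \<forall>ps. fst ` set ps \<subseteq> {0..t} \<longrightarrow>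
    L2_sq (Leb t) (\<lambda>x. step_transform H t ps x - fbm_transform H t f x) \<le>
    ennreal C * LH_norm_sq H t (\<lambda>x. step_fun ps x - f x)"
proof -
  let ?M = "Leb t"
  let ?a = "1/2 - H"
  define C where "C = 2 + 2 * (corr_const ?a / (1/2 - corr_exp ?a))\<^sup>2"
  have C: "C > 0" by (simp add: C_def add_pos_nonneg)
  have "L2_sq ?M (\<lambda>x. step_transform H t ps x - fbm_transform H t f x) \<le>
    ennreal C * LH_norm_sq H t (\<lambda>x. step_fun ps x - f x)" if ps: "fst ` set ps \<subseteq> {0..t}" for ps
  proof -
    let ?D = "L2_sq ?M (\<lambda>x. step_transform H t ps x - fbm_transform H t f x)"
    let ?c = "comb (\<lambda>s x. abel (1 - ?a) x s) ps"
    have "?D \<le> ennreal C * L2_sq ?M \<xi>" if \<xi>: "\<xi> \<in> frac_preimages H t (\<lambda>x. step_fun ps x - f x)" for \<xi>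
    proof -
      have "(\<lambda>x. ?c x - \<xi> x) \<in> frac_preimages H t (\<lambda>x. step_fun ps x - (step_fun ps x - f x))"
        by (intro frac_preimages_diff comb_abel_in_frac_preimages(1) ps \<xi>)
      then have d: "(\<lambda>x. ?c x - \<xi> x) \<in> frac_preimages H t f" by simp
      have c2: "?c \<in> L2_fun t" "\<xi> \<in> L2_fun t"
        using comb_abel_in_frac_preimages(1)[OF ps] \<xi> by (auto simp: frac_preimages_def)
      have "AE x in ?M. step_transform H t ps x - fbm_transform H t f x = - corr_op t ?a \<xi> x"
        using comb_abel_in_frac_preimages(2)[OF ps] fbm_transform_eq_corr_op_AE[OF d]
        by eventually_elim (use corr_op_diff[OF order_bounds(1,2) c2] in simp)
      then have "?D = L2_sq ?M (\<lambda>x. - corr_op t ?a \<xi> x)" by (rule L2_sq_cong_AE)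
      also have "\<dots> \<le> ennreal C * L2_sq ?M \<xi>"
        unfolding C_def L2_sq_uminus by (intro corr_op_L2(1) order_bounds c2)
      finally show ?thesis .
    qed
    note le = this
    have CC: "ennreal (1 / C) * ennreal C = 1" using C by (simp flip: ennreal_mult)
    have "ennreal (1 / C) * ?D \<le> (INF \<xi>\<in>frac_preimages H t (\<lambda>x. step_fun ps x - f x). L2_sq ?M \<xi>)"
    proof (rule INF_greatest)
      fix \<xi> assume "\<xi> \<in> frac_preimages H t (\<lambda>x. step_fun ps x - f x)"
      from mult_left_mono[OF le[OF this], of "ennreal (1 / C)"]
      show "ennreal (1 / C) * ?D \<le> L2_sq ?M \<xi>" by (simp add: mult.assoc[symmetric] CC)
    qed
    also have "\<dots> = LH_norm_sq H t (\<lambda>x. step_fun ps x - f x)"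
      using H by (simp add: LH_norm_sq_def L2_sq_def)
    finally have "ennreal C * (ennreal (1 / C) * ?D) \<le> ennreal C * LH_norm_sq H t (\<lambda>x. step_fun ps x - f x)"
      by (rule mult_left_mono) simp
    then show ?thesis by (simp add: mult.assoc[symmetric] CC mult.commute[of "ennreal C" "ennreal (1 / C)"])
  qed
  then show ?thesis using C by blast
qed

end

section \<open>Hurst parameter below one half: density of step functions\<close>

lemma abel_comp_integral:
  assumes a: "0 < \<alpha>" "\<alpha> < 1" and x: "x \<in> {0..t}" and u: "u \<in> {0..t}" and ne: "x \<noteq> u"
  shows "integrable (Leb t) (\<lambda>y. abel \<alpha> x y * abel (1 - \<alpha>) y u)"
    and "(LINT y|Leb t. abel \<alpha> x y * abel (1 - \<alpha>) y u) = indicat_real {0..u} x"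
proof -
  have m: "(\<lambda>y. abel \<alpha> x y * abel (1 - \<alpha>) y u) \<in> borel_measurable (Leb t)"
    by (intro borel_measurable_times borel_measurable_abel_left borel_measurable_abel_right)
  have nn: "0 \<le> abel \<alpha> x y * abel (1 - \<alpha>) y u" for y
    using a by (intro mult_nonneg_nonneg abel_nonneg) auto
  have val: "(\<integral>\<^sup>+y. ennreal (abel \<alpha> x y * abel (1 - \<alpha>) y u) \<partial>Leb t) = ennreal (indicat_real {0..u} x)"
  proof (cases "x < u")
    case True
    then show ?thesis using abel_comp[OF a, of x u t] x u by simp
  next
    case False
    then have z: "abel \<alpha> x y * abel (1 - \<alpha>) y u = 0" for y by (auto simp: abel_def)
    show ?thesis unfolding z using False ne by simp
  qed
  show "integrable (Leb t) (\<lambda>y. abel \<alpha> x y * abel (1 - \<alpha>) y u)"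
    using m nn val by (intro integrableI_bounded) auto
  show "(LINT y|Leb t. abel \<alpha> x y * abel (1 - \<alpha>) y u) = indicat_real {0..u} x"
    using nn val by (subst integral_eq_nn_integral[OF m]) auto
qed

text \<open>Among the cells of an equidistant partition exactly one contains \<open>u\<close>, so a sum over the cells reduces
to one term; its right endpoint is the generator that replaces the one at \<open>u\<close>.\<close>

lemma grid_cell:
  assumes s: "0 < s" and n: "0 < (n::nat)" and u: "0 < u" "u < s"
  obtains j where "j \<in> {1..n}" "u \<le> s * real j / n" "s * real j / n - u \<le> s / n"
    "\<And>c :: nat \<Rightarrow> real. (\<Sum>k=1..n. indicat_real {s * (real k - 1) / n<..s * real k / n} u * c k) = c j"
proof -
  define y where "y = n * u / s"
  define j where "j = nat \<lceil>y\<rceil>"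
  have y: "0 < y" "y \<le> real n" using s n u by (auto simp: y_def field_simps)
  have c: "0 < \<lceil>y\<rceil>" "\<lceil>y\<rceil> \<le> int n" using y by (simp_all only: zero_less_ceiling ceiling_le_iff of_int_of_nat_eq)
  then have j: "j \<in> {1..n}" unfolding j_def atLeastAtMost_iff by linarith
  have "real j = real_of_int \<lceil>y\<rceil>" using c(1) by (simp only: j_def of_nat_nat less_imp_le)
  then have "real j - 1 < n * u / s" "n * u / s \<le> real j"
    using ceiling_correct[of y] unfolding y_def by linarith+
  then have ju: "s * (real j - 1) / n < u" "u \<le> s * real j / n" using s n by (auto simp: field_simps)
  have "u \<in> {s * (real k - 1) / n<..s * real k / n} \<longleftrightarrow> k = j" for k
  proof
    assume "u \<in> {s * (real k - 1) / n<..s * real k / n}"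
    then have "real k - 1 < n * u / s" "n * u / s \<le> real k" using s n by (auto simp: field_simps)
    then have "\<lceil>y\<rceil> = int k" unfolding y_def by (intro ceiling_unique) auto
    then show "k = j" by (simp add: j_def)
  qed (use ju in auto)
  then have "(\<Sum>k=1..n. indicat_real {s * (real k - 1) / n<..s * real k / n} u * c k) = (\<Sum>k=1..n. if k = j then c k else 0)" for c
    by (intro sum.cong) (auto simp: indicator_def)
  then have "(\<Sum>k=1..n. indicat_real {s * (real k - 1) / n<..s * real k / n} u * c k) = c j" for c
    using j by simp
  moreover have "s * real j / n - u \<le> s / n"
  proof -
    have "s * real j / n - s / n = s * (real j - 1) / n"
      by (simp add: diff_divide_distrib right_diff_distrib)
    then show ?thesis using ju(1) by linarith
  qed
  ultimately show ?thesis using that j ju(2) by blast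
qed

lemma approximable_cong_AE:
  fixes f g :: "real \<Rightarrow> 'k::{banach, second_countable_topology}"
  assumes "approximable \<kappa> t f" "AE x in Leb t. f x = g x"
    and "g \<in> borel_measurable (Leb t)"
  shows "approximable \<kappa> t g"
proof -
  have "L2_sq (Leb t) (\<lambda>x. comb \<kappa> ps x - f x) = L2_sq (Leb t) (\<lambda>x. comb \<kappa> ps x - g x)" for ps
    using assms(2) by (intro L2_sq_cong_AE) auto
  then show ?thesis using assms by (simp add: approximable_def)
qed

text \<open>By Abel's identity the indicator of \<open>[0,s]\<close> is the integral of the generators at \<open>u\<close> against the
weight \<open>abel \<alpha> u s\<close>. Rounding \<open>u\<close> up to a grid turns the integral into a finite combination, and
the error is controlled by the Hoelder continuity of \<open>u \<mapsto> abel (1 - \<alpha>) x u\<close> in \<open>L\<^sup>2\<close>.\<close>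

lemma indicator_approximable_abel:
  assumes a: "0 < \<alpha>" "\<alpha> < 1/2" and t: "0 < t" and s: "s \<in> {0..t}"
  shows "approximable (\<lambda>u x. abel (1 - \<alpha>) x u) t (indicat_real {0..s})"
proof (cases "s = 0")
  case True
  have "AE x in Leb t. comb (\<lambda>u x. abel (1 - \<alpha>) x u) [] x = indicat_real {0..s} x"
    using AE_Icc_neq[where c=0 and a=0 and b=t] by eventually_elim (auto simp: True)
  moreover have "approximable (\<lambda>u x. abel (1 - \<alpha>) x u) t (comb (\<lambda>u x. abel (1 - \<alpha>) x u) ([] :: (real \<times> real) list))"
    by (rule approximable_comb[OF borel_measurable_abel_left]) simp
  ultimately show ?thesis
    by (intro approximable_cong_AE[OF _ _ borel_measurable_indicator_Icc])
next
  case False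
  then have s0: "0 < s" "s \<le> t" using s by auto
  let ?M = "Leb t"
  let ?\<phi> = "\<lambda>u x. abel (1 - \<alpha>) x u"
  let ?w = "\<lambda>u. abel \<alpha> u s"
  define W where "W = t powr \<alpha> / \<alpha> / Gamma \<alpha>"
  define K where "K = 2 / (1 - 2 * \<alpha>) / (Gamma (1 - \<alpha>))\<^sup>2"
  define e where "e = 1 - 2 * \<alpha>"
  have e: "e > 0" using a by (simp add: e_def)
  have K: "K \<ge> 0" using a by (simp add: K_def)
  have W: "W \<ge> 0" using a Gamma_real_pos[of \<alpha>] by (simp add: W_def)
  have wnn: "0 \<le> ?w u" for u by (rule abel_nonneg[OF a(1)])
  have wW: "(\<integral>\<^sup>+u. ennreal (?w u) \<partial>?M) \<le> ennreal W"
    unfolding W_def using s by (rule abel_left_integral_le[OF a(1)])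
  have wint: "integrable ?M ?w"
    using wW wnn by (intro integrableI_bounded) (auto intro: le_less_trans)
  interpret pair_sigma_finite ?M ?M by (rule pair_sigma_finite_Icc)
  show ?thesis
  proof (rule approximable_limit)
    show "?\<phi> u \<in> borel_measurable ?M" for u by (rule borel_measurable_abel_left)
    show "indicat_real {0..s} \<in> borel_measurable ?M" by (rule borel_measurable_indicator_Icc)
    fix \<epsilon> :: real assume \<epsilon>: "\<epsilon> > 0"
    have "(\<lambda>n. W * (K * (s / real n) powr e * W)) \<longlonglongrightarrow> W * (K * 0 powr e * W)"
      using e s0 by (intro tendsto_intros tendsto_powr' lim_const_over_n) auto
    then have "\<forall>\<^sub>F n in sequentially. W * (K * (s / real n) powr e * W) < \<epsilon>"
      using \<epsilon> by (intro order_tendstoD(2)) auto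
    moreover have "\<forall>\<^sub>F n in sequentially. 0 < n" by (rule eventually_gt_at_top)
    ultimately have "\<forall>\<^sub>F n in sequentially. W * (K * (s / real n) powr e * W) < \<epsilon> \<and> 0 < n"
      by (rule eventually_conj)
    then obtain n where n: "W * (K * (s / real n) powr e * W) < \<epsilon>" "0 < n"
      unfolding eventually_sequentially by blast
    let ?I = "\<lambda>k::nat. {s * (real k - 1) / n<..s * real k / n}"
    let ?p = "\<lambda>k::nat. s * real k / n"
    let ?h = "\<lambda>x u. \<Sum>k=1..n. indicat_real (?I k) u * ?\<phi> (?p k) x"
    let ?D = "\<lambda>x u. ?\<phi> u x - ?h x u"
    let ?J = "\<lambda>x. \<integral>\<^sup>+u. ennreal ((?D x u)\<^sup>2) * ennreal (?w u) \<partial>?M"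
    define g where "g x = (LINT u|?M. ?h x u * ?w u)" for x
    have Im: "indicat_real (?I k) \<in> borel_measurable ?M" for k
      by (intro measurable_lebesgue_on_borel borel_measurable_indicator) simp
    have wI: "integrable ?M (\<lambda>u. indicat_real (?I k) u * ?w u)" for k
    proof (rule Bochner_Integration.integrable_bound[OF wint])
      show "(\<lambda>u. indicat_real (?I k) u * ?w u) \<in> borel_measurable ?M"
        by (intro borel_measurable_times Im borel_measurable_abel_left)
      show "AE u in ?M. norm (indicat_real (?I k) u * ?w u) \<le> norm (?w u)"
        by (intro AE_I2) (auto simp: indicator_def)
    qed
    have hI: "integrable ?M (\<lambda>u. ?h x u * ?w u)" for x
      unfolding sum_distrib_right
    proof (rule Bochner_Integration.integrable_sum)
      fix k
      have "integrable ?M (\<lambda>u. ?\<phi> (?p k) x * (indicat_real (?I k) u * ?w u))"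
        by (intro integrable_mult_right wI)
      then show "integrable ?M (\<lambda>u. indicat_real (?I k) u * ?\<phi> (?p k) x * ?w u)"
        by (simp add: mult_ac)
    qed
    have g_sum: "g x = (\<Sum>k=1..n. ?\<phi> (?p k) x *\<^sub>R (LINT u|?M. indicat_real (?I k) u * ?w u))" for x
    proof -
      have "g x = (LINT u|?M. (\<Sum>k=1..n. ?\<phi> (?p k) x * (indicat_real (?I k) u * ?w u)))"
        unfolding g_def sum_distrib_right
        by (intro Bochner_Integration.integral_cong sum.cong refl) (simp only: mult_ac)
      also have "\<dots> = (\<Sum>k=1..n. LINT u|?M. ?\<phi> (?p k) x * (indicat_real (?I k) u * ?w u))"
        by (intro Bochner_Integration.integral_sum integrable_mult_right wI)
      finally show ?thesis by simp
    qed
    have "approximable ?\<phi> t g"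
      unfolding g_sum[abs_def]
    proof (rule approximable_sum)
      show "?\<phi> u \<in> borel_measurable ?M" for u by (rule borel_measurable_abel_left)
      fix k assume k: "k \<in> {1..n}"
      have "?p k \<le> s * 1" using k n s0 by (auto simp: field_simps)
      then have "fst ` set [(?p k, LINT u|?M. indicat_real (?I k) u * ?w u)] \<subseteq> {0..t}" using s0 by simp
      from approximable_comb[OF borel_measurable_abel_left this]
      show "approximable ?\<phi> t (\<lambda>x. ?\<phi> (?p k) x *\<^sub>R (LINT u|?M. indicat_real (?I k) u * ?w u))"
        by (simp add: comb_def[abs_def])
    qed
    moreover have "L2_sq ?M (\<lambda>x. g x - indicat_real {0..s} x) < ennreal \<epsilon>"
    proof -
      have Dp: "(\<lambda>p. ?D (fst p) (snd p)) \<in> borel_measurable (?M \<Otimes>\<^sub>M ?M)"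
        by (intro borel_measurable_diff borel_measurable_abel_pair borel_measurable_sum borel_measurable_times
            measurable_compose[OF measurable_snd Im] measurable_compose[OF measurable_fst borel_measurable_abel_left])
      have D2: "(\<lambda>u. ?D x u) \<in> borel_measurable ?M" for x
        by (intro borel_measurable_diff borel_measurable_abel_right borel_measurable_sum borel_measurable_times Im borel_measurable_const)
      have D1: "(\<lambda>x. ?D x u) \<in> borel_measurable ?M" for u
        by (intro borel_measurable_diff borel_measurable_abel_left borel_measurable_sum borel_measurable_times borel_measurable_const)
      have wm: "?w \<in> borel_measurable ?M" by (rule borel_measurable_abel_left)
      have sw: "(\<lambda>u. sqrt (?w u)) \<in> borel_measurable ?M" using wm by measurable
      have pt: "AE x in ?M. ennreal ((norm (g x - indicat_real {0..s} x))\<^sup>2) \<le> ennreal W * (?J x)"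
        using AE_Icc_neq[where c=s and a=0 and b=t] AE_space
      proof eventually_elim
        case (elim x)
        have x: "x \<in> {0..t}" using elim by simp
        have "0 < 1 - \<alpha>" "1 - \<alpha> < 1" using a by auto
        from abel_comp_integral[OF this x s elim(1)]
        have ci: "integrable ?M (\<lambda>u. ?\<phi> u x * ?w u)" "(LINT u|?M. ?\<phi> u x * ?w u) = indicat_real {0..s} x"
          by auto
        have Di: "integrable ?M (\<lambda>u. ?D x u * ?w u)"
          using Bochner_Integration.integrable_diff[OF ci(1) hI[of x]] by (simp add: left_diff_distrib)
        have "indicat_real {0..s} x - g x = (LINT u|?M. ?D x u * ?w u)"
          using Bochner_Integration.integral_diff[OF ci(1) hI[of x]] ci(2) by (simp add: left_diff_distrib g_def)
        then have "ennreal (norm (g x - indicat_real {0..s} x)) = ennreal (norm (LINT u|?M. ?D x u * ?w u))"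
          by (metis norm_minus_commute)
        also have "\<dots> \<le> (\<integral>\<^sup>+u. ennreal (norm (?D x u * ?w u)) \<partial>?M)"
          by (rule integral_norm_bound_ennreal[OF Di])
        also have "\<dots> = (\<integral>\<^sup>+u. ennreal (sqrt (?w u)) * ennreal (sqrt (?w u) * \<bar>?D x u\<bar>) \<partial>?M)"
        proof (rule nn_integral_cong)
          fix u
          have "norm (?D x u * ?w u) = sqrt (?w u) * (sqrt (?w u) * \<bar>?D x u\<bar>)"
            using wnn[of u] by (simp add: abs_mult mult.assoc[symmetric])
          then show "ennreal (norm (?D x u * ?w u)) = ennreal (sqrt (?w u)) * ennreal (sqrt (?w u) * \<bar>?D x u\<bar>)"
            using wnn[of u] by (simp only: ennreal_mult' real_sqrt_ge_zero)
        qed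
        finally have "(ennreal (norm (g x - indicat_real {0..s} x)))\<^sup>2 \<le> (\<integral>\<^sup>+u. ennreal (sqrt (?w u)) * ennreal (sqrt (?w u) * \<bar>?D x u\<bar>) \<partial>?M)\<^sup>2"
          by (rule power_mono) simp
        also have "\<dots> \<le> (\<integral>\<^sup>+u. (ennreal (sqrt (?w u)))\<^sup>2 \<partial>?M) * (\<integral>\<^sup>+u. (ennreal (sqrt (?w u) * \<bar>?D x u\<bar>))\<^sup>2 \<partial>?M)"
          by (intro Cauchy_Schwarz_nn_integral measurable_compose[OF _ measurable_ennreal]
              borel_measurable_times borel_measurable_abs D2 sw)
        also have "(\<integral>\<^sup>+u. (ennreal (sqrt (?w u)))\<^sup>2 \<partial>?M) = (\<integral>\<^sup>+u. ennreal (?w u) \<partial>?M)"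
          using wnn by (intro nn_integral_cong) (simp add: ennreal_power)
        also have "(\<integral>\<^sup>+u. (ennreal (sqrt (?w u) * \<bar>?D x u\<bar>))\<^sup>2 \<partial>?M) = (?J x)"
        proof (rule nn_integral_cong)
          fix u
          have "(sqrt (?w u) * \<bar>?D x u\<bar>)\<^sup>2 = (?D x u)\<^sup>2 * ?w u"
            using wnn[of u] by (simp add: power_mult_distrib mult.commute)
          moreover have nn: "0 \<le> sqrt (?w u) * \<bar>?D x u\<bar>"
            using wnn[of u] by (intro mult_nonneg_nonneg) auto
          ultimately show "(ennreal (sqrt (?w u) * \<bar>?D x u\<bar>))\<^sup>2 = ennreal ((?D x u)\<^sup>2) * ennreal (?w u)"
            by (simp only: ennreal_power[OF nn] ennreal_mult'[OF zero_le_power2])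
        qed
        also have "(\<integral>\<^sup>+u. ennreal (?w u) \<partial>?M) * (?J x) \<le>
            ennreal W * (?J x)"
          by (intro mult_right_mono wW) simp
        finally show ?case by (simp only: ennreal_power norm_ge_zero)
      qed
      have D2w: "(\<lambda>(x, u). ennreal ((?D x u)\<^sup>2) * ennreal (?w u)) \<in> borel_measurable (?M \<Otimes>\<^sub>M ?M)"
        unfolding case_prod_unfold
        by (intro borel_measurable_times_ennreal measurable_compose[OF _ measurable_ennreal] borel_measurable_power Dp
            measurable_compose[OF measurable_snd wm])
      have "L2_sq ?M (\<lambda>x. g x - indicat_real {0..s} x) \<le> (\<integral>\<^sup>+x. ennreal W * (?J x) \<partial>?M)"
        unfolding L2_sq_def by (rule nn_integral_mono_AE[OF pt])
      also have "\<dots> = ennreal W * (\<integral>\<^sup>+x. (?J x) \<partial>?M)"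
        by (rule nn_integral_cmult, rule M1.borel_measurable_nn_integral[OF D2w])
      also have "(\<integral>\<^sup>+x. (?J x) \<partial>?M) =
          (\<integral>\<^sup>+u. (\<integral>\<^sup>+x. ennreal ((?D x u)\<^sup>2) * ennreal (?w u) \<partial>?M) \<partial>?M)"
        by (rule Fubini'[OF D2w, symmetric])
      also have "\<dots> \<le> (\<integral>\<^sup>+u. ennreal (K * (s / n) powr e) * ennreal (?w u) \<partial>?M)"
      proof (rule nn_integral_mono_AE)
        show "AE u in ?M. (\<integral>\<^sup>+x. ennreal ((?D x u)\<^sup>2) * ennreal (?w u) \<partial>?M) \<le> ennreal (K * (s / n) powr e) * ennreal (?w u)"
          using AE_Icc_neq[where c=0 and a=0 and b=t] AE_space
        proof eventually_elim
          case (elim u)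
          have "(\<integral>\<^sup>+x. ennreal ((?D x u)\<^sup>2) * ennreal (?w u) \<partial>?M) = (\<integral>\<^sup>+x. ennreal ((?D x u)\<^sup>2) \<partial>?M) * ennreal (?w u)"
            by (intro nn_integral_multc measurable_compose[OF _ measurable_ennreal] borel_measurable_power D1)
          also have "\<dots> \<le> ennreal (K * (s / n) powr e) * ennreal (?w u)"
          proof (cases "u < s")
            case True
            have u: "0 < u" using elim by auto
            obtain j where j: "j \<in> {1..n}" "u \<le> ?p j" "?p j - u \<le> s / n"
              "\<And>c :: nat \<Rightarrow> real. (\<Sum>k=1..n. indicat_real (?I k) u * c k) = c j"
              using grid_cell[OF s0(1) n(2) u True] by blast
            have "?p j \<le> s * 1" using j(1) n s0 by (auto simp: field_simps)
            then have pj: "?p j \<le> t" using s0 by simp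
            have "(\<integral>\<^sup>+x. ennreal ((?D x u)\<^sup>2) \<partial>?M) = L2_sq ?M (\<lambda>x. abel (1 - \<alpha>) x u - abel (1 - \<alpha>) x (?p j))"
              unfolding L2_sq_def j(4) by simp
            also have "\<dots> \<le> ennreal (2 * (?p j - u) powr (1 - 2 * \<alpha>) / (1 - 2 * \<alpha>) / (Gamma (1 - \<alpha>))\<^sup>2)"
              using u by (intro abel_difference_L2 a j(2) pj) simp
            also have "\<dots> \<le> ennreal (K * (s / n) powr e)"
            proof (rule ennreal_leI)
              have "(?p j - u) powr e \<le> (s / n) powr e" using j e by (intro powr_mono2) auto
              then have "K * (?p j - u) powr e \<le> K * (s / n) powr e" using K by (rule mult_left_mono)
              then show "2 * (?p j - u) powr (1 - 2 * \<alpha>) / (1 - 2 * \<alpha>) / (Gamma (1 - \<alpha>))\<^sup>2 \<le> K * (s / n) powr e"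
                by (simp add: K_def e_def)
            qed
            finally show ?thesis by (rule mult_right_mono) simp
          qed (simp add: abel_def)
          finally show ?case .
        qed
      qed
      also have "\<dots> = ennreal (K * (s / n) powr e) * (\<integral>\<^sup>+u. ennreal (?w u) \<partial>?M)"
        by (rule nn_integral_cmult) measurable
      also have "ennreal W * \<dots> \<le> ennreal W * (ennreal (K * (s / n) powr e) * ennreal W)"
        by (intro mult_left_mono wW) auto
      also have "\<dots> = ennreal (W * (K * (s / n) powr e * W))"
        using W K by (simp add: ennreal_mult)
      also have "\<dots> < ennreal \<epsilon>" using n(1) \<epsilon> by (intro ennreal_lessI) auto
      finally show ?thesis by (simp add: mult_left_mono)
    qed
    ultimately show "\<exists>g. approximable ?\<phi> t g \<and> L2_sq ?M (\<lambda>x. g x - indicat_real {0..s} x) < ennreal \<epsilon>"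
      by blast
  qed
qed

text \<open>The norm of the integrand space is that of the preimage in \<open>L\<^sup>2\<close>, so combinations of Abel kernels
have to approximate an arbitrary preimage.\<close>

lemma step_fun_dense_lt:
  assumes H: "0 < H" "H < 1/2" and t: "0 < t" and f: "f \<in> LH H t" and e: "e > 0"
  shows "\<exists>ps. fst ` set ps \<subseteq> {0..t} \<and> LH_norm_sq H t (\<lambda>x. step_fun ps x - f x) < ennreal e"
proof -
  obtain \<phi> where \<phi>: "\<phi> \<in> frac_preimages H t f" using f H by (auto simp: LH_def)
  then have \<phi>2: "\<phi> \<in> L2_fun t" by (simp add: frac_preimages_def)
  have "approximable (\<lambda>u x. abel (1 - (1/2 - H)) x u) t \<phi>"
  proof (rule approximable_trans[OF borel_measurable_abel_left])
    show "step_approx t \<phi>" using t \<phi>2 by (intro step_approx_L2) auto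
    show "approximable (\<lambda>u x. abel (1 - (1/2 - H)) x u) t (indicat_real {0..s})" if "s \<in> {0..t}" for s
      using H t that by (intro indicator_approximable_abel) auto
  qed
  then obtain ps where ps: "fst ` set ps \<subseteq> {0..t}"
    "L2_sq (Leb t) (\<lambda>x. comb (\<lambda>u x. abel (1 - (1/2 - H)) x u) ps x - \<phi> x) < ennreal e"
    using e unfolding approximable_def by blast
  have "(\<lambda>x. comb (\<lambda>u x. abel (1 - (1/2 - H)) x u) ps x - \<phi> x) \<in> frac_preimages H t (\<lambda>x. step_fun ps x - f x)"
    by (intro frac_preimages_diff[OF H t] comb_abel_in_frac_preimages(1)[OF H t] ps \<phi>)
  then have "LH_norm_sq H t (\<lambda>x. step_fun ps x - f x) \<le>
      L2_sq (Leb t) (\<lambda>x. comb (\<lambda>u x. abel (1 - (1/2 - H)) x u) ps x - \<phi> x)"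
    using H unfolding LH_norm_sq_def L2_sq_def by (auto intro: INF_lower)
  then show ?thesis using ps by (intro exI[of _ ps]) (auto intro: le_less_trans)
qed

section \<open>Hurst parameter one half\<close>

lemma fbm_transform_half:
  assumes "x \<noteq> 0"
  shows "fbm_transform (1/2) t f x = f x"
  using assms by (simp add: fbm_transform_def frac_deriv_def frac_int_def)

lemma fbm_transform_half_AE: "AE x in Leb t. fbm_transform (1/2) t f x = f x"
  using AE_Icc_neq[where c=0 and a=0 and b=t] by eventually_elim (rule fbm_transform_half)

lemma frac_preimages_half:
  "\<phi> \<in> frac_preimages (1/2) t f \<longleftrightarrow> \<phi> \<in> L2_fun t \<and> (AE s in Leb t. f s = \<phi> s)"
  by (simp add: frac_preimages_def frac_int_def)

lemma LH_half:
  "f \<in> LH (1/2) t \<longleftrightarrow> f \<in> L2_fun t"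
proof
  assume "f \<in> LH (1/2) t"
  then obtain \<phi> where \<phi>: "\<phi> \<in> L2_fun t" "AE s in Leb t. \<phi> s = f s"
    unfolding LH_def by (auto simp: frac_preimages_half eq_commute)
  have "f \<in> borel_measurable (Leb t)"
    by (rule borel_measurable_lebesgue_on_AE[OF _ _ \<phi>(2)]) (use \<phi>(1) in \<open>auto simp: L2_fun_iff\<close>)
  then show "f \<in> L2_fun t" using \<phi>(1) L2_sq_cong_AE[OF \<phi>(2)] by (simp add: L2_fun_iff)
next
  assume "f \<in> L2_fun t"
  then have "f \<in> frac_preimages (1/2) t f" by (simp add: frac_preimages_half)
  then show "f \<in> LH (1/2) t" unfolding LH_def by auto
qed

lemma LH_norm_sq_half:
  assumes "f \<in> L2_fun t"
  shows "LH_norm_sq (1/2) t f = L2_sq (Leb t) f"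
proof -
  have "(INF \<phi>\<in>frac_preimages (1/2) t f. L2_sq (Leb t) \<phi>) = L2_sq (Leb t) f"
  proof (rule antisym)
    show "(INF \<phi>\<in>frac_preimages (1/2) t f. L2_sq (Leb t) \<phi>) \<le> L2_sq (Leb t) f"
      using assms by (intro INF_lower) (simp add: frac_preimages_half)
    show "L2_sq (Leb t) f \<le> (INF \<phi>\<in>frac_preimages (1/2) t f. L2_sq (Leb t) \<phi>)"
    proof (rule INF_greatest)
      fix \<phi> assume "\<phi> \<in> frac_preimages (1/2) t f"
      then show "L2_sq (Leb t) f \<le> L2_sq (Leb t) \<phi>"
        using L2_sq_cong_AE[of f \<phi>] by (simp add: frac_preimages_half)
    qed
  qed
  then show ?thesis by (simp add: LH_norm_sq_def L2_sq_def)
qed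

section \<open>Hurst parameter below one half: transforms of indicators\<close>

text \<open>For positive \<open>x < u\<close> this is minus the derivative in \<open>x\<close> of the integral of
\<open>y powr (-\<alpha>) * (y - x) powr (-\<alpha>)\<close> over \<open>[x,u]\<close>, after an integration by parts that removes the
singularity of the differentiated kernel. Up to a power of \<open>x\<close> and a Gamma factor it is the
transform of the indicator of \<open>[0,u]\<close>.\<close>

definition rho :: "real \<Rightarrow> real \<Rightarrow> real \<Rightarrow> ennreal" where
  "rho \<alpha> u x = (if 0 < x \<and> x < u then ennreal (u powr (- \<alpha>) * (u - x) powr (- \<alpha>)) +
     (\<integral>\<^sup>+y. ennreal (\<alpha> * y powr (- 1 - \<alpha>) * (y - x) powr (- \<alpha>)) * indicator {x..u} y \<partial>lborel) else 0)"

lemma borel_measurable_rho [measurable]: "rho \<alpha> u \<in> borel_measurable borel"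
proof -
  have [measurable]: "(\<lambda>p. ennreal (\<alpha> * snd p powr (- 1 - \<alpha>) * (snd p - fst p) powr (- \<alpha>)) * indicator {fst p..u} (snd p))
     \<in> borel_measurable (borel \<Otimes>\<^sub>M lborel)"
  proof -
    have "(\<lambda>p. ennreal (\<alpha> * snd p powr (- 1 - \<alpha>) * (snd p - fst p) powr (- \<alpha>)) * indicator {fst p..u} (snd p)) =
      (\<lambda>p :: real \<times> real. ennreal (\<alpha> * snd p powr (- 1 - \<alpha>) * (snd p - fst p) powr (- \<alpha>)) * (if fst p \<le> snd p \<and> snd p \<le> u then 1 else 0))"
      by (auto simp: indicator_def)
    also have "\<dots> \<in> borel_measurable (borel \<Otimes>\<^sub>M lborel)" by measurable
    finally show ?thesis .
  qed
  have "(\<lambda>x. \<integral>\<^sup>+y. ennreal (\<alpha> * y powr (- 1 - \<alpha>) * (y - x) powr (- \<alpha>)) * indicator {x..u} y \<partial>lborel) \<in> borel_measurable borel"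
    by (rule lborel.borel_measurable_nn_integral) (simp add: case_prod_unfold)
  then show ?thesis unfolding rho_def[abs_def] by measurable
qed

lemma nn_integral_powr_shift:
  assumes a: "\<alpha> < 1" and s: "s \<le> y"
  shows "(\<integral>\<^sup>+x. ennreal ((y - x) powr (- \<alpha>)) * indicator {s..y} x \<partial>lborel) = ennreal ((y - s) powr (1 - \<alpha>) / (1 - \<alpha>))"
proof -
  have "(\<integral>\<^sup>+x. ennreal ((y - x) powr (- \<alpha>)) * indicator {s..y} x \<partial>lebesgue) =
      ennreal (- ((y - y) powr (1 - \<alpha>) / (1 - \<alpha>)) - (- ((y - s) powr (1 - \<alpha>) / (1 - \<alpha>))))"
    using a s by (intro nn_integral_FTC)
      (auto intro!: continuous_intros derivative_eq_intros continuous_on_powr')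
  then show ?thesis unfolding nn_integral_completion by simp
qed

lemma nn_integral_powr_shift':
  assumes a: "\<alpha> < 1" and s: "x \<le> u"
  shows "(\<integral>\<^sup>+y. ennreal ((y - x) powr (- \<alpha>)) * indicator {x..u} y \<partial>lborel) = ennreal ((u - x) powr (1 - \<alpha>) / (1 - \<alpha>))"
proof -
  have "(\<integral>\<^sup>+y. ennreal ((y - x) powr (- \<alpha>)) * indicator {x..u} y \<partial>lebesgue) =
      ennreal ((u - x) powr (1 - \<alpha>) / (1 - \<alpha>) - (x - x) powr (1 - \<alpha>) / (1 - \<alpha>))"
    using a s by (intro nn_integral_FTC)
      (auto intro!: continuous_intros derivative_eq_intros continuous_on_powr')
  then show ?thesis unfolding nn_integral_completion by simp
qed

lemma rho_le:
  assumes a: "0 < \<alpha>" "\<alpha> < 1/2" and x: "0 < x" "x < u"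
  shows "rho \<alpha> u x \<le> ennreal (u powr (- \<alpha>) * (u - x) powr (- \<alpha>) + \<alpha> * x powr (- 1 - \<alpha>) * ((u - x) powr (1 - \<alpha>) / (1 - \<alpha>)))"
proof -
  have "(\<integral>\<^sup>+y. ennreal (\<alpha> * y powr (- 1 - \<alpha>) * (y - x) powr (- \<alpha>)) * indicator {x..u} y \<partial>lborel) \<le>
      (\<integral>\<^sup>+y. ennreal (\<alpha> * x powr (- 1 - \<alpha>)) * (ennreal ((y - x) powr (- \<alpha>)) * indicator {x..u} y) \<partial>lborel)"
  proof (rule nn_integral_mono)
    fix y :: real
    show "ennreal (\<alpha> * y powr (- 1 - \<alpha>) * (y - x) powr (- \<alpha>)) * indicator {x..u} y \<le>
        ennreal (\<alpha> * x powr (- 1 - \<alpha>)) * (ennreal ((y - x) powr (- \<alpha>)) * indicator {x..u} y)"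
    proof (cases "y \<in> {x..u}")
      case True
      have "\<alpha> * y powr (- 1 - \<alpha>) * (y - x) powr (- \<alpha>) \<le> \<alpha> * x powr (- 1 - \<alpha>) * (y - x) powr (- \<alpha>)"
        using True x a by (intro mult_right_mono mult_left_mono powr_mono2') auto
      then have "ennreal (\<alpha> * y powr (- 1 - \<alpha>) * (y - x) powr (- \<alpha>)) \<le> ennreal (\<alpha> * x powr (- 1 - \<alpha>)) * ennreal ((y - x) powr (- \<alpha>))"
        by (subst ennreal_mult''[symmetric]) (auto intro: ennreal_leI)
      then show ?thesis using True by simp
    qed simp
  qed
  also have "\<dots> = ennreal (\<alpha> * x powr (- 1 - \<alpha>)) * (\<integral>\<^sup>+y. ennreal ((y - x) powr (- \<alpha>)) * indicator {x..u} y \<partial>lborel)"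
    by (rule nn_integral_cmult) measurable
  also have "\<dots> = ennreal (\<alpha> * x powr (- 1 - \<alpha>)) * ennreal ((u - x) powr (1 - \<alpha>) / (1 - \<alpha>))"
    using a x by (subst nn_integral_powr_shift') auto
  also have "\<dots> = ennreal (\<alpha> * x powr (- 1 - \<alpha>) * ((u - x) powr (1 - \<alpha>) / (1 - \<alpha>)))"
    using a by (intro ennreal_mult''[symmetric]) simp
  finally show ?thesis using x a
    by (simp add: rho_def add_left_mono)
qed

text \<open>Integrating \<open>rho\<close> over \<open>x\<close> under the inner integral leaves a function of \<open>y\<close> that differs from the
right-hand integrand by an exact derivative, whose integral is that of the boundary term in \<open>rho\<close>.\<close>

lemma rho_tail_integral:
  assumes a: "0 < \<alpha>" "\<alpha> < 1/2" and s: "0 \<le> s" "s \<le> u"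
  shows "(\<integral>\<^sup>+x. rho \<alpha> u x * indicator {s..u} x \<partial>lborel) =
    (\<integral>\<^sup>+y. ennreal (y powr (- \<alpha>) * (y - s) powr (- \<alpha>)) * indicator {s..u} y \<partial>lborel)"
proof -
  let ?p = "\<lambda>y. y powr (1 - \<alpha>) / (1 - \<alpha>)"
  let ?k = "\<lambda>x y. ennreal (\<alpha> * y powr (- 1 - \<alpha>) * (y - x) powr (- \<alpha>)) * (if s \<le> x \<and> x \<le> y \<and> y \<le> u then 1 else 0)"
  let ?d = "\<lambda>y. y powr (- \<alpha>) * (y - s) powr (- \<alpha>) - \<alpha> / (1 - \<alpha>) * y powr (- 1 - \<alpha>) * (y - s) powr (1 - \<alpha>)"
  let ?r = "\<lambda>y. \<alpha> / (1 - \<alpha>) * y powr (- 1 - \<alpha>) * (y - s) powr (1 - \<alpha>)"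
  have r_nn: "0 \<le> ?r y" for y using a by simp
  have d_nn: "0 \<le> ?d y" if y: "y \<in> {s..u}" for y
  proof (cases "y = 0")
    case False
    then have y0: "y > 0" using y s by auto
    define c where "c = \<alpha> / (1 - \<alpha>)"
    have e1: "y powr (- \<alpha>) = y powr (- 1 - \<alpha>) * y"
      using y0 powr_mult_base[of y "- 1 - \<alpha>"] by (simp add: mult.commute)
    have e2: "(y - s) powr (1 - \<alpha>) = (y - s) powr (- \<alpha>) * (y - s)"
      using y powr_mult_base[of "y - s" "- \<alpha>"] by (simp add: mult.commute)
    have "?d y = y powr (- 1 - \<alpha>) * (y - s) powr (- \<alpha>) * (y - \<alpha> / (1 - \<alpha>) * (y - s))"
      unfolding e1 e2 c_def[symmetric] by (simp add: algebra_simps)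
    moreover have "\<alpha> / (1 - \<alpha>) * (y - s) \<le> 1 * y" using a y s by (intro mult_mono) auto
    ultimately show ?thesis by simp
  qed simp
  have FT: "(\<integral>\<^sup>+y. ennreal (?d y) * indicator {s..u} y \<partial>lborel) = ennreal (u powr (- \<alpha>) * (?p (u - s)))"
  proof -
    have "(\<integral>\<^sup>+y. ennreal (?d y) * indicator {s..u} y \<partial>lebesgue) =
        ennreal (u powr (- \<alpha>) * (?p (u - s)) - s powr (- \<alpha>) * ((s - s) powr (1 - \<alpha>) / (1 - \<alpha>)))"
    proof (rule nn_integral_FTC)
      show "continuous_on {s..u} (\<lambda>y. y powr (- \<alpha>) * (?p (y - s)))"
      proof (cases "s = 0")
        case True
        have eq: "(\<lambda>y. y powr (- \<alpha>) * (?p (y - s))) = (\<lambda>y. y powr (1 - 2 * \<alpha>) / (1 - \<alpha>))"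
          by (auto simp: True simp flip: powr_add)
        show ?thesis unfolding eq using a s by (intro continuous_intros continuous_on_powr') auto
      next
        case False
        then show ?thesis using a s by (intro continuous_intros continuous_on_powr') auto
      qed
      show "((\<lambda>y. y powr (- \<alpha>) * (?p (y - s))) has_real_derivative ?d y) (at y)" if "y \<in> {s<..<u}" for y
      proof -
        have "((\<lambda>y. y powr (- \<alpha>) * (?p (y - s))) has_real_derivative
            (- \<alpha>) * y powr (- \<alpha> - 1) * (?p (y - s)) + ((1 - \<alpha>) * (y - s) powr (1 - \<alpha> - 1) / (1 - \<alpha>)) * y powr (- \<alpha>)) (at y)"
          using that s a by (auto intro!: derivative_eq_intros simp: diff_divide_distrib)
        moreover have "(- \<alpha>) * y powr (- \<alpha> - 1) * (?p (y - s)) + ((1 - \<alpha>) * (y - s) powr (1 - \<alpha> - 1) / (1 - \<alpha>)) * y powr (- \<alpha>) = ?d y"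
        proof -
          have e: "- \<alpha> - 1 = - 1 - \<alpha>" by simp
          show ?thesis unfolding e using a by simp
        qed
        ultimately show ?thesis by simp
      qed
    qed (use s d_nn in auto)
    then show ?thesis unfolding nn_integral_completion by simp
  qed
  have "AE x in lborel. x \<noteq> 0 \<and> x \<noteq> u" using AE_lborel_singleton[of 0] AE_lborel_singleton[of u] by eventually_elim simp
  then have "(\<integral>\<^sup>+x. rho \<alpha> u x * indicator {s..u} x \<partial>lborel) =
     (\<integral>\<^sup>+x. ennreal (u powr (- \<alpha>)) * (ennreal ((u - x) powr (- \<alpha>)) * indicator {s..u} x) + (\<integral>\<^sup>+y. ?k x y \<partial>lborel) \<partial>lborel)"
  proof (intro nn_integral_cong_AE, eventually_elim)
    fix x :: real assume x: "x \<noteq> 0 \<and> x \<noteq> u"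
    show "rho \<alpha> u x * indicator {s..u} x = ennreal (u powr (- \<alpha>)) * (ennreal ((u - x) powr (- \<alpha>)) * indicator {s..u} x) + (\<integral>\<^sup>+y. ?k x y \<partial>lborel)"
    proof (cases "x \<in> {s..u}")
      case True
      then have x': "0 < x" "x < u" "s \<le> x" using x s by auto
      have "(\<integral>\<^sup>+y. ?k x y \<partial>lborel) = (\<integral>\<^sup>+y. ennreal (\<alpha> * y powr (- 1 - \<alpha>) * (y - x) powr (- \<alpha>)) * indicator {x..u} y \<partial>lborel)"
        using x' by (intro nn_integral_cong) (auto simp: indicator_def)
      then show ?thesis using x' by (simp add: rho_def ennreal_mult)
    next
      case False
      then have z: "?k x y = 0" for y by auto
      show ?thesis unfolding z using False by auto
    qed
  qed
  also have "\<dots> = (\<integral>\<^sup>+x. ennreal (u powr (- \<alpha>)) * (ennreal ((u - x) powr (- \<alpha>)) * indicator {s..u} x) \<partial>lborel) +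
      (\<integral>\<^sup>+x. (\<integral>\<^sup>+y. ?k x y \<partial>lborel) \<partial>lborel)"
    by (rule nn_integral_add) measurable
  also have "(\<integral>\<^sup>+x. (\<integral>\<^sup>+y. ?k x y \<partial>lborel) \<partial>lborel) = (\<integral>\<^sup>+y. (\<integral>\<^sup>+x. ?k x y \<partial>lborel) \<partial>lborel)"
    by (rule lborel_pair.Fubini') measurable
  also have "\<dots> = (\<integral>\<^sup>+y. ennreal (?r y) * indicator {s..u} y \<partial>lborel)"
  proof (rule nn_integral_cong)
    fix y :: real
    show "(\<integral>\<^sup>+x. ?k x y \<partial>lborel) = ennreal (?r y) * indicator {s..u} y"
    proof (cases "y \<in> {s..u}")
      case True
      have "(\<integral>\<^sup>+x. ?k x y \<partial>lborel) = (\<integral>\<^sup>+x. ennreal (\<alpha> * y powr (- 1 - \<alpha>)) * (ennreal ((y - x) powr (- \<alpha>)) * indicator {s..y} x) \<partial>lborel)"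
        using True a by (intro nn_integral_cong) (auto simp: indicator_def ennreal_mult'')
      also have "\<dots> = ennreal (\<alpha> * y powr (- 1 - \<alpha>)) * (\<integral>\<^sup>+x. ennreal ((y - x) powr (- \<alpha>)) * indicator {s..y} x \<partial>lborel)"
        by (rule nn_integral_cmult) measurable
      also have "\<dots> = ennreal (\<alpha> * y powr (- 1 - \<alpha>)) * ennreal (?p (y - s))"
        using a True by (subst nn_integral_powr_shift) auto
      also have "\<dots> = ennreal (\<alpha> * y powr (- 1 - \<alpha>) * (?p (y - s)))"
        using a by (intro ennreal_mult''[symmetric]) simp
      finally show ?thesis using True by simp
    next
      case False
      then have z: "?k x y = 0" for x by auto
      show ?thesis unfolding z using False by auto
    qed
  qed
  also have "(\<integral>\<^sup>+x. ennreal (u powr (- \<alpha>)) * (ennreal ((u - x) powr (- \<alpha>)) * indicator {s..u} x) \<partial>lborel) =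
      ennreal (u powr (- \<alpha>)) * (\<integral>\<^sup>+x. ennreal ((u - x) powr (- \<alpha>)) * indicator {s..u} x \<partial>lborel)"
    by (rule nn_integral_cmult) measurable
  also have "\<dots> = ennreal (u powr (- \<alpha>)) * ennreal (?p (u - s))"
    using a s by (subst nn_integral_powr_shift) auto
  also have "\<dots> = ennreal (u powr (- \<alpha>) * (?p (u - s)))"
    by (rule ennreal_mult'[symmetric]) simp
  also have "\<dots> = (\<integral>\<^sup>+y. ennreal (?d y) * indicator {s..u} y \<partial>lborel)" by (rule FT[symmetric])
  also have "(\<integral>\<^sup>+y. ennreal (?d y) * indicator {s..u} y \<partial>lborel) + (\<integral>\<^sup>+y. ennreal (?r y) * indicator {s..u} y \<partial>lborel) =
      (\<integral>\<^sup>+y. ennreal (?d y) * indicator {s..u} y + ennreal (?r y) * indicator {s..u} y \<partial>lborel)"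
    by (rule nn_integral_add[symmetric]) measurable
  also have "\<dots> = (\<integral>\<^sup>+y. ennreal (y powr (- \<alpha>) * (y - s) powr (- \<alpha>)) * indicator {s..u} y \<partial>lborel)"
  proof (rule nn_integral_cong)
    fix y :: real
    show "ennreal (?d y) * indicator {s..u} y + ennreal (?r y) * indicator {s..u} y = ennreal (y powr (- \<alpha>) * (y - s) powr (- \<alpha>)) * indicator {s..u} y"
    proof (cases "y \<in> {s..u}")
      case True
      have "ennreal (?d y) + ennreal (?r y) = ennreal (?d y + ?r y)"
        by (rule ennreal_plus[symmetric, OF d_nn[OF True] r_nn])
      then show ?thesis using True by simp
    qed simp
  qed
  finally show ?thesis .
qed

text \<open>The derivative in \<open>s\<close> of \<open>s powr (2 * \<alpha>) * rho \<alpha> v s\<close>.\<close>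

definition rho_density :: "real \<Rightarrow> real \<Rightarrow> real \<Rightarrow> real" where
  "rho_density \<alpha> v s = \<alpha> * v powr (1 - \<alpha>) * s powr (2 * \<alpha> - 1) * (v - s) powr (- \<alpha> - 1)"

lemma borel_measurable_rho_density [measurable]: "rho_density \<alpha> v \<in> borel_measurable borel"
  unfolding rho_density_def[abs_def] by measurable

text \<open>The substitution \<open>y = x v / s\<close> exchanges the endpoints of \<open>[x,v]\<close>; a reflection restores the
orientation.\<close>

lemma nn_integral_inversion:
  assumes a: "0 < \<alpha>" "\<alpha> < 1/2" and x: "0 < x" "x < v"
  shows "(\<integral>\<^sup>+y. ennreal (y powr (- 1 - \<alpha>) * (y - x) powr (- \<alpha>)) * indicator {x..v} y \<partial>lborel) =
    ennreal (x powr (- 2 * \<alpha>) * v powr (- \<alpha>)) *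
      (\<integral>\<^sup>+s. ennreal (s powr (2 * \<alpha> - 1) * (v - s) powr (- \<alpha>)) * indicator {x..v} s \<partial>lborel)"
proof -
  \<comment> \<open>The decreasing map \<open>s \<mapsto> x * v / s\<close> after the reflection \<open>s = x + v - \<sigma>\<close>, hence increasing.\<close>
  define g where "g \<sigma> = x * v / (x + v - \<sigma>)" for \<sigma>
  define g' where "g' \<sigma> = x * v / (x + v - \<sigma>)\<^sup>2" for \<sigma>
  let ?f = "\<lambda>y. y powr (- 1 - \<alpha>) * (y - x) powr (- \<alpha>)"
  let ?w = "\<lambda>s. s powr (2 * \<alpha> - 1) * (v - s) powr (- \<alpha>)"
  let ?c = "x powr (- 2 * \<alpha>) * v powr (- \<alpha>)"
  have gxv: "g x = x" "g v = v" using x by (auto simp: g_def)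
  have "(\<integral>\<^sup>+y. ennreal (?f y) * indicator {x..v} y \<partial>lborel) = (\<integral>\<^sup>+y. ?f y * indicator {g x..g v} y \<partial>lborel)"
    unfolding gxv by (intro nn_integral_cong) (auto simp: indicator_def)
  also have "\<dots> = (\<integral>\<^sup>+\<sigma>. ?f (g \<sigma>) * g' \<sigma> * indicator {x..v} \<sigma> \<partial>lborel)"
  proof (rule nn_integral_substitution)
    show "set_borel_measurable borel {g x..g v} ?f"
      unfolding set_borel_measurable_def by measurable
    show "(g has_real_derivative g' \<sigma>) (at \<sigma>)" if "\<sigma> \<in> {x..v}" for \<sigma>
      unfolding g_def[abs_def] g'_def using that x
      by (auto intro!: derivative_eq_intros simp: power2_eq_square)
    show "continuous_on {x..v} g'"
      unfolding g'_def[abs_def] using x by (intro continuous_intros) auto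
    show "0 \<le> g' \<sigma>" if "\<sigma> \<in> {x..v}" for \<sigma> using x by (simp add: g'_def)
  qed (use x in auto)
  also have "\<dots> = (\<integral>\<^sup>+\<sigma>. ennreal ?c * (ennreal (?w ((x + v) + (- 1) * \<sigma>)) * indicator {x..v} ((x + v) + (- 1) * \<sigma>)) \<partial>lborel)"
  proof (rule nn_integral_cong)
    fix \<sigma> :: real
    show "ennreal (?f (g \<sigma>) * g' \<sigma> * indicator {x..v} \<sigma>) =
      ennreal ?c * (ennreal (?w ((x + v) + (- 1) * \<sigma>)) * indicator {x..v} ((x + v) + (- 1) * \<sigma>))"
    proof (cases "\<sigma> \<in> {x..v}")
      case True
      define s where "s = x + v - \<sigma>"
      have s: "x \<le> s" "s \<le> v" "0 < s" "(x + v) + (- 1) * \<sigma> = s" using True x by (auto simp: s_def)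
      have gs: "g \<sigma> = x * v / s" "g' \<sigma> = x * v / s\<^sup>2" by (auto simp: g_def g'_def s_def)
      have gx: "g \<sigma> - x = x * (v - s) / s" using s x by (simp add: gs field_simps)
      have "?f (g \<sigma>) * g' \<sigma> = ?c * ?w s"
      proof -
        have s2: "s\<^sup>2 = s powr 2" using s by simp
        have xv: "x = x powr 1" "v = v powr 1" using x by simp_all
        have p1: "(x * v / s) powr (- 1 - \<alpha>) = x powr (- 1 - \<alpha>) * v powr (- 1 - \<alpha>) * s powr (1 + \<alpha>)"
          using x s by (simp add: powr_divide powr_mult powr_minus_divide powr_diff powr_add field_simps)
        have p2: "(x * (v - s) / s) powr (- \<alpha>) = x powr (- \<alpha>) * (v - s) powr (- \<alpha>) * s powr \<alpha>"
          using x s by (simp add: powr_divide powr_mult powr_minus_divide)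
        have p3: "x powr (- 1 - \<alpha>) * x powr (- \<alpha>) * x = x powr (- 2 * \<alpha>)"
        proof -
          have "x powr (- 1 - \<alpha>) * x powr (- \<alpha>) * x powr 1 = x powr (- 2 * \<alpha>)"
            unfolding powr_add[symmetric] by simp
          then show ?thesis using x by simp
        qed
        have p4: "v powr (- 1 - \<alpha>) * v = v powr (- \<alpha>)"
          using powr_mult_base[of v "- 1 - \<alpha>"] x by (simp add: mult.commute)
        have p5: "s powr (1 + \<alpha>) * s powr \<alpha> / s powr 2 = s powr (2 * \<alpha> - 1)"
          unfolding powr_add[symmetric] powr_diff[symmetric] by simp
        have "?f (g \<sigma>) * g' \<sigma> = (x powr (- 1 - \<alpha>) * v powr (- 1 - \<alpha>) * s powr (1 + \<alpha>)) *
            (x powr (- \<alpha>) * (v - s) powr (- \<alpha>) * s powr \<alpha>) * (x * v / s powr 2)"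
          unfolding gx unfolding gs p1 p2 s2 ..
        also have "\<dots> = (x powr (- 1 - \<alpha>) * x powr (- \<alpha>) * x) * (v powr (- 1 - \<alpha>) * v) *
            (s powr (1 + \<alpha>) * s powr \<alpha> / s powr 2) * (v - s) powr (- \<alpha>)"
          by (simp add: algebra_simps)
        also have "\<dots> = ?c * ?w s" unfolding p3 p4 p5 by (simp add: algebra_simps)
        finally show ?thesis .
      qed
      moreover have "ennreal ?c * ennreal (?w s) = ennreal (?c * ?w s)" by (rule ennreal_mult[symmetric]) auto
      ultimately show ?thesis using True s by simp
    next
      case False
      then have "(x + v) + (- 1) * \<sigma> \<notin> {x..v}" by auto
      then show ?thesis using False by simp
    qed
  qed
  also have "\<dots> = (\<integral>\<^sup>+s. ennreal ?c * (ennreal (?w s) * indicator {x..v} s) \<partial>lborel)"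
    by (subst nn_integral_real_affine[where c = "- 1" and t = "x + v"]) (auto, measurable)
  also have "\<dots> = ennreal ?c * (\<integral>\<^sup>+s. ennreal (?w s) * indicator {x..v} s \<partial>lborel)"
    by (rule nn_integral_cmult) measurable
  finally show ?thesis .
qed

text \<open>Inversion turns the inner integral of \<open>rho\<close> into an integral whose dependence on \<open>x\<close> is only
through its lower limit. Completing it to \<open>[0,v]\<close> gives the constant; the rest is the exact
derivative of \<open>s powr (2 * \<alpha>) * v powr (-\<alpha>) * (v - s) powr (-\<alpha>)\<close>.\<close>

lemma rho_cumulative:
  assumes a: "0 < \<alpha>" "\<alpha> < 1/2" and x: "0 < x" "x < v"
  shows "ennreal (x powr (2 * \<alpha>)) * rho \<alpha> v x = ennreal (\<alpha> * Beta (2 * \<alpha>) (1 - \<alpha>)) +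
    (\<integral>\<^sup>+s. ennreal (rho_density \<alpha> v s) * indicator {0..x} s \<partial>lborel)"
proof -
  let ?w = "\<lambda>s. s powr (2 * \<alpha> - 1) * (v - s) powr (- \<alpha>)"
  let ?c = "\<alpha> * v powr (- \<alpha>)"
  let ?I = "\<lambda>A. \<integral>\<^sup>+s. ennreal (?w s) * indicator A s \<partial>lborel"
  let ?Q = "\<integral>\<^sup>+s. ennreal (rho_density \<alpha> v s) * indicator {0..x} s \<partial>lborel"
  have c0: "0 \<le> ?c" using a by simp
  have tot: "ennreal ?c * ?I {0..v} = ennreal (\<alpha> * Beta (2 * \<alpha>) (1 - \<alpha>))"
  proof -
    have "?I {0..v} = ennreal (Beta (2 * \<alpha>) (1 - \<alpha>) * v powr \<alpha>)"
      using nn_integral_Beta_two_factors[of "2 * \<alpha>" "1 - \<alpha>" 0 v] a x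
      unfolding nn_integral_completion by simp
    then have "ennreal ?c * ?I {0..v} = ennreal (?c * (Beta (2 * \<alpha>) (1 - \<alpha>) * v powr \<alpha>))"
      using c0 by (simp add: ennreal_mult')
    also have "?c * (Beta (2 * \<alpha>) (1 - \<alpha>) * v powr \<alpha>) = \<alpha> * Beta (2 * \<alpha>) (1 - \<alpha>)"
      using x by (simp add: powr_minus)
    finally show ?thesis .
  qed
  have split: "?I {0..v} = ?I {0..x} + ?I {x..v}"
  proof -
    have "AE s in lborel. s \<noteq> x" by (rule AE_lborel_singleton)
    then have "?I {0..v} = (\<integral>\<^sup>+s. ennreal (?w s) * indicator {0..x} s + ennreal (?w s) * indicator {x..v} s \<partial>lborel)"
      using x by (intro nn_integral_cong_AE) (auto elim!: eventually_mono simp: indicator_def)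
    also have "\<dots> = ?I {0..x} + ?I {x..v}" by (rule nn_integral_add) measurable
    finally show ?thesis .
  qed
  have FT: "ennreal (x powr (2 * \<alpha>) * v powr (- \<alpha>) * (v - x) powr (- \<alpha>)) = ?Q + ennreal ?c * ?I {0..x}"
  proof -
    have "(\<integral>\<^sup>+s. ennreal (rho_density \<alpha> v s + ?c * ?w s) * indicator {0..x} s \<partial>lebesgue) =
      ennreal (x powr (2 * \<alpha>) * v powr (- \<alpha>) * (v - x) powr (- \<alpha>) - 0 powr (2 * \<alpha>) * v powr (- \<alpha>) * (v - 0) powr (- \<alpha>))"
    proof (rule nn_integral_FTC)
      show "continuous_on {0..x} (\<lambda>s. s powr (2 * \<alpha>) * v powr (- \<alpha>) * (v - s) powr (- \<alpha>))"
        using a x by (intro continuous_intros continuous_on_powr') auto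
      show "((\<lambda>s. s powr (2 * \<alpha>) * v powr (- \<alpha>) * (v - s) powr (- \<alpha>)) has_real_derivative rho_density \<alpha> v s + ?c * ?w s) (at s)"
        if s: "s \<in> {0<..<x}" for s
      proof -
        have D: "((\<lambda>s. s powr (2 * \<alpha>) * v powr (- \<alpha>) * (v - s) powr (- \<alpha>)) has_real_derivative
            2 * \<alpha> * s powr (2 * \<alpha> - 1) * v powr (- \<alpha>) * (v - s) powr (- \<alpha>) +
            \<alpha> * (v - s) powr (- \<alpha> - 1) * (s powr (2 * \<alpha>) * v powr (- \<alpha>))) (at s)"
          using s x by (auto intro!: derivative_eq_intros)
        have e1: "s powr (2 * \<alpha>) = s powr (2 * \<alpha> - 1) * s"
          using s powr_mult_base[of s "2 * \<alpha> - 1"] by (simp add: mult.commute)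
        have e2: "(v - s) powr (- \<alpha>) = (v - s) powr (- \<alpha> - 1) * (v - s)"
          using s x powr_mult_base[of "v - s" "- \<alpha> - 1"] by (simp add: mult.commute)
        have e3: "v powr (1 - \<alpha>) = v powr (- \<alpha>) * v"
          using x powr_mult_base[of v "- \<alpha>"] by (simp add: mult.commute)
        have "2 * \<alpha> * s powr (2 * \<alpha> - 1) * v powr (- \<alpha>) * (v - s) powr (- \<alpha>) +
            \<alpha> * (v - s) powr (- \<alpha> - 1) * (s powr (2 * \<alpha>) * v powr (- \<alpha>)) = rho_density \<alpha> v s + ?c * ?w s"
          unfolding rho_density_def e1 e2 e3 by (simp add: algebra_simps)
        with D show ?thesis by simp
      qed
    qed (use a x in \<open>auto simp: rho_density_def\<close>)
    then have "ennreal (x powr (2 * \<alpha>) * v powr (- \<alpha>) * (v - x) powr (- \<alpha>)) =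
      (\<integral>\<^sup>+s. ennreal (rho_density \<alpha> v s + ?c * ?w s) * indicator {0..x} s \<partial>lborel)"
      unfolding nn_integral_completion using a by simp
    also have "\<dots> = (\<integral>\<^sup>+s. ennreal (rho_density \<alpha> v s) * indicator {0..x} s + ennreal ?c * (ennreal (?w s) * indicator {0..x} s) \<partial>lborel)"
    proof (rule nn_integral_cong)
      fix s :: real
      have "ennreal (rho_density \<alpha> v s + ?c * ?w s) = ennreal (rho_density \<alpha> v s) + ennreal (?c * ?w s)"
        using a by (intro ennreal_plus) (auto simp: rho_density_def)
      moreover have "ennreal (?c * ?w s) = ennreal ?c * ennreal (?w s)" using c0 by (intro ennreal_mult) auto
      ultimately show "ennreal (rho_density \<alpha> v s + ?c * ?w s) * indicator {0..x} s =
          ennreal (rho_density \<alpha> v s) * indicator {0..x} s + ennreal ?c * (ennreal (?w s) * indicator {0..x} s)"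
        by (simp add: indicator_def)
    qed
    also have "\<dots> = ?Q + (\<integral>\<^sup>+s. ennreal ?c * (ennreal (?w s) * indicator {0..x} s) \<partial>lborel)"
      by (rule nn_integral_add) measurable
    also have "(\<integral>\<^sup>+s. ennreal ?c * (ennreal (?w s) * indicator {0..x} s) \<partial>lborel) = ennreal ?c * ?I {0..x}"
      by (rule nn_integral_cmult) measurable
    finally show ?thesis .
  qed
  have R: "ennreal (x powr (2 * \<alpha>)) * rho \<alpha> v x = ennreal (x powr (2 * \<alpha>) * v powr (- \<alpha>) * (v - x) powr (- \<alpha>)) + ennreal ?c * ?I {x..v}"
  proof -
    have "(\<integral>\<^sup>+y. ennreal (\<alpha> * y powr (- 1 - \<alpha>) * (y - x) powr (- \<alpha>)) * indicator {x..v} y \<partial>lborel) =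
      (\<integral>\<^sup>+y. ennreal \<alpha> * (ennreal (y powr (- 1 - \<alpha>) * (y - x) powr (- \<alpha>)) * indicator {x..v} y) \<partial>lborel)"
      using a by (intro nn_integral_cong) (simp add: indicator_def mult.assoc ennreal_mult')
    also have "\<dots> = ennreal \<alpha> * (\<integral>\<^sup>+y. ennreal (y powr (- 1 - \<alpha>) * (y - x) powr (- \<alpha>)) * indicator {x..v} y \<partial>lborel)"
      by (rule nn_integral_cmult) measurable
    also have "\<dots> = ennreal \<alpha> * (ennreal (x powr (- 2 * \<alpha>) * v powr (- \<alpha>)) * ?I {x..v})"
      by (simp only: nn_integral_inversion[OF a x])
    finally have J: "(\<integral>\<^sup>+y. ennreal (\<alpha> * y powr (- 1 - \<alpha>) * (y - x) powr (- \<alpha>)) * indicator {x..v} y \<partial>lborel) =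
      ennreal \<alpha> * (ennreal (x powr (- 2 * \<alpha>) * v powr (- \<alpha>)) * ?I {x..v})" .
    have r: "rho \<alpha> v x = ennreal (v powr (- \<alpha>) * (v - x) powr (- \<alpha>)) + ennreal \<alpha> * (ennreal (x powr (- 2 * \<alpha>) * v powr (- \<alpha>)) * ?I {x..v})"
      unfolding rho_def J using x by simp
    have k1: "ennreal (x powr (2 * \<alpha>)) * ennreal (v powr (- \<alpha>) * (v - x) powr (- \<alpha>)) = ennreal (x powr (2 * \<alpha>) * v powr (- \<alpha>) * (v - x) powr (- \<alpha>))"
      by (subst ennreal_mult[symmetric]) (auto simp: mult.assoc)
    have k2: "ennreal (x powr (2 * \<alpha>)) * ennreal \<alpha> * ennreal (x powr (- 2 * \<alpha>) * v powr (- \<alpha>)) = ennreal ?c"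
    proof -
      have "ennreal (x powr (2 * \<alpha>)) * ennreal \<alpha> * ennreal (x powr (- 2 * \<alpha>) * v powr (- \<alpha>)) =
         ennreal (x powr (2 * \<alpha>) * \<alpha> * (x powr (- 2 * \<alpha>) * v powr (- \<alpha>)))"
        using a by (simp add: ennreal_mult')
      also have "x powr (2 * \<alpha>) * \<alpha> * (x powr (- 2 * \<alpha>) * v powr (- \<alpha>)) = ?c"
        using x by (simp add: powr_minus)
      finally show ?thesis .
    qed
    show ?thesis unfolding r distrib_left k1 by (simp add: k2[symmetric] mult.assoc)
  qed
  have "ennreal (x powr (2 * \<alpha>)) * rho \<alpha> v x = ?Q + ennreal ?c * ?I {0..v}"
    unfolding R FT split distrib_left by (simp add: add.assoc)
  then show ?thesis unfolding tot by (simp add: add.commute)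
qed

text \<open>Expand only the factor with the later time by \<open>rho_cumulative\<close>. After exchanging integrals the other
factor occurs through its tail integrals, and the integral against \<open>rho_density\<close> is a Beta integral
with three factors.\<close>

lemma rho_product_integral:
  assumes a: "0 < \<alpha>" "\<alpha> < 1/2" and uv: "0 \<le> u" "u \<le> v"
  shows "(\<integral>\<^sup>+x. ennreal (x powr (2 * \<alpha>)) * rho \<alpha> u x * rho \<alpha> v x \<partial>lborel) =
    ennreal (\<alpha> * Beta (2 * \<alpha>) (1 - \<alpha>) / (1 - 2 * \<alpha>) *
      (u powr (1 - 2 * \<alpha>) + v powr (1 - 2 * \<alpha>) - (v - u) powr (1 - 2 * \<alpha>)))"
proof -
  let ?m = "\<lambda>s y. ennreal (rho_density \<alpha> v s * (y - s) powr (- \<alpha>)) * (if 0 \<le> s \<and> s \<le> y then 1 else 0)"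
  let ?p = "\<lambda>x. x powr (1 - 2 * \<alpha>) / (1 - 2 * \<alpha>)"
  define D where "D = \<alpha> * Beta (2 * \<alpha>) (1 - \<alpha>)"
  have D: "0 \<le> D" using a by (simp add: D_def Beta_real_pos less_imp_le)
  let ?q = "\<lambda>x s. ennreal (rho_density \<alpha> v s) * (if 0 \<le> s \<and> s \<le> x then 1 else 0)"
  let ?q' = "\<lambda>s. ennreal (rho_density \<alpha> v s) * indicator {0..u} s"
  let ?y = "\<lambda>y. ennreal (y powr (- \<alpha>)) * indicator {0..u} y"
  have q0: "0 \<le> rho_density \<alpha> v s" for s using a by (simp add: rho_density_def)
  have "(\<integral>\<^sup>+x. ennreal (x powr (2 * \<alpha>)) * rho \<alpha> u x * rho \<alpha> v x \<partial>lborel) =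
      (\<integral>\<^sup>+x. ennreal D * rho \<alpha> u x + (\<integral>\<^sup>+s. rho \<alpha> u x * ?q x s \<partial>lborel) \<partial>lborel)"
  proof (rule nn_integral_cong)
    fix x :: real
    show "ennreal (x powr (2 * \<alpha>)) * rho \<alpha> u x * rho \<alpha> v x = ennreal D * rho \<alpha> u x + (\<integral>\<^sup>+s. rho \<alpha> u x * ?q x s \<partial>lborel)"
    proof (cases "0 < x \<and> x < u")
      case True
      have "(\<integral>\<^sup>+s. ?q x s \<partial>lborel) = (\<integral>\<^sup>+s. ennreal (rho_density \<alpha> v s) * indicator {0..x} s \<partial>lborel)"
        by (intro nn_integral_cong) (auto simp: indicator_def)
      then have "ennreal (x powr (2 * \<alpha>)) * rho \<alpha> v x = ennreal D + (\<integral>\<^sup>+s. ?q x s \<partial>lborel)"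
        using rho_cumulative[OF a, of x v] True uv by (simp add: D_def)
      moreover have "(\<integral>\<^sup>+s. rho \<alpha> u x * ?q x s \<partial>lborel) = rho \<alpha> u x * (\<integral>\<^sup>+s. ?q x s \<partial>lborel)"
        by (rule nn_integral_cmult) measurable
      ultimately show ?thesis
        by (simp only: mult.assoc mult.left_commute[of _ "rho \<alpha> u x"] distrib_left mult.commute[of "ennreal D"])
    next
      case False
      then have "rho \<alpha> u x = 0" by (simp add: rho_def)
      then show ?thesis by simp
    qed
  qed
  also have "\<dots> = (\<integral>\<^sup>+x. ennreal D * rho \<alpha> u x \<partial>lborel) + (\<integral>\<^sup>+x. (\<integral>\<^sup>+s. rho \<alpha> u x * ?q x s \<partial>lborel) \<partial>lborel)"
    by (rule nn_integral_add) measurable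
  also have "(\<integral>\<^sup>+x. ennreal D * rho \<alpha> u x \<partial>lborel) = ennreal (D * (?p u))"
  proof -
    have "(\<integral>\<^sup>+x. ennreal D * rho \<alpha> u x \<partial>lborel) = ennreal D * (\<integral>\<^sup>+x. rho \<alpha> u x \<partial>lborel)"
      by (rule nn_integral_cmult) measurable
    also have "(\<integral>\<^sup>+x. rho \<alpha> u x \<partial>lborel) = (\<integral>\<^sup>+x. rho \<alpha> u x * indicator {0..u} x \<partial>lborel)"
      by (intro nn_integral_cong) (auto simp: rho_def indicator_def)
    also have "\<dots> = (\<integral>\<^sup>+y. ennreal ((y - 0) powr (- (2 * \<alpha>))) * indicator {0..u} y \<partial>lborel)"
      unfolding rho_tail_integral[OF a order_refl uv(1)]
      by (intro nn_integral_cong) (auto simp: indicator_def simp flip: powr_add)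
    also have "\<dots> = ennreal (?p u)"
      using a uv by (subst nn_integral_powr_shift') auto
    finally show ?thesis by (simp only: ennreal_mult'[OF D])
  qed
  also have "(\<integral>\<^sup>+x. (\<integral>\<^sup>+s. rho \<alpha> u x * ?q x s \<partial>lborel) \<partial>lborel) = (\<integral>\<^sup>+s. (\<integral>\<^sup>+x. rho \<alpha> u x * ?q x s \<partial>lborel) \<partial>lborel)"
    by (rule lborel_pair.Fubini') measurable
  also have "\<dots> = (\<integral>\<^sup>+s. (\<integral>\<^sup>+y. ?y y * (?m s y) \<partial>lborel) \<partial>lborel)"
  proof (rule nn_integral_cong)
    fix s :: real
    show "(\<integral>\<^sup>+x. rho \<alpha> u x * ?q x s \<partial>lborel) =
      (\<integral>\<^sup>+y. ?y y * (?m s y) \<partial>lborel)"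
    proof (cases "0 \<le> s \<and> s \<le> u")
      case True
      have "(\<integral>\<^sup>+x. rho \<alpha> u x * ?q x s \<partial>lborel) = (\<integral>\<^sup>+x. ennreal (rho_density \<alpha> v s) * (rho \<alpha> u x * indicator {s..u} x) \<partial>lborel)"
        using True by (intro nn_integral_cong) (auto simp: indicator_def rho_def mult.commute)
      also have "\<dots> = ennreal (rho_density \<alpha> v s) * (\<integral>\<^sup>+x. rho \<alpha> u x * indicator {s..u} x \<partial>lborel)"
        by (rule nn_integral_cmult) measurable
      also have "\<dots> = ennreal (rho_density \<alpha> v s) * (\<integral>\<^sup>+y. ennreal (y powr (- \<alpha>) * (y - s) powr (- \<alpha>)) * indicator {s..u} y \<partial>lborel)"
        using True by (simp only: rho_tail_integral[OF a])
      also have "\<dots> = (\<integral>\<^sup>+y. ennreal (rho_density \<alpha> v s) * (ennreal (y powr (- \<alpha>) * (y - s) powr (- \<alpha>)) * indicator {s..u} y) \<partial>lborel)"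
        by (rule nn_integral_cmult[symmetric]) measurable
      also have "\<dots> = (\<integral>\<^sup>+y. ?y y * (?m s y) \<partial>lborel)"
        using True q0[of s] by (intro nn_integral_cong) (auto simp: indicator_def ennreal_mult ac_simps)
      finally show ?thesis .
    next
      case False
      then have z: "rho \<alpha> u x * ?q x s = 0" for x by (auto simp: rho_def)
      have z': "?y y * (?m s y) = 0" for y
        using False by (auto simp: indicator_def)
      show ?thesis unfolding z z' by simp
    qed
  qed
  also have "\<dots> = (\<integral>\<^sup>+y. (\<integral>\<^sup>+s. ?y y * (?m s y) \<partial>lborel) \<partial>lborel)"
    by (rule lborel_pair.Fubini') measurable
  also have "\<dots> = (\<integral>\<^sup>+y. ennreal (D * (v - y) powr (- 2 * \<alpha>)) * indicator {0..u} y \<partial>lborel)"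
  proof -
    have "AE y in lborel. y \<noteq> 0 \<and> y \<noteq> v" using AE_lborel_singleton[of 0] AE_lborel_singleton[of v] by eventually_elim simp
    then show ?thesis
    proof (intro nn_integral_cong_AE, eventually_elim)
      fix y :: real assume y: "y \<noteq> 0 \<and> y \<noteq> v"
      show "(\<integral>\<^sup>+s. ?y y * (?m s y) \<partial>lborel) =
          ennreal (D * (v - y) powr (- 2 * \<alpha>)) * indicator {0..u} y"
      proof (cases "y \<in> {0..u}")
        case True
        then have y': "0 < y" "y < v" using y uv by auto
        let ?k = "\<alpha> * v powr (1 - \<alpha>)"
        let ?z = "\<lambda>s. s powr (2 * \<alpha> - 1) * (y - s) powr (1 - \<alpha> - 1) * (v - s) powr (- (2 * \<alpha>) - (1 - \<alpha>))"
        have e: "1 - \<alpha> - 1 = - \<alpha>" "- (2 * \<alpha>) - (1 - \<alpha>) = - \<alpha> - 1" "2 * \<alpha> + (1 - \<alpha>) - 1 = \<alpha>" by simp_all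
        have "(\<integral>\<^sup>+s. ?y y * (?m s y) \<partial>lborel) =
          (\<integral>\<^sup>+s. ennreal (y powr (- \<alpha>) * ?k) * (ennreal (?z s) * indicator {0..y} s) \<partial>lborel)"
        proof (rule nn_integral_cong)
          fix s :: real
          have "ennreal (y powr (- \<alpha>)) * ennreal (rho_density \<alpha> v s * (y - s) powr (- \<alpha>)) = ennreal (y powr (- \<alpha>) * (rho_density \<alpha> v s * (y - s) powr (- \<alpha>)))"
            by (rule ennreal_mult'[symmetric]) simp
          also have "y powr (- \<alpha>) * (rho_density \<alpha> v s * (y - s) powr (- \<alpha>)) = y powr (- \<alpha>) * ?k * ?z s"
            unfolding e rho_density_def by (simp only: ac_simps)
          also have "ennreal (y powr (- \<alpha>) * ?k * ?z s) = ennreal (y powr (- \<alpha>) * ?k) * ennreal (?z s)"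
            using a by (intro ennreal_mult') simp
          finally show "?y y * (?m s y) =
            ennreal (y powr (- \<alpha>) * ?k) * (ennreal (?z s) * indicator {0..y} s)"
            using True by (auto simp: indicator_def)
        qed
        also have "\<dots> = ennreal (y powr (- \<alpha>) * ?k) * (\<integral>\<^sup>+s. ennreal (?z s) * indicator {0..y} s \<partial>lborel)"
          by (rule nn_integral_cmult) measurable
        also have "(\<integral>\<^sup>+s. ennreal (?z s) * indicator {0..y} s \<partial>lborel) =
            ennreal (Beta (2 * \<alpha>) (1 - \<alpha>) * y powr (2 * \<alpha> + (1 - \<alpha>) - 1) * (v - y) powr (- (2 * \<alpha>)) * v powr (- (1 - \<alpha>)))"
          using a y' by (intro nn_integral_Beta_three_factors[unfolded nn_integral_completion]) auto
        also have "ennreal (y powr (- \<alpha>) * ?k) * \<dots> = ennreal (y powr (- \<alpha>) * ?k * (Beta (2 * \<alpha>) (1 - \<alpha>) * y powr (2 * \<alpha> + (1 - \<alpha>) - 1) * (v - y) powr (- (2 * \<alpha>)) * v powr (- (1 - \<alpha>))))"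
          using a by (intro ennreal_mult'[symmetric]) simp
        also have "y powr (- \<alpha>) * ?k * (Beta (2 * \<alpha>) (1 - \<alpha>) * y powr (2 * \<alpha> + (1 - \<alpha>) - 1) * (v - y) powr (- (2 * \<alpha>)) * v powr (- (1 - \<alpha>))) =
            D * (v - y) powr (- 2 * \<alpha>)"
        proof -
          have e1: "y powr (- \<alpha>) * y powr \<alpha> = 1" using y' by (simp flip: powr_add)
          have e2: "v powr (1 - \<alpha>) * v powr (- (1 - \<alpha>)) = 1" using y' by (simp flip: powr_add)
          have "y powr (- \<alpha>) * ?k * (Beta (2 * \<alpha>) (1 - \<alpha>) * y powr (2 * \<alpha> + (1 - \<alpha>) - 1) * (v - y) powr (- (2 * \<alpha>)) * v powr (- (1 - \<alpha>))) =
            (y powr (- \<alpha>) * y powr \<alpha>) * (v powr (1 - \<alpha>) * v powr (- (1 - \<alpha>))) * (D * (v - y) powr (- 2 * \<alpha>))"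
            unfolding e D_def by (simp add: ac_simps)
          then show ?thesis unfolding e1 e2 by simp
        qed
        finally show ?thesis using True by simp
      qed simp
    qed
  qed
  also have "\<dots> = ennreal (- (D * (?p (v - u))) - (- (D * (?p (v - 0)))))"
  proof -
    have "(\<integral>\<^sup>+y. ennreal (D * (v - y) powr (- 2 * \<alpha>)) * indicator {0..u} y \<partial>lebesgue) =
      ennreal (- (D * (?p (v - u))) - (- (D * (?p (v - 0)))))"
    proof (rule nn_integral_FTC)
      show "continuous_on {0..u} (\<lambda>y. - (D * ((v - y) powr (1 - 2 * \<alpha>) / (1 - 2 * \<alpha>))))"
        using a uv by (intro continuous_intros continuous_on_powr') auto
      show "((\<lambda>y. - (D * ((v - y) powr (1 - 2 * \<alpha>) / (1 - 2 * \<alpha>)))) has_real_derivative D * (v - y) powr (- 2 * \<alpha>)) (at y)"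
        if "y \<in> {0<..<u}" for y
      proof -
        define e where "e = 1 - 2 * \<alpha>"
        have e: "e \<noteq> 0" "- 2 * \<alpha> = e - 1" using a by (auto simp: e_def)
        show ?thesis unfolding e(2) e_def[symmetric]
          using that uv e(1) by (auto intro!: derivative_eq_intros)
      qed
    qed (use uv D in auto)
    then show ?thesis unfolding nn_integral_completion .
  qed
  also have "ennreal (D * (?p u)) + \<dots> =
    ennreal (D * (?p u) + (- (D * (?p (v - u))) - (- (D * (?p (v - 0))))))"
  proof (rule ennreal_plus[symmetric])
    show "0 \<le> D * (?p u)" using D a by simp
    have "(v - u) powr (1 - 2 * \<alpha>) \<le> (v - 0) powr (1 - 2 * \<alpha>)" using uv a by (intro powr_mono2) auto
    then have "D * (?p (v - u)) \<le> D * (?p (v - 0))"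
      using D a by (intro mult_left_mono divide_right_mono) auto
    then show "0 \<le> - (D * (?p (v - u))) - (- (D * (?p (v - 0))))"
      by simp
  qed
  also have "D * (?p u) + (- (D * (?p (v - u))) - (- (D * (?p (v - 0))))) =
    D / (1 - 2 * \<alpha>) * (u powr (1 - 2 * \<alpha>) + v powr (1 - 2 * \<alpha>) - (v - u) powr (1 - 2 * \<alpha>))"
    by (simp add: add_divide_distrib diff_divide_distrib algebra_simps)
  finally show ?thesis unfolding D_def .
qed

text \<open>The counterpart of \<open>hurst_const_mult_Beta_gt\<close>: the Beta integral differs, the constant does not.\<close>

lemma hurst_const_mult_Beta_lt:
  assumes "0 < H" "H < 1/2"
  shows "hurst_const H * ((1/2 - H) * Beta (2 * (1/2 - H)) (1 - (1/2 - H)) / (1 - 2 * (1/2 - H)) / (Gamma (1 - (1/2 - H)))\<^sup>2) = 1/2"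
proof -
  define a where "a = 1/2 - H"
  have a: "0 < a" "a < 1/2" and Ha: "H = 1/2 - a" using assms by (auto simp: a_def)
  have g: "Gamma (1 + 2 * a) = 2 * a * Gamma (2 * a)"
  proof -
    have "2 * a \<notin> \<int>\<^sub>\<le>\<^sub>0" using nonpos_Ints_nonpos[of "2 * a"] a by auto
    then show ?thesis using Gamma_plus1[of "2 * a"] by (simp add: add.commute)
  qed
  have n: "Gamma (1 + a) \<noteq> 0" "Gamma (1 - a) \<noteq> 0" "Gamma (2 * a) \<noteq> 0"
    using Gamma_real_pos[of "1 + a"] Gamma_real_pos[of "1 - a"] Gamma_real_pos[of "2 * a"] a by linarith+
  have e: "3/2 - H = 1 + a" "H + 1/2 = 1 - a" "2 - 2 * H = 1 + 2 * a" "1 - 2 * a = 2 * H" "2 * a + (1 - a) = 1 + a"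
    by (auto simp: a_def field_simps)
  have "hurst_const H * (a * Beta (2 * a) (1 - a) / (1 - 2 * a) / (Gamma (1 - a))\<^sup>2) = 1/2"
    unfolding hurst_const_def Beta_def e g using n a assms by (simp add: field_simps power2_eq_square)
  then show ?thesis unfolding a_def .
qed

lemma L2_fun_dominated:
  fixes f :: "real \<Rightarrow> 'k::{banach, second_countable_topology}" and g :: "real \<Rightarrow> 'l::{banach, second_countable_topology}"
  assumes "g \<in> L2_fun t" "f \<in> borel_measurable (Leb t)" "\<And>x. x \<in> {0..t} \<Longrightarrow> norm (f x) \<le> norm (g x)"
  shows "f \<in> L2_fun t"
proof -
  have "L2_sq (Leb t) f \<le> L2_sq (Leb t) g"
    unfolding L2_sq_def using assms(3) by (intro nn_integral_mono ennreal_leI power_mono) auto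
  then show ?thesis using assms by (auto simp: L2_fun_iff intro: le_less_trans)
qed

lemma L2_fun_const: "(\<lambda>_. c) \<in> L2_fun t"
  for c :: "'k::{banach, second_countable_topology}"
proof -
  interpret finite_measure "Leb t" by (rule finite_measure_Icc)
  show ?thesis by (simp add: L2_fun_def)
qed

lemma rho_finite:
  assumes a: "0 < \<alpha>" "\<alpha> < 1/2"
  shows "rho \<alpha> u x < \<infinity>"
proof (cases "0 < x \<and> x < u")
  case True
  then show ?thesis using rho_le[OF a, of x u] by (auto intro: le_less_trans)
qed (auto simp: rho_def)

context
  fixes H t :: real
  assumes H: "0 < H" "H < 1/2" and t: "0 < t"
begin

text \<open>The fractional integral of the weighted indicator is the tail integral of \<open>rho\<close>, to which the
differentiation theorem applies; near \<open>u\<close>, the singularity of \<open>rho\<close> is that of an Abel kernel.\<close>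

lemma fbm_transform_indicator_lt_AE:
  assumes u: "u \<in> {0..t}"
  shows "AE x in Leb t. fbm_transform H t (indicat_real {0..u}) x =
    - (x powr (1/2 - H) * (enn2real (rho (1/2 - H) u x) / Gamma (1 - (1/2 - H))))"
proof -
  let ?M = "Leb t"
  define \<alpha> where "\<alpha> = 1/2 - H"
  have a: "0 < \<alpha>" "\<alpha> < 1/2" using H by (auto simp: \<alpha>_def)
  define \<Gamma> where "\<Gamma> = Gamma (1 - \<alpha>)"
  have \<Gamma>: "0 < \<Gamma>" unfolding \<Gamma>_def using a by (intro Gamma_real_pos) simp
  let ?\<psi> = "\<lambda>y. enn2real (rho \<alpha> u y) / \<Gamma>"
  let ?G = "frac_int t (1 - \<alpha>) (\<lambda>r. r powr (- \<alpha>) *\<^sub>R indicat_real {0..u} r)"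
  have \<psi>m: "?\<psi> \<in> borel_measurable borel" by measurable
  have AE: "AE x in ?M. (?G has_vector_derivative - ?\<psi> x) (at x)"
  proof (rule tail_integral_derivative_AE[OF t])
    fix \<delta> :: real assume d: "\<delta> > 0"
    define C where "C = \<alpha> * \<delta> powr (- 1 - \<alpha>) * (u powr (1 - \<alpha>) / (1 - \<alpha>)) / \<Gamma>"
    have C: "0 \<le> C" using a \<Gamma> by (simp add: C_def)
    have g: "(\<lambda>x. u powr (- \<alpha>) *\<^sub>R abel (1 - \<alpha>) x u + C) \<in> L2_fun t"
      by (intro L2_fun_add L2_fun_const L2_fun_linear[OF abel_in_L2_fun[OF a u]] bounded_linear_scaleR_right)
    show "(\<lambda>y. indicator {\<delta>..} y *\<^sub>R ?\<psi> y) \<in> L2_fun t"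
    proof (rule L2_fun_dominated[OF g])
      show "(\<lambda>y. indicator {\<delta>..} y *\<^sub>R ?\<psi> y) \<in> borel_measurable ?M"
        by (rule measurable_lebesgue_on_borel) measurable
      fix x assume x: "x \<in> {0..t}"
      have nn: "0 \<le> u powr (- \<alpha>) *\<^sub>R abel (1 - \<alpha>) x u + C"
        using a C abel_nonneg[of "1 - \<alpha>" x u] by simp
      show "norm (indicator {\<delta>..} x *\<^sub>R ?\<psi> x) \<le> norm (u powr (- \<alpha>) *\<^sub>R abel (1 - \<alpha>) x u + C)"
      proof (cases "\<delta> \<le> x \<and> x < u")
        case True
        then have x': "0 < x" "x < u" using d by auto
        let ?b = "u powr (- \<alpha>) * (u - x) powr (- \<alpha>) + \<alpha> * x powr (- 1 - \<alpha>) * ((u - x) powr (1 - \<alpha>) / (1 - \<alpha>))"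
        have b0: "0 \<le> ?b" using a by simp
        have "enn2real (rho \<alpha> u x) \<le> ?b"
          using enn2real_mono[OF rho_le[OF a x']] b0 by (simp add: enn2real_ennreal)
        also have "\<dots> \<le> u powr (- \<alpha>) * (u - x) powr (- \<alpha>) + \<alpha> * \<delta> powr (- 1 - \<alpha>) * (u powr (1 - \<alpha>) / (1 - \<alpha>))"
          using a x' d True by (intro add_mono order_refl mult_mono divide_right_mono powr_mono2 powr_mono2') auto
        finally have "?\<psi> x \<le> (u powr (- \<alpha>) * (u - x) powr (- \<alpha>) + \<alpha> * \<delta> powr (- 1 - \<alpha>) * (u powr (1 - \<alpha>) / (1 - \<alpha>))) / \<Gamma>"
          using \<Gamma> by (intro divide_right_mono) auto
        also have "\<dots> = u powr (- \<alpha>) *\<^sub>R abel (1 - \<alpha>) x u + C"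
          using x' by (simp add: abel_def C_def \<Gamma>_def add_divide_distrib)
        finally show ?thesis using True nn \<Gamma> by simp
      next
        case False
        then have z: "indicator {\<delta>..} x *\<^sub>R ?\<psi> x = 0" by (auto simp: indicator_def rho_def)
        show ?thesis unfolding z by simp
      qed
    qed
  next
    fix x :: real assume x: "0 < x" "x < t"
    let ?f = "\<lambda>y. abel (1 - \<alpha>) x y *\<^sub>R y powr (- \<alpha>) *\<^sub>R indicat_real {0..u} y"
    let ?r = "\<lambda>y. indicat_real {x..} y *\<^sub>R ?\<psi> y"
    have fm: "?f \<in> borel_measurable ?M"
      by (intro borel_measurable_scaleR borel_measurable_abel_right measurable_lebesgue_on_borel) measurable
    have rm: "?r \<in> borel_measurable ?M" by (rule measurable_lebesgue_on_borel) measurable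
    have "?G x = (LINT y|?M. ?f y)"
      using a x by (intro frac_int_eq_abel) auto
    also have "\<dots> = enn2real (\<integral>\<^sup>+y. ennreal (?f y) \<partial>?M)"
      using a abel_nonneg[of "1 - \<alpha>" x] by (intro integral_eq_nn_integral fm) simp
    also have "(\<integral>\<^sup>+y. ennreal (?f y) \<partial>?M) = (\<integral>\<^sup>+y. ennreal (?r y) \<partial>?M)"
    proof -
      have 1: "(\<integral>\<^sup>+y. ennreal (?f y) \<partial>?M) = ennreal (1 / \<Gamma>) * (\<integral>\<^sup>+y. ennreal (y powr (- \<alpha>) * (y - x) powr (- \<alpha>)) * indicator {x..u} y \<partial>lborel)"
      proof -
        have "(\<integral>\<^sup>+y. ennreal (?f y) \<partial>?M) = (\<integral>\<^sup>+y. ennreal (?f y) * indicator {0..t} y \<partial>lborel)"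
          by (simp only: nn_integral_lebesgue_on[OF lmeasurable_cbox[of 0 t, THEN fmeasurableD, unfolded cbox_interval]] nn_integral_completion)
        also have "\<dots> = (\<integral>\<^sup>+y. ennreal (1 / \<Gamma>) * (ennreal (y powr (- \<alpha>) * (y - x) powr (- \<alpha>)) * indicator {x..u} y) \<partial>lborel)"
          using x u \<Gamma> by (intro nn_integral_cong)
            (auto simp: indicator_def abel_def \<Gamma>_def[symmetric] ennreal_mult[symmetric] mult.commute)
        also have "\<dots> = ennreal (1 / \<Gamma>) * (\<integral>\<^sup>+y. ennreal (y powr (- \<alpha>) * (y - x) powr (- \<alpha>)) * indicator {x..u} y \<partial>lborel)"
          by (rule nn_integral_cmult) measurable
        finally show ?thesis .
      qed
      have 2: "(\<integral>\<^sup>+y. ennreal (?r y) \<partial>?M) = ennreal (1 / \<Gamma>) * (\<integral>\<^sup>+y. rho \<alpha> u y * indicator {x..u} y \<partial>lborel)"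
      proof -
        have "(\<integral>\<^sup>+y. ennreal (?r y) \<partial>?M) = (\<integral>\<^sup>+y. ennreal (?r y) * indicator {0..t} y \<partial>lborel)"
          by (simp only: nn_integral_lebesgue_on[OF lmeasurable_cbox[of 0 t, THEN fmeasurableD, unfolded cbox_interval]] nn_integral_completion)
        also have "\<dots> = (\<integral>\<^sup>+y. ennreal (1 / \<Gamma>) * (rho \<alpha> u y * indicator {x..u} y) \<partial>lborel)"
        proof (rule nn_integral_cong)
          fix y :: real
          have "ennreal (?\<psi> y) = ennreal (1 / \<Gamma>) * ennreal (enn2real (rho \<alpha> u y))"
            using \<Gamma> by (subst ennreal_mult[symmetric]) auto
          also have "ennreal (enn2real (rho \<alpha> u y)) = rho \<alpha> u y"
            using rho_finite[OF a, of u y] by simp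
          finally have e: "ennreal (?\<psi> y) = ennreal (1 / \<Gamma>) * rho \<alpha> u y" .
          show "ennreal (?r y) * indicator {0..t} y = ennreal (1 / \<Gamma>) * (rho \<alpha> u y * indicator {x..u} y)"
          proof (cases "x \<le> y \<and> y < u")
            case True
            then show ?thesis using e x u by (simp add: indicator_def)
          next
            case False
            then show ?thesis by (auto simp: indicator_def rho_def)
          qed
        qed
        also have "\<dots> = ennreal (1 / \<Gamma>) * (\<integral>\<^sup>+y. rho \<alpha> u y * indicator {x..u} y \<partial>lborel)"
          by (rule nn_integral_cmult) measurable
        finally show ?thesis .
      qed
      show ?thesis
      proof (cases "x \<le> u")
        case True
        then show ?thesis unfolding 1 2 using rho_tail_integral[OF a, of x u] x by simp
      next
        case False
        then have "{x..u} = {}" by auto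
        then show ?thesis unfolding 1 2 by simp
      qed
    qed
    also have "enn2real \<dots> = (LINT y|?M. ?r y)"
      using \<Gamma> by (intro integral_eq_nn_integral[symmetric] rm) simp
    finally show "?G x = (LINT y|?M. ?r y)" .
  qed
  then show ?thesis
  proof eventually_elim
    case (elim x)
    then show ?case
      unfolding fbm_transform_eq_derivative[OF H(2,1)] \<alpha>_def[symmetric] \<Gamma>_def[symmetric]
      by (simp add: vector_derivative_at)
  qed
qed

lemma fbm_transform_indicator_covariance_lt:
  assumes "u \<in> {0..t}" "v \<in> {0..t}"
  shows "hurst_const H * (LINT x|Leb t.
      fbm_transform H t (indicat_real {0..u}) x * fbm_transform H t (indicat_real {0..v}) x) = fbm_cov H u v"
proof -
  let ?M = "Leb t"
  have *: "hurst_const H * (LINT x|?M.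
      fbm_transform H t (indicat_real {0..u}) x * fbm_transform H t (indicat_real {0..v}) x) = fbm_cov H u v"
    if uv: "0 \<le> u" "u \<le> v" "v \<le> t" for u v
  proof -
    define \<alpha> where "\<alpha> = 1/2 - H"
    have a: "0 < \<alpha>" "\<alpha> < 1/2" using H by (auto simp: \<alpha>_def)
    define \<Gamma> where "\<Gamma> = Gamma (1 - \<alpha>)"
    have \<Gamma>: "0 < \<Gamma>" unfolding \<Gamma>_def using a by (intro Gamma_real_pos) simp
    let ?k = "\<lambda>u. fbm_transform H t (indicat_real {0..u})"
    let ?p = "\<lambda>u x. x powr \<alpha> * (enn2real (rho \<alpha> u x) / \<Gamma>)"
    define S where "S = u powr (1 - 2 * \<alpha>) + v powr (1 - 2 * \<alpha>) - (v - u) powr (1 - 2 * \<alpha>)"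
    have S: "0 \<le> S"
    proof -
      have "(v - u) powr (1 - 2 * \<alpha>) \<le> v powr (1 - 2 * \<alpha>)" using uv a by (intro powr_mono2) auto
      then have "(v - u) powr (1 - 2 * \<alpha>) \<le> u powr (1 - 2 * \<alpha>) + v powr (1 - 2 * \<alpha>)"
        by (rule order_trans) simp
      then show ?thesis by (simp add: S_def)
    qed
    define D where "D = \<alpha> * Beta (2 * \<alpha>) (1 - \<alpha>) / (1 - 2 * \<alpha>)"
    have D: "0 \<le> D" using a by (simp add: D_def Beta_real_pos less_imp_le)
    have uvt: "u \<in> {0..t}" "v \<in> {0..t}" using uv by auto
    have "(LINT x|?M. ?k u x * ?k v x) = (LINT x|?M. ?p u x * ?p v x)"
    proof -
      have pm: "(\<lambda>x. ?p u x * ?p v x) \<in> borel_measurable ?M"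
        by (rule measurable_lebesgue_on_borel) measurable
      have AE: "AE x in ?M. ?p u x * ?p v x = ?k u x * ?k v x"
        using fbm_transform_indicator_lt_AE[OF uvt(1)] fbm_transform_indicator_lt_AE[OF uvt(2)]
        unfolding \<alpha>_def \<Gamma>_def by eventually_elim simp
      have "(\<lambda>x. ?k u x * ?k v x) \<in> borel_measurable ?M"
        by (rule borel_measurable_lebesgue_on_AE[OF pm _ AE]) simp
      then show ?thesis using integral_cong_AE[OF pm _ AE] by simp
    qed
    also have "\<dots> = enn2real (\<integral>\<^sup>+x. ennreal (?p u x * ?p v x) \<partial>?M)"
    proof (rule integral_eq_nn_integral)
      show "(\<lambda>x. ?p u x * ?p v x) \<in> borel_measurable ?M"
        by (rule measurable_lebesgue_on_borel) measurable
      show "AE x in ?M. 0 \<le> ?p u x * ?p v x" using \<Gamma> by simp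
    qed
    also have "(\<integral>\<^sup>+x. ennreal (?p u x * ?p v x) \<partial>?M) = (\<integral>\<^sup>+x. ennreal (?p u x * ?p v x) * indicator {0..t} x \<partial>lborel)"
      by (simp only: nn_integral_lebesgue_on[OF lmeasurable_cbox[of 0 t, THEN fmeasurableD, unfolded cbox_interval]] nn_integral_completion)
    also have "\<dots> = (\<integral>\<^sup>+x. ennreal (1 / \<Gamma>\<^sup>2) * (ennreal (x powr (2 * \<alpha>)) * rho \<alpha> u x * rho \<alpha> v x) \<partial>lborel)"
    proof (rule nn_integral_cong)
      fix x :: real
      show "ennreal (?p u x * ?p v x) * indicator {0..t} x = ennreal (1 / \<Gamma>\<^sup>2) * (ennreal (x powr (2 * \<alpha>)) * rho \<alpha> u x * rho \<alpha> v x)"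
      proof (cases "0 < x \<and> x < u")
        case True
        have "?p u x * ?p v x = 1 / \<Gamma>\<^sup>2 * ((x powr \<alpha> * x powr \<alpha>) * enn2real (rho \<alpha> u x) * enn2real (rho \<alpha> v x))"
          by (simp add: power2_eq_square)
        also have "x powr \<alpha> * x powr \<alpha> = x powr (2 * \<alpha>)" by (simp flip: powr_add)
        finally have "ennreal (?p u x * ?p v x) = ennreal (1 / \<Gamma>\<^sup>2) * (ennreal (x powr (2 * \<alpha>)) * ennreal (enn2real (rho \<alpha> u x)) * ennreal (enn2real (rho \<alpha> v x)))"
          by (simp only: ennreal_mult' ennreal_mult'' enn2real_nonneg mult_nonneg_nonneg powr_ge_zero zero_le_divide_1_iff zero_le_power2)
        then show ?thesis using True uv rho_finite[OF a] by simp
      qed (auto simp: rho_def)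
    qed
    also have "\<dots> = ennreal (1 / \<Gamma>\<^sup>2) * (\<integral>\<^sup>+x. ennreal (x powr (2 * \<alpha>)) * rho \<alpha> u x * rho \<alpha> v x \<partial>lborel)"
      by (rule nn_integral_cmult) measurable
    also have "\<dots> = ennreal (1 / \<Gamma>\<^sup>2) * ennreal (D * S)"
      unfolding S_def D_def by (simp only: rho_product_integral[OF a uv(1,2)])
    also have "\<dots> = ennreal (1 / \<Gamma>\<^sup>2 * (D * S))" by (rule ennreal_mult'[symmetric]) simp
    also have "enn2real \<dots> = 1 / \<Gamma>\<^sup>2 * (D * S)" using D S by (intro enn2real_ennreal) simp
    finally have "hurst_const H * (LINT x|?M. ?k u x * ?k v x) = (hurst_const H * (D / \<Gamma>\<^sup>2)) * S" by simp
    also have "hurst_const H * (D / \<Gamma>\<^sup>2) = 1/2"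
      unfolding D_def \<Gamma>_def \<alpha>_def by (rule hurst_const_mult_Beta_lt[OF H])
    also have "1/2 * S = fbm_cov H u v"
      using uv by (simp add: S_def \<alpha>_def fbm_cov_def abs_minus_commute)
    finally show ?thesis .
  qed
  show ?thesis
  proof (cases "u \<le> v")
    case True
    then show ?thesis using * assms by simp
  next
    case False
    then show ?thesis using *[of v u] assms by (simp add: fbm_cov_commute mult.commute)
  qed
qed

end

section \<open>The transform for all Hurst parameters\<close>

lemma indicator_in_L2_fun: "indicat_real {0..u} \<in> L2_fun t"
proof -
  have "indicat_real {0..u} = step_fun [(u, 1)]" by (auto simp: step_fun_def)
  then show ?thesis using step_fun_in_L2_fun[of "[(u, 1 :: real)]" t] by simp
qed

context
  fixes H t :: real
  assumes H: "0 < H" "H < 1" and t: "0 < t"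
begin

lemma fbm_transform_in_L2_fun:
  assumes f: "f \<in> LH H t"
  shows "fbm_transform H t f \<in> L2_fun t"
proof (cases H "1/2 :: real" rule: linorder_cases)
  case less
  then show ?thesis using fbm_transform_in_L2_fun_lt[OF H(1) less t f] by simp
next
  case equal
  have f2: "f \<in> L2_fun t" using f unfolding equal LH_half .
  have AE: "AE x in Leb t. f x = fbm_transform (1/2) t f x"
    using fbm_transform_half_AE[of t f] by eventually_elim simp
  have "fbm_transform (1/2) t f \<in> borel_measurable (Leb t)"
    by (rule borel_measurable_lebesgue_on_AE[OF _ _ AE]) (use f2 in \<open>auto simp: L2_fun_iff\<close>)
  then show ?thesis using f2 L2_sq_cong_AE[OF AE] unfolding equal L2_fun_iff by simp
next
  case greater
  then show ?thesis using fbm_transform_in_L2_fun_gt[OF greater H(2) t f] by simp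
qed

lemma step_transform_bound:
  assumes f: "f \<in> LH H t"
  shows "\<exists>C>0. \<forall>ps. fst ` set ps \<subseteq> {0..t} \<longrightarrow>
    L2_sq (Leb t) (\<lambda>x. step_transform H t ps x - fbm_transform H t f x) \<le>
    ennreal C * LH_norm_sq H t (\<lambda>x. step_fun ps x - f x)"
proof (cases H "1/2 :: real" rule: linorder_cases)
  case less
  then show ?thesis using step_transform_bound_lt[OF H(1) less t f] by simp
next
  case equal
  have f2: "f \<in> L2_fun t" using f unfolding equal LH_half .
  have "L2_sq (Leb t) (\<lambda>x. step_transform (1/2) t ps x - fbm_transform (1/2) t f x) =
    LH_norm_sq (1/2) t (\<lambda>x. step_fun ps x - f x)" for ps
  proof -
    have "AE x in Leb t. step_transform (1/2) t ps x - fbm_transform (1/2) t f x = step_fun ps x - f x"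
      using AE_Icc_neq[where c=0 and a=0 and b=t]
      by eventually_elim (simp add: fbm_transform_half step_fun_eq_comb comb_def)
    then have "L2_sq (Leb t) (\<lambda>x. step_transform (1/2) t ps x - fbm_transform (1/2) t f x) =
        L2_sq (Leb t) (\<lambda>x. step_fun ps x - f x)"
      by (rule L2_sq_cong_AE)
    also have "\<dots> = LH_norm_sq (1/2) t (\<lambda>x. step_fun ps x - f x)"
      by (rule LH_norm_sq_half[symmetric, OF L2_fun_diff[OF step_fun_in_L2_fun f2]])
    finally show ?thesis .
  qed
  then show ?thesis unfolding equal by (intro exI[of _ 1]) simp
next
  case greater
  have "1 / hurst_const H > 0" using hurst_const_pos[OF H] by simp
  then show ?thesis using step_transform_bound_gt[OF greater H(2) t f] by blast
qed

lemma step_fun_dense: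
  assumes f: "f \<in> LH H t" and e: "e > 0"
  shows "\<exists>ps. fst ` set ps \<subseteq> {0..t} \<and> LH_norm_sq H t (\<lambda>x. step_fun ps x - f x) < ennreal e"
proof (cases H "1/2 :: real" rule: linorder_cases)
  case less
  then show ?thesis using step_fun_dense_lt[OF H(1) less t f e] by simp
next
  case equal
  have f2: "f \<in> L2_fun t" using f unfolding equal LH_half .
  have "step_approx t f" using t f2 by (intro step_approx_L2) auto
  then obtain ps where "fst ` set ps \<subseteq> {0..t}" "L2_sq (Leb t) (\<lambda>x. step_fun ps x - f x) < ennreal e"
    unfolding step_approx_def using e by blast
  then show ?thesis unfolding equal
    by (intro exI[of _ ps]) (simp add: LH_norm_sq_half[OF L2_fun_diff[OF step_fun_in_L2_fun f2]])
next
  case greater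
  then show ?thesis using step_fun_dense_gt[OF greater H(2) t f e] by simp
qed

lemma LH_linear:
  fixes f :: "real \<Rightarrow> 'k::{banach, second_countable_topology}"
    and L :: "'k \<Rightarrow> 'l::{banach, second_countable_topology}"
  assumes f: "f \<in> LH H t" and L: "bounded_linear L"
  shows "(\<lambda>x. L (f x)) \<in> LH H t"
    and "AE x in Leb t. fbm_transform H t (\<lambda>x. L (f x)) x = L (fbm_transform H t f x)"
proof -
  have "(\<lambda>x. L (f x)) \<in> LH H t \<and>
    (AE x in Leb t. fbm_transform H t (\<lambda>x. L (f x)) x = L (fbm_transform H t f x))"
  proof (cases H "1/2 :: real" rule: linorder_cases)
    case less
    then show ?thesis using LH_linear_lt[OF H(1) less t f L] by simp
  next
    case equal
    have f2: "f \<in> L2_fun t" using f unfolding equal LH_half .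
    show ?thesis unfolding equal LH_half
      using L2_fun_linear[OF f2 L] fbm_transform_half_AE[of t "\<lambda>x. L (f x)"] fbm_transform_half_AE[of t f]
      by (auto elim: eventually_elim2)
  next
    case greater
    then show ?thesis using LH_linear_gt[OF greater H(2) t f L] by simp
  qed
  then show "(\<lambda>x. L (f x)) \<in> LH H t"
    and "AE x in Leb t. fbm_transform H t (\<lambda>x. L (f x)) x = L (fbm_transform H t f x)" by auto
qed

lemma indicator_in_LH:
  assumes u: "u \<in> {0..t}"
  shows "indicat_real {0..u} \<in> LH H t"
proof (cases H "1/2 :: real" rule: linorder_cases)
  case less
  then show ?thesis using abel_in_frac_preimages[OF H(1) less t u] by (auto simp: LH_def)
next
  case equal
  show ?thesis unfolding equal LH_half by (rule indicator_in_L2_fun)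
next
  case greater
  have m: "indicat_real {0..u} \<in> borel_measurable (Leb t)"
    and fin: "L2_sq (Leb t) (indicat_real {0..u}) < \<infinity>"
    using indicator_in_L2_fun[of u t] by (auto simp: L2_fun_iff)
  have "LH_energy H t (indicat_real {0..u}) < \<infinity>"
    using fin by (intro le_less_trans[OF LH_energy_le_L2_sq[OF greater H(2) t m]]) (simp add: ennreal_mult_less_top)
  then show ?thesis using greater m by (simp add: LH_def)
qed

lemma fbm_transform_indicator_covariance:
  assumes uv: "u \<in> {0..t}" "v \<in> {0..t}"
  shows "hurst_const H * (LINT x|Leb t.
      fbm_transform H t (indicat_real {0..u}) x * fbm_transform H t (indicat_real {0..v}) x) = fbm_cov H u v"
proof (cases H "1/2 :: real" rule: linorder_cases)
  case less
  then show ?thesis using fbm_transform_indicator_covariance_lt[OF H(1) less t uv] by simp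
next
  case equal
  have m: "indicat_real {0..min u v} \<in> borel_measurable (Leb t)"
    using indicator_in_L2_fun by (simp add: L2_fun_iff)
  have AE: "AE x in Leb t. indicat_real {0..min u v} x =
      fbm_transform (1/2) t (indicat_real {0..u}) x * fbm_transform (1/2) t (indicat_real {0..v}) x"
    using fbm_transform_half_AE[of t "indicat_real {0..u}"] fbm_transform_half_AE[of t "indicat_real {0..v}"]
    by eventually_elim (auto simp: indicator_def)
  have "(LINT x|Leb t. fbm_transform (1/2) t (indicat_real {0..u}) x * fbm_transform (1/2) t (indicat_real {0..v}) x)
      = (LINT x|Leb t. indicat_real {0..min u v} x)"
    using integral_cong_AE[OF m borel_measurable_lebesgue_on_AE[OF m _ AE] AE] by simp
  also have "\<dots> = (LINT x|lebesgue. indicat_real {0..t} x *\<^sub>R indicat_real {0..min u v} x)"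
    by (rule integral_restrict_space) simp
  also have "\<dots> = (LINT x|lebesgue. indicat_real {0..min u v} x)"
    using uv by (intro Bochner_Integration.integral_cong) (auto simp: indicator_def)
  also have "\<dots> = min u v" using uv by simp
  finally have "(LINT x|Leb t. fbm_transform (1/2) t (indicat_real {0..u}) x * fbm_transform (1/2) t (indicat_real {0..v}) x) = min u v" .
  moreover have "hurst_const (1/2) = 1" by (simp add: hurst_const_def)
  moreover have "fbm_cov (1/2) u v = min u v" using uv by (auto simp: fbm_cov_def min_def)
  ultimately show ?thesis unfolding equal by simp
next
  case greater
  then show ?thesis using fbm_transform_indicator_covariance_gt[OF greater H(2) t uv] by simp
qed

end

section \<open>Bilinear limits and completeness in the mean square\<close>

lemma L2_product_integrable:
  fixes f g :: "'w \<Rightarrow> real"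
  assumes "f \<in> borel_measurable M" "g \<in> borel_measurable M" "L2_sq M f < \<infinity>" "L2_sq M g < \<infinity>"
  shows "integrable M (\<lambda>x. f x * g x)"
proof -
  have i: "integrable M (\<lambda>x. (f x)\<^sup>2)" "integrable M (\<lambda>x. (g x)\<^sup>2)"
    using assms by (auto simp: L2_sq_def integrable_iff_bounded)
  show ?thesis
  proof (rule Bochner_Integration.integrable_bound[OF Bochner_Integration.integrable_add[OF i]])
    show "AE x in M. norm (f x * g x) \<le> norm ((f x)\<^sup>2 + (g x)\<^sup>2)"
    proof (rule AE_I2)
      fix x
      have "0 \<le> (\<bar>f x\<bar> - \<bar>g x\<bar>)\<^sup>2 + (f x)\<^sup>2 + (g x)\<^sup>2" by simp
      then show "norm (f x * g x) \<le> norm ((f x)\<^sup>2 + (g x)\<^sup>2)"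
        by (simp add: power2_diff abs_mult)
    qed
  qed (use assms in measurable)
qed

lemma nn_integral_norm_product_sq_le:
  fixes f :: "'w \<Rightarrow> 'k::{banach, second_countable_topology}" and g :: "'w \<Rightarrow> 'l::{banach, second_countable_topology}"
  assumes [measurable]: "f \<in> borel_measurable M" "g \<in> borel_measurable M"
  shows "(\<integral>\<^sup>+x. ennreal (norm (f x) * norm (g x)) \<partial>M)\<^sup>2 \<le> L2_sq M f * L2_sq M g"
  using Cauchy_Schwarz_nn_integral[of "\<lambda>x. ennreal (norm (f x))" M "\<lambda>x. ennreal (norm (g x))"]
  by (simp add: L2_sq_def ennreal_mult ennreal_power)

lemma bilinear_L2_integrable:
  fixes f :: "'w \<Rightarrow> 'k::{banach, second_countable_topology}" and g :: "'w \<Rightarrow> 'l::{banach, second_countable_topology}"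
    and prod :: "'k \<Rightarrow> 'l \<Rightarrow> 'm::{banach, second_countable_topology}"
  assumes bl: "bounded_bilinear prod"
    and fg: "f \<in> borel_measurable M" "g \<in> borel_measurable M" "L2_sq M f < \<infinity>" "L2_sq M g < \<infinity>"
  shows "(\<lambda>x. prod (f x) (g x)) \<in> borel_measurable M" "integrable M (\<lambda>x. prod (f x) (g x))"
proof -
  interpret bounded_bilinear prod by (rule bl)
  have cont: "continuous_on UNIV (\<lambda>p. prod (fst p) (snd p))"
    by (intro continuous_on continuous_intros)
  show m: "(\<lambda>x. prod (f x) (g x)) \<in> borel_measurable M"
    by (rule borel_measurable_continuous_Pair[OF fg(1,2)]) (use cont in simp)
  obtain K where K: "K > 0" "\<And>a b. norm (prod a b) \<le> norm a * norm b * K" using pos_bounded by blast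
  have L2: "L2_sq M (\<lambda>x. norm (f x)) < \<infinity>" "L2_sq M (\<lambda>x. norm (g x)) < \<infinity>"
    using fg(3,4) by (auto simp: L2_sq_def)
  have nm: "(\<lambda>x. norm (f x)) \<in> borel_measurable M" "(\<lambda>x. norm (g x)) \<in> borel_measurable M"
    using fg by measurable
  have "integrable M (\<lambda>x. norm (f x) * norm (g x) * K)"
    by (intro Bochner_Integration.integrable_mult_left L2_product_integrable nm L2)
  then show "integrable M (\<lambda>x. prod (f x) (g x))"
  proof (rule Bochner_Integration.integrable_bound[OF _ m])
    show "AE x in M. norm (prod (f x) (g x)) \<le> norm (norm (f x) * norm (g x) * K)"
      using K by (intro AE_I2) (auto intro: order_trans abs_ge_self)
  qed
qed

text \<open>The Cauchy--Schwarz inequality, squared to stay within extended nonnegative reals.\<close>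

lemma nn_integral_product_tendsto_zero:
  fixes D :: "nat \<Rightarrow> 'w \<Rightarrow> 'k::{banach, second_countable_topology}" and g :: "nat \<Rightarrow> 'w \<Rightarrow> 'l::{banach, second_countable_topology}"
  assumes [measurable]: "\<And>n. D n \<in> borel_measurable M" "\<And>n. g n \<in> borel_measurable M"
    and D: "(\<lambda>n. L2_sq M (D n)) \<longlonglongrightarrow> 0" and g: "\<forall>\<^sub>F n in sequentially. L2_sq M (g n) \<le> ennreal C"
  shows "(\<lambda>n. \<integral>\<^sup>+x. ennreal (norm (D n x) * norm (g n x)) \<partial>M) \<longlonglongrightarrow> 0"
proof -
  let ?I = "\<lambda>n. \<integral>\<^sup>+x. ennreal (norm (D n x) * norm (g n x)) \<partial>M"
  have "(\<lambda>n. L2_sq M (D n) * ennreal C) \<longlonglongrightarrow> 0 * ennreal C"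
    by (intro tendsto_mult_ennreal D tendsto_const) auto
  then have z: "(\<lambda>n. L2_sq M (D n) * ennreal C) \<longlonglongrightarrow> 0" by simp
  have "(\<lambda>n. (?I n)\<^sup>2) \<longlonglongrightarrow> 0"
  proof (rule tendsto_sandwich[OF _ _ tendsto_const z])
    show "\<forall>\<^sub>F n in sequentially. (?I n)\<^sup>2 \<le> L2_sq M (D n) * ennreal C"
      using g
    proof eventually_elim
      case (elim n)
      have "(?I n)\<^sup>2 \<le> L2_sq M (D n) * L2_sq M (g n)"
        by (rule nn_integral_norm_product_sq_le) measurable
      also have "\<dots> \<le> L2_sq M (D n) * ennreal C" using elim by (rule mult_left_mono) simp
      finally show ?case .
    qed
  qed simp
  show ?thesis
  proof (rule order_tendstoI)
    fix a :: ennreal assume a: "0 < a"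
    define e where "e = min 1 (enn2real (min 1 a))"
    have e: "0 < e" "ennreal e \<le> a"
    proof -
      have "min 1 a \<noteq> 0" using a by (auto simp: min_def)
      have "min 1 a < \<infinity>" by (rule le_less_trans[of _ 1]) auto
      with \<open>min 1 a \<noteq> 0\<close> have "0 < enn2real (min 1 a)" by (auto simp: enn2real_positive_iff zero_less_iff_neq_zero)
      then show "0 < e" by (simp add: e_def)
      have "ennreal e \<le> ennreal (enn2real (min 1 a))" by (intro ennreal_leI) (simp add: e_def)
      also have "\<dots> = min 1 a" using \<open>min 1 a < \<infinity>\<close> by (intro ennreal_enn2real) simp
      finally show "ennreal e \<le> a" by simp
    qed
    have "\<forall>\<^sub>F n in sequentially. (?I n)\<^sup>2 < ennreal (e\<^sup>2)"
      using e(1) \<open>(\<lambda>n. (?I n)\<^sup>2) \<longlonglongrightarrow> 0\<close> by (intro order_tendstoD) auto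
    then show "\<forall>\<^sub>F n in sequentially. (?I n) < a"
    proof eventually_elim
      case (elim n)
      then have "\<not> ennreal e \<le> (?I n)"
        using e(1) power_mono[of "ennreal e" "?I n" 2]
        by (auto simp: ennreal_power not_le[symmetric])
      then show ?case using e(2) by (auto simp: not_le intro: less_le_trans)
    qed
  qed simp
qed

text \<open>\<open>prod f\<^sub>n g\<^sub>n - prod f g = prod (f\<^sub>n - f) g\<^sub>n + prod f (g\<^sub>n - g)\<close>, and both terms tend to zero in
\<open>L\<^sup>1\<close>. It is used for the inner product and for the tensor product, in both the probability space and the
time interval.\<close>

lemma bilinear_L2_limit:
  fixes f :: "'w \<Rightarrow> 'k::{banach, second_countable_topology}" and g :: "'w \<Rightarrow> 'l::{banach, second_countable_topology}"
    and prod :: "'k \<Rightarrow> 'l \<Rightarrow> 'm::{banach, second_countable_topology}"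
  assumes bl: "bounded_bilinear prod"
    and m: "f \<in> borel_measurable M" "g \<in> borel_measurable M"
      "\<And>n. fn n \<in> borel_measurable M" "\<And>n. gn n \<in> borel_measurable M"
    and fin: "L2_sq M f < \<infinity>" "L2_sq M g < \<infinity>"
    and lim: "(\<lambda>n. L2_sq M (\<lambda>x. fn n x - f x)) \<longlonglongrightarrow> 0" "(\<lambda>n. L2_sq M (\<lambda>x. gn n x - g x)) \<longlonglongrightarrow> 0"
    and int: "\<And>n. integrable M (\<lambda>x. prod (fn n x) (gn n x))"
  shows "(\<lambda>n. LINT x|M. prod (fn n x) (gn n x)) \<longlonglongrightarrow> (LINT x|M. prod (f x) (g x))"
proof -
  let ?a = "\<lambda>n x. norm (fn n x - f x) * norm (gn n x)" and ?b = "\<lambda>n x. norm (gn n x - g x) * norm (f x)"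
  let ?d = "\<lambda>n x. norm (prod (fn n x) (gn n x) - prod (f x) (g x))"
  interpret bounded_bilinear prod by (rule bl)
  note [measurable] = m
  obtain K where K: "K > 0" "\<And>a b. norm (prod a b) \<le> norm a * norm b * K" using pos_bounded by blast
  define C where "C = enn2real (2 + 2 * L2_sq M g) + enn2real (L2_sq M f)"
  have C: "2 + 2 * L2_sq M g \<le> ennreal C" "L2_sq M f \<le> ennreal C"
  proof -
    have f1: "2 + 2 * L2_sq M g < \<infinity>" using fin by (simp add: ennreal_mult_less_top)
    have "2 + 2 * L2_sq M g = ennreal (enn2real (2 + 2 * L2_sq M g))" using f1 by simp
    also have "\<dots> \<le> ennreal C" unfolding C_def by (intro ennreal_leI) simp
    finally show "2 + 2 * L2_sq M g \<le> ennreal C" .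
    have "L2_sq M f = ennreal (enn2real (L2_sq M f))" using fin by simp
    also have "\<dots> \<le> ennreal C" unfolding C_def by (intro ennreal_leI) simp
    finally show "L2_sq M f \<le> ennreal C" .
  qed
  have gnC: "\<forall>\<^sub>F n in sequentially. L2_sq M (gn n) \<le> ennreal C"
  proof -
    have "\<forall>\<^sub>F n in sequentially. L2_sq M (\<lambda>x. gn n x - g x) < 1" using lim(2) by (rule order_tendstoD) simp
    then show ?thesis
    proof eventually_elim
      case (elim n)
      have "L2_sq M (\<lambda>x. (gn n x - g x) + g x) \<le> 2 * L2_sq M (\<lambda>x. gn n x - g x) + 2 * L2_sq M g"
        by (rule L2_sq_add_le) measurable
      also have "\<dots> \<le> 2 * 1 + 2 * L2_sq M g"
        using elim by (intro add_mono mult_left_mono) auto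
      finally show ?case using C(1) by simp
    qed
  qed
  have z1: "(\<lambda>n. \<integral>\<^sup>+x. ennreal (?a n x) \<partial>M) \<longlonglongrightarrow> 0"
    by (rule nn_integral_product_tendsto_zero[OF _ _ lim(1) gnC]) measurable
  have z2: "(\<lambda>n. \<integral>\<^sup>+x. ennreal (?b n x) \<partial>M) \<longlonglongrightarrow> 0"
    by (rule nn_integral_product_tendsto_zero[OF _ _ lim(2)]) (use C in \<open>auto intro: always_eventually\<close>)
  have "(\<lambda>n. ennreal K * ((\<integral>\<^sup>+x. ennreal (?a n x) \<partial>M) +
      (\<integral>\<^sup>+x. ennreal (?b n x) \<partial>M))) \<longlonglongrightarrow> ennreal K * (0 + 0)"
    by (intro ennreal_tendsto_cmult tendsto_add z1 z2) simp
  then have z: "(\<lambda>n. ennreal K * ((\<integral>\<^sup>+x. ennreal (?a n x) \<partial>M) +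
      (\<integral>\<^sup>+x. ennreal (?b n x) \<partial>M))) \<longlonglongrightarrow> 0" by simp
  show ?thesis
  proof (rule tendsto_L1_int[OF int bilinear_L2_integrable(2)[OF bl m(1,2) fin]])
    show "((\<lambda>n. \<integral>\<^sup>+x. ennreal (?d n x) \<partial>M) \<longlongrightarrow> 0) sequentially"
    proof (rule tendsto_sandwich[OF _ _ tendsto_const z])
      show "\<forall>\<^sub>F n in sequentially. (\<integral>\<^sup>+x. ennreal (?d n x) \<partial>M) \<le>
        ennreal K * ((\<integral>\<^sup>+x. ennreal (?a n x) \<partial>M) +
          (\<integral>\<^sup>+x. ennreal (?b n x) \<partial>M))"
      proof (intro always_eventually allI)
        fix n
        have "(\<integral>\<^sup>+x. ennreal (?d n x) \<partial>M) \<le>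
          (\<integral>\<^sup>+x. ennreal K * (ennreal (?a n x) + ennreal (?b n x)) \<partial>M)"
        proof (rule nn_integral_mono)
          fix x
          have "prod (fn n x) (gn n x) - prod (f x) (g x) = prod (fn n x - f x) (gn n x) + prod (f x) (gn n x - g x)"
            by (simp add: diff_left diff_right)
          also have "norm \<dots> \<le> norm (fn n x - f x) * norm (gn n x) * K + norm (f x) * norm (gn n x - g x) * K"
            by (rule order_trans[OF norm_triangle_ineq]) (intro add_mono K)
          also have "\<dots> = K * (?a n x + ?b n x)"
            by (simp add: algebra_simps)
          finally have "ennreal (?d n x) \<le>
              ennreal (K * (?a n x + ?b n x))"
            by (rule ennreal_leI)
          also have "\<dots> = ennreal K * (ennreal (?a n x) + ennreal (?b n x))"
            using K(1) by (simp add: ennreal_mult' ennreal_plus)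
          finally show "ennreal (?d n x) \<le> ennreal K * (ennreal (?a n x) + ennreal (?b n x))" .
        qed
        also have "\<dots> = ennreal K * (\<integral>\<^sup>+x. ennreal (?a n x) + ennreal (?b n x) \<partial>M)"
          by (rule nn_integral_cmult) measurable
        also have "(\<integral>\<^sup>+x. ennreal (?a n x) + ennreal (?b n x) \<partial>M) =
          (\<integral>\<^sup>+x. ennreal (?a n x) \<partial>M) + (\<integral>\<^sup>+x. ennreal (?b n x) \<partial>M)"
          by (rule nn_integral_add) measurable
        finally show "(\<integral>\<^sup>+x. ennreal (?d n x) \<partial>M) \<le>
          ennreal K * ((\<integral>\<^sup>+x. ennreal (?a n x) \<partial>M) +
            (\<integral>\<^sup>+x. ennreal (?b n x) \<partial>M))" .
      qed
    qed simp
  qed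
qed

text \<open>The Riesz--Fischer argument: along a subsequence the increments \<open>d\<^sub>i\<close> have squared norm at most
\<open>4\<^sup>-\<^sup>i\<close>, so \<open>\<Sum>\<^sub>i 2\<^sup>i \<bar>d\<^sub>i\<bar>\<^sup>2\<close> is finite almost everywhere, hence so is \<open>\<Sum>\<^sub>i \<bar>d\<^sub>i\<bar>\<close>. Fatou's
lemma identifies the limit.\<close>

lemma L2_complete:
  fixes X :: "nat \<Rightarrow> 'w \<Rightarrow> 'k::{banach, second_countable_topology}"
  assumes m [measurable]: "\<And>n. X n \<in> borel_measurable M"
    and Cauchy: "\<And>e. e > 0 \<Longrightarrow> \<exists>N. \<forall>n\<ge>N. \<forall>k\<ge>N. L2_sq M (\<lambda>x. X n x - X k x) < ennreal e"
  shows "\<exists>Y. converges_L2 M X Y"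
proof -
  have "\<forall>i. \<exists>N. \<forall>n\<ge>N. \<forall>k\<ge>N. L2_sq M (\<lambda>x. X n x - X k x) < ennreal ((1/4) ^ i)"
    by (intro allI Cauchy) simp
  then obtain N where N: "\<And>i n k. n \<ge> N i \<Longrightarrow> k \<ge> N i \<Longrightarrow> L2_sq M (\<lambda>x. X n x - X k x) < ennreal ((1/4) ^ i)"
    by metis
  \<comment> \<open>An increasing sequence of indices that dominates both \<open>N i\<close> and \<open>i\<close>.\<close>
  define r where "r i = (\<Sum>j\<le>i. N j) + i" for i
  have r1: "N i \<le> r i" for i
    unfolding r_def using member_le_sum[of i "{..i}" N] by (simp add: trans_le_add1)
  have r2: "r i \<le> r (Suc i)" for i by (simp add: r_def)
  have r3: "i \<le> r i" for i by (simp add: r_def)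
  define d where "d i x = X (r (Suc i)) x - X (r i) x" for i x
  have [measurable]: "d i \<in> borel_measurable M" for i unfolding d_def[abs_def] by measurable
  have d_le: "L2_sq M (d i) \<le> ennreal ((1/4) ^ i)" for i
    unfolding d_def[abs_def] using N[of i "r (Suc i)" "r i"] r1[of i] r2[of i] by simp
  have "(\<integral>\<^sup>+x. (\<Sum>i. ennreal (2 ^ i * (norm (d i x))\<^sup>2)) \<partial>M) = (\<Sum>i. \<integral>\<^sup>+x. ennreal (2 ^ i * (norm (d i x))\<^sup>2) \<partial>M)"
    by (rule nn_integral_suminf) measurable
  also have "\<dots> \<le> (\<Sum>i. ennreal ((1/2) ^ i))"
  proof (rule suminf_le)
    fix i
    have "(\<integral>\<^sup>+x. ennreal (2 ^ i * (norm (d i x))\<^sup>2) \<partial>M) = ennreal (2 ^ i) * L2_sq M (d i)"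
      unfolding L2_sq_def by (subst nn_integral_cmult[symmetric]) (auto simp: ennreal_mult)
    also have "\<dots> \<le> ennreal (2 ^ i) * ennreal ((1/4) ^ i)" by (intro mult_left_mono d_le) simp
    also have "\<dots> = ennreal (2 ^ i * (1/4) ^ i)" by (rule ennreal_mult[symmetric]) auto
    also have "2 ^ i * (1/4) ^ i = (1/2 :: real) ^ i" by (simp flip: power_mult_distrib)
    finally show "(\<integral>\<^sup>+x. ennreal (2 ^ i * (norm (d i x))\<^sup>2) \<partial>M) \<le> ennreal ((1/2) ^ i)" .
  qed auto
  also have "\<dots> < \<infinity>" by (subst suminf_ennreal2) (auto intro: summable_geometric)
  finally have "AE x in M. (\<Sum>i. ennreal (2 ^ i * (norm (d i x))\<^sup>2)) \<noteq> \<infinity>"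
    by (intro nn_integral_PInf_AE) auto
  then have conv: "AE x in M. convergent (\<lambda>i. X (r i) x)"
  proof eventually_elim
    case (elim x)
    then have "summable (\<lambda>i. 2 ^ i * (norm (d i x))\<^sup>2)"
      by (intro summable_suminf_not_top) auto
    then have "summable (\<lambda>i. (1/2) ^ i + 2 ^ i * (norm (d i x))\<^sup>2)"
      by (intro summable_add summable_geometric) auto
    then have "summable (\<lambda>i. d i x)"
    proof (rule summable_comparison_test')
      fix i :: nat
      let ?h = "(1/2 :: real) ^ i"
      have h: "?h > 0" "2 ^ i * ?h = 1" by (simp_all flip: power_mult_distrib)
      have "0 \<le> 2 ^ i * (?h - norm (d i x))\<^sup>2 + norm (d i x)" by simp
      also have "\<dots> = (2 ^ i * ?h) * ?h - 2 * (2 ^ i * ?h) * norm (d i x) + 2 ^ i * (norm (d i x))\<^sup>2 + norm (d i x)"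
        by (simp only: power2_eq_square algebra_simps)
      also have "\<dots> = ?h - norm (d i x) + 2 ^ i * (norm (d i x))\<^sup>2" unfolding h(2) by simp
      finally show "norm (d i x) \<le> ?h + 2 ^ i * (norm (d i x))\<^sup>2" by simp
    qed
    then have "convergent (\<lambda>n. \<Sum>i<n. d i x)" by (simp add: summable_iff_convergent)
    moreover have "(\<Sum>i<n. d i x) = X (r n) x - X (r 0) x" for n
      unfolding d_def by (rule sum_lessThan_telescope)
    ultimately have "convergent (\<lambda>n. X (r n) x - X (r 0) x)" by simp
    then have "convergent (\<lambda>n. (X (r n) x - X (r 0) x) + X (r 0) x)" by (intro convergent_add convergent_const)
    then show ?case by simp
  qed
  define Y where "Y x = lim (\<lambda>i. X (r i) x)" for x
  have Ym [measurable]: "Y \<in> borel_measurable M" unfolding Y_def[abs_def] by measurable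
  have bound: "L2_sq M (\<lambda>x. X n x - Y x) \<le> ennreal ((1/4) ^ i)" if n: "n \<ge> N i" for n i
  proof -
    have "L2_sq M (\<lambda>x. X n x - Y x) \<le> (\<integral>\<^sup>+x. liminf (\<lambda>k. ennreal ((norm (X n x - X (r k) x))\<^sup>2)) \<partial>M)"
      unfolding L2_sq_def
    proof (rule nn_integral_mono_AE)
      show "AE x in M. ennreal ((norm (X n x - Y x))\<^sup>2) \<le> liminf (\<lambda>k. ennreal ((norm (X n x - X (r k) x))\<^sup>2))"
        using conv
      proof eventually_elim
        case (elim x)
        then have l: "(\<lambda>k. X (r k) x) \<longlonglongrightarrow> Y x" unfolding Y_def by (simp add: convergent_LIMSEQ_iff)
        have "(\<lambda>k. ennreal ((norm (X n x - X (r k) x))\<^sup>2)) \<longlonglongrightarrow> ennreal ((norm (X n x - Y x))\<^sup>2)"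
          by (intro tendsto_ennrealI tendsto_intros l)
        from lim_imp_Liminf[OF sequentially_bot this] show ?case by (rule eq_refl[OF sym])
      qed
    qed
    also have "\<dots> \<le> liminf (\<lambda>k. \<integral>\<^sup>+x. ennreal ((norm (X n x - X (r k) x))\<^sup>2) \<partial>M)"
      by (rule nn_integral_liminf) measurable
    also have "\<dots> \<le> ennreal ((1/4) ^ i)"
    proof -
      have "\<forall>\<^sub>F k in sequentially. (\<integral>\<^sup>+x. ennreal ((norm (X n x - X (r k) x))\<^sup>2) \<partial>M) \<le> ennreal ((1/4) ^ i)"
        using N[OF n] r3 unfolding L2_sq_def
        by (intro eventually_sequentiallyI[of "N i"]) (meson less_imp_le order_trans)
      then show ?thesis
        using Liminf_mono[of "\<lambda>k. \<integral>\<^sup>+x. ennreal ((norm (X n x - X (r k) x))\<^sup>2) \<partial>M" "\<lambda>_. ennreal ((1/4) ^ i)" sequentially]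
        by (simp add: Liminf_const)
    qed
    finally show ?thesis .
  qed
  have "(\<lambda>n. L2_sq M (\<lambda>x. X n x - Y x)) \<longlonglongrightarrow> 0"
  proof (rule order_tendstoI)
    fix a :: ennreal assume a: "0 < a"
    have "(\<lambda>i. ennreal ((1/4) ^ i)) \<longlonglongrightarrow> ennreal 0" by (intro tendsto_ennrealI LIMSEQ_realpow_zero) auto
    then have "\<forall>\<^sub>F i in sequentially. ennreal ((1/4) ^ i) < a" using a by (intro order_tendstoD) auto
    then obtain i where "ennreal ((1/4) ^ i) < a" by (auto simp: eventually_sequentially)
    then show "\<forall>\<^sub>F n in sequentially. L2_sq M (\<lambda>x. X n x - Y x) < a"
      using bound by (intro eventually_sequentiallyI[of "N i"]) (meson le_less_trans)
  qed simp
  then show ?thesis using Ym unfolding converges_L2_def L2_sq_def by blast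
qed

text \<open>Applied to the process and to the transformed indicators, with the same coefficients, this turns
equality of covariances into the isometry.\<close>

lemma comb_bilinear_integral:
  fixes \<kappa> \<kappa>' :: "real \<Rightarrow> 'w \<Rightarrow> real"
    and prod :: "'k::{banach, second_countable_topology} \<Rightarrow> 'l::{banach, second_countable_topology} \<Rightarrow> 'm::{banach, second_countable_topology}"
  assumes bl: "bounded_bilinear prod"
    and int: "\<And>s r. s \<in> fst ` set ps \<Longrightarrow> r \<in> fst ` set qs \<Longrightarrow> integrable M (\<lambda>x. \<kappa> s x * \<kappa>' r x)"
  shows "has_bochner_integral M (\<lambda>x. prod (comb \<kappa> ps x) (comb \<kappa>' qs x))
    (\<Sum>(s, v)\<leftarrow>ps. \<Sum>(r, w)\<leftarrow>qs. (LINT x|M. \<kappa> s x * \<kappa>' r x) *\<^sub>R prod v w)"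
proof -
  interpret bounded_bilinear prod by (rule bl)
  have inner: "has_bochner_integral M (\<lambda>x. prod (\<kappa> s x *\<^sub>R v) (comb \<kappa>' rs x))
      (\<Sum>(r, w)\<leftarrow>rs. (LINT x|M. \<kappa> s x * \<kappa>' r x) *\<^sub>R prod v w)"
    if s: "s \<in> fst ` set ps" and rs: "set rs \<subseteq> set qs" for s v rs
    using rs
  proof (induction rs)
    case Nil
    then show ?case by (simp add: comb_def zero_right has_bochner_integral_zero)
  next
    case (Cons p rs)
    obtain r w where p: "p = (r, w)" by (cases p)
    have "r \<in> fst ` set qs" using Cons.prems p by force
    then have "has_bochner_integral M (\<lambda>x. \<kappa> s x * \<kappa>' r x) (LINT x|M. \<kappa> s x * \<kappa>' r x)"
      using int[OF s] by (intro has_bochner_integral_integrable) auto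
    from has_bochner_integral_add[OF has_bochner_integral_scaleR_left[OF this, of "prod v w"] Cons.IH]
    show ?case using Cons.prems by (simp add: p comb_Cons add_right scaleR_left scaleR_right mult.commute)
  qed
  have "has_bochner_integral M (\<lambda>x. prod (comb \<kappa> rs x) (comb \<kappa>' qs x))
    (\<Sum>(s, v)\<leftarrow>rs. \<Sum>(r, w)\<leftarrow>qs. (LINT x|M. \<kappa> s x * \<kappa>' r x) *\<^sub>R prod v w)" if "set rs \<subseteq> set ps" for rs
    using that
  proof (induction rs)
    case Nil
    then show ?case by (simp add: comb_def zero_left has_bochner_integral_zero)
  next
    case (Cons p rs)
    obtain s v where p: "p = (s, v)" by (cases p)
    have s: "s \<in> fst ` set ps" using Cons.prems p by force
    show ?case
      using has_bochner_integral_add[OF inner[OF s order_refl, of v] Cons.IH] Cons.prems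
      by (simp add: p comb_Cons add_left)
  qed
  then show ?thesis by simp
qed

section \<open>Isometry of the Wiener integral\<close>

text \<open>Two processes whose cross covariance is a multiple of that of fractional Brownian motion. It
covers the variance of one coordinate (\<open>\<rho> = 1\<close>), distinct coordinates (\<open>\<rho> = 0\<close>), and the zero
process that belongs to a vanishing eigenvalue (\<open>\<rho> = 0\<close>).\<close>

definition fbm_pair :: "'w measure \<Rightarrow> real \<Rightarrow> real \<Rightarrow> real \<Rightarrow> (real \<Rightarrow> 'w \<Rightarrow> real) \<Rightarrow> (real \<Rightarrow> 'w \<Rightarrow> real) \<Rightarrow> bool" where
  "fbm_pair M H t \<rho> b b' \<longleftrightarrow>
     (\<forall>s\<in>{0..t}. b s \<in> borel_measurable M \<and> b' s \<in> borel_measurable M \<and> L2_sq M (b s) < \<infinity> \<and> L2_sq M (b' s) < \<infinity>) \<and>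
     (\<forall>s\<in>{0..t}. \<forall>r\<in>{0..t}. (LINT \<omega>|M. b s \<omega> * b' r \<omega>) = \<rho> * fbm_cov H s r)"

lemma step_integral_eq_comb: "step_integral b ps = comb b ps"
  by (auto simp: step_integral_def comb_def)

lemma borel_measurable_step_integral:
  fixes ps :: "(real \<times> 'k::{banach, second_countable_topology}) list"
  assumes "\<And>s. s \<in> fst ` set ps \<Longrightarrow> b s \<in> borel_measurable M"
  shows "step_integral b ps \<in> borel_measurable M"
  using assms
proof (induction ps)
  case Nil
  then show ?case by (simp add: step_integral_def)
next
  case (Cons p ps)
  obtain s v where p: "p = (s, v)" by (cases p)
  have [measurable]: "b s \<in> borel_measurable M" "step_integral b ps \<in> borel_measurable M"
    using Cons by (auto simp: p)
  have "step_integral b (p # ps) = (\<lambda>\<omega>. b s \<omega> *\<^sub>R v + step_integral b ps \<omega>)"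
    by (auto simp: p step_integral_def)
  then show ?case by simp
qed

lemma sum_list_scaleR: "(\<Sum>x\<leftarrow>xs. c *\<^sub>R f x) = c *\<^sub>R (\<Sum>x\<leftarrow>xs. f x)"
  for f :: "'x \<Rightarrow> 'k::real_vector"
  by (induction xs) (auto simp: scaleR_right_distrib)

lemma L2_sq_eq_integral:
  fixes f :: "'w \<Rightarrow> 'k::{real_inner, banach, second_countable_topology}"
  assumes "integrable M (\<lambda>x. f x \<bullet> f x)"
  shows "L2_sq M f = ennreal (LINT x|M. f x \<bullet> f x)"
  unfolding L2_sq_def power2_norm_eq_inner using assms by (intro nn_integral_eq_integral) auto

lemma L2_sq_finite_of_close:
  fixes f g :: "'w \<Rightarrow> 'k::{banach, second_countable_topology}"
  assumes "f \<in> borel_measurable M" "g \<in> borel_measurable M" "L2_sq M f < \<infinity>" "L2_sq M (\<lambda>x. f x - g x) < \<infinity>"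
  shows "L2_sq M g < \<infinity>"
proof -
  have "L2_sq M (\<lambda>x. f x - (f x - g x)) \<le> 2 * L2_sq M f + 2 * L2_sq M (\<lambda>x. f x - g x)"
    by (rule L2_sq_diff_le) (use assms in measurable)
  also have "\<dots> < \<infinity>" using assms by (simp add: ennreal_mult_less_top)
  finally show ?thesis by simp
qed

context
  fixes H t :: real
  assumes H: "0 < H" "H < 1" and t: "0 < t"
begin

text \<open>Both sides expand into the same double sum over the coefficients, by
\<open>fbm_transform_indicator_covariance\<close>.\<close>

lemma step_isometry:
  fixes prod :: "'k::{banach, second_countable_topology} \<Rightarrow> 'l::{banach, second_countable_topology} \<Rightarrow> 'm::{banach, second_countable_topology}"
  assumes bl: "bounded_bilinear prod" and b: "fbm_pair M H t \<rho> b b'"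
    and ps: "fst ` set ps \<subseteq> {0..t}" and qs: "fst ` set qs \<subseteq> {0..t}"
  shows "integrable M (\<lambda>\<omega>. prod (step_integral b ps \<omega>) (step_integral b' qs \<omega>))"
    and "integrable (Leb t) (\<lambda>x. prod (step_transform H t ps x) (step_transform H t qs x))"
    and "(LINT \<omega>|M. prod (step_integral b ps \<omega>) (step_integral b' qs \<omega>)) =
      (\<rho> * hurst_const H) *\<^sub>R (LINT x|Leb t. prod (step_transform H t ps x) (step_transform H t qs x))"
proof -
  let ?L = "Leb t"
  let ?k = "\<lambda>s. fbm_transform H t (indicat_real {0..s})"
  have 1: "has_bochner_integral M (\<lambda>\<omega>. prod (step_integral b ps \<omega>) (step_integral b' qs \<omega>))
      (\<Sum>(s, v)\<leftarrow>ps. \<Sum>(r, w)\<leftarrow>qs. (LINT \<omega>|M. b s \<omega> * b' r \<omega>) *\<^sub>R prod v w)"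
    unfolding step_integral_eq_comb
  proof (rule comb_bilinear_integral[OF bl])
    fix s r assume "s \<in> fst ` set ps" "r \<in> fst ` set qs"
    then have "s \<in> {0..t}" "r \<in> {0..t}" using ps qs by auto
    then show "integrable M (\<lambda>\<omega>. b s \<omega> * b' r \<omega>)"
      using b unfolding fbm_pair_def by (intro L2_product_integrable) auto
  qed
  have 2: "has_bochner_integral ?L (\<lambda>x. prod (step_transform H t ps x) (step_transform H t qs x))
      (\<Sum>(s, v)\<leftarrow>ps. \<Sum>(r, w)\<leftarrow>qs. (LINT x|?L. ?k s x * ?k r x) *\<^sub>R prod v w)"
  proof (rule comb_bilinear_integral[OF bl])
    fix s r assume "s \<in> fst ` set ps" "r \<in> fst ` set qs"
    then have "?k s \<in> L2_fun t" "?k r \<in> L2_fun t"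
      using ps qs by (auto intro!: fbm_transform_in_L2_fun[OF H t] indicator_in_LH[OF H t])
    then show "integrable ?L (\<lambda>x. ?k s x * ?k r x)"
      unfolding L2_fun_iff by (intro L2_product_integrable) auto
  qed
  have "(\<Sum>(s, v)\<leftarrow>ps. \<Sum>(r, w)\<leftarrow>qs. (LINT \<omega>|M. b s \<omega> * b' r \<omega>) *\<^sub>R prod v w) =
    (\<Sum>p\<leftarrow>ps. \<Sum>q\<leftarrow>qs. (\<rho> * hurst_const H) *\<^sub>R (LINT x|?L. ?k (fst p) x * ?k (fst q) x) *\<^sub>R prod (snd p) (snd q))"
  proof (intro arg_cong[where f = sum_list] map_cong refl, clarify)
    fix s v assume s: "(s, v) \<in> set ps"
    show "(\<Sum>(r, w)\<leftarrow>qs. (LINT \<omega>|M. b s \<omega> * b' r \<omega>) *\<^sub>R prod v w) =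
      (\<Sum>q\<leftarrow>qs. (\<rho> * hurst_const H) *\<^sub>R (LINT x|?L. ?k (fst (s, v)) x * ?k (fst q) x) *\<^sub>R prod (snd (s, v)) (snd q))"
    proof (intro arg_cong[where f = sum_list] map_cong refl, clarify)
      fix r w assume r: "(r, w) \<in> set qs"
      have sr: "s \<in> {0..t}" "r \<in> {0..t}" using ps qs s r by force+
      then have "(LINT \<omega>|M. b s \<omega> * b' r \<omega>) = \<rho> * (hurst_const H * (LINT x|?L. ?k s x * ?k r x))"
        using b unfolding fbm_transform_indicator_covariance[OF H t sr] fbm_pair_def by blast
      then show "(LINT \<omega>|M. b s \<omega> * b' r \<omega>) *\<^sub>R prod v w =
          (\<rho> * hurst_const H) *\<^sub>R (LINT x|?L. ?k (fst (s, v)) x * ?k (fst (r, w)) x) *\<^sub>R prod (snd (s, v)) (snd (r, w))"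
        by (simp add: mult.assoc)
    qed
  qed
  also have "\<dots> = (\<rho> * hurst_const H) *\<^sub>R (\<Sum>(s, v)\<leftarrow>ps. \<Sum>(r, w)\<leftarrow>qs. (LINT x|?L. ?k s x * ?k r x) *\<^sub>R prod v w)"
    unfolding sum_list_scaleR by (simp add: case_prod_unfold)
  finally show "(LINT \<omega>|M. prod (step_integral b ps \<omega>) (step_integral b' qs \<omega>)) =
      (\<rho> * hurst_const H) *\<^sub>R (LINT x|?L. prod (step_transform H t ps x) (step_transform H t qs x))"
    unfolding has_bochner_integral_integral_eq[OF 1] has_bochner_integral_integral_eq[OF 2] .
  show "integrable M (\<lambda>\<omega>. prod (step_integral b ps \<omega>) (step_integral b' qs \<omega>))"
    using 1 by (auto simp: has_bochner_integral_iff)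
  show "integrable ?L (\<lambda>x. prod (step_transform H t ps x) (step_transform H t qs x))"
    using 2 by (auto simp: has_bochner_integral_iff)
qed

lemma step_integral_L2_sq:
  fixes ps :: "(real \<times> 'k::{real_inner, banach, second_countable_topology}) list"
  assumes b: "fbm_pair M H t \<rho> b b" "0 \<le> \<rho>" and ps: "fst ` set ps \<subseteq> {0..t}"
  shows "L2_sq M (step_integral b ps) = ennreal (\<rho> * hurst_const H) * L2_sq (Leb t) (step_transform H t ps)"
    and "L2_sq (Leb t) (step_transform H t ps) < \<infinity>"
proof -
  note iso = step_isometry[OF bounded_bilinear_inner b(1) ps ps]
  have "0 \<le> \<rho> * hurst_const H" using b hurst_const_pos[OF H] by simp
  then show "L2_sq M (step_integral b ps) = ennreal (\<rho> * hurst_const H) * L2_sq (Leb t) (step_transform H t ps)"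
    unfolding L2_sq_eq_integral[OF iso(1)] L2_sq_eq_integral[OF iso(2)] iso(3) real_scaleR_def
    by (rule ennreal_mult')
  show "L2_sq (Leb t) (step_transform H t ps) < \<infinity>"
    unfolding L2_sq_eq_integral[OF iso(2)] by simp
qed

lemma step_fun_sequence:
  fixes f :: "real \<Rightarrow> 'k::{real_inner, banach, second_countable_topology}"
  assumes f: "f \<in> LH H t"
  shows "\<exists>ps :: nat \<Rightarrow> (real \<times> 'k) list. (\<forall>n. fst ` set (ps n) \<subseteq> {0..t}) \<and>
    (\<lambda>n. LH_norm_sq H t (\<lambda>s. step_fun (ps n) s - f s)) \<longlonglongrightarrow> 0"
proof -
  have "\<forall>n. \<exists>ps. fst ` set ps \<subseteq> {0..t} \<and> LH_norm_sq H t (\<lambda>x. step_fun ps x - f x) < ennreal (1 / Suc n)"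
    by (intro allI step_fun_dense[OF H t f]) simp
  then obtain ps where ps: "\<And>n. fst ` set (ps n) \<subseteq> {0..t}"
      "\<And>n. LH_norm_sq H t (\<lambda>x. step_fun (ps n) x - f x) < ennreal (1 / Suc n)"
    by metis
  have z: "(\<lambda>n. ennreal (1 / Suc n)) \<longlonglongrightarrow> 0"
    using tendsto_ennrealI[OF LIMSEQ_Suc[OF lim_1_over_n]] by simp
  have "(\<lambda>n. LH_norm_sq H t (\<lambda>s. step_fun (ps n) s - f s)) \<longlonglongrightarrow> 0"
  proof (rule tendsto_sandwich[OF _ _ tendsto_const z])
    show "\<forall>\<^sub>F n in sequentially. LH_norm_sq H t (\<lambda>s. step_fun (ps n) s - f s) \<le> ennreal (1 / Suc n)"
      by (intro always_eventually allI less_imp_le ps(2))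
  qed simp
  then show ?thesis using ps(1) by blast
qed

lemma step_transform_tendsto:
  fixes f :: "real \<Rightarrow> 'k::{real_inner, banach, second_countable_topology}"
  assumes f: "f \<in> LH H t" and ps: "\<And>n. fst ` set (ps n) \<subseteq> {0..t}"
    and lim: "(\<lambda>n. LH_norm_sq H t (\<lambda>s. step_fun (ps n) s - f s)) \<longlonglongrightarrow> 0"
  shows "(\<lambda>n. L2_sq (Leb t) (\<lambda>x. step_transform H t (ps n) x - fbm_transform H t f x)) \<longlonglongrightarrow> 0"
proof -
  obtain C where C: "C > 0" "\<And>ps. fst ` set ps \<subseteq> {0..t} \<Longrightarrow>
    L2_sq (Leb t) (\<lambda>x. step_transform H t ps x - fbm_transform H t f x) \<le>
    ennreal C * LH_norm_sq H t (\<lambda>x. step_fun ps x - f x)"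
    using step_transform_bound[OF H t f] by blast
  have "(\<lambda>n. ennreal C * LH_norm_sq H t (\<lambda>s. step_fun (ps n) s - f s)) \<longlonglongrightarrow> ennreal C * 0"
    by (intro ennreal_tendsto_cmult lim) simp
  then have z: "(\<lambda>n. ennreal C * LH_norm_sq H t (\<lambda>s. step_fun (ps n) s - f s)) \<longlonglongrightarrow> 0" by simp
  show ?thesis
  proof (rule tendsto_sandwich[OF _ _ tendsto_const z])
    show "\<forall>\<^sub>F n in sequentially. L2_sq (Leb t) (\<lambda>x. step_transform H t (ps n) x - fbm_transform H t f x) \<le>
        ennreal C * LH_norm_sq H t (\<lambda>s. step_fun (ps n) s - f s)"
      by (intro always_eventually allI C(2) ps)
  qed simp
qed

lemma borel_measurable_step_transform:
  fixes ps :: "(real \<times> 'k::{banach, second_countable_topology}) list"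
  assumes "fst ` set ps \<subseteq> {0..t}"
  shows "step_transform H t ps \<in> borel_measurable (Leb t)"
  unfolding step_integral_eq_comb[symmetric]
proof (rule borel_measurable_step_integral)
  fix s assume "s \<in> fst ` set ps"
  then have "fbm_transform H t (indicat_real {0..s}) \<in> L2_fun t"
    using assms by (auto intro!: fbm_transform_in_L2_fun[OF H t] indicator_in_LH[OF H t])
  then show "fbm_transform H t (indicat_real {0..s}) \<in> borel_measurable (Leb t)"
    by (simp add: L2_fun_iff)
qed

text \<open>The isometry turns the Cauchy property of the transformed step functions into that of their
integrals.\<close>

lemma step_integral_converges:
  fixes f :: "real \<Rightarrow> 'k::{real_inner, banach, second_countable_topology}"
  assumes f: "f \<in> LH H t" and b: "fbm_pair M H t \<rho> b b" "0 \<le> \<rho>"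
    and ps: "\<And>n. fst ` set (ps n) \<subseteq> {0..t}"
    and lim: "(\<lambda>n. LH_norm_sq H t (\<lambda>s. step_fun (ps n) s - f s)) \<longlonglongrightarrow> 0"
  shows "\<exists>X. converges_L2 M (\<lambda>n. step_integral b (ps n)) X"
proof (rule L2_complete)
  let ?d = "\<lambda>n k \<omega>. step_integral b (ps n) \<omega> - step_integral b (ps k) \<omega>"
  let ?L = "Leb t"
  let ?D = "\<lambda>n. L2_sq ?L (\<lambda>x. step_transform H t (ps n) x - fbm_transform H t f x)"
  show m: "step_integral b (ps n) \<in> borel_measurable M" for n
    using b ps[of n] unfolding fbm_pair_def by (intro borel_measurable_step_integral) blast
  define c where "c = \<rho> * hurst_const H"
  have c: "0 \<le> c" using b hurst_const_pos[OF H] by (simp add: c_def)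
  have Tm: "fbm_transform H t f \<in> borel_measurable ?L"
    using fbm_transform_in_L2_fun[OF H t f] by (simp add: L2_fun_iff)
  have bound: "L2_sq M (?d n k) \<le>
      ennreal c * (2 * ?D n + 2 * ?D k)" for n k
  proof -
    \<comment> \<open>The difference of two step functions is again a combination of generators.\<close>
    let ?q = "ps n @ map (\<lambda>(s, v). (s, - v)) (ps k)"
    have q: "fst ` set ?q \<subseteq> {0..t}" using ps[of n] ps[of k] by force
    have neg: "linear (uminus :: 'k \<Rightarrow> 'k)" by (simp add: linear_iff)
    have eq: "comb \<kappa> ?q x = comb \<kappa> (ps n) x - comb \<kappa> (ps k) x" for \<kappa> :: "real \<Rightarrow> 'z \<Rightarrow> real" and x
      by (simp add: comb_append comb_map[OF neg])
    have "L2_sq M (?d n k) = L2_sq M (step_integral b ?q)"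
      unfolding step_integral_eq_comb by (simp add: eq[abs_def])
    also have "\<dots> = ennreal c * L2_sq ?L (step_transform H t ?q)"
      unfolding c_def by (rule step_integral_L2_sq(1)[OF b q])
    also have "\<dots> \<le> ennreal c * (2 * ?D n + 2 * ?D k)"
    proof (rule mult_left_mono)
      have "L2_sq ?L (step_transform H t ?q) = L2_sq ?L (\<lambda>x. step_transform H t (ps n) x - step_transform H t (ps k) x)"
        by (simp add: eq[abs_def])
      also have "\<dots> \<le> 2 * ?D n + 2 * L2_sq ?L (\<lambda>x. fbm_transform H t f x - step_transform H t (ps k) x)"
        by (intro L2_sq_triangle_le borel_measurable_step_transform ps Tm)
      also have "L2_sq ?L (\<lambda>x. fbm_transform H t f x - step_transform H t (ps k) x) = ?D k"
        by (rule L2_sq_minus_commute)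
      finally show "L2_sq ?L (step_transform H t ?q) \<le> 2 * ?D n + 2 * ?D k" .
    qed simp
    finally show ?thesis .
  qed
  fix e :: real assume e: "e > 0"
  define \<delta> where "\<delta> = e / (4 * c + 4)"
  have \<delta>: "\<delta> > 0" "c * (4 * \<delta>) < e" using e c by (auto simp: \<delta>_def field_simps)
  have "\<forall>\<^sub>F n in sequentially. ?D n < ennreal \<delta>"
    using step_transform_tendsto[OF f ps lim] \<delta> by (intro order_tendstoD) auto
  then obtain N where N: "\<And>n. n \<ge> N \<Longrightarrow> ?D n < ennreal \<delta>" by (auto simp: eventually_sequentially)
  show "\<exists>N. \<forall>n\<ge>N. \<forall>k\<ge>N. L2_sq M (?d n k) < ennreal e"
  proof (intro exI[of _ N] allI impI)
    fix n k assume nk: "n \<ge> N" "k \<ge> N"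
    note bound[of n k]
    also have "ennreal c * (2 * ?D n + 2 * ?D k) \<le> ennreal c * (2 * ennreal \<delta> + 2 * ennreal \<delta>)"
      using N[OF nk(1)] N[OF nk(2)] by (intro mult_left_mono add_mono) auto
    also have "2 * ennreal \<delta> + 2 * ennreal \<delta> = ennreal (4 * \<delta>)"
    proof -
      have "2 * ennreal \<delta> = ennreal (2 * \<delta>)" using ennreal_mult'[of 2 \<delta>] by simp
      then show ?thesis using \<delta> by (simp flip: ennreal_plus)
    qed
    also have "ennreal c * ennreal (4 * \<delta>) = ennreal (c * (4 * \<delta>))" using c by (rule ennreal_mult'[symmetric])
    also have "\<dots> < ennreal e" using \<delta> e by (intro ennreal_lessI) auto
    finally show "L2_sq M (?d n k) < ennreal e" .
  qed
qed

text \<open>The Wiener integral is some limit of some approximating sequence; this extracts the sequence for which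
it is the limit.\<close>

lemma wiener_integral_approx:
  fixes f :: "real \<Rightarrow> 'k::{real_inner, banach, second_countable_topology}"
  assumes f: "f \<in> LH H t" and b: "fbm_pair M H t \<rho> b b" "0 \<le> \<rho>"
  shows "\<exists>ps. (\<forall>n. fst ` set (ps n) \<subseteq> {0..t}) \<and>
    (\<lambda>n. L2_sq (Leb t) (\<lambda>x. step_transform H t (ps n) x - fbm_transform H t f x)) \<longlonglongrightarrow> 0 \<and>
    (\<forall>n. step_integral b (ps n) \<in> borel_measurable M) \<and>
    (\<lambda>n. L2_sq M (\<lambda>\<omega>. step_integral b (ps n) \<omega> - wiener_integral M H t b f \<omega>)) \<longlonglongrightarrow> 0 \<and>
    wiener_integral M H t b f \<in> borel_measurable M \<and> L2_sq M (wiener_integral M H t b f) < \<infinity>"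
proof -
  let ?W = "wiener_integral M H t b f"
  let ?P = "\<lambda>X. \<exists>ps :: nat \<Rightarrow> (real \<times> 'k) list. (\<forall>n. fst ` set (ps n) \<subseteq> {0..t}) \<and>
        (\<lambda>n. LH_norm_sq H t (\<lambda>s. step_fun (ps n) s - f s)) \<longlonglongrightarrow> 0 \<and>
        converges_L2 M (\<lambda>n. step_integral b (ps n)) X"
  obtain ps0 :: "nat \<Rightarrow> (real \<times> 'k) list" where ps0: "\<And>n. fst ` set (ps0 n) \<subseteq> {0..t}"
      "(\<lambda>n. LH_norm_sq H t (\<lambda>s. step_fun (ps0 n) s - f s)) \<longlonglongrightarrow> 0"
    using step_fun_sequence[OF f] by blast
  obtain X where "converges_L2 M (\<lambda>n. step_integral b (ps0 n)) X"
    using step_integral_converges[OF f b ps0] by blast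
  then have "?P X" using ps0 by blast
  then have "?P (Eps ?P)" by (rule someI[where P = ?P])
  then have "?P ?W" unfolding wiener_integral_def .
  then obtain ps :: "nat \<Rightarrow> (real \<times> 'k) list" where ps: "\<And>n. fst ` set (ps n) \<subseteq> {0..t}"
      "(\<lambda>n. LH_norm_sq H t (\<lambda>s. step_fun (ps n) s - f s)) \<longlonglongrightarrow> 0"
      "converges_L2 M (\<lambda>n. step_integral b (ps n)) ?W"
    by blast
  have m: "step_integral b (ps n) \<in> borel_measurable M" for n
    using b ps(1)[of n] unfolding fbm_pair_def by (intro borel_measurable_step_integral) blast
  have W: "?W \<in> borel_measurable M" "(\<lambda>n. L2_sq M (\<lambda>\<omega>. step_integral b (ps n) \<omega> - ?W \<omega>)) \<longlonglongrightarrow> 0"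
    using ps(3) by (auto simp: converges_L2_def L2_sq_def)
  have "\<forall>\<^sub>F n in sequentially. L2_sq M (\<lambda>\<omega>. step_integral b (ps n) \<omega> - ?W \<omega>) < \<infinity>"
    by (rule order_tendstoD[OF W(2)]) simp
  then obtain n where n: "L2_sq M (\<lambda>\<omega>. step_integral b (ps n) \<omega> - ?W \<omega>) < \<infinity>"
    by (auto simp: eventually_sequentially)
  have "L2_sq M (step_integral b (ps n)) < \<infinity>"
    using step_integral_L2_sq[OF b ps(1)[of n]] by (simp add: ennreal_mult_less_top)
  then have "L2_sq M ?W < \<infinity>" using n by (intro L2_sq_finite_of_close[OF m W(1)])
  with ps(1) m W show ?thesis
    by (intro exI[of _ ps] conjI allI step_transform_tendsto[OF f ps(1,2)])
qed

text \<open>The approximating sequences of the two integrals may be unrelated: the bilinear limit needs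
only that each of them converges.\<close>

lemma wiener_isometry:
  fixes f :: "real \<Rightarrow> 'k::{real_inner, banach, second_countable_topology}"
    and g :: "real \<Rightarrow> 'l::{real_inner, banach, second_countable_topology}"
    and prod :: "'k \<Rightarrow> 'l \<Rightarrow> 'm::{banach, second_countable_topology}"
  assumes bl: "bounded_bilinear prod" and f: "f \<in> LH H t" and g: "g \<in> LH H t"
    and b: "fbm_pair M H t \<rho>\<^sub>1 b b" "0 \<le> \<rho>\<^sub>1" and b': "fbm_pair M H t \<rho>\<^sub>2 b' b'" "0 \<le> \<rho>\<^sub>2"
    and bb': "fbm_pair M H t \<rho> b b'"
  shows "has_bochner_integral M (\<lambda>\<omega>. prod (wiener_integral M H t b f \<omega>) (wiener_integral M H t b' g \<omega>))
    ((\<rho> * hurst_const H) *\<^sub>R (LINT x|Leb t. prod (fbm_transform H t f x) (fbm_transform H t g x)))"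
proof -
  let ?L = "Leb t"
  obtain ps where ps: "\<And>n. fst ` set (ps n) \<subseteq> {0..t}"
    "(\<lambda>n. L2_sq ?L (\<lambda>x. step_transform H t (ps n) x - fbm_transform H t f x)) \<longlonglongrightarrow> 0"
    "\<And>n. step_integral b (ps n) \<in> borel_measurable M"
    "(\<lambda>n. L2_sq M (\<lambda>\<omega>. step_integral b (ps n) \<omega> - wiener_integral M H t b f \<omega>)) \<longlonglongrightarrow> 0"
    "wiener_integral M H t b f \<in> borel_measurable M" "L2_sq M (wiener_integral M H t b f) < \<infinity>"
    using wiener_integral_approx[OF f b] by (elim exE conjE) (rule that; (assumption | erule spec))
  obtain qs where qs: "\<And>n. fst ` set (qs n) \<subseteq> {0..t}"
    "(\<lambda>n. L2_sq ?L (\<lambda>x. step_transform H t (qs n) x - fbm_transform H t g x)) \<longlonglongrightarrow> 0"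
    "\<And>n. step_integral b' (qs n) \<in> borel_measurable M"
    "(\<lambda>n. L2_sq M (\<lambda>\<omega>. step_integral b' (qs n) \<omega> - wiener_integral M H t b' g \<omega>)) \<longlonglongrightarrow> 0"
    "wiener_integral M H t b' g \<in> borel_measurable M" "L2_sq M (wiener_integral M H t b' g) < \<infinity>"
    using wiener_integral_approx[OF g b'] by (elim exE conjE) (rule that; (assumption | erule spec))
  have T: "fbm_transform H t f \<in> borel_measurable ?L" "L2_sq ?L (fbm_transform H t f) < \<infinity>"
    "fbm_transform H t g \<in> borel_measurable ?L" "L2_sq ?L (fbm_transform H t g) < \<infinity>"
    using fbm_transform_in_L2_fun[OF H t f] fbm_transform_in_L2_fun[OF H t g] by (auto simp: L2_fun_iff)
  note iso = step_isometry[OF bl bb' ps(1) qs(1)]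
  have "(\<lambda>n. LINT \<omega>|M. prod (step_integral b (ps n) \<omega>) (step_integral b' (qs n) \<omega>)) \<longlonglongrightarrow>
      (LINT \<omega>|M. prod (wiener_integral M H t b f \<omega>) (wiener_integral M H t b' g \<omega>))"
    by (rule bilinear_L2_limit[OF bl ps(5) qs(5) ps(3) qs(3) ps(6) qs(6) ps(4) qs(4) iso(1)])
  moreover have "(\<lambda>n. (\<rho> * hurst_const H) *\<^sub>R (LINT x|?L. prod (step_transform H t (ps n) x) (step_transform H t (qs n) x))) \<longlonglongrightarrow>
      (\<rho> * hurst_const H) *\<^sub>R (LINT x|?L. prod (fbm_transform H t f x) (fbm_transform H t g x))"
    by (intro tendsto_scaleR tendsto_const bilinear_L2_limit[OF bl T(1,3) _ _ T(2,4) ps(2) qs(2) iso(2)]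
        borel_measurable_step_transform ps(1) qs(1))
  ultimately have "(LINT \<omega>|M. prod (wiener_integral M H t b f \<omega>) (wiener_integral M H t b' g \<omega>)) =
      (\<rho> * hurst_const H) *\<^sub>R (LINT x|?L. prod (fbm_transform H t f x) (fbm_transform H t g x))"
    unfolding iso(3) by (rule LIMSEQ_unique)
  then show ?thesis
    using bilinear_L2_integrable(2)[OF bl ps(5) qs(5) ps(6) qs(6)] by (simp add: has_bochner_integral_iff)
qed

end

section \<open>Hilbert--Schmidt operators and the eigenbasis of the covariance\<close>

lemma bounded_linear_hs_apply: "bounded_linear (\<lambda>A. hs_apply A x)"
proof (rule bounded_linear_intro)
  show "norm (hs_apply A x) \<le> norm A * norm x" for A :: "'a hs" by (rule norm_hs_apply_le)
qed (auto simp: hs_apply_add hs_apply_scaleR)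

lemma bounded_bilinear_hs_tensor:
  "bounded_bilinear (hs_tensor :: 'a::{real_inner, banach, second_countable_topology} \<Rightarrow> 'a \<Rightarrow> 'a hs)"
proof
  show "hs_tensor (a + a') b = hs_tensor a b + hs_tensor a' b" for a a' b :: 'a
    by (rule hs_eqI) (simp add: hs_apply_tensor hs_apply_add scaleR_right_distrib)
  show "hs_tensor a (b + b') = hs_tensor a b + hs_tensor a b'" for a b b' :: 'a
    by (rule hs_eqI) (simp add: hs_apply_tensor hs_apply_add inner_add_right scaleR_left_distrib)
  show "hs_tensor (r *\<^sub>R a) b = r *\<^sub>R hs_tensor a b" for r and a b :: 'a
    by (rule hs_eqI) (simp add: hs_apply_tensor hs_apply_scaleR)
  show "hs_tensor a (r *\<^sub>R b) = r *\<^sub>R hs_tensor a b" for r and a b :: 'a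
    by (rule hs_eqI) (simp add: hs_apply_tensor hs_apply_scaleR)
  show "\<exists>K. \<forall>a b :: 'a. norm (hs_tensor a b) \<le> norm a * norm b * K"
    by (intro exI[of _ 1]) (simp add: norm_hs_tensor)
qed

lemma hs_apply_comp: "hs_apply (A \<odot> B) x = hs_apply A (hs_apply B x)"
  by (simp add: hs_comp.rep_eq)

lemma hs_adjoint_scaleR: "hs_adjoint (c *\<^sub>R A) = c *\<^sub>R hs_adjoint A"
  by (rule hs_adjoint_unique) (simp add: hs_apply_scaleR inner_hs_apply_left)

lemma hs_comp_scaleR_adjoint: "(a *\<^sub>R A) \<odot> L \<odot> hs_adjoint (a *\<^sub>R B) = (a * a) *\<^sub>R (A \<odot> L \<odot> hs_adjoint B)"
  by (rule hs_eqI) (simp add: hs_apply_comp hs_apply_scaleR hs_adjoint_scaleR blinfun.scaleR_right)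

context
  fixes \<Lambda> :: "'a::{real_inner, banach, second_countable_topology} hs"
    and K :: "nat set" and lam :: "nat \<Rightarrow> real" and h :: "nat \<Rightarrow> 'a"
  assumes \<Lambda>: "trace_class_covariance \<Lambda>" and eig: "eigenbasis \<Lambda> K lam h"
begin

lemma eigenvector_inner: "k \<in> K \<Longrightarrow> l \<in> K \<Longrightarrow> h k \<bullet> h l = (if k = l then 1 else 0)"
  using eig unfolding eigenbasis_def orthonormal_basis_def orthonormal_def pairwise_def orthogonal_def inj_on_def
  by (auto simp: dot_square_norm)

lemma norm_eigenvector: "k \<in> K \<Longrightarrow> norm (h k) = 1"
  using eig unfolding eigenbasis_def orthonormal_basis_def orthonormal_def by auto

lemma eigenvector: "k \<in> K \<Longrightarrow> hs_apply \<Lambda> (h k) = lam k *\<^sub>R h k"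
  using eig unfolding eigenbasis_def by auto

text \<open>Bounded weights suffice for convergence of the series below, since the values of a Hilbert--Schmidt
operator on the eigenbasis are square summable.\<close>

lemma eigenvalue_bounds: "k \<in> K \<Longrightarrow> 0 \<le> lam k" "k \<in> K \<Longrightarrow> lam k \<le> norm \<Lambda>"
proof -
  assume k: "k \<in> K"
  have "0 \<le> hs_apply \<Lambda> (h k) \<bullet> h k" using \<Lambda> unfolding trace_class_covariance_def by blast
  then show p: "0 \<le> lam k" using k by (simp add: eigenvector eigenvector_inner)
  have "norm (hs_apply \<Lambda> (h k)) \<le> norm \<Lambda> * norm (h k)" by (rule norm_hs_apply_le)
  then show "lam k \<le> norm \<Lambda>" using k p by (simp add: eigenvector norm_eigenvector)
qed

lemma sum_norm_sq_eigenbasis_le: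
  assumes S: "finite S" "S \<subseteq> K"
  shows "(\<Sum>k\<in>S. (norm (hs_apply A (h k)))\<^sup>2) \<le> (norm A)\<^sup>2"
proof -
  have inj: "inj_on h S" using eig S(2) inj_on_subset unfolding eigenbasis_def by blast
  have hs: "((\<lambda>e. (norm (hs_apply A e))\<^sup>2) has_sum (norm A)\<^sup>2) (h ` K)"
    using eig by (intro norm_hs_any_basis) (simp add: eigenbasis_def)
  have "(\<Sum>k\<in>S. (norm (hs_apply A (h k)))\<^sup>2) = (\<Sum>e\<in>h ` S. (norm (hs_apply A e))\<^sup>2)"
    by (simp add: sum.reindex[OF inj])
  also have "\<dots> \<le> infsum (\<lambda>e. (norm (hs_apply A e))\<^sup>2) (h ` K)"
    using S hs by (intro finite_sum_le_infsum) (auto simp: summable_on_def)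
  also have "\<dots> = (norm A)\<^sup>2" using hs by (rule infsumI)
  finally show ?thesis .
qed

lemma sum_norm_product_le:
  assumes S: "finite S" "S \<subseteq> K"
  shows "(\<Sum>k\<in>S. norm (lam k *\<^sub>R hs_tensor (hs_apply A (h k)) (hs_apply B (h k)))) \<le> norm \<Lambda> * (norm A * norm B)"
proof -
  have le: "L2_set (\<lambda>k. norm (hs_apply A (h k))) S \<le> norm A" for A
    unfolding L2_set_def using sum_norm_sq_eigenbasis_le[OF S, of A] by (intro real_le_lsqrt) auto
  have "(\<Sum>k\<in>S. norm (lam k *\<^sub>R hs_tensor (hs_apply A (h k)) (hs_apply B (h k)))) \<le>
      (\<Sum>k\<in>S. norm \<Lambda> * (norm (hs_apply A (h k)) * norm (hs_apply B (h k))))"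
  proof (rule sum_mono)
    fix k assume "k \<in> S"
    then have "\<bar>lam k\<bar> \<le> norm \<Lambda>" using eigenvalue_bounds[of k] S by auto
    then show "norm (lam k *\<^sub>R hs_tensor (hs_apply A (h k)) (hs_apply B (h k))) \<le> norm \<Lambda> * (norm (hs_apply A (h k)) * norm (hs_apply B (h k)))"
      by (simp add: norm_hs_tensor mult_right_mono)
  qed
  also have "\<dots> = norm \<Lambda> * (\<Sum>k\<in>S. \<bar>norm (hs_apply A (h k))\<bar> * \<bar>norm (hs_apply B (h k))\<bar>)"
    by (simp add: sum_distrib_left)
  also have "\<dots> \<le> norm \<Lambda> * (L2_set (\<lambda>k. norm (hs_apply A (h k))) S * L2_set (\<lambda>k. norm (hs_apply B (h k))) S)"
    by (intro mult_left_mono L2_set_mult_ineq) auto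
  also have "\<dots> \<le> norm \<Lambda> * (norm A * norm B)"
    by (intro mult_left_mono mult_mono le) (auto simp: L2_set_nonneg)
  finally show ?thesis .
qed

text \<open>The series converges absolutely in the Hilbert--Schmidt norm, so its sum can be identified weakly,
where it is Parseval's identity for \<open>\<Lambda> B* x\<close> and \<open>A* y\<close>.\<close>

lemma spectral_sum_tendsto:
  "(\<lambda>n. \<Sum>k\<in>K \<inter> {..<n}. lam k *\<^sub>R hs_tensor (hs_apply A (h k)) (hs_apply B (h k))) \<longlonglongrightarrow> A \<odot> \<Lambda> \<odot> hs_adjoint B"
proof -
  let ?g = "\<lambda>k. if k \<in> K then lam k *\<^sub>R hs_tensor (hs_apply A (h k)) (hs_apply B (h k)) else 0"
  have part: "(\<Sum>k\<in>K \<inter> {..<n}. f k) = (\<Sum>k<n. if k \<in> K then f k else 0)" for n and f :: "nat \<Rightarrow> 'z::comm_monoid_add"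
    by (subst Int_commute) (simp add: sum.inter_restrict)
  have summ: "summable (\<lambda>k. norm (?g k))"
  proof (rule bounded_imp_summable)
    fix n
    have "(\<Sum>k\<le>n. norm (?g k)) = (\<Sum>k\<in>K \<inter> {..<Suc n}. norm (lam k *\<^sub>R hs_tensor (hs_apply A (h k)) (hs_apply B (h k))))"
      unfolding part unfolding lessThan_Suc_atMost by (intro sum.cong) auto
    also have "\<dots> \<le> norm \<Lambda> * (norm A * norm B)" by (rule sum_norm_product_le) auto
    finally show "(\<Sum>k\<le>n. norm (?g k)) \<le> norm \<Lambda> * (norm A * norm B)" .
  qed simp
  then have "summable ?g" by (rule summable_norm_cancel)
  then have lim: "(\<lambda>n. \<Sum>k<n. ?g k) \<longlonglongrightarrow> suminf ?g" by (rule summable_LIMSEQ)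
  have "suminf ?g = A \<odot> \<Lambda> \<odot> hs_adjoint B"
  proof (rule hs_eqI)
    fix x :: 'a
    show "hs_apply (suminf ?g) x = hs_apply (A \<odot> \<Lambda> \<odot> hs_adjoint B) x"
    proof (rule vector_eq_rdot[THEN iffD1], rule allI)
      fix y :: 'a
      let ?u = "hs_apply (hs_adjoint B) x" and ?v = "hs_apply (hs_adjoint A) y"
      let ?c = "\<lambda>k. if k \<in> K then lam k * (?u \<bullet> h k) * (?v \<bullet> h k) else 0"
      have bl: "bounded_linear (\<lambda>A. hs_apply A x \<bullet> y)"
        by (rule bounded_linear_compose[OF bounded_linear_inner_left bounded_linear_hs_apply])
      have adj: "hs_apply (hs_adjoint C) z \<bullet> w = z \<bullet> hs_apply C w" for C and z w :: 'a
        using inner_hs_apply_left[of C w z] by (simp only: inner_commute)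
      have c: "hs_apply (?g k) x \<bullet> y = ?c k" for k
        unfolding adj by (simp add: hs_apply_scaleR hs_apply_tensor hs_apply_zero inner_commute[of y])
      have "(\<lambda>n. hs_apply (\<Sum>k<n. ?g k) x \<bullet> y) \<longlonglongrightarrow> hs_apply (suminf ?g) x \<bullet> y"
        by (rule bounded_linear.tendsto[OF bl lim])
      then have "(\<lambda>n. \<Sum>k<n. ?c k) \<longlonglongrightarrow> hs_apply (suminf ?g) x \<bullet> y"
        unfolding hs_apply_sum inner_sum_left c .
      moreover have "(\<lambda>n. \<Sum>k<n. ?c k) \<longlonglongrightarrow> hs_apply (A \<odot> \<Lambda> \<odot> hs_adjoint B) x \<bullet> y"
      proof -
        have inj: "inj_on h K" using eig by (simp add: eigenbasis_def)
        have "((\<lambda>e. (hs_apply \<Lambda> ?u \<bullet> e) * (?v \<bullet> e)) has_sum hs_apply \<Lambda> ?u \<bullet> ?v) (h ` K)"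
          using eig by (intro parseval_inner) (simp add: eigenbasis_def)
        then have "((\<lambda>k. (hs_apply \<Lambda> ?u \<bullet> h k) * (?v \<bullet> h k)) has_sum hs_apply \<Lambda> ?u \<bullet> ?v) K"
          by (simp add: has_sum_reindex[OF inj] o_def)
        also have "((\<lambda>k. (hs_apply \<Lambda> ?u \<bullet> h k) * (?v \<bullet> h k)) has_sum hs_apply \<Lambda> ?u \<bullet> ?v) K \<longleftrightarrow>
            (?c has_sum hs_apply \<Lambda> ?u \<bullet> ?v) UNIV"
        proof (rule has_sum_cong_neutral)
          fix k assume k: "k \<in> K \<inter> UNIV"
          have "hs_apply \<Lambda> ?u \<bullet> h k = ?u \<bullet> hs_apply \<Lambda> (h k)" using \<Lambda> by (simp add: trace_class_covariance_def)
          then show "(hs_apply \<Lambda> ?u \<bullet> h k) * (?v \<bullet> h k) = ?c k" using k by (simp add: eigenvector)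
        qed auto
        finally have "?c sums (hs_apply \<Lambda> ?u \<bullet> ?v)" by (rule has_sum_imp_sums)
        then show ?thesis by (simp add: sums_def hs_apply_comp inner_hs_apply_left)
      qed
      ultimately show "hs_apply (suminf ?g) x \<bullet> y = hs_apply (A \<odot> \<Lambda> \<odot> hs_adjoint B) x \<bullet> y"
        by (rule LIMSEQ_unique)
    qed
  qed
  with lim show ?thesis unfolding part by simp
qed

text \<open>Pairing the random operator \<open>B s \<otimes> B r\<close> with two eigenvectors is a bounded linear functional of it,
so it commutes with the expectation.\<close>

lemma fbm_coord_pair:
  assumes B: "hilbert_fbm M H \<Lambda> B" and k: "k \<in> K" and l: "l \<in> K"
  shows "fbm_pair M H t (if k = l \<and> lam k \<noteq> 0 then 1 else 0) (fbm_coord B lam h k) (fbm_coord B lam h l)"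
proof -
  have m: "fbm_coord B lam h k s \<in> borel_measurable M" "L2_sq M (fbm_coord B lam h k s) < \<infinity>"
    if k: "k \<in> K" and s: "s \<in> {0..t}" for k s
  proof -
    have Bs [measurable]: "B s \<in> borel_measurable M" and int: "integrable M (\<lambda>\<omega>. (norm (B s \<omega>))\<^sup>2)"
      using B s by (auto simp: hilbert_fbm_def gaussian_process_def)
    show "fbm_coord B lam h k s \<in> borel_measurable M" unfolding fbm_coord_def[abs_def] by measurable
    have fin: "L2_sq M (B s) < \<infinity>" using int by (simp add: L2_sq_def integrable_iff_bounded)
    have "L2_sq M (\<lambda>\<omega>. (B s \<omega> \<bullet> h k) / sqrt (lam k)) \<le> ennreal ((1 / \<bar>sqrt (lam k)\<bar>)\<^sup>2) * L2_sq M (B s)"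
    proof (rule L2_sq_map_le[OF Bs])
      fix y :: 'a
      have "\<bar>y \<bullet> h k\<bar> \<le> norm y * norm (h k)" by (rule Cauchy_Schwarz_ineq2)
      then show "norm ((y \<bullet> h k) / sqrt (lam k)) \<le> 1 / \<bar>sqrt (lam k)\<bar> * norm y"
        using k by (simp add: norm_eigenvector divide_right_mono)
    qed
    also have "\<dots> < \<infinity>" using fin by (simp add: ennreal_mult_less_top)
    finally show "L2_sq M (fbm_coord B lam h k s) < \<infinity>" unfolding fbm_coord_def[abs_def] .
  qed
  have cov: "(LINT \<omega>|M. fbm_coord B lam h k s \<omega> * fbm_coord B lam h l r \<omega>) =
      (if k = l \<and> lam k \<noteq> 0 then 1 else 0) * fbm_cov H s r" if sr: "s \<in> {0..t}" "r \<in> {0..t}" for s r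
  proof -
    have "has_bochner_integral M (\<lambda>\<omega>. hs_tensor (B s \<omega>) (B r \<omega>)) (fbm_cov H s r *\<^sub>R \<Lambda>)"
      using B sr by (auto simp: hilbert_fbm_def)
    from has_bochner_integral_bounded_linear[OF bounded_linear_compose[OF bounded_linear_inner_left[of "h k"] bounded_linear_hs_apply[of "h l"]] this]
    have "has_bochner_integral M (\<lambda>\<omega>. (h l \<bullet> B r \<omega>) * (B s \<omega> \<bullet> h k)) (fbm_cov H s r * (lam l * (h l \<bullet> h k)))"
      using l by (simp add: hs_apply_tensor hs_apply_scaleR eigenvector mult_ac)
    then have "(LINT \<omega>|M. (h l \<bullet> B r \<omega>) * (B s \<omega> \<bullet> h k)) = fbm_cov H s r * (lam l * (h l \<bullet> h k))"
      by (rule has_bochner_integral_integral_eq)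
    moreover have "fbm_coord B lam h k s \<omega> * fbm_coord B lam h l r \<omega> =
        ((h l \<bullet> B r \<omega>) * (B s \<omega> \<bullet> h k)) / (sqrt (lam k) * sqrt (lam l))" for \<omega>
      by (simp add: fbm_coord_def inner_commute)
    ultimately have "(LINT \<omega>|M. fbm_coord B lam h k s \<omega> * fbm_coord B lam h l r \<omega>) =
        fbm_cov H s r * (lam l * (h l \<bullet> h k)) / (sqrt (lam k) * sqrt (lam l))"
      by simp
    then show ?thesis using k l eigenvalue_bounds(1)[OF k] by (auto simp: eigenvector_inner)
  qed
  show ?thesis unfolding fbm_pair_def using m k l cov by blast
qed

end

section \<open>The operator-valued stochastic integral\<close>

locale stochastic_integrals =
  fixes M :: "'w measure" and H t :: real and B :: "real \<Rightarrow> 'w \<Rightarrow> 'a::{real_inner, banach, second_countable_topology}"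
    and \<Lambda> :: "'a hs" and K :: "nat set" and lam :: "nat \<Rightarrow> real" and h :: "nat \<Rightarrow> 'a"
  assumes H: "0 < H" "H < 1" and t: "0 < t" and B: "hilbert_fbm M H \<Lambda> B" and eig: "eigenbasis \<Lambda> K lam h"
begin

lemma covariance: "trace_class_covariance \<Lambda>" using B by (simp add: hilbert_fbm_def)

definition coord_integral :: "(real \<Rightarrow> 'a hs) \<Rightarrow> nat \<Rightarrow> 'w \<Rightarrow> 'a" where
  "coord_integral F k = wiener_integral M H t (fbm_coord B lam h k) (\<lambda>s. hs_apply (F s) (h k))"

definition partial_integral :: "(real \<Rightarrow> 'a hs) \<Rightarrow> nat set \<Rightarrow> 'w \<Rightarrow> 'a" where
  "partial_integral F S \<omega> = (\<Sum>k\<in>S. sqrt (lam k) *\<^sub>R coord_integral F k \<omega>)"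

abbreviation transform :: "(real \<Rightarrow> 'a hs) \<Rightarrow> real \<Rightarrow> 'a hs" where
  "transform \<equiv> fbm_transform H t"

abbreviation coord :: "(real \<Rightarrow> 'a hs) \<Rightarrow> nat \<Rightarrow> real \<Rightarrow> 'a" where
  "coord F k x \<equiv> hs_apply (transform F x) (h k)"

abbreviation leb :: "real measure" where "leb \<equiv> Leb t"

lemma transform_L2:
  assumes "F \<in> LH H t"
  shows "transform F \<in> borel_measurable leb" "L2_sq leb (transform F) < \<infinity>"
  using fbm_transform_in_L2_fun[OF H t assms] by (auto simp: L2_fun_iff)

lemma borel_measurable_hs_apply:
  assumes "F \<in> borel_measurable M'"
  shows "(\<lambda>x. hs_apply (F x) v) \<in> borel_measurable M'"
proof -
  have "(\<lambda>A. hs_apply A v) \<in> borel_measurable borel"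
    by (intro borel_measurable_continuous_onI linear_continuous_on bounded_linear_hs_apply)
  then show ?thesis using measurable_compose[OF assms] by blast
qed

lemma coord_transform_L2:
  assumes "F \<in> LH H t"
  shows "(\<lambda>x. hs_apply (transform F x) v) \<in> borel_measurable leb" "L2_sq leb (\<lambda>x. hs_apply (transform F x) v) < \<infinity>"
proof -
  show "(\<lambda>x. hs_apply (transform F x) v) \<in> borel_measurable leb"
    by (rule borel_measurable_hs_apply) (rule transform_L2[OF assms])
  have "L2_sq leb (\<lambda>x. hs_apply (transform F x) v) \<le> ennreal ((norm v)\<^sup>2) * L2_sq leb (transform F)"
    by (rule L2_sq_map_le[OF transform_L2(1)[OF assms]]) (metis norm_hs_apply_le mult.commute)
  also have "\<dots> < \<infinity>" using transform_L2(2)[OF assms] by (simp add: ennreal_mult_less_top)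
  finally show "L2_sq leb (\<lambda>x. hs_apply (transform F x) v) < \<infinity>" .
qed

text \<open>Evaluation at \<open>h k\<close> is bounded and linear, so it commutes with the transform.\<close>

lemma coord_integral_isometry:
  fixes prod :: "'a \<Rightarrow> 'a \<Rightarrow> 'm::{banach, second_countable_topology}"
  assumes bl: "bounded_bilinear prod" and F: "F \<in> LH H t" and G: "G \<in> LH H t" and k: "k \<in> K" and l: "l \<in> K"
  shows "has_bochner_integral M (\<lambda>\<omega>. prod (coord_integral F k \<omega>) (coord_integral G l \<omega>))
    (((if k = l \<and> lam k \<noteq> 0 then 1 else 0) * hurst_const H) *\<^sub>R
      (LINT x|leb. prod (coord F k x) (coord G l x)))"
proof -
  note LF = LH_linear[OF H t F bounded_linear_hs_apply[of "h k"]]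
  note LG = LH_linear[OF H t G bounded_linear_hs_apply[of "h l"]]
  note pair = fbm_coord_pair[OF covariance eig B]
  let ?f = "\<lambda>x. prod (coord F k x) (coord G l x)"
  let ?g = "\<lambda>x. prod (fbm_transform H t (\<lambda>s. hs_apply (F s) (h k)) x) (fbm_transform H t (\<lambda>s. hs_apply (G s) (h l)) x)"
  have fm: "?f \<in> borel_measurable leb"
    by (rule bilinear_L2_integrable(1)[OF bl]) (intro coord_transform_L2 F G)+
  have AE: "AE x in leb. ?f x = ?g x"
    using LF(2) LG(2) by eventually_elim simp
  have gm: "?g \<in> borel_measurable leb"
    by (rule borel_measurable_lebesgue_on_AE[OF fm _ AE]) simp
  have "(LINT x|leb. ?f x) = (LINT x|leb. ?g x)" by (rule integral_cong_AE[OF fm gm AE])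
  then show ?thesis
    unfolding coord_integral_def
    using wiener_isometry[OF H t bl LF(1) LG(1) pair[OF k k, of t] _ pair[OF l l, of t] _ pair[OF k l, of t]]
    by simp
qed

lemma coord_integral_L2:
  assumes F: "F \<in> LH H t" and k: "k \<in> K"
  shows "coord_integral F k \<in> borel_measurable M"
proof -
  have "0 \<le> (if k = k \<and> lam k \<noteq> 0 then 1 else 0 :: real)" by simp
  from wiener_integral_approx[OF H t LH_linear(1)[OF H t F bounded_linear_hs_apply[of "h k"]] fbm_coord_pair[OF covariance eig B k k, of t] this]
  show ?thesis unfolding coord_integral_def by blast
qed

text \<open>Only the diagonal terms survive. Division by zero in a coordinate with vanishing eigenvalue makes
that coordinate zero, in agreement with its weight \<open>lam k = 0\<close>.\<close>

lemma partial_integral_isometry: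
  fixes prod :: "'a \<Rightarrow> 'a \<Rightarrow> 'm::{banach, second_countable_topology}"
  assumes bl: "bounded_bilinear prod" and F: "F \<in> LH H t" and G: "G \<in> LH H t" and S: "finite S" "S \<subseteq> K"
  shows "has_bochner_integral M (\<lambda>\<omega>. prod (partial_integral F S \<omega>) (partial_integral G S \<omega>))
    (hurst_const H *\<^sub>R (LINT x|leb. (\<Sum>k\<in>S. lam k *\<^sub>R prod (coord F k x) (coord G k x))))"
proof -
  interpret bounded_bilinear prod by (rule bl)
  let ?I = "\<lambda>k l. LINT x|leb. prod (coord F k x) (coord G l x)"
  have e: "prod (partial_integral F S \<omega>) (partial_integral G S \<omega>) =
      (\<Sum>k\<in>S. \<Sum>l\<in>S. (sqrt (lam k) * sqrt (lam l)) *\<^sub>R prod (coord_integral F k \<omega>) (coord_integral G l \<omega>))" for \<omega>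
    unfolding partial_integral_def sum_left unfolding sum_right
    by (simp add: scaleR_left scaleR_right mult.commute)
  have "has_bochner_integral M (\<lambda>\<omega>. prod (partial_integral F S \<omega>) (partial_integral G S \<omega>))
    (\<Sum>k\<in>S. \<Sum>l\<in>S. (sqrt (lam k) * sqrt (lam l)) *\<^sub>R ((if k = l \<and> lam k \<noteq> 0 then 1 else 0) * hurst_const H) *\<^sub>R ?I k l)"
    unfolding e using S
    by (intro has_bochner_integral_sum has_bochner_integral_scaleR_right coord_integral_isometry[OF bl F G]) auto
  also have "(\<Sum>k\<in>S. \<Sum>l\<in>S. (sqrt (lam k) * sqrt (lam l)) *\<^sub>R ((if k = l \<and> lam k \<noteq> 0 then 1 else 0) * hurst_const H) *\<^sub>R ?I k l) =
    (\<Sum>k\<in>S. \<Sum>l\<in>S. if k = l then (hurst_const H * lam k) *\<^sub>R ?I k k else 0)"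
    using S eigenvalue_bounds(1)[OF covariance eig] by (intro sum.cong refl) (auto simp: subset_iff mult.commute)
  also have "\<dots> = hurst_const H *\<^sub>R (\<Sum>k\<in>S. lam k *\<^sub>R ?I k k)"
    using S by (simp add: scaleR_sum_right)
  also have "(\<Sum>k\<in>S. lam k *\<^sub>R ?I k k) =
      (LINT x|leb. (\<Sum>k\<in>S. lam k *\<^sub>R prod (coord F k x) (coord G k x)))"
  proof -
    have "integrable leb (\<lambda>x. lam k *\<^sub>R prod (coord F k x) (coord G k x))" for k
      by (intro integrable_scaleR_right bilinear_L2_integrable(2)[OF bl] coord_transform_L2 F G)
    then show ?thesis by (subst Bochner_Integration.integral_sum) auto
  qed
  finally show ?thesis .
qed

lemma borel_measurable_partial_integral:
  assumes "F \<in> LH H t" "S \<subseteq> K"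
  shows "partial_integral F S \<in> borel_measurable M"
  unfolding partial_integral_def[abs_def] using assms coord_integral_L2[OF assms(1)]
  by (intro borel_measurable_sum borel_measurable_scaleR borel_measurable_const) auto

lemma partial_integral_L2_sq:
  assumes F: "F \<in> LH H t" and S: "finite S" "S \<subseteq> K"
  shows "L2_sq M (partial_integral F S) =
    ennreal (\<Sum>k\<in>S. hurst_const H * (lam k * (LINT x|leb. (norm (coord F k x))\<^sup>2)))"
proof -
  note iso = partial_integral_isometry[OF bounded_bilinear_inner F F S]
  have int: "integrable leb (\<lambda>x. lam k *\<^sub>R (coord F k x \<bullet> coord F k x))" for k
    by (intro integrable_scaleR_right bilinear_L2_integrable(2)[OF bounded_bilinear_inner] coord_transform_L2 F)
  have "L2_sq M (partial_integral F S) = ennreal (LINT \<omega>|M. partial_integral F S \<omega> \<bullet> partial_integral F S \<omega>)"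
    using iso by (intro L2_sq_eq_integral) (simp add: has_bochner_integral_iff)
  also have "(LINT \<omega>|M. partial_integral F S \<omega> \<bullet> partial_integral F S \<omega>) =
      (\<Sum>k\<in>S. hurst_const H * (lam k * (LINT x|leb. (norm (coord F k x))\<^sup>2)))"
    unfolding has_bochner_integral_integral_eq[OF iso] Bochner_Integration.integral_sum[OF int]
    by (simp add: power2_norm_eq_inner sum_distrib_left)
  finally show ?thesis .
qed

text \<open>The second moments of the summands are bounded by those of an orthogonal expansion of the transform
in the eigenbasis, which are summable.\<close>

lemma partial_integral_converges:
  assumes F: "F \<in> LH H t"
  shows "\<exists>X. converges_L2 M (\<lambda>n. partial_integral F (K \<inter> {..<n})) X"
proof (rule L2_complete)
  let ?d = "\<lambda>n m \<omega>. partial_integral F (K \<inter> {..<n}) \<omega> - partial_integral F (K \<inter> {..<m}) \<omega>"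
  show "partial_integral F (K \<inter> {..<n}) \<in> borel_measurable M" for n
    by (rule borel_measurable_partial_integral[OF F]) simp
  let ?J = "\<lambda>k. LINT x|leb. (norm (coord F k x))\<^sup>2"
  let ?w = "\<lambda>k. hurst_const H * (lam k * ?J k)"
  let ?c = "\<lambda>k. if k \<in> K then ?w k else 0"
  have c0: "0 \<le> hurst_const H" using hurst_const_pos[OF H] by simp
  have w0: "0 \<le> ?w k" if "k \<in> K" for k
    using c0 eigenvalue_bounds(1)[OF covariance eig that] by (intro mult_nonneg_nonneg Bochner_Integration.integral_nonneg) auto
  have part: "(\<Sum>k\<in>K \<inter> A. ?w k) = (\<Sum>k\<in>A. ?c k)" if "finite A" for A
    using that by (subst Int_commute) (simp add: sum.inter_restrict)
  have sqint: "integrable leb (\<lambda>x. (norm (transform F x))\<^sup>2)"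
    using transform_L2[OF F] by (auto simp: L2_sq_def integrable_iff_bounded)
  have sqint_k: "integrable leb (\<lambda>x. (norm (coord F k x))\<^sup>2)" for k
    using coord_transform_L2[OF F] by (auto simp: L2_sq_def integrable_iff_bounded)
  have "summable ?c"
  proof (rule bounded_imp_summable)
    fix n
    let ?S = "K \<inter> {..n}"
    have "(\<Sum>k\<le>n. ?c k) = (\<Sum>k\<in>?S. ?w k)" by (rule part[symmetric]) simp
    also have "\<dots> \<le> (\<Sum>k\<in>?S. hurst_const H * (norm \<Lambda> * ?J k))"
      using c0 eigenvalue_bounds(2)[OF covariance eig]
      by (intro sum_mono mult_left_mono mult_right_mono Bochner_Integration.integral_nonneg) auto
    also have "\<dots> = hurst_const H * norm \<Lambda> * (\<Sum>k\<in>?S. ?J k)" by (simp add: sum_distrib_left mult.assoc)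
    also have "(\<Sum>k\<in>?S. ?J k) = (LINT x|leb. (\<Sum>k\<in>?S. (norm (coord F k x))\<^sup>2))"
      by (rule Bochner_Integration.integral_sum[symmetric]) (rule sqint_k)
    also have "\<dots> \<le> (LINT x|leb. (norm (transform F x))\<^sup>2)"
      by (intro integral_mono Bochner_Integration.integrable_sum sqint sqint_k sum_norm_sq_eigenbasis_le[OF covariance eig]) auto
    finally show "(\<Sum>k\<le>n. ?c k) \<le> hurst_const H * norm \<Lambda> * (LINT x|leb. (norm (transform F x))\<^sup>2)"
      using c0 by (simp add: mult_left_mono)
  qed (use w0 in auto)
  fix e :: real assume e: "e > 0"
  obtain N where N: "\<And>m n. m \<ge> N \<Longrightarrow> norm (\<Sum>k=m..<n. ?c k) < e"
    using \<open>summable ?c\<close> e unfolding summable_Cauchy by blast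
  have le: "L2_sq M (?d n m) < ennreal e"
    if mn: "N \<le> m" "m \<le> n" for m n
  proof -
    have "partial_integral F (K \<inter> {..<n}) \<omega> - partial_integral F (K \<inter> {..<m}) \<omega> = partial_integral F (K \<inter> {m..<n}) \<omega>" for \<omega>
    proof -
      have "K \<inter> {..<n} = (K \<inter> {..<m}) \<union> (K \<inter> {m..<n})" using mn by auto
      moreover have "(K \<inter> {..<m}) \<inter> (K \<inter> {m..<n}) = {}" by auto
      ultimately show ?thesis unfolding partial_integral_def by (simp add: sum.union_disjoint)
    qed
    then have "L2_sq M (?d n m) =
        L2_sq M (partial_integral F (K \<inter> {m..<n}))" by simp
    also have "\<dots> = ennreal (\<Sum>k\<in>K \<inter> {m..<n}. ?w k)" by (rule partial_integral_L2_sq[OF F]) auto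
    also have "(\<Sum>k\<in>K \<inter> {m..<n}. ?w k) = (\<Sum>k=m..<n. ?c k)" by (rule part) simp
    also have "ennreal \<dots> < ennreal e" using N[OF mn(1), of n] e by (intro ennreal_lessI) auto
    finally show ?thesis .
  qed
  show "\<exists>N. \<forall>n\<ge>N. \<forall>m\<ge>N. L2_sq M (?d n m) < ennreal e"
  proof (intro exI[of _ N] allI impI)
    fix n m assume "n \<ge> N" "m \<ge> N"
    then show "L2_sq M (?d n m) < ennreal e"
      using le[of m n] le[of n m]
        L2_sq_minus_commute[of M "partial_integral F (K \<inter> {..<n})" "partial_integral F (K \<inter> {..<m})"]
      by (cases "m \<le> n") auto
  qed
qed

lemma stoch_integral_limit:
  assumes F: "F \<in> LH H t"
  defines "X \<equiv> stoch_integral M H t B K lam h F"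
  shows "X \<in> borel_measurable M" "L2_sq M X < \<infinity>"
    "(\<lambda>n. L2_sq M (\<lambda>\<omega>. partial_integral F (K \<inter> {..<n}) \<omega> - X \<omega>)) \<longlonglongrightarrow> 0"
proof -
  have "X = (SOME X. converges_L2 M (\<lambda>n. partial_integral F (K \<inter> {..<n})) X)"
    unfolding X_def stoch_integral_def partial_integral_def[abs_def] coord_integral_def ..
  then have X: "converges_L2 M (\<lambda>n. partial_integral F (K \<inter> {..<n})) X"
    using someI_ex[OF partial_integral_converges[OF F]] by simp
  then show m: "X \<in> borel_measurable M"
    and lim: "(\<lambda>n. L2_sq M (\<lambda>\<omega>. partial_integral F (K \<inter> {..<n}) \<omega> - X \<omega>)) \<longlonglongrightarrow> 0"
    by (auto simp: converges_L2_def L2_sq_def)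
  have "\<forall>\<^sub>F n in sequentially. L2_sq M (\<lambda>\<omega>. partial_integral F (K \<inter> {..<n}) \<omega> - X \<omega>) < \<infinity>"
    by (rule order_tendstoD[OF lim]) simp
  then obtain n where n: "L2_sq M (\<lambda>\<omega>. partial_integral F (K \<inter> {..<n}) \<omega> - X \<omega>) < \<infinity>"
    by (auto simp: eventually_sequentially)
  have "L2_sq M (partial_integral F (K \<inter> {..<n})) < \<infinity>"
    by (subst partial_integral_L2_sq[OF F]) auto
  then show "L2_sq M X < \<infinity>"
    by (rule L2_sq_finite_of_close[OF borel_measurable_partial_integral[OF F] m _ n, OF inf_le1])
qed

lemma spectral_integral:
  assumes F: "F \<in> LH H t" and G: "G \<in> LH H t"
  shows "integrable leb (\<lambda>x. transform F x \<odot> \<Lambda> \<odot> hs_adjoint (transform G x))"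
    and "(\<lambda>n. LINT x|leb. (\<Sum>k\<in>K \<inter> {..<n}. lam k *\<^sub>R hs_tensor (coord F k x) (coord G k x)))
      \<longlonglongrightarrow> (LINT x|leb. transform F x \<odot> \<Lambda> \<odot> hs_adjoint (transform G x))"
proof -
  let ?s = "\<lambda>n x. \<Sum>k\<in>K \<inter> {..<n}. lam k *\<^sub>R hs_tensor (coord F k x) (coord G k x)"
  let ?l = "\<lambda>x. transform F x \<odot> \<Lambda> \<odot> hs_adjoint (transform G x)"
  let ?w = "\<lambda>x. norm \<Lambda> * (norm (transform F x) * norm (transform G x))"
  have sm: "?s n \<in> borel_measurable leb" for n
    by (intro borel_measurable_sum borel_measurable_scaleR borel_measurable_const
        bilinear_L2_integrable(1)[OF bounded_bilinear_hs_tensor] coord_transform_L2 F G)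
  have lim: "(\<lambda>n. ?s n x) \<longlonglongrightarrow> ?l x" for x by (rule spectral_sum_tendsto[OF covariance eig])
  have lm: "?l \<in> borel_measurable leb" by (rule borel_measurable_LIMSEQ_metric[OF sm lim])
  have nm: "(\<lambda>x. norm (transform F x)) \<in> borel_measurable leb" "L2_sq leb (\<lambda>x. norm (transform F x)) < \<infinity>"
    if "F \<in> LH H t" for F
    using transform_L2[OF that] by (auto simp: L2_sq_def)
  have w: "integrable leb ?w"
    by (intro Bochner_Integration.integrable_mult_right L2_product_integrable nm F G)
  have bound: "norm (?s n x) \<le> ?w x" for n x
    by (rule order_trans[OF norm_sum sum_norm_product_le[OF covariance eig]]) auto
  show "integrable leb ?l"
    by (rule integrable_dominated_convergence[where s = ?s, OF lm sm w]) (use lim bound in auto)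
  show "(\<lambda>n. LINT x|leb. ?s n x) \<longlonglongrightarrow> (LINT x|leb. ?l x)"
    by (rule integral_dominated_convergence[where s = ?s, OF lm sm w]) (use lim bound in auto)
qed

lemma stoch_integral_covariance:
  assumes F: "F \<in> LH H t" and G: "G \<in> LH H t"
  shows "has_bochner_integral M (\<lambda>\<omega>. hs_tensor (stoch_integral M H t B K lam h F \<omega>) (stoch_integral M H t B K lam h G \<omega>))
    (hurst_const H *\<^sub>R (LINT x|leb. transform F x \<odot> \<Lambda> \<odot> hs_adjoint (transform G x)))"
proof -
  note X = stoch_integral_limit[OF F] and Y = stoch_integral_limit[OF G]
  have iso: "has_bochner_integral M (\<lambda>\<omega>. hs_tensor (partial_integral F (K \<inter> {..<n}) \<omega>) (partial_integral G (K \<inter> {..<n}) \<omega>))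
    (hurst_const H *\<^sub>R (LINT x|leb. (\<Sum>k\<in>K \<inter> {..<n}. lam k *\<^sub>R hs_tensor (coord F k x) (coord G k x))))" for n
    by (rule partial_integral_isometry[OF bounded_bilinear_hs_tensor F G]) auto
  have "(\<lambda>n. LINT \<omega>|M. hs_tensor (partial_integral F (K \<inter> {..<n}) \<omega>) (partial_integral G (K \<inter> {..<n}) \<omega>)) \<longlonglongrightarrow>
      (LINT \<omega>|M. hs_tensor (stoch_integral M H t B K lam h F \<omega>) (stoch_integral M H t B K lam h G \<omega>))"
  proof (rule bilinear_L2_limit[OF bounded_bilinear_hs_tensor X(1) Y(1) _ _ X(2) Y(2) X(3) Y(3)])
    show "integrable M (\<lambda>\<omega>. hs_tensor (partial_integral F (K \<inter> {..<n}) \<omega>) (partial_integral G (K \<inter> {..<n}) \<omega>))" for n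
      using iso[of n] by (simp add: has_bochner_integral_iff)
  qed (auto intro: borel_measurable_partial_integral F G)
  moreover have "(\<lambda>n. LINT \<omega>|M. hs_tensor (partial_integral F (K \<inter> {..<n}) \<omega>) (partial_integral G (K \<inter> {..<n}) \<omega>)) \<longlonglongrightarrow>
      hurst_const H *\<^sub>R (LINT x|leb. transform F x \<odot> \<Lambda> \<odot> hs_adjoint (transform G x))"
    unfolding has_bochner_integral_integral_eq[OF iso]
    by (intro tendsto_scaleR tendsto_const spectral_integral(2) F G)
  ultimately have "(LINT \<omega>|M. hs_tensor (stoch_integral M H t B K lam h F \<omega>) (stoch_integral M H t B K lam h G \<omega>)) =
      hurst_const H *\<^sub>R (LINT x|leb. transform F x \<odot> \<Lambda> \<odot> hs_adjoint (transform G x))"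
    by (rule LIMSEQ_unique)
  then show ?thesis
    using bilinear_L2_integrable(2)[OF bounded_bilinear_hs_tensor X(1) Y(1) X(2) Y(2)]
    by (simp add: has_bochner_integral_iff)
qed

end

theorem theorem2:
  fixes M :: "'w measure"
    and B :: "real \<Rightarrow> 'w \<Rightarrow> 'a::{real_inner, banach, second_countable_topology}"
    and \<Lambda> :: "'a hs" and F G :: "real \<Rightarrow> 'a hs" and H t :: real
    and K :: "nat set" and lam :: "nat \<Rightarrow> real" and h :: "nat \<Rightarrow> 'a"
  assumes "prob_space M"
    and "0 < H" and "H < 1"
    and "hilbert_fbm M H \<Lambda> B"
    and "eigenbasis \<Lambda> K lam h"
    and "t > 0"
    and "F \<in> LH H t" and "G \<in> LH H t"
  defines "X \<equiv> stoch_integral M H t B K lam h F"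
    and "Y \<equiv> stoch_integral M H t B K lam h G"
    and "DF \<equiv> frac_deriv t (1/2 - H) (\<lambda>r. r powr (H - 1/2) *\<^sub>R F r)"
    and "DG \<equiv> frac_deriv t (1/2 - H) (\<lambda>r. r powr (H - 1/2) *\<^sub>R G r)"
  shows "integrable M (\<lambda>\<omega>. hs_tensor (X \<omega>) (Y \<omega>)) \<and>
    integrable (lebesgue_on {0..t})
      (\<lambda>s. s powr (1 - 2 * H) *\<^sub>R (DF s \<odot> \<Lambda> \<odot> hs_adjoint (DG s))) \<and>
    (LINT \<omega>|M. hs_tensor (X \<omega>) (Y \<omega>)) =
      hurst_const H *\<^sub>R
        (LINT s|lebesgue_on {0..t}. s powr (1 - 2 * H) *\<^sub>R (DF s \<odot> \<Lambda> \<odot> hs_adjoint (DG s)))"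
proof -
  interpret stochastic_integrals M H t B \<Lambda> K lam h
    using assms by unfold_locales auto
  have eq: "s powr (1 - 2 * H) *\<^sub>R (DF s \<odot> \<Lambda> \<odot> hs_adjoint (DG s)) = transform F s \<odot> \<Lambda> \<odot> hs_adjoint (transform G s)" for s
  proof -
    have "s powr (1/2 - H) * s powr (1/2 - H) = s powr (1 - 2 * H)"
      unfolding powr_add[symmetric] by simp
    then show ?thesis
      unfolding fbm_transform_def DF_def DG_def hs_comp_scaleR_adjoint by simp
  qed
  show ?thesis
    unfolding eq X_def Y_def
    using stoch_integral_covariance[OF \<open>F \<in> LH H t\<close> \<open>G \<in> LH H t\<close>] spectral_integral(1)[OF \<open>F \<in> LH H t\<close> \<open>G \<in> LH H t\<close>]
    by (simp add: has_bochner_integral_iff)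
qed

end
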